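(* Let $p$ be a prime and let $\Phi=(\phi_1,\dots,\phi_k)$ be a system of linear forms $\phi_i\colon \mathbb{F}_p^d\to\mathbb{F}_p$ with complexity $s(\Phi)$. Then there is a constant $M\ge 0$ depending on $\Phi$ such that for any $n\ge 1$, any $1$-bounded functions $f_1,\dots,f_k\colon \mathbb{F}_p^n\to\mathbb{C}$ and any $i_0\in[k]$, \[ \left|\Lambda_\Phi(f_1,\dots,f_k)\right| \le \|f_{i_0}\|_{U^{s(\Phi)+1}}^{2^{-M}}. \] Moreover, if $\phi_i(x_1,\dots,x_d)=\sum_{j=1}^d a_{ij}x_j$ with integer coefficients satisfying $|a_{ij}|\le L$ for all $i,j$, then one may take $M\ll k^3\bigl(\log k+\log\log(10L)\bigr)$, with an absolute implied constant.
   Context: A function is $1$-bounded if its absolute value is at most $1$ everywhere. For $f_i\colon\mathbb{F}_p^n\to\mathbb{C}$, $\Lambda_\Phi(f_1,\dots,f_k)=\mathbb{E}_{x_1,\dots,x_d\in\mathbb{F}_p^n}\prod_{i=1}^k f_i(\phi_i(x_1,\dots,x_d))$, where $\phi_i$ is applied coordinatewise to $(\mathbb{F}_p^n)^d$. The Gowers norm is $\|f\|_{U^{t}}=\bigl(\mathbb{E}_{x,h_1,\dots,h_t\in\mathbb{F}_p^n}\prod_{\omega\in\{0,1\}^t}\mathcal{C}^{|\omega|}f(x+\omega_1h_1+\dots+\omega_th_t)\bigr)^{1/2^t}$, where $\mathcal{C}$ denotes complex conjugation and $|\omega|=\sum\omega_i$. The complexity $s(\Phi)$ is the largest integer $t\ge0$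 such that the tensor powers $\phi_1^{\otimes t},\dots,\phi_k^{\otimes t}\in((\mathbb{F}_p^d)^* )^{\otimes t}$ are linearly dependent. *)

theory Defs
  imports Complex_Main "HOL-Library.FuncSet" "HOL-Computational_Algebra.Primes"
begin

text \<open>
  The prime \<open>p\<close> and the dimensions \<open>n\<close>, \<open>d\<close> are terms and not types, because the constants in the
  theorem are chosen before \<open>n\<close>, and one of them even before \<open>p\<close>.  The field with \<open>p\<close> elements is
  represented by the residues \<open>0, \<dots>, p - 1\<close> with arithmetic modulo \<open>p\<close>, and its \<open>n\<close>-th power by
  extensional functions on \<open>{..<n}\<close>.  All index sets start at 0.
\<close>

definition Fp :: "nat \<Rightarrow> int set" where
  "Fp p = {0..<int p}"

definition Fp_vec :: "nat \<Rightarrow> nat \<Rightarrow> (nat \<Rightarrow> int) set" where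
  "Fp_vec p n = {..<n} \<rightarrow>\<^sub>E Fp p"

definition vec_add :: "nat \<Rightarrow> nat \<Rightarrow> (nat \<Rightarrow> int) \<Rightarrow> (nat \<Rightarrow> int) \<Rightarrow> (nat \<Rightarrow> int)" where
  "vec_add p n x y = (\<lambda>j\<in>{..<n}. (x j + y j) mod int p)"

definition vec_scale :: "nat \<Rightarrow> nat \<Rightarrow> int \<Rightarrow> (nat \<Rightarrow> int) \<Rightarrow> (nat \<Rightarrow> int)" where
  "vec_scale p n c x = (\<lambda>j\<in>{..<n}. (c * x j) mod int p)"

definition linear_form :: "nat \<Rightarrow> nat \<Rightarrow> ((nat \<Rightarrow> int) \<Rightarrow> int) \<Rightarrow> bool" where
  "linear_form p d \<phi> \<longleftrightarrow>
     \<phi> \<in> Fp_vec p d \<rightarrow> Fp p \<and>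
     (\<forall>x\<in>Fp_vec p d. \<forall>y\<in>Fp_vec p d. \<phi> (vec_add p d x y) = (\<phi> x + \<phi> y) mod int p) \<and>
     (\<forall>c\<in>Fp p. \<forall>x\<in>Fp_vec p d. \<phi> (vec_scale p d c x) = (c * \<phi> x) mod int p)"

text \<open>
  The \<open>t\<close>-th tensor power of a linear form on \<open>V\<close>, under the canonical identification of the \<open>t\<close>-th
  tensor power of the dual of the finite-dimensional space \<open>V\<close> with the \<open>t\<close>-linear forms on \<open>V\<close>.
  For \<open>t = 0\<close> this is the scalar 1.
\<close>

definition tensor_power ::
    "nat \<Rightarrow> nat \<Rightarrow> ((nat \<Rightarrow> int) \<Rightarrow> int) \<Rightarrow> (nat \<Rightarrow> nat \<Rightarrow> int) \<Rightarrow> int" where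
  "tensor_power p t \<phi> v = (\<Prod>l<t. \<phi> (v l)) mod int p"

text \<open>
  Linear dependence over the prime field of the tensor powers as an indexed family, so that repeated
  members count as dependent.
\<close>

definition tensor_dependent ::
    "nat \<Rightarrow> nat \<Rightarrow> nat \<Rightarrow> (nat \<Rightarrow> (nat \<Rightarrow> int) \<Rightarrow> int) \<Rightarrow> nat \<Rightarrow> bool" where
  "tensor_dependent p d k \<Phi> t \<longleftrightarrow>
     (\<exists>c \<in> {..<k} \<rightarrow> Fp p. (\<exists>i<k. c i \<noteq> 0) \<and>
        (\<forall>v \<in> {..<t} \<rightarrow>\<^sub>E Fp_vec p d.
           (\<Sum>i<k. c i * tensor_power p t (\<Phi> i) v) mod int p = 0))"

text \<open>
  The largest \<open>t\<close> with dependent \<open>t\<close>-th tensor powers is meaningful only if these \<open>t\<close> are bounded.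
  If there is no such \<open>t\<close> at all, which for \<open>k \<ge> 1\<close> happens only for a single nonzero form, the
  value is 0.
\<close>

definition finite_complexity ::
    "nat \<Rightarrow> nat \<Rightarrow> nat \<Rightarrow> (nat \<Rightarrow> (nat \<Rightarrow> int) \<Rightarrow> int) \<Rightarrow> bool" where
  "finite_complexity p d k \<Phi> \<longleftrightarrow> finite {t. tensor_dependent p d k \<Phi> t}"

definition complexity ::
    "nat \<Rightarrow> nat \<Rightarrow> nat \<Rightarrow> (nat \<Rightarrow> (nat \<Rightarrow> int) \<Rightarrow> int) \<Rightarrow> nat" where
  "complexity p d k \<Phi> = Sup {t. tensor_dependent p d k \<Phi> t}"

definition expect :: "'a set \<Rightarrow> ('a \<Rightarrow> complex) \<Rightarrow> complex" where
  "expect A g = (\<Sum>x\<in>A. g x) / of_nat (card A)"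

text \<open>
  The form \<open>\<phi>\<close> in \<open>d\<close> variables applied to \<open>d\<close> vectors of length \<open>n\<close>, coordinate by coordinate.
\<close>

definition apply_form ::
    "nat \<Rightarrow> nat \<Rightarrow> ((nat \<Rightarrow> int) \<Rightarrow> int) \<Rightarrow> (nat \<Rightarrow> nat \<Rightarrow> int) \<Rightarrow> (nat \<Rightarrow> int)" where
  "apply_form d n \<phi> x = (\<lambda>j\<in>{..<n}. \<phi> (\<lambda>m\<in>{..<d}. x m j))"

definition Lambda ::
    "nat \<Rightarrow> nat \<Rightarrow> nat \<Rightarrow> (nat \<Rightarrow> (nat \<Rightarrow> int) \<Rightarrow> int) \<Rightarrow> nat \<Rightarrow>
      (nat \<Rightarrow> (nat \<Rightarrow> int) \<Rightarrow> complex) \<Rightarrow> complex" where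
  "Lambda p d k \<Phi> n f =
     expect ({..<d} \<rightarrow>\<^sub>E Fp_vec p n) (\<lambda>x. \<Prod>i<k. f i (apply_form d n (\<Phi> i) x))"

definition cube_point ::
    "nat \<Rightarrow> nat \<Rightarrow> nat \<Rightarrow> (nat \<Rightarrow> int) \<Rightarrow> (nat \<Rightarrow> nat \<Rightarrow> int) \<Rightarrow> (nat \<Rightarrow> nat) \<Rightarrow> (nat \<Rightarrow> int)" where
  "cube_point p n t x h \<omega> = (\<lambda>j\<in>{..<n}. (x j + (\<Sum>l<t. int (\<omega> l) * h l j)) mod int p)"

text \<open>
  For \<open>t \<ge> 1\<close> the average below is a nonnegative real number, so taking its real part does not
  lose anything.
\<close>

definition gowers_norm ::
    "nat \<Rightarrow> nat \<Rightarrow> nat \<Rightarrow> ((nat \<Rightarrow> int) \<Rightarrow> complex) \<Rightarrow> real" where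
  "gowers_norm p n t f =
     root (2 ^ t) (Re (expect (Fp_vec p n \<times> ({..<t} \<rightarrow>\<^sub>E Fp_vec p n))
       (\<lambda>(x, h). \<Prod>\<omega> \<in> {..<t} \<rightarrow>\<^sub>E {0, 1}.
          (cnj ^^ (\<Sum>l<t. \<omega> l)) (f (cube_point p n t x h \<omega>)))))"

definition one_bounded :: "nat \<Rightarrow> nat \<Rightarrow> ((nat \<Rightarrow> int) \<Rightarrow> complex) \<Rightarrow> bool" where
  "one_bounded p n f \<longleftrightarrow> (\<forall>x\<in>Fp_vec p n. cmod (f x) \<le> 1)"

definition gowers_control ::
    "nat \<Rightarrow> nat \<Rightarrow> nat \<Rightarrow> (nat \<Rightarrow> (nat \<Rightarrow> int) \<Rightarrow> int) \<Rightarrow> real \<Rightarrow> bool" where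
  "gowers_control p d k \<Phi> M \<longleftrightarrow>
     (\<forall>n\<ge>1. \<forall>f. (\<forall>i<k. one_bounded p n (f i)) \<longrightarrow>
        (\<forall>i0<k. cmod (Lambda p d k \<Phi> n f)
           \<le> gowers_norm p n (complexity p d k \<Phi> + 1) (f i0) powr (2 powr (- M))))"

end

theory Submission
  imports Defs "HOL-Library.Function_Algebras" "HOL-Library.Product_Plus" "HOL-Analysis.Convex"
begin

text \<open>
  Let \<open>U\<^sub>t f\<close> denote the \<open>2 ^ t\<close>-th power of the Gowers norm. As a function of its argument at a
  position \<open>j\<close>, the average \<open>\<Lambda>\<close> is an inner product with a function \<open>H\<close>. If \<open>U\<^sub>t\<close> controls that
  position, then \<open>U\<^sub>t H\<close> is at least a power of \<open>|\<Lambda>|\<close>, and replacing the argument by the dual function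
  of order \<open>t\<close> of \<open>H\<close> turns \<open>\<Lambda>\<close> into exactly \<open>U\<^sub>t H\<close>. By Cauchy--Schwarz this applies at every
  position for \<open>t = k - 1\<close>, so that all functions except \<open>f i0\<close> become dual functions. Their order is
  then lowered, one position at a time, down to one more than the complexity; then \<open>f i0\<close> is
  controlled by the norm in the theorem.

  To pass from order \<open>t + 1\<close> to \<open>t\<close> one eliminates the cubes of the dual functions by Cauchy--Schwarz
  in \<open>t\<close> directions. What remains is an average of \<open>\<Prod>i<k. A i (\<phi> i Y\<^sub>1, \<dots>, \<phi> i Y\<^sub>t)\<close> in which every
  \<open>A i\<close> is positive definite in each of its variables. A Fourier expansion in the last variable gives a
  sum with nonnegative terms over the linear relations between the forms. The theorems of
  Balog--Szemeredi--Gowers and Pluennecke convert the other variables one by one into further relations,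
  with an exponent of order \<open>k\<^sup>3 log L\<close> each. At the end the terms are indexed by relations between the
  \<open>t\<close>-th tensor powers of the forms. These are trivial for \<open>t\<close> above the complexity, and the trivial
  term bounds \<open>U\<^sub>t H\<close> from below.

  Each of the at most \<open>k\<^sup>2\<close> steps raises \<open>|\<Lambda>|\<close> to a power \<open>(k log L) ^ O(k)\<close>, which gives the bound for
  \<open>M\<close>. Constant factors are removed by applying the inequality to tensor powers of the functions.
\<close>

text \<open>Why a variable can be converted into relations: suppose that the Fourier weight of the
  \<open>i\<close>-th factor were the indicator of the graph of a homomorphism \<open>L i\<close>.
  If the tuple of all \<open>L i (\<phi> i Y)\<close> satisfies the known relations for every
  \<open>Y\<close>, then taking for \<open>Y\<close> the vector with the single entry
  \<open>h\<close> in position \<open>j\<close> shows that the tuple of all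
  \<open>a i j L i h\<close> satisfies them. So the tuple of all \<open>L i h\<close> satisfies a
  longer list of relations, one for each \<open>j\<close>. In general the large weights only form a
  set with approximate additive structure, and sumset estimates take the place of linearity. This
  structure rests on positive definiteness, which turns mass on a set into mass on its differences.
  Arbitrary functions do not have it. It arises when the cubes of dual functions are eliminated,
  because Cauchy--Schwarz replaces each \<open>A i\<close> by an autocorrelation; this is why all
  functions are made dual functions first. The dependence on \<open>L\<close> is logarithmic because
  the dilate of a set by an integer is built up from the binary digits of that integer.\<close>

section \<open>Sumsets\<close>

definition sumset :: "'a::ab_group_add set \<Rightarrow> 'a set \<Rightarrow> 'a set" where
  "sumset A B = (\<lambda>(a, b). a + b) ` (A \<times> B)"

definition diffset :: "'a::ab_group_add set \<Rightarrow> 'a set \<Rightarrow> 'a set" where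
  "diffset A B = (\<lambda>(a, b). a - b) ` (A \<times> B)"

primrec multsum :: "nat \<Rightarrow> 'a::ab_group_add set \<Rightarrow> 'a set" where
  "multsum 0 A = {0}"
| "multsum (Suc m) A = sumset A (multsum m A)"

lemma mem_sumset: "x \<in> sumset A B \<longleftrightarrow> (\<exists>a\<in>A. \<exists>b\<in>B. x = a + b)"
  unfolding sumset_def by force

lemma mem_diffset: "x \<in> diffset A B \<longleftrightarrow> (\<exists>a\<in>A. \<exists>b\<in>B. x = a - b)"
  unfolding diffset_def by force

lemma sumsetI: "a \<in> A \<Longrightarrow> b \<in> B \<Longrightarrow> a + b \<in> sumset A B"
  by (auto simp: mem_sumset)

lemma diffsetI: "a \<in> A \<Longrightarrow> b \<in> B \<Longrightarrow> a - b \<in> diffset A B"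
  by (auto simp: mem_diffset)

lemma finite_sumset [simp]: "finite A \<Longrightarrow> finite B \<Longrightarrow> finite (sumset A B)"
  unfolding sumset_def by simp

lemma finite_diffset [simp]: "finite A \<Longrightarrow> finite B \<Longrightarrow> finite (diffset A B)"
  unfolding diffset_def by simp

lemma finite_multsum [simp]: "finite A \<Longrightarrow> finite (multsum m A)"
  by (induction m) auto

lemma card_sumset_le: "finite A \<Longrightarrow> finite B \<Longrightarrow> card (sumset A B) \<le> card A * card B"
  unfolding sumset_def by (metis card_cartesian_product card_image_le finite_cartesian_product)

lemma sumset_assoc: "sumset (sumset A B) C = sumset A (sumset B C)"
proof -
  have "sumset (sumset A B) C = (\<lambda>(a, b, c). a + b + c) ` (A \<times> B \<times> C)"
    unfolding sumset_def by force
  also have "\<dots> = sumset A (sumset B C)"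
    unfolding sumset_def by (force simp: add.assoc)
  finally show ?thesis .
qed

lemma sumset_mono: "A \<subseteq> A' \<Longrightarrow> B \<subseteq> B' \<Longrightarrow> sumset A B \<subseteq> sumset A' B'"
  unfolding sumset_def by auto

lemma diffset_uminus: "diffset A B = sumset A (uminus ` B)"
proof -
  have "x \<in> diffset A B \<longleftrightarrow> x \<in> sumset A (uminus ` B)" for x
    by (auto simp: mem_sumset mem_diffset)
  then show ?thesis by blast
qed

lemma card_diffset_swap: "card (diffset A B) = card (diffset B A)"
proof -
  have "diffset A B = uminus ` diffset B A"
    unfolding diffset_def image_image by (force simp: image_iff)
  then show ?thesis by (simp add: card_image)
qed

lemma uminus_multsum: "uminus ` multsum m A = multsum m (uminus ` A)"
proof (induction m)
  case (Suc m)
  have "uminus ` sumset A (multsum m A) = sumset (uminus ` A) (uminus ` multsum m A)"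
  proof (intro subset_antisym subsetI)
    fix x assume "x \<in> uminus ` sumset A (multsum m A)"
    then obtain a b where "a \<in> A" "b \<in> multsum m A" "x = - a + - b"
      by (auto simp: mem_sumset)
    then show "x \<in> sumset (uminus ` A) (uminus ` multsum m A)" unfolding mem_sumset by blast
  next
    fix x assume "x \<in> sumset (uminus ` A) (uminus ` multsum m A)"
    then obtain a b where "a \<in> A" "b \<in> multsum m A" "x = - (a + b)"
      by (auto simp: mem_sumset)
    then show "x \<in> uminus ` sumset A (multsum m A)" by (metis imageI sumsetI)
  qed
  then show ?case using Suc by simp
qed simp

lemma card_translate: "card ((\<lambda>x. x + c) ` A) = card (A::'a::ab_group_add set)"
  by (rule card_image) (simp add: inj_on_def)

text \<open>The map \<open>(u, x) \<mapsto> (a u - x, x - b u)\<close> with a fixed representation \<open>u = a u - b u\<close> is injective.\<close>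

lemma ruzsa_triangle:
  assumes "finite A" "finite B" "finite X"
  shows "card (diffset A B) * card X \<le> card (diffset A X) * card (diffset X B)"
proof -
  have "\<exists>p. fst p \<in> A \<and> snd p \<in> B \<and> u = fst p - snd p" if "u \<in> diffset A B" for u
    using that unfolding mem_diffset by (metis fst_conv snd_conv)
  then obtain r where r: "\<And>u. u \<in> diffset A B \<Longrightarrow> fst (r u) \<in> A \<and> snd (r u) \<in> B \<and> u = fst (r u) - snd (r u)"
    by metis
  let ?f = "\<lambda>(u, x). (fst (r u) - x, x - snd (r u))"
  have "inj_on ?f (diffset A B \<times> X)"
  proof (rule inj_onI, clarify)
    fix u x v y
    assume u: "u \<in> diffset A B" and v: "v \<in> diffset A B"
      and 1: "fst (r u) - x = fst (r v) - y" and 2: "x - snd (r u) = y - snd (r v)"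
    have "fst (r u) - snd (r u) = (fst (r u) - x) + (x - snd (r u))" by simp
    also have "\<dots> = fst (r v) - snd (r v)" unfolding 1 2 by simp
    finally have "u = v" using r[OF u] r[OF v] by metis
    then show "u = v \<and> x = y" using 1 by simp
  qed
  moreover have "?f ` (diffset A B \<times> X) \<subseteq> diffset A X \<times> diffset X B"
    using r by (auto intro!: diffsetI)
  ultimately have "card (diffset A B \<times> X) \<le> card (diffset A X \<times> diffset X B)"
    using assms by (intro card_inj_on_le) auto
  then show ?thesis by (simp add: card_cartesian_product)
qed

text \<open>\<open>X\<close> is a maximal subset of \<open>A\<close> whose translates of
  \<open>T\<close> are pairwise disjoint. Disjointness bounds \<open>card X\<close>. By maximality
  the translate of any \<open>a \<in> A\<close> meets one of them, so that \<open>a\<close> differs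
  from a point of \<open>X\<close> by an element of \<open>T - T\<close>.\<close>

lemma ruzsa_covering:
  fixes A T :: "'a::ab_group_add set"
  assumes "finite A" "finite T" "T \<noteq> {}" "real (card (sumset A T)) \<le> K * real (card T)"
  obtains X where "finite X" "X \<subseteq> A" "real (card X) \<le> K" "A \<subseteq> sumset X (diffset T T)"
proof -
  define tr where "tr x = (\<lambda>t. x + t) ` T" for x
  define P where "P X \<longleftrightarrow> X \<subseteq> A \<and> (\<forall>x\<in>X. \<forall>y\<in>X. x \<noteq> y \<longrightarrow> tr x \<inter> tr y = {})" for X
  have "finite {X. P X}" by (rule finite_subset[of _ "Pow A"]) (use assms in \<open>auto simp: P_def\<close>)
  moreover have "{} \<in> {X. P X}" by (simp add: P_def)
  ultimately obtain X where X: "P X" and max: "\<And>Y. P Y \<Longrightarrow> X \<subseteq> Y \<Longrightarrow> X = Y"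
    using finite_has_maximal[of "{X. P X}"] by auto
  have XA: "X \<subseteq> A" using X by (simp add: P_def)
  have fX: "finite X" using XA assms finite_subset by blast
  have "card (\<Union>x\<in>X. tr x) = (\<Sum>x\<in>X. card (tr x))"
    using fX X assms by (intro card_UN_disjoint) (auto simp: P_def tr_def)
  also have "\<dots> = card X * card T" by (simp add: tr_def card_image inj_on_def)
  finally have c1: "card (\<Union>x\<in>X. tr x) = card X * card T" .
  have "(\<Union>x\<in>X. tr x) \<subseteq> sumset A T" using XA by (auto simp: tr_def intro: sumsetI)
  then have "card X * card T \<le> card (sumset A T)"
    using assms unfolding c1[symmetric] by (intro card_mono) auto
  then have "real (card X) * real (card T) \<le> K * real (card T)"
    using assms(4) by (simp flip: of_nat_mult)
  moreover have "card T > 0" using assms by (simp add: card_gt_0_iff)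
  ultimately have "real (card X) \<le> K" by simp
  moreover have "A \<subseteq> sumset X (diffset T T)"
  proof
    fix a assume a: "a \<in> A"
    have "\<exists>x\<in>X. tr a \<inter> tr x \<noteq> {}"
    proof (rule ccontr)
      assume n: "\<not> ?thesis"
      then have "P (insert a X)" using X a unfolding P_def by (metis Int_commute insert_iff insert_subset)
      with max have "a \<in> X" by blast
      with n assms(3) show False by (auto simp: tr_def)
    qed
    then obtain x t t' where "x \<in> X" "t \<in> T" "t' \<in> T" "a + t = x + t'" by (auto simp: tr_def)
    then have "a = x + (t' - t)" by (simp add: eq_diff_eq add_diff_eq)
    then show "a \<in> sumset X (diffset T T)" using \<open>x \<in> X\<close> \<open>t \<in> T\<close> \<open>t' \<in> T\<close>
      by (auto intro!: sumsetI diffsetI)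
  qed
  ultimately show thesis using that fX XA by blast
qed

text \<open>Induction over \<open>C\<close>. \<open>Z\<close> holds the points whose translate of
  \<open>B\<close> by \<open>c\<close> is already covered, and \<open>W \<subseteq> Z\<close> those
  with \<open>x + c\<close> already in \<open>X + C\<close>. The new element \<open>c\<close> adds
  at most \<open>card (X + B) - card (Z + B)\<close> points to \<open>X + B + C\<close>, which
  minimality, applied to \<open>Z\<close>, bounds by \<open>K (card X - card Z)\<close>. It adds
  exactly \<open>card X - card W\<close> points to \<open>X + C\<close>.\<close>

lemma petridis:
  fixes X B :: "'a::ab_group_add set" and K :: real
  assumes fin: "finite X" "finite B" "finite C"
    and K: "real (card (sumset X B)) = K * real (card X)"
    and min: "\<And>Z. Z \<subseteq> X \<Longrightarrow> K * real (card Z) \<le> real (card (sumset Z B))"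
    and K0: "K \<ge> 0"
  shows "real (card (sumset (sumset X B) C)) \<le> K * real (card (sumset X C))"
  using fin(3)
proof (induction C)
  case empty
  then show ?case by (simp add: sumset_def)
next
  case (insert c C)
  define Z where "Z = {x \<in> X. (\<lambda>y. y + c) ` sumset {x} B \<subseteq> sumset (sumset X B) C}"
  define W where "W = {x \<in> X. x + c \<in> sumset X C}"
  let ?tr = "\<lambda>S. (\<lambda>y. y + c) ` S"
  have ZX: "Z \<subseteq> X" and fZ: "finite Z" and fW: "finite W" "W \<subseteq> X"
    using fin by (auto simp: Z_def W_def)
  have "W \<subseteq> Z"
  proof
    fix x assume "x \<in> W"
    then obtain x' c' where x: "x \<in> X" "x' \<in> X" "c' \<in> C" "x + c = x' + c'"
      by (auto simp: W_def mem_sumset)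
    have "y + c \<in> sumset (sumset X B) C" if y: "y \<in> sumset {x} B" for y
    proof -
      obtain b where b: "b \<in> B" "y = x + b" using y by (auto simp: mem_sumset)
      have "y + c = (x' + b) + c'" using x(4) b(2) by (metis add.assoc add.commute)
      moreover have "(x' + b) + c' \<in> sumset (sumset X B) C" using x b by (intro sumsetI)
      ultimately show ?thesis by simp
    qed
    then show "x \<in> Z" using x by (auto simp: Z_def)
  qed
  then have cWZ: "card W \<le> card Z" using fZ card_mono by blast
  have sub: "sumset (sumset X B) (insert c C) \<subseteq> sumset (sumset X B) C \<union> (?tr (sumset X B) - ?tr (sumset Z B))"
  proof
    fix v assume "v \<in> sumset (sumset X B) (insert c C)"
    then obtain u c' where v: "u \<in> sumset X B" "c' \<in> insert c C" "v = u + c'"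
      unfolding mem_sumset[of v] by blast
    have "?tr (sumset Z B) \<subseteq> sumset (sumset X B) C"
    proof
      fix y assume "y \<in> ?tr (sumset Z B)"
      then obtain z b where "z \<in> Z" "b \<in> B" "y = z + b + c" by (auto simp: mem_sumset)
      then show "y \<in> sumset (sumset X B) C" unfolding Z_def by (auto simp: mem_sumset image_subset_iff)
    qed
    moreover have "v \<in> sumset (sumset X B) C \<or> v \<in> ?tr (sumset X B)"
      using v by (auto intro: sumsetI)
    ultimately show "v \<in> sumset (sumset X B) C \<union> (?tr (sumset X B) - ?tr (sumset Z B))" by blast
  qed
  have subZ: "?tr (sumset Z B) \<subseteq> ?tr (sumset X B)" by (intro image_mono sumset_mono ZX order_refl)
  have "card (sumset (sumset X B) (insert c C)) \<le> card (sumset (sumset X B) C) + card (?tr (sumset X B) - ?tr (sumset Z B))"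
    using card_mono[OF _ sub] card_Un_le insert fin
    by (meson finite_Diff finite_UnI finite_imageI finite_sumset order_trans)
  also have "card (?tr (sumset X B) - ?tr (sumset Z B)) = card (sumset X B) - card (sumset Z B)"
    using subZ fin fZ by (subst card_Diff_subset) (auto simp: card_translate)
  finally have 1: "real (card (sumset (sumset X B) (insert c C))) \<le>
      real (card (sumset (sumset X B) C)) + (real (card (sumset X B)) - real (card (sumset Z B)))"
    using card_mono[OF _ subZ] fin fZ by (simp add: card_translate of_nat_diff)
  have eq: "sumset X (insert c C) = sumset X C \<union> (?tr X - ?tr W)"
  proof -
    have "sumset X (insert c C) = sumset X C \<union> ?tr X" unfolding sumset_def by force
    moreover have "?tr W \<subseteq> sumset X C" by (auto simp: W_def)
    ultimately show ?thesis by blast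
  qed
  have dis: "sumset X C \<inter> (?tr X - ?tr W) = {}" by (auto simp: W_def)
  have "card (sumset X (insert c C)) = card (sumset X C) + (card X - card W)"
    unfolding eq using dis fin insert fW
    by (subst card_Un_disjoint) (auto simp: card_Diff_subset card_translate image_mono)
  then have 2: "real (card (sumset X (insert c C))) = real (card (sumset X C)) + (real (card X) - real (card W))"
    using card_mono[OF fin(1) fW(2)] by (simp add: of_nat_diff)
  have "real (card (sumset (sumset X B) (insert c C))) \<le> K * card (sumset X C) + (K * card X - K * card Z)"
    using 1 insert.IH K min[OF ZX] by linarith
  also have "\<dots> \<le> K * card (sumset X C) + (K * card X - K * card W)"
    using cWZ K0 by (simp add: mult_left_mono)
  also have "\<dots> = K * card (sumset X (insert c C))" unfolding 2 by (simp add: algebra_simps)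
  finally show ?case .
qed

text \<open>\<open>X\<close> minimizes the ratio of \<open>card (X + B)\<close> to
  \<open>card X\<close> among the nonempty subsets of \<open>A\<close>. One \<open>X\<close> serves
  all \<open>m\<close>; this uniformity lets \<open>pluennecke_ruzsa\<close> combine two multiple
  sums.\<close>

lemma pluennecke:
  fixes A B :: "'a::ab_group_add set" and K :: real
  assumes fin: "finite A" "finite B" "A \<noteq> {}" and K: "real (card (sumset A B)) \<le> K * real (card A)"
  obtains X where "X \<subseteq> A" "X \<noteq> {}" "\<And>m. real (card (sumset X (multsum m B))) \<le> K ^ m * real (card X)"
proof -
  let ?r = "\<lambda>X. real (card (sumset X B)) / real (card X)"
  let ?S = "{X. X \<subseteq> A \<and> X \<noteq> {}}"
  have fS: "finite ?S" and neS: "?S \<noteq> {}" using fin by auto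
  define X where "X = arg_min_on ?r ?S"
  have X: "X \<in> ?S" unfolding X_def using fS neS by (rule arg_min_if_finite)
  have mn: "?r X \<le> ?r Z" if "Z \<in> ?S" for Z
    using arg_min_least[OF fS neS that] unfolding X_def .
  define K' where "K' = ?r X"
  have fX: "finite X" using X fin finite_subset by auto
  have cX: "card X > 0" using X fX by (simp add: card_gt_0_iff)
  have "K' \<le> ?r A" unfolding K'_def using mn fin by auto
  also have "\<dots> \<le> K" using K fin by (simp add: divide_le_eq card_gt_0_iff)
  finally have K'K: "K' \<le> K" .
  have K'0: "K' \<ge> 0" unfolding K'_def by simp
  have XB: "real (card (sumset X B)) = K' * real (card X)" using cX by (simp add: K'_def)
  have min: "K' * real (card Z) \<le> real (card (sumset Z B))" if "Z \<subseteq> X" for Z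
  proof (cases "Z = {}")
    case False
    then have "Z \<in> ?S" "card Z > 0" using that X fX by (auto simp: card_gt_0_iff finite_subset)
    then show ?thesis using mn[of Z] by (simp add: K'_def[symmetric] le_divide_eq)
  qed simp
  have "real (card (sumset X (multsum m B))) \<le> K' ^ m * real (card X)" for m
  proof (induction m)
    case 0
    then show ?case using card_sumset_le[of X "{0}"] fX by simp
  next
    case (Suc m)
    have "real (card (sumset X (multsum (Suc m) B))) = real (card (sumset (sumset X B) (multsum m B)))"
      by (simp add: sumset_assoc)
    also have "\<dots> \<le> K' * real (card (sumset X (multsum m B)))"
      by (rule petridis[OF fX fin(2) _ XB min K'0]) (use fin in auto)
    also have "\<dots> \<le> K' * (K' ^ m * real (card X))" using Suc K'0 by (rule mult_left_mono)
    finally show ?case by (simp add: mult.assoc)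
  qed
  moreover have "K' ^ m * real (card X) \<le> K ^ m * real (card X)" for m
    using K'K K'0 by (intro mult_right_mono power_mono) auto
  ultimately have "real (card (sumset X (multsum m B))) \<le> K ^ m * real (card X)" for m
    using order_trans by blast
  then show thesis using that X by blast
qed

text \<open>The previous bound is used with \<open>B = - T\<close>, and the two multiple sums are
  compared through the common \<open>X\<close> by the Ruzsa triangle inequality.\<close>

lemma pluennecke_ruzsa:
  fixes T :: "'a::ab_group_add set" and K :: real
  assumes fin: "finite T" "T \<noteq> {}" and K: "real (card (diffset T T)) \<le> K * real (card T)"
  shows "real (card (diffset (multsum n T) (multsum m T))) \<le> K ^ (n + m) * real (card T)"
proof -
  have K0: "0 \<le> K"
  proof (rule ccontr)
    assume "\<not> 0 \<le> K"
    moreover have "0 < real (card T)" using fin by (simp add: card_gt_0_iff)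
    ultimately have "K * real (card T) < 0" by (simp add: mult_neg_pos)
    then show False using K by linarith
  qed
  have "real (card (sumset T (uminus ` T))) \<le> K * real (card T)" using K by (simp add: diffset_uminus)
  then obtain X where X: "X \<subseteq> T" "X \<noteq> {}"
      "\<And>m. real (card (sumset X (multsum m (uminus ` T)))) \<le> K ^ m * real (card X)"
    using pluennecke[of T "uminus ` T" K] fin by blast
  have fX: "finite X" using X fin finite_subset by auto
  have cX: "card X > 0" using X fX by (simp add: card_gt_0_iff)
  have d: "real (card (diffset X (multsum m T))) \<le> K ^ m * real (card X)" for m
    using X(3)[of m] by (simp add: diffset_uminus uminus_multsum)
  have "real (card (diffset (multsum n T) (multsum m T))) * real (card X)
      \<le> real (card (diffset (multsum n T) X)) * real (card (diffset X (multsum m T)))"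
    using ruzsa_triangle[of "multsum n T" "multsum m T" X] fin fX
    by (metis finite_multsum of_nat_le_iff of_nat_mult)
  also have "\<dots> \<le> (K ^ n * real (card X)) * (K ^ m * real (card X))"
    using d[of n] d[of m] K0 by (intro mult_mono) (auto simp: card_diffset_swap[of _ X])
  finally have "real (card (diffset (multsum n T) (multsum m T))) \<le> K ^ (n + m) * real (card X)"
    using cX by (simp add: power_add mult_ac)
  also have "\<dots> \<le> K ^ (n + m) * real (card T)"
    using K0 X fin by (intro mult_left_mono) (auto simp: card_mono)
  finally show ?thesis .
qed

section \<open>Integer multiples and sumsets with dilates\<close>

definition zmul :: "int \<Rightarrow> 'a::ab_group_add \<Rightarrow> 'a" where
  "zmul c x = (\<Sum>i<nat c. x) - (\<Sum>i<nat (- c). x)"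

lemma zmul_0_left [simp]: "zmul 0 x = 0"
  and zmul_1_left [simp]: "zmul 1 x = x"
  and zmul_0_right [simp]: "zmul c 0 = 0"
  by (simp_all add: zmul_def)

lemma zmul_add_right: "zmul c (x + y) = zmul c x + zmul c y"
  by (simp add: zmul_def sum.distrib)

lemma zmul_succ: "zmul (c + 1) x = zmul c x + x"
proof (cases "c \<ge> 0")
  case True
  then have "nat (c + 1) = Suc (nat c)" "nat (- c) = 0" "nat (- (c + 1)) = 0" by auto
  then show ?thesis by (simp add: zmul_def)
next
  case False
  then have "nat (c + 1) = 0" "nat c = 0" "nat (- c) = Suc (nat (- (c + 1)))" by auto
  then show ?thesis by (simp add: zmul_def)
qed

lemma zmul_pred: "zmul (c - 1) x = zmul c x - x"
  using zmul_succ[of "c - 1" x] by (simp add: algebra_simps)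

lemma zmul_add_left: "zmul (c + d) x = zmul c x + zmul d x"
proof (induction d rule: int_induct[where k = 0])
  case (step1 i)
  have "zmul (c + (i + 1)) x = zmul (c + i + 1) x" by (simp add: add.assoc)
  also have "\<dots> = zmul c x + zmul (i + 1) x" using step1 unfolding zmul_succ by (simp add: add.assoc)
  finally show ?case .
next
  case (step2 i)
  have "zmul (c + (i - 1)) x = zmul (c + i - 1) x" by (simp add: add_diff_eq)
  also have "\<dots> = zmul c x + zmul (i - 1) x" using step2 unfolding zmul_pred by (simp add: add_diff_eq)
  finally show ?case .
qed simp

lemma zmul_minus_right: "zmul c (- x) = - zmul c x"
  using zmul_add_right[of c x "- x"] by (simp add: eq_neg_iff_add_eq_0 add.commute)

lemma zmul_minus_left: "zmul (- c) x = - zmul c x"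
  using zmul_add_left[of c "- c" x] by (simp add: eq_neg_iff_add_eq_0 add.commute)

lemma zmul_diff_right: "zmul c (x - y) = zmul c x - zmul c y"
  using zmul_add_right[of c x "- y"] by (simp add: zmul_minus_right)

lemma zmul_diff_left: "zmul (c - d) x = zmul c x - zmul d x"
  using zmul_add_left[of c "- d" x] by (simp add: zmul_minus_left)

lemma zmul_zmul: "zmul c (zmul d x) = zmul (c * d) x"
proof (induction c rule: int_induct[where k = 0])
  case (step1 i)
  then show ?case by (simp add: zmul_succ distrib_right zmul_add_left)
next
  case (step2 i)
  then show ?case by (simp add: zmul_pred left_diff_distrib zmul_diff_left)
qed simp

lemma zmul_sum_right: "zmul c (\<Sum>i\<in>I. f i) = (\<Sum>i\<in>I. zmul c (f i))"
  by (induction I rule: infinite_finite_induct) (auto simp: zmul_add_right)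

lemma zmul_sum_left: "zmul (\<Sum>i\<in>I. f i) x = (\<Sum>i\<in>I. zmul (f i) x)"
  by (induction I rule: infinite_finite_induct) (auto simp: zmul_add_left)

lemma zmul_2: "zmul 2 x = x + x"
  using zmul_succ[of 1 x] by simp

lemma fst_zmul: "fst (zmul c p) = zmul c (fst p)" and snd_zmul: "snd (zmul c p) = zmul c (snd p)"
  by (simp_all add: zmul_def fst_sum snd_sum)

lemma sum_fun_apply: "(\<Sum>i\<in>I. f i) x = (\<Sum>i\<in>I. f i x)"
  for f :: "'i \<Rightarrow> 'a \<Rightarrow> 'b::comm_monoid_add"
  by (induction I rule: infinite_finite_induct) auto

lemma zmul_fun: "zmul c f = (\<lambda>i. zmul c (f i))"
  by (rule ext) (simp add: zmul_def sum_fun_apply)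

text \<open>The binary digits of \<open>c\<close> are used one at a time. With
  \<open>c = 2 d + e\<close> the set \<open>S + S\<close> occurs twice, once for doubling and once
  for adding \<open>e\<close> times the point, and both times it is covered by the translates from
  \<open>X\<close>. The exponent of \<open>K\<close> is therefore linear in the number of
  digits.\<close>

lemma dilate_cover:
  fixes T :: "'a::ab_group_add set"
  defines "S \<equiv> diffset T T"
  assumes T: "finite T" "T \<noteq> {}" and XS: "finite X" "real (card X) \<le> K" "sumset S S \<subseteq> sumset X S"
    and c: "0 \<le> c" "c < 2 ^ B"
  shows "\<exists>Y. finite Y \<and> real (card Y) \<le> K ^ (2 * B) \<and> zmul c ` S \<subseteq> sumset Y S"
  using c
proof (induction B arbitrary: c)
  case 0
  obtain t where "t \<in> T" using T by blast
  then have "0 \<in> S" unfolding S_def by (metis diff_self diffsetI)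
  then have "0 + 0 \<in> sumset {0} S" by (intro sumsetI) auto
  moreover have "c = 0" using 0 by auto
  ultimately have "zmul c ` S \<subseteq> sumset {0} S" by auto
  then show ?case by (intro exI[of _ "{0}"]) auto
next
  case (Suc B)
  define d e where "d = c div 2" and "e = c mod 2"
  have ce: "c = 2 * d + e" "e = 0 \<or> e = 1" "0 \<le> d" "d < 2 ^ B" using Suc.prems by (auto simp: d_def e_def)
  obtain Y where Y: "finite Y" "real (card Y) \<le> K ^ (2 * B)" "zmul d ` S \<subseteq> sumset Y S"
    using Suc.IH ce by blast
  obtain t where t: "t \<in> T" using T by blast
  then have S0: "0 \<in> S" unfolding S_def by (metis diff_self diffsetI)
  let ?Y = "sumset (zmul 2 ` Y) (sumset X X)"
  have K0: "0 \<le> K" using XS(2) by linarith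
  have fY: "finite ?Y" using Y XS by simp
  have "card ?Y \<le> card Y * (card X * card X)"
    using card_sumset_le[of "zmul 2 ` Y" "sumset X X"] card_sumset_le[of X X] Y XS card_image_le[of Y "zmul 2"]
    by (meson finite_imageI finite_sumset mult_le_mono order_trans)
  then have "real (card ?Y) \<le> real (card Y) * (real (card X) * real (card X))"
    unfolding of_nat_mult[symmetric] of_nat_le_iff .
  also have "\<dots> \<le> K ^ (2 * B) * (K * K)"
    using Y XS K0 by (intro mult_mono) auto
  finally have cY: "real (card ?Y) \<le> K ^ (2 * Suc B)" by (simp add: power_add mult_ac)
  have "zmul c s \<in> sumset ?Y S" if s: "s \<in> S" for s
  proof -
    have "zmul d s \<in> sumset Y S" using Y(3) s by blast
    then obtain y s1 where 1: "y \<in> Y" "s1 \<in> S" "zmul d s = y + s1" unfolding mem_sumset by blast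
    have "s1 + s1 \<in> sumset S S" using 1 by (intro sumsetI)
    then have "s1 + s1 \<in> sumset X S" using XS(3) by blast
    then obtain x s2 where 2: "x \<in> X" "s2 \<in> S" "s1 + s1 = x + s2" unfolding mem_sumset by blast
    have "s2 + zmul e s \<in> sumset S S" using 2 s S0 ce(2) by (auto intro!: sumsetI)
    then have "s2 + zmul e s \<in> sumset X S" using XS(3) by blast
    then obtain x' s3 where 3: "x' \<in> X" "s3 \<in> S" "s2 + zmul e s = x' + s3"
      unfolding mem_sumset by blast
    have "zmul c s = zmul 2 (zmul d s) + zmul e s" by (simp add: ce(1) zmul_add_left zmul_zmul)
    also have "\<dots> = zmul 2 y + (s1 + s1) + zmul e s" by (simp add: 1 zmul_add_right zmul_2)
    also have "\<dots> = zmul 2 y + x + (s2 + zmul e s)" by (simp add: 2 add.assoc)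
    also have "\<dots> = (zmul 2 y + (x + x')) + s3" by (simp add: 3 add.assoc)
    finally show ?thesis using 1 2 3 by (auto intro!: sumsetI)
  qed
  then show ?case using fY cY by blast
qed

text \<open>This will bound the number of possible errors in the conversion. Covering puts
  \<open>c T - T\<close> into few translates of \<open>S = T - T\<close>, so that it suffices to
  bound the fibres of \<open>S\<close>, although only those of \<open>T\<close> are given.\<close>

lemma dilate_difference_fiber:
  fixes T :: "('a::ab_group_add \<times> 'b::ab_group_add) set"
  assumes T: "finite T" "T \<noteq> {}" and K: "real (card (diffset T T)) \<le> K * real (card T)"
    and F: "\<And>x. real (card {v. (x, v) \<in> T}) \<le> F" and c: "\<bar>c\<bar> < 2 ^ B"
  shows "finite {v. \<exists>t\<in>T. \<exists>t'\<in>T. zmul c t - t' = (x, v)}"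
    and "real (card {v. \<exists>t\<in>T. \<exists>t'\<in>T. zmul c t - t' = (x, v)}) \<le> K ^ (10 * B + 10) * F"
proof -
  define S where "S = diffset T T"
  \<comment> \<open>The exponent 5 belongs to \<open>S + S + T\<close>, a difference of three and
    two copies of \<open>T\<close>. The last summand \<open>T\<close> serves both the covering lemma
    and the fibre bound for \<open>S\<close>.\<close>
  define K1 where "K1 = K ^ 5"
  have fS: "finite S" using T by (simp add: S_def)
  obtain t0 where t0: "t0 \<in> T" using T by blast
  have S0: "0 \<in> S" unfolding S_def using t0 by (metis diff_self diffsetI)
  have cT: "card T > 0" using T by (simp add: card_gt_0_iff)
  have "sumset (sumset S S) T \<subseteq> diffset (multsum 3 T) (multsum 2 T)"
  proof
    fix v assume "v \<in> sumset (sumset S S) T"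
    then obtain s s' t where ss: "s \<in> S" "s' \<in> S" "t \<in> T" "v = s + s' + t"
      by (auto simp: mem_sumset)
    then obtain a b a' b' where *: "a \<in> T" "b \<in> T" "a' \<in> T" "b' \<in> T" "v = (a - b) + (a' - b') + t"
      unfolding S_def mem_diffset by blast
    have "a + (a' + (t + 0)) \<in> multsum 3 T" unfolding numeral_3_eq_3 multsum.simps
      using * ss by (intro sumsetI) auto
    moreover have "b + (b' + 0) \<in> multsum 2 T" unfolding numeral_2_eq_2 multsum.simps
      using * by (intro sumsetI) auto
    moreover have "v = (a + (a' + (t + 0))) - (b + (b' + 0))" using * by (simp add: algebra_simps)
    ultimately show "v \<in> diffset (multsum 3 T) (multsum 2 T)" by (metis diffsetI)
  qed
  then have "card (sumset (sumset S S) T) \<le> card (diffset (multsum 3 T) (multsum 2 T))"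
    using T by (intro card_mono) auto
  also have "real \<dots> \<le> K ^ (3 + 2) * real (card T)" by (rule pluennecke_ruzsa[OF T K])
  finally have K1: "real (card (sumset (sumset S S) T)) \<le> K1 * real (card T)" by (simp add: K1_def)
  then obtain X where X: "finite X" "real (card X) \<le> K1" "sumset S S \<subseteq> sumset X S"
    using ruzsa_covering[of "sumset S S" T K1] T fS unfolding S_def by (metis finite_sumset)
  have "0 + 0 + t0 \<in> sumset (sumset S S) T" using S0 t0 by (intro sumsetI)
  then have "sumset S S \<noteq> {}" unfolding sumset_def by auto
  have K10: "0 \<le> K1" using X(2) by linarith
  define d where "d = \<bar>c\<bar>"
  obtain Y where Y: "finite Y" "real (card Y) \<le> K1 ^ (2 * B)" "zmul d ` S \<subseteq> sumset Y S"
    using dilate_cover[OF T X[unfolded S_def], of d B] c unfolding S_def d_def by auto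
  have cS: "zmul c s \<in> sumset Y S" if "s \<in> S" for s
  proof (cases "c \<ge> 0")
    case True
    then show ?thesis using Y(3) that by (auto simp: d_def)
  next
    case False
    have "- s \<in> S" using that unfolding S_def mem_diffset by (metis minus_diff_eq)
    then have "zmul d (- s) \<in> sumset Y S" using Y(3) by blast
    then show ?thesis using False by (simp add: d_def zmul_minus_left zmul_minus_right)
  qed
  define Z where "Z = (\<lambda>y. y + (zmul c t0 - t0)) ` sumset Y X"
  have fZ: "finite Z" using Y X by (simp add: Z_def)
  have "card Z \<le> card Y * card X"
    using card_sumset_le[of Y X] Y X by (simp add: Z_def card_translate)
  then have "real (card Z) \<le> real (card Y) * real (card X)" unfolding of_nat_mult[symmetric] of_nat_le_iff .
  also have "\<dots> \<le> K1 ^ (2 * B) * K1" using Y X K10 by (intro mult_mono) auto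
  finally have cZ: "real (card Z) \<le> K1 ^ (2 * B) * K1" .
  have inZS: "zmul c t - t' \<in> sumset Z S" if t: "t \<in> T" "t' \<in> T" for t t'
  proof -
    have "t - t0 \<in> S" using t t0 unfolding S_def by (intro diffsetI)
    then obtain y s where 1: "y \<in> Y" "s \<in> S" "zmul c (t - t0) = y + s" using cS unfolding mem_sumset by blast
    have "t0 - t' \<in> S" using t t0 unfolding S_def by (intro diffsetI)
    then have "s + (t0 - t') \<in> sumset S S" using 1 by (intro sumsetI)
    then have "s + (t0 - t') \<in> sumset X S" using X(3) by blast
    then obtain x s' where 2: "x \<in> X" "s' \<in> S" "s + (t0 - t') = x + s'" unfolding mem_sumset by blast
    have "zmul c t - t' = zmul c (t - t0) + (t0 - t') + (zmul c t0 - t0)" by (simp add: zmul_diff_right)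
    also have "\<dots> = y + (s + (t0 - t')) + (zmul c t0 - t0)" by (simp add: 1 add.assoc)
    also have "\<dots> = (y + x + (zmul c t0 - t0)) + s'" by (simp add: 2 add_ac)
    finally show ?thesis using 1 2 unfolding Z_def by (auto intro!: sumsetI imageI)
  qed
  have fibS: "real (card {v. (x, v) \<in> S}) \<le> K1 * F" for x
  proof -
    \<comment> \<open>With one point \<open>(u, g u)\<close> of \<open>T\<close> chosen over each
      \<open>u \<in> P\<close>, the sums \<open>(x, v) + (u, g u)\<close> with
      \<open>(x, v) \<in> S\<close> are distinct elements of \<open>S + S + T\<close>. A large fibre
      of \<open>S\<close> would make this set too large.\<close>
    define P where "P = fst ` T"
    have "\<forall>u\<in>P. \<exists>v. (u, v) \<in> T" by (auto simp: P_def)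
    then obtain g where g: "\<And>u. u \<in> P \<Longrightarrow> (u, g u) \<in> T" by metis
    have fP: "finite P" using T by (simp add: P_def)
    have "P \<noteq> {}" using T by (simp add: P_def)
    then have cP: "real (card P) > 0" using fP by (simp add: card_gt_0_iff)
    let ?V = "{v. (x, v) \<in> S}"
    have fV: "finite ?V" by (rule finite_subset[of _ "snd ` S"]) (use fS in force)+
    let ?f = "\<lambda>(v, u). (x, v) + (u, g u)"
    have "inj_on ?f (?V \<times> P)" by (auto simp: inj_on_def)
    moreover have "?f ` (?V \<times> P) \<subseteq> sumset (sumset S S) T"
    proof
      fix w assume "w \<in> ?f ` (?V \<times> P)"
      then obtain v u where vu: "(x, v) \<in> S" "u \<in> P" "w = ((x, v) + 0) + (u, g u)" by auto
      show "w \<in> sumset (sumset S S) T" unfolding vu(3) using vu S0 g by (intro sumsetI) auto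
    qed
    ultimately have "card (?V \<times> P) \<le> card (sumset (sumset S S) T)"
      using fS T by (intro card_inj_on_le) auto
    then have "real (card ?V) * real (card P) \<le> K1 * real (card T)"
      using K1 by (simp add: card_cartesian_product flip: of_nat_mult)
    also have "real (card T) \<le> F * real (card P)"
    proof -
      have "T = (\<Union>u\<in>P. Pair u ` {v. (u, v) \<in> T})" by (force simp: P_def)
      then have "card T = card (\<Union>u\<in>P. Pair u ` {v. (u, v) \<in> T})" by (rule arg_cong)
      also have "\<dots> \<le> (\<Sum>u\<in>P. card (Pair u ` {v. (u, v) \<in> T}))"
        using fP by (rule card_UN_le)
      also have "\<dots> = (\<Sum>u\<in>P. card {v. (u, v) \<in> T})" by (simp add: card_image inj_on_def)
      finally have "real (card T) \<le> (\<Sum>u\<in>P. real (card {v. (u, v) \<in> T}))" unfolding of_nat_sum[symmetric] of_nat_le_iff .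
      also have "\<dots> \<le> (\<Sum>u\<in>P. F)" by (intro sum_mono F)
      finally show ?thesis by (simp add: mult.commute)
    qed
    finally have "real (card ?V) * real (card P) \<le> (K1 * F) * real (card P)"
      using K10 by (simp add: mult_left_mono mult.assoc)
    then show ?thesis using cP by simp
  qed
  let ?W = "{v. \<exists>t\<in>T. \<exists>t'\<in>T. zmul c t - t' = (x, v)}"
  have sub: "?W \<subseteq> (\<Union>z\<in>Z. (\<lambda>v. snd z + v) ` {v. (x - fst z, v) \<in> S})"
  proof
    fix v assume "v \<in> ?W"
    then have "(x, v) \<in> sumset Z S" using inZS by force
    then obtain z s where z: "z \<in> Z" "s \<in> S" "(x, v) = z + s" unfolding mem_sumset by blast
    then have "s = (x - fst z, v - snd z)" by (cases z; cases s) auto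
    with z have "(x - fst z, v - snd z) \<in> S" by simp
    then have "snd z + (v - snd z) \<in> (\<lambda>v. snd z + v) ` {v. (x - fst z, v) \<in> S}" by (intro imageI) simp
    then show "v \<in> (\<Union>z\<in>Z. (\<lambda>v. snd z + v) ` {v. (x - fst z, v) \<in> S})" using z by auto
  qed
  have fin: "finite {v. (y, v) \<in> S}" for y
    by (rule finite_subset[of _ "snd ` S"]) (use fS in force)+
  have finU: "finite (\<Union>z\<in>Z. (\<lambda>v. snd z + v) ` {v. (x - fst z, v) \<in> S})" using fZ fin by auto
  then show "finite ?W" using sub by (rule rev_finite_subset)
  have "card ?W \<le> card (\<Union>z\<in>Z. (\<lambda>v. snd z + v) ` {v. (x - fst z, v) \<in> S})"
    by (rule card_mono[OF finU sub])
  also have "\<dots> \<le> (\<Sum>z\<in>Z. card ((\<lambda>v. snd z + v) ` {v. (x - fst z, v) \<in> S}))" using fZ by (rule card_UN_le)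
  also have "\<dots> = (\<Sum>z\<in>Z. card {v. (x - fst z, v) \<in> S})" by (simp add: card_image inj_on_def)
  finally have "real (card ?W) \<le> (\<Sum>z\<in>Z. real (card {v. (x - fst z, v) \<in> S}))" unfolding of_nat_sum[symmetric] of_nat_le_iff .
  also have "\<dots> \<le> (\<Sum>z\<in>Z. K1 * F)" by (intro sum_mono fibS)
  also have "\<dots> = real (card Z) * (K1 * F)" by simp
  also have "\<dots> \<le> (K1 ^ (2 * B) * K1) * (K1 * F)"
    using cZ K10 F[of undefined] by (intro mult_right_mono mult_nonneg_nonneg) (auto intro: order_trans[OF of_nat_0_le_iff])
  also have "\<dots> = K1 ^ (2 * B + 2) * F" by (simp add: power_add power2_eq_square)
  also have "K1 ^ (2 * B + 2) = K ^ (10 * B + 10)" 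
    unfolding K1_def power_mult[symmetric] by (simp add: algebra_simps)
  finally show "real (card ?W) \<le> K ^ (10 * B + 10) * F" .
qed

section \<open>Dense graphs and positive definite kernels\<close>

lemma card_pairs_eq_sum:
  assumes "finite A" "finite B"
  shows "card {p \<in> A \<times> B. P (fst p) (snd p)} = (\<Sum>a\<in>A. card {b \<in> B. P a b})"
proof -
  have "{p \<in> A \<times> B. P (fst p) (snd p)} = Sigma A (\<lambda>a. {b \<in> B. P a b})" by auto
  then show ?thesis using assms by (simp add: card_SigmaI)
qed

lemma card_pairs_eq_sum':
  assumes "finite A" "finite B"
  shows "card {p \<in> A \<times> B. P (fst p) (snd p)} = (\<Sum>b\<in>B. card {a \<in> A. P a b})"
proof -
  have "{p \<in> A \<times> B. P (fst p) (snd p)} = prod.swap ` Sigma B (\<lambda>b. {a \<in> A. P a b})" by (auto simp: image_iff)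
  then show ?thesis using assms by (simp add: card_SigmaI card_image)
qed

text \<open>A dense part of a random neighbourhood works: a pair of vertices with few common neighbours
  is unlikely to lie in it.\<close>

lemma dense_graph_paths:
  fixes E :: "'a \<Rightarrow> 'a \<Rightarrow> bool" and \<alpha> :: real
  assumes A: "finite A" "A \<noteq> {}" and \<alpha>: "0 < \<alpha>"
    and E: "\<alpha> * real (card A) ^ 2 \<le> real (card {p \<in> A \<times> A. E (fst p) (snd p)})"
  obtains A' where "A' \<subseteq> A" "\<alpha> / 2 * real (card A) \<le> real (card A')"
    "\<And>x y. x \<in> A' \<Longrightarrow> y \<in> A' \<Longrightarrow> \<alpha> ^ 5 / 4096 * real (card A) ^ 3 \<le>
      real (card {(b, z, b'). b \<in> A \<and> z \<in> A \<and> b' \<in> A \<and> E x b \<and> E z b \<and> E z b' \<and> E y b'})"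
proof -
  define n where "n = real (card A)"
  have n0: "n > 0" using A by (simp add: n_def card_gt_0_iff)
  define c where "c x y = real (card {b \<in> A. E x b \<and> E y b})" for x y
  define N where "N b = {x \<in> A. E x b}" for b
  define d where "d b = real (card (N b))" for b
  \<comment> \<open>With this \<open>\<epsilon>\<close>, sixteen times the number of bad pairs uses
    up half of the second moment. The weight 16 ensures that at most \<open>d b / 4\<close> vertices
    have more than \<open>d b / 4\<close> bad partners, so that two remaining vertices share
    \<open>d b / 2\<close> good middle vertices. The constant 4096 is
    \<open>4 * 32 ^ 2\<close>.\<close>
  define \<epsilon> where "\<epsilon> = \<alpha>\<^sup>2 / 32"
  define bad where "bad b = {p \<in> N b \<times> N b. c (fst p) (snd p) < \<epsilon> * n}" for b
  have fN: "finite (N b)" for b using A by (simp add: N_def)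
  have "\<alpha> * n\<^sup>2 \<le> (\<Sum>b\<in>A. d b)"
    using E card_pairs_eq_sum'[OF A(1) A(1), of E] by (simp add: n_def d_def N_def)
  then have "(\<alpha> * n\<^sup>2)\<^sup>2 \<le> (\<Sum>b\<in>A. d b)\<^sup>2" using \<alpha> n0 by (intro power_mono) auto
  also have "\<dots> \<le> (\<Sum>b\<in>A. 1\<^sup>2) * (\<Sum>b\<in>A. (d b)\<^sup>2)"
    using Cauchy_Schwarz_ineq_sum[of "\<lambda>_. 1" d A] by simp
  finally have "n * (\<alpha>\<^sup>2 * n ^ 3) \<le> n * (\<Sum>b\<in>A. (d b)\<^sup>2)"
    by (simp add: n_def power2_eq_square power3_eq_cube mult_ac)
  then have sumd: "\<alpha>\<^sup>2 * n ^ 3 \<le> (\<Sum>b\<in>A. (d b)\<^sup>2)" using n0 by simp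
  have "(\<Sum>b\<in>A. real (card (bad b))) = (\<Sum>b\<in>A. \<Sum>p\<in>A\<times>A. of_bool (E (fst p) b \<and> E (snd p) b \<and> c (fst p) (snd p) < \<epsilon> * n))"
  proof (rule sum.cong[OF refl])
    fix b assume "b \<in> A"
    have "bad b = (A \<times> A) \<inter> {p. E (fst p) b \<and> E (snd p) b \<and> c (fst p) (snd p) < \<epsilon> * n}"
      by (auto simp: bad_def N_def)
    then show "real (card (bad b)) = (\<Sum>p\<in>A\<times>A. of_bool (E (fst p) b \<and> E (snd p) b \<and> c (fst p) (snd p) < \<epsilon> * n))"
      using A by (simp add: sum_of_bool_eq)
  qed
  also have "\<dots> = (\<Sum>p\<in>A\<times>A. \<Sum>b\<in>A. of_bool (E (fst p) b \<and> E (snd p) b \<and> c (fst p) (snd p) < \<epsilon> * n))"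
    by (rule sum.swap)
  also have "\<dots> \<le> (\<Sum>p\<in>A\<times>A. \<epsilon> * n)"
  proof (rule sum_mono)
    fix p assume "p \<in> A \<times> A"
    show "(\<Sum>b\<in>A. of_bool (E (fst p) b \<and> E (snd p) b \<and> c (fst p) (snd p) < \<epsilon> * n)) \<le> \<epsilon> * n"
    proof (cases "c (fst p) (snd p) < \<epsilon> * n")
      case True
      have "(\<Sum>b\<in>A. of_bool (E (fst p) b \<and> E (snd p) b \<and> c (fst p) (snd p) < \<epsilon> * n)) = c (fst p) (snd p)"
        using A True by (simp add: sum_of_bool_eq c_def Int_def)
      then show ?thesis using True by simp
    next
      case False
      then show ?thesis using n0 by (simp add: \<epsilon>_def)
    qed
  qed
  also have "\<dots> = \<epsilon> * n ^ 3" by (simp add: n_def power3_eq_cube card_cartesian_product)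
  finally have sumbad: "(\<Sum>b\<in>A. real (card (bad b))) \<le> \<epsilon> * n ^ 3" .
  have "(\<Sum>b\<in>A. (\<alpha> * n)\<^sup>2 / 2) \<le> (\<Sum>b\<in>A. (d b)\<^sup>2 - 16 * real (card (bad b)))"
  proof -
    have "(\<Sum>b\<in>A. (\<alpha> * n)\<^sup>2 / 2) = \<alpha>\<^sup>2 * n ^ 3 - 16 * (\<epsilon> * n ^ 3)"
      by (simp add: n_def \<epsilon>_def power2_eq_square power3_eq_cube)
    also have "\<dots> \<le> (\<Sum>b\<in>A. (d b)\<^sup>2) - 16 * (\<Sum>b\<in>A. real (card (bad b)))"
      using sumd sumbad by linarith
    finally show ?thesis by (simp add: sum_subtractf sum_distrib_left)
  qed
  then have "\<exists>b\<in>A. (\<alpha> * n)\<^sup>2 / 2 \<le> (d b)\<^sup>2 - 16 * real (card (bad b))"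
    using A by (meson not_less sum_strict_mono linorder_not_le)
  then obtain b where b: "b \<in> A" "(\<alpha> * n)\<^sup>2 / 2 \<le> (d b)\<^sup>2 - 16 * real (card (bad b))" by blast
  have d0: "d b \<ge> 0" by (simp add: d_def)
  have badle: "16 * real (card (bad b)) \<le> (d b)\<^sup>2"
    using b(2) zero_le_power2[of "\<alpha> * n"] by linarith
  have "(\<alpha> * n)\<^sup>2 / 2 \<le> (d b)\<^sup>2" using b(2) by linarith
  moreover have "(2 / 3 * (\<alpha> * n))\<^sup>2 \<le> (\<alpha> * n)\<^sup>2 / 2" by (simp add: power_mult_distrib field_simps)
  ultimately have "2 / 3 * (\<alpha> * n) \<le> d b" using d0 power2_le_imp_le order_trans by blast
  then have dlb: "\<alpha> * n \<le> 3 / 2 * d b" by linarith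
  define bp where "bp x = {y \<in> N b. c x y < \<epsilon> * n}" for x
  define A' where "A' = {x \<in> N b. real (card (bp x)) \<le> d b / 4}"
  have A'N: "A' \<subseteq> N b" by (auto simp: A'_def)
  have "(\<Sum>x\<in>N b. real (card (bp x))) = real (card (bad b))"
    unfolding bad_def bp_def using card_pairs_eq_sum[OF fN fN, where P = "\<lambda>x y. c x y < \<epsilon> * n"] by simp
  moreover have "(\<Sum>x\<in>N b - A'. d b / 4) \<le> (\<Sum>x\<in>N b - A'. real (card (bp x)))"
    by (intro sum_mono) (auto simp: A'_def)
  moreover have "(\<Sum>x\<in>N b - A'. real (card (bp x))) \<le> (\<Sum>x\<in>N b. real (card (bp x)))"
    by (intro sum_mono2 fN) auto
  ultimately have "real (card (N b - A')) * (d b / 4) \<le> (d b)\<^sup>2 / 16"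
    using badle unfolding sum_constant by linarith
  moreover have "\<alpha> * n > 0" using n0 \<alpha> by simp
  then have "d b > 0" using dlb by linarith
  ultimately have "real (card (N b - A')) \<le> d b / 4" by (simp add: power2_eq_square)
  moreover have "real (card (N b - A')) = d b - real (card A')"
    using A'N fN by (simp add: card_Diff_subset finite_subset card_mono of_nat_diff d_def)
  ultimately have cA': "3 / 4 * d b \<le> real (card A')" by linarith
  show thesis
  proof
    show "A' \<subseteq> A" using A'N by (auto simp: N_def)
    show "\<alpha> / 2 * real (card A) \<le> real (card A')" using cA' dlb by (simp add: n_def)
  next
    fix x y assume x: "x \<in> A'" and y: "y \<in> A'"
    define Z where "Z = N b - bp x - bp y"
    have "card (N b) \<le> card (Z \<union> bp x \<union> bp y)" using fN by (intro card_mono) (auto simp: Z_def bp_def)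
    also have "\<dots> \<le> card Z + card (bp x) + card (bp y)"
      by (meson add_mono_thms_linordered_semiring(3) card_Un_le order_trans)
    finally have cZ: "d b / 2 \<le> real (card Z)"
      using x y unfolding A'_def d_def by force
    have fZ: "finite Z" using fN by (simp add: Z_def)
    have Z1: "\<epsilon> * n \<le> c x z" "\<epsilon> * n \<le> c y z" if "z \<in> Z" for z
      using that by (auto simp: Z_def bp_def)
    define S where "S = Sigma Z (\<lambda>z. {b \<in> A. E x b \<and> E z b} \<times> {b \<in> A. E y b \<and> E z b})"
    define Tr where "Tr = {(b, z, b'). b \<in> A \<and> z \<in> A \<and> b' \<in> A \<and> E x b \<and> E z b \<and> E z b' \<and> E y b'}"
    have fTr: "finite Tr" by (rule finite_subset[of _ "A \<times> A \<times> A"]) (use A in \<open>auto simp: Tr_def\<close>)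
    have "inj_on (\<lambda>(z, b, b'). (b, z, b')) S" by (auto simp: inj_on_def)
    moreover have "(\<lambda>(z, b, b'). (b, z, b')) ` S \<subseteq> Tr" by (auto simp: S_def Tr_def Z_def N_def)
    ultimately have "card S \<le> card Tr" using fTr by (intro card_inj_on_le)
    moreover have "real (card S) = (\<Sum>z\<in>Z. c x z * c y z)"
      using fZ A by (simp add: S_def card_SigmaI c_def card_cartesian_product)
    moreover have "(\<Sum>z\<in>Z. (\<epsilon> * n) * (\<epsilon> * n)) \<le> (\<Sum>z\<in>Z. c x z * c y z)"
      using Z1 n0 by (intro sum_mono mult_mono) (auto simp: \<epsilon>_def c_def)
    ultimately have "real (card Z) * ((\<epsilon> * n) * (\<epsilon> * n)) \<le> real (card Tr)" by simp
    moreover have "(\<alpha> * n / 4) * ((\<epsilon> * n) * (\<epsilon> * n)) \<le> real (card Z) * ((\<epsilon> * n) * (\<epsilon> * n))"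
      using cZ dlb n0 d0 \<alpha> by (intro mult_right_mono) auto
    moreover have "(\<alpha> * n / 4) * ((\<epsilon> * n) * (\<epsilon> * n)) = \<alpha> ^ 5 / 4096 * n ^ 3"
      by (simp add: \<epsilon>_def power2_eq_square power3_eq_cube eval_nat_numeral)
    ultimately show "\<alpha> ^ 5 / 4096 * real (card A) ^ 3 \<le>
      real (card {(b, z, b'). b \<in> A \<and> z \<in> A \<and> b' \<in> A \<and> E x b \<and> E z b \<and> E z b' \<and> E y b'})"
      unfolding n_def[symmetric] Tr_def[symmetric] by linarith
  qed
qed

section \<open>Positive semidefinite kernels\<close>

lemma mult_cnj_eq: "z * cnj z = complex_of_real ((cmod z)\<^sup>2)"
  by (rule complex_norm_square[symmetric])

text \<open>Positive semidefiniteness in the form of a Gram representation. The Schur product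
  theorem is then the tensor product of vectors, and Cauchy--Schwarz for the kernel is the
  inequality for the vectors.\<close>

definition psd_on :: "'x set \<Rightarrow> ('x \<Rightarrow> 'x \<Rightarrow> complex) \<Rightarrow> bool" where
  "psd_on S K \<longleftrightarrow> (\<exists>m v. \<forall>x\<in>S. \<forall>y\<in>S. K x y = (\<Sum>\<omega><(m::nat). v x \<omega> * cnj (v y \<omega>)))"

lemma psd_on_rank1: "(\<And>x y. x \<in> S \<Longrightarrow> y \<in> S \<Longrightarrow> K x y = u x * cnj (u y)) \<Longrightarrow> psd_on S K"
  unfolding psd_on_def by (rule exI[of _ 1], rule exI[of _ "\<lambda>x _. u x"]) auto

lemma psd_on_cong: "psd_on S K \<Longrightarrow> (\<And>x y. x \<in> S \<Longrightarrow> y \<in> S \<Longrightarrow> K' x y = K x y) \<Longrightarrow> psd_on S K'"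
  unfolding psd_on_def by auto

lemma psd_on_reindex: "psd_on S K \<Longrightarrow> g ` S' \<subseteq> S \<Longrightarrow> psd_on S' (\<lambda>x y. K (g x) (g y))"
  unfolding psd_on_def by (force simp: image_subset_iff)

lemma psd_on_add:
  assumes "psd_on S K" "psd_on S K'"
  shows "psd_on S (\<lambda>x y. K x y + K' x y)"
proof -
  obtain m v m' v' where *: "\<And>x y. x \<in> S \<Longrightarrow> y \<in> S \<Longrightarrow> K x y = (\<Sum>\<omega><(m::nat). v x \<omega> * cnj (v y \<omega>))"
      "\<And>x y. x \<in> S \<Longrightarrow> y \<in> S \<Longrightarrow> K' x y = (\<Sum>\<omega><(m'::nat). v' x \<omega> * cnj (v' y \<omega>))"
    using assms unfolding psd_on_def by metis
  let ?u = "\<lambda>x \<omega>. if \<omega> < m then v x \<omega> else v' x (\<omega> - m)"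
  have split: "(\<Sum>\<omega><m + m'. g \<omega>) = (\<Sum>\<omega><m. g \<omega>) + (\<Sum>\<omega><m'. g (m + \<omega>))" for g :: "nat \<Rightarrow> complex"
    by (induction m') (auto simp: add.assoc)
  have "K x y + K' x y = (\<Sum>\<omega><m + m'. ?u x \<omega> * cnj (?u y \<omega>))" if "x \<in> S" "y \<in> S" for x y
    unfolding *[OF that] split by simp
  then show ?thesis unfolding psd_on_def
    by (intro exI[of _ "m + m'"] exI[of _ ?u] ballI)
qed

lemma psd_on_mult:
  assumes "psd_on S K" "psd_on S K'"
  shows "psd_on S (\<lambda>x y. K x y * K' x y)"
proof -
  obtain m v m' v' where *: "\<And>x y. x \<in> S \<Longrightarrow> y \<in> S \<Longrightarrow> K x y = (\<Sum>\<omega><(m::nat). v x \<omega> * cnj (v y \<omega>))"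
      "\<And>x y. x \<in> S \<Longrightarrow> y \<in> S \<Longrightarrow> K' x y = (\<Sum>\<omega><(m'::nat). v' x \<omega> * cnj (v' y \<omega>))"
    using assms unfolding psd_on_def by metis
  let ?P = "{..<m} \<times> {..<m'}"
  obtain h where h: "bij_betw h {..<card ?P} ?P"
    using ex_bij_betw_nat_finite[of ?P] by (auto simp: lessThan_atLeast0)
  let ?u = "\<lambda>x p. v x (fst p) * v' x (snd p)"
  have "K x y * K' x y = (\<Sum>\<omega><card ?P. ?u x (h \<omega>) * cnj (?u y (h \<omega>)))" if "x \<in> S" "y \<in> S" for x y
  proof -
    have "K x y * K' x y = (\<Sum>p\<in>?P. ?u x p * cnj (?u y p))"
      unfolding *[OF that] sum_product sum.cartesian_product by (simp add: case_prod_unfold mult_ac)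
    also have "\<dots> = (\<Sum>\<omega><card ?P. ?u x (h \<omega>) * cnj (?u y (h \<omega>)))"
      by (rule sum.reindex_bij_betw[OF h, symmetric])
    finally show ?thesis .
  qed
  then show ?thesis unfolding psd_on_def 
    by (intro exI[of _ "card ?P"] exI[of _ "\<lambda>x \<omega>. ?u x (h \<omega>)"] ballI)
qed

lemma psd_on_prod: "finite I \<Longrightarrow> (\<And>i. i \<in> I \<Longrightarrow> psd_on S (K i)) \<Longrightarrow> psd_on S (\<lambda>x y. \<Prod>i\<in>I. K i x y)"
proof (induction I rule: finite_induct)
  case empty
  show ?case by (rule psd_on_rank1[where u = "\<lambda>_. 1"]) simp
next
  case (insert i I)
  then show ?case using psd_on_mult by (auto simp: fun_eq_iff)
qed

lemma psd_on_sum: "finite I \<Longrightarrow> (\<And>i. i \<in> I \<Longrightarrow> psd_on S (K i)) \<Longrightarrow> psd_on S (\<lambda>x y. \<Sum>i\<in>I. K i x y)"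
proof (induction I rule: finite_induct)
  case empty
  show ?case by (rule psd_on_rank1[where u = "\<lambda>_. 0"]) simp
next
  case (insert i I)
  then show ?case using psd_on_add by (auto simp: fun_eq_iff)
qed

lemma psd_on_divide:
  assumes "psd_on S K" "(r::real) \<ge> 0" shows "psd_on S (\<lambda>x y. K x y / of_real r)"
proof -
  have "psd_on S (\<lambda>x y. K x y * (of_real (1 / sqrt r) * cnj (of_real (1 / sqrt r))))"
    by (intro psd_on_mult assms psd_on_rank1[where u = "\<lambda>_. of_real (1 / sqrt r)"]) simp
  moreover have "of_real (1 / sqrt r) * cnj (of_real (1 / sqrt r)) = 1 / complex_of_real r"
    using assms(2) by (simp flip: of_real_mult)
  ultimately show ?thesis by simp
qed

lemma psd_on_quadratic_form:
  assumes K: "psd_on S K" and F: "finite F" "F \<subseteq> S"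
  shows "\<exists>r\<ge>0. (\<Sum>x\<in>F. \<Sum>y\<in>F. u x * cnj (u y) * K x y) = complex_of_real r"
proof -
  obtain m v where *: "\<And>x y. x \<in> S \<Longrightarrow> y \<in> S \<Longrightarrow> K x y = (\<Sum>\<omega><(m::nat). v x \<omega> * cnj (v y \<omega>))"
    using K unfolding psd_on_def by metis
  have "(\<Sum>x\<in>F. \<Sum>y\<in>F. u x * cnj (u y) * K x y)
      = (\<Sum>x\<in>F. \<Sum>y\<in>F. \<Sum>\<omega><m. (u x * v x \<omega>) * cnj (u y * v y \<omega>))"
    using F by (intro sum.cong refl) (auto simp: * sum_distrib_left mult_ac subset_iff)
  also have "\<dots> = (\<Sum>x\<in>F. \<Sum>\<omega><m. \<Sum>y\<in>F. (u x * v x \<omega>) * cnj (u y * v y \<omega>))"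
    by (intro sum.cong refl sum.swap)
  also have "\<dots> = (\<Sum>\<omega><m. \<Sum>x\<in>F. \<Sum>y\<in>F. (u x * v x \<omega>) * cnj (u y * v y \<omega>))"
    by (rule sum.swap)
  also have "\<dots> = (\<Sum>\<omega><m. (\<Sum>x\<in>F. u x * v x \<omega>) * cnj (\<Sum>x\<in>F. u x * v x \<omega>))"
    by (simp add: sum_product cnj_sum)
  also have "\<dots> = of_real (\<Sum>\<omega><m. (cmod (\<Sum>x\<in>F. u x * v x \<omega>))\<^sup>2)"
    by (simp only: mult_cnj_eq of_real_sum)
  finally show ?thesis
    by (intro exI[of _ "\<Sum>\<omega><m. (cmod (\<Sum>x\<in>F. u x * v x \<omega>))\<^sup>2"] conjI sum_nonneg) simp_all
qed

lemma cauchy_schwarz_complex: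
  fixes a b :: "'i \<Rightarrow> complex"
  shows "(cmod (\<Sum>i\<in>I. a i * b i))\<^sup>2 \<le> (\<Sum>i\<in>I. (cmod (a i))\<^sup>2) * (\<Sum>i\<in>I. (cmod (b i))\<^sup>2)"
proof -
  have "cmod (\<Sum>i\<in>I. a i * b i) \<le> (\<Sum>i\<in>I. cmod (a i) * cmod (b i))"
    using norm_sum[of "\<lambda>i. a i * b i" I] by (simp add: norm_mult)
  then have "(cmod (\<Sum>i\<in>I. a i * b i))\<^sup>2 \<le> (\<Sum>i\<in>I. cmod (a i) * cmod (b i))\<^sup>2"
    by (intro power_mono) auto
  also have "\<dots> \<le> (\<Sum>i\<in>I. (cmod (a i))\<^sup>2) * (\<Sum>i\<in>I. (cmod (b i))\<^sup>2)"
    by (rule Cauchy_Schwarz_ineq_sum)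
  finally show ?thesis .
qed

text \<open>Applied to kernels that depend on \<open>x - y\<close>, with \<open>z\<close> as a base
  point: a large sum over the points of \<open>F\<close> forces a large sum over their
  differences.\<close>

lemma psd_on_cauchy_schwarz:
  assumes K: "psd_on S K" and F: "finite F" "F \<subseteq> S" and z: "z \<in> S"
  shows "(cmod (\<Sum>x\<in>F. u x * K x z))\<^sup>2 \<le> Re (K z z) * Re (\<Sum>x\<in>F. \<Sum>y\<in>F. u x * cnj (u y) * K x y)"
proof -
  obtain m v where *: "\<And>x y. x \<in> S \<Longrightarrow> y \<in> S \<Longrightarrow> K x y = (\<Sum>\<omega><(m::nat). v x \<omega> * cnj (v y \<omega>))"
    using K unfolding psd_on_def by metis
  let ?g = "\<lambda>\<omega>. \<Sum>x\<in>F. u x * v x \<omega>"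
  have "(\<Sum>x\<in>F. u x * K x z) = (\<Sum>x\<in>F. \<Sum>\<omega><m. (u x * v x \<omega>) * cnj (v z \<omega>))"
    using F z by (intro sum.cong refl) (auto simp: * sum_distrib_left mult_ac subset_iff)
  also have "\<dots> = (\<Sum>\<omega><m. ?g \<omega> * cnj (v z \<omega>))"
    by (subst sum.swap) (simp add: sum_distrib_right)
  finally have 1: "(cmod (\<Sum>x\<in>F. u x * K x z))\<^sup>2 \<le> (\<Sum>\<omega><m. (cmod (?g \<omega>))\<^sup>2) * (\<Sum>\<omega><m. (cmod (v z \<omega>))\<^sup>2)"
    using cauchy_schwarz_complex[of ?g "\<lambda>\<omega>. cnj (v z \<omega>)" "{..<m}"] by simp
  have "K z z = of_real (\<Sum>\<omega><m. (cmod (v z \<omega>))\<^sup>2)"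
    using *[OF z z] by (simp only: mult_cnj_eq of_real_sum)
  then have 2: "Re (K z z) = (\<Sum>\<omega><m. (cmod (v z \<omega>))\<^sup>2)" by (metis Re_complex_of_real)
  have "(\<Sum>x\<in>F. \<Sum>y\<in>F. u x * cnj (u y) * K x y)
      = (\<Sum>x\<in>F. \<Sum>y\<in>F. \<Sum>\<omega><m. (u x * v x \<omega>) * cnj (u y * v y \<omega>))"
    using F by (intro sum.cong refl) (auto simp: * sum_distrib_left mult_ac subset_iff)
  also have "\<dots> = (\<Sum>x\<in>F. \<Sum>\<omega><m. \<Sum>y\<in>F. (u x * v x \<omega>) * cnj (u y * v y \<omega>))"
    by (intro sum.cong refl sum.swap)
  also have "\<dots> = (\<Sum>\<omega><m. \<Sum>x\<in>F. \<Sum>y\<in>F. (u x * v x \<omega>) * cnj (u y * v y \<omega>))"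
    by (rule sum.swap)
  also have "\<dots> = (\<Sum>\<omega><m. ?g \<omega> * cnj (?g \<omega>))"
    by (simp add: sum_product cnj_sum)
  also have "\<dots> = of_real (\<Sum>\<omega><m. (cmod (?g \<omega>))\<^sup>2)"
    by (simp only: mult_cnj_eq of_real_sum)
  finally have 3: "Re (\<Sum>x\<in>F. \<Sum>y\<in>F. u x * cnj (u y) * K x y) = (\<Sum>\<omega><m. (cmod (?g \<omega>))\<^sup>2)"
    by (metis Re_complex_of_real)
  show ?thesis using 1 unfolding 2 3 by (simp add: mult.commute)
qed

section \<open>Finite subgroups and linear forms\<close>

text \<open>Groups are sets and not types, so that groups depending on numbers such as
  \<open>p\<close> and \<open>n\<close> share one type.\<close>

definition fin_subgroup :: "'a::ab_group_add set \<Rightarrow> bool" where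
  "fin_subgroup V \<longleftrightarrow> finite V \<and> 0 \<in> V \<and> (\<forall>x\<in>V. \<forall>y\<in>V. x - y \<in> V)"

lemma fin_subgroupD:
  assumes "fin_subgroup V"
  shows "finite V" "0 \<in> V" "x \<in> V \<Longrightarrow> y \<in> V \<Longrightarrow> x - y \<in> V"
    "x \<in> V \<Longrightarrow> y \<in> V \<Longrightarrow> x + y \<in> V" "x \<in> V \<Longrightarrow> - x \<in> V" "card V > 0"
proof -
  show 1: "finite V" "0 \<in> V" and 2: "x \<in> V \<Longrightarrow> y \<in> V \<Longrightarrow> x - y \<in> V" for x y
    using assms by (auto simp: fin_subgroup_def)
  show 3: "x \<in> V \<Longrightarrow> - x \<in> V" for x using 2[of 0 x] 1 by simp
  show "x \<in> V \<Longrightarrow> y \<in> V \<Longrightarrow> x + y \<in> V" using 2[of x "- y"] 3[of y] by simp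
  show "card V > 0" using 1 by (auto simp: card_gt_0_iff)
qed

lemma fin_subgroup_sum: "fin_subgroup V \<Longrightarrow> (\<And>i. i \<in> I \<Longrightarrow> f i \<in> V) \<Longrightarrow> sum f I \<in> V"
  by (induction I rule: infinite_finite_induct) (auto simp: fin_subgroupD)

lemma fin_subgroup_zmul: "fin_subgroup V \<Longrightarrow> x \<in> V \<Longrightarrow> zmul c x \<in> V"
  unfolding zmul_def by (intro fin_subgroupD(3) fin_subgroup_sum)

lemma fin_subgroup_Times: "fin_subgroup V \<Longrightarrow> fin_subgroup W \<Longrightarrow> fin_subgroup (V \<times> W)"
  by (auto simp: fin_subgroup_def zero_prod_def)

text \<open>Tuples are extended by 0, so that they form a finite subgroup of the functions with
  pointwise addition and the construction can be iterated, as in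
  \<open>vpow t (vpow d V)\<close>.\<close>

definition vpow :: "nat \<Rightarrow> 'a::ab_group_add set \<Rightarrow> (nat \<Rightarrow> 'a) set" where
  "vpow d V = {x. (\<forall>j<d. x j \<in> V) \<and> (\<forall>j\<ge>d. x j = 0)}"

lemma vpow_bij: "bij_betw (\<lambda>g. \<lambda>j. if j < d then g j else 0) ({..<d} \<rightarrow>\<^sub>E V) (vpow d V)"
proof (rule bij_betw_byWitness[where f' = "\<lambda>x. restrict x {..<d}"])
  show "\<forall>a\<in>{..<d} \<rightarrow>\<^sub>E V. restrict (\<lambda>j. if j < d then a j else 0) {..<d} = a"
    by (auto simp: restrict_def PiE_def extensional_def fun_eq_iff)
  show "\<forall>a'\<in>vpow d V. (\<lambda>j. if j < d then restrict a' {..<d} j else 0) = a'"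
    by (auto simp: vpow_def fun_eq_iff)
  show "(\<lambda>g. \<lambda>j. if j < d then g j else 0) ` ({..<d} \<rightarrow>\<^sub>E V) \<subseteq> vpow d V"
    unfolding vpow_def image_subset_iff by (auto dest: PiE_mem)
  show "(\<lambda>x. restrict x {..<d}) ` vpow d V \<subseteq> {..<d} \<rightarrow>\<^sub>E V"
    unfolding vpow_def image_subset_iff PiE_iff by simp
qed

lemma finite_vpow: "finite V \<Longrightarrow> finite (vpow d V)"
  using bij_betw_finite[OF vpow_bij[of d V]] by (simp add: finite_PiE)

lemma fin_subgroup_vpow: "fin_subgroup V \<Longrightarrow> fin_subgroup (vpow d V)"
  unfolding fin_subgroup_def using finite_vpow[of V d] by (auto simp: vpow_def)

lemma vpowD: "x \<in> vpow d V \<Longrightarrow> j < d \<Longrightarrow> x j \<in> V" "x \<in> vpow d V \<Longrightarrow> j \<ge> d \<Longrightarrow> x j = 0"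
  by (auto simp: vpow_def)

lemma vpow_nth: "fin_subgroup V \<Longrightarrow> x \<in> vpow d V \<Longrightarrow> x j \<in> V"
  by (cases "j < d") (auto simp: vpow_def fin_subgroupD)

text \<open>Integer coefficients acting by \<open>zmul\<close> give one form on the prime field and
  on all powers of it.\<close>

definition lform :: "(nat \<Rightarrow> int) \<Rightarrow> nat \<Rightarrow> (nat \<Rightarrow> 'a::ab_group_add) \<Rightarrow> 'a" where
  "lform a d Y = (\<Sum>j<d. zmul (a j) (Y j))"

lemma lform_add: "lform a d (Y + Z) = lform a d Y + lform a d Z"
  by (simp add: lform_def zmul_add_right sum.distrib)

lemma lform_diff: "lform a d (Y - Z) = lform a d Y - lform a d Z"
  by (simp add: lform_def zmul_diff_right sum_subtractf)

lemma lform_0: "lform a d 0 = 0"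
  by (simp add: lform_def)

lemma lform_in: "fin_subgroup V \<Longrightarrow> Y \<in> vpow d V \<Longrightarrow> lform a d Y \<in> V"
  unfolding lform_def by (intro fin_subgroup_sum fin_subgroup_zmul) (auto simp: vpow_def)

definition unitv :: "nat \<Rightarrow> 'a::ab_group_add \<Rightarrow> nat \<Rightarrow> 'a" where
  "unitv j x = (\<lambda>i. if i = j then x else 0)"

lemma unitv_in: "fin_subgroup V \<Longrightarrow> x \<in> V \<Longrightarrow> j < d \<Longrightarrow> unitv j x \<in> vpow d V"
  by (auto simp: unitv_def vpow_def fin_subgroupD)

lemma unitv_add: "unitv j (x + y) = unitv j x + unitv j y"
  and unitv_diff: "unitv j (x - y) = unitv j x - unitv j y"
  and unitv_uminus: "unitv j (- x) = - unitv j x"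
  and unitv_0: "unitv j 0 = 0"
  by (auto simp: unitv_def fun_eq_iff)

lemma lform_unitv: "j < d \<Longrightarrow> lform a d (unitv j x) = zmul (a j) x"
proof -
  assume "j < d"
  have "lform a d (unitv j x) = (\<Sum>i<d. if i = j then zmul (a j) x else 0)"
    unfolding lform_def by (intro sum.cong) (auto simp: unitv_def)
  then show ?thesis using \<open>j < d\<close> by simp
qed

section \<open>Counting by fibres and by random translates\<close>

lemma card_le_card_image_mult:
  assumes "finite X" "\<And>y. y \<in> g ` X \<Longrightarrow> real (card {x \<in> X. g x = y}) \<le> c"
  shows "real (card X) \<le> real (card (g ` X)) * c"
proof -
  have "card X = (\<Sum>y\<in>g ` X. card {x \<in> X. g x = y})"
    using sum.image_gen[OF assms(1), of "\<lambda>_. 1::nat" g] by simp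
  then have "real (card X) = (\<Sum>y\<in>g ` X. real (card {x \<in> X. g x = y}))" by simp
  also have "\<dots> \<le> (\<Sum>y\<in>g ` X. c)" by (intro sum_mono assms)
  finally show ?thesis by simp
qed

lemma pigeonhole_fiber:
  assumes "finite H" "f ` H \<subseteq> S" "finite S" "real (card S) \<le> c" "H \<noteq> {}"
  shows "\<exists>v. real (card H) \<le> c * real (card {h \<in> H. f h = v})"
proof (rule ccontr)
  assume "\<not> ?thesis"
  then have less: "c * real (card {h \<in> H. f h = v}) < real (card H)" for v by (auto simp: not_le)
  have fne: "f ` H \<noteq> {}" using assms by simp
  have "card (f ` H) \<le> card S" using assms by (intro card_mono)
  then have cle: "real (card (f ` H)) \<le> c" using assms(4) by linarith
  have "card (f ` H) > 0" using fne assms(1) by (simp add: card_gt_0_iff)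
  then have c0: "c > 0" using cle by linarith
  have "real (card H) \<le> real (card (f ` H)) * Max ((\<lambda>y. real (card {h \<in> H. f h = y})) ` (f ` H))"
    by (rule card_le_card_image_mult[OF assms(1)]) (use assms(1) in \<open>auto intro!: Max_ge\<close>)
  moreover have "Max ((\<lambda>y. real (card {h \<in> H. f h = y})) ` (f ` H)) \<in> (\<lambda>y. real (card {h \<in> H. f h = y})) ` (f ` H)"
    using fne assms(1) by (intro Max_in) auto
  then obtain v where v: "Max ((\<lambda>y. real (card {h \<in> H. f h = y})) ` (f ` H)) = real (card {h \<in> H. f h = v})"
    by blast
  ultimately have "real (card H) \<le> real (card (f ` H)) * real (card {h \<in> H. f h = v})" by simp
  also have "\<dots> \<le> c * real (card {h \<in> H. f h = v})" using cle by (intro mult_right_mono) auto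
  finally show False using less[of v] by linarith
qed

text \<open>For a uniformly random \<open>x \<in> G\<close> the expected number of admissible
  \<open>h\<close> is exactly the left-hand side.\<close>

lemma translate_select1:
  fixes G :: "'g::ab_group_add set"
  assumes G: "fin_subgroup G" and H: "finite H" and U: "U \<subseteq> G" and t: "\<And>h. h \<in> H \<Longrightarrow> t h \<in> G"
  shows "\<exists>x\<in>G. real (card H) * (real (card U) / real (card G)) \<le> real (card {h \<in> H. x + t h \<in> U})"
proof (rule ccontr)
  assume "\<not> ?thesis"
  then have less: "\<And>x. x \<in> G \<Longrightarrow> real (card {h \<in> H. x + t h \<in> U}) < real (card H) * (real (card U) / real (card G))"
    by (auto simp: not_le)
  have fG: "finite G" using G by (rule fin_subgroupD)
  have "(\<Sum>x\<in>G. real (card {h \<in> H. x + t h \<in> U})) < (\<Sum>x\<in>G. real (card H) * (real (card U) / real (card G)))"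
    by (rule sum_strict_mono[OF fG]) (use G less in \<open>auto simp: fin_subgroup_def\<close>)
  also have "\<dots> = real (card H) * real (card U)"
    using fin_subgroupD(6)[OF G] by simp
  finally have 1: "(\<Sum>x\<in>G. real (card {h \<in> H. x + t h \<in> U})) < real (card H) * real (card U)" .
  have "(\<Sum>x\<in>G. card {h \<in> H. x + t h \<in> U}) = (\<Sum>h\<in>H. card {x \<in> G. x + t h \<in> U})"
    using card_pairs_eq_sum[OF fG H, of "\<lambda>x h. x + t h \<in> U"]
      card_pairs_eq_sum'[OF fG H, of "\<lambda>x h. x + t h \<in> U"] by simp
  also have "\<dots> = (\<Sum>h\<in>H. card U)"
  proof (rule sum.cong[OF refl])
    fix h assume h: "h \<in> H"
    have "{x \<in> G. x + t h \<in> U} = (\<lambda>u. u + (- t h)) ` U"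
    proof (intro subset_antisym subsetI)
      fix x assume "x \<in> {x \<in> G. x + t h \<in> U}"
      then have "x + t h \<in> U" by simp
      then have "(x + t h) + (- t h) \<in> (\<lambda>u. u + (- t h)) ` U" by (rule imageI)
      then show "x \<in> (\<lambda>u. u + (- t h)) ` U" by simp
    next
      fix x assume "x \<in> (\<lambda>u. u + (- t h)) ` U"
      then show "x \<in> {x \<in> G. x + t h \<in> U}" using U t[OF h] fin_subgroupD(3)[OF G] by auto
    qed
    then show "card {x \<in> G. x + t h \<in> U} = card U" by (simp only: card_translate)
  qed
  finally have "(\<Sum>x\<in>G. real (card {h \<in> H. x + t h \<in> U})) = real (card H) * real (card U)"
    by (simp flip: of_nat_sum)
  with 1 show False by simp
qed

lemma translate_select:
  fixes G :: "'g::ab_group_add set"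
  assumes "finite I" and G: "fin_subgroup G" and H: "finite H"
    and U: "\<And>i. i \<in> I \<Longrightarrow> U i \<subseteq> G" and t: "\<And>i h. i \<in> I \<Longrightarrow> h \<in> H \<Longrightarrow> t i h \<in> G"
  shows "\<exists>x. (\<forall>i\<in>I. x i \<in> G) \<and> real (card H) * (\<Prod>i\<in>I. real (card (U i)) / real (card G))
      \<le> real (card {h \<in> H. \<forall>i\<in>I. x i + t i h \<in> U i})"
  using assms(1) U t
proof (induction I rule: finite_induct)
  case empty
  then show ?case by simp
next
  case (insert i I)
  have "\<exists>x. (\<forall>i\<in>I. x i \<in> G) \<and> real (card H) * (\<Prod>i\<in>I. real (card (U i)) / real (card G))
      \<le> real (card {h \<in> H. \<forall>i\<in>I. x i + t i h \<in> U i})" using insert by auto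
  then obtain x where x: "\<forall>i\<in>I. x i \<in> G" "real (card H) * (\<Prod>i\<in>I. real (card (U i)) / real (card G))
      \<le> real (card {h \<in> H. \<forall>i\<in>I. x i + t i h \<in> U i})" by blast
  let ?H = "{h \<in> H. \<forall>i\<in>I. x i + t i h \<in> U i}"
  obtain z where z: "z \<in> G" "real (card ?H) * (real (card (U i)) / real (card G)) \<le> real (card {h \<in> ?H. z + t i h \<in> U i})"
    using translate_select1[OF G, of ?H "U i" "t i"] H insert.prems by auto
  have eq: "{h \<in> ?H. z + t i h \<in> U i} = {h \<in> H. \<forall>i'\<in>insert i I. (x(i := z)) i' + t i' h \<in> U i'}"
    using insert.hyps by auto
  have "real (card H) * (\<Prod>i\<in>insert i I. real (card (U i)) / real (card G))
      = (real (card H) * (\<Prod>i\<in>I. real (card (U i)) / real (card G))) * (real (card (U i)) / real (card G))"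
    using insert.hyps by simp
  also have "\<dots> \<le> real (card ?H) * (real (card (U i)) / real (card G))"
    by (intro mult_right_mono x(2)) simp
  also note z(2)
  finally show ?case unfolding eq using x(1) z(1) insert.hyps
    by (intro exI[of _ "x(i := z)"]) auto
qed

section \<open>Converting a variable into a relation\<close>

lemma sum_UN_le_sum:
  fixes f :: "'c \<Rightarrow> real"
  assumes "finite I" "\<And>i. i \<in> I \<Longrightarrow> finite (S i)" "\<And>i x. i \<in> I \<Longrightarrow> x \<in> S i \<Longrightarrow> 0 \<le> f x"
  shows "sum f (\<Union>i\<in>I. S i) \<le> (\<Sum>i\<in>I. sum f (S i))"
  using assms
proof (induction I rule: finite_induct)
  case (insert i I)
  have "sum f (\<Union>i\<in>insert i I. S i) + sum f (S i \<inter> (\<Union>i\<in>I. S i)) = sum f (S i) + sum f (\<Union>i\<in>I. S i)"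
    using insert by (subst sum.union_inter[symmetric]) auto
  moreover have "0 \<le> sum f (S i \<inter> (\<Union>i\<in>I. S i))" using insert.prems by (intro sum_nonneg) auto
  moreover have "sum f (\<Union>i\<in>I. S i) \<le> (\<Sum>i\<in>I. sum f (S i))" by (rule insert.IH) (use insert.prems in auto)
  ultimately have "sum f (\<Union>i\<in>insert i I. S i) \<le> sum f (S i) + (\<Sum>i\<in>I. sum f (S i))" by linarith
  then show ?case using insert.hyps by simp
qed simp

text \<open>\<open>w i (x, \<alpha>)\<close> stands for the Fourier coefficient of the
  \<open>i\<close>-th factor at the frequency \<open>\<alpha>\<close> when the variable to be
  converted has the value \<open>x\<close>. This variable enters through the forms in a tuple
  \<open>Y\<close>; the conversion trades \<open>Y\<close> for a single \<open>h \<in> V\<close>,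
  and \<open>R\<close> for \<open>R'\<close>. By the last assumption a relation is determined by all
  of its coordinates but one.\<close>

locale bilinear_conversion =
  fixes V :: "'a::ab_group_add set" and Q :: "'b::ab_group_add set"
    and w :: "nat \<Rightarrow> 'a \<times> 'b \<Rightarrow> real" and k d B :: nat and a :: "nat \<Rightarrow> nat \<Rightarrow> int"
    and J :: "nat set" and R :: "(nat \<Rightarrow> 'b) set"
  assumes V: "fin_subgroup V" and Q: "fin_subgroup Q" and k: "k > 0"
    and w_nonneg: "\<And>i g. i < k \<Longrightarrow> g \<in> V \<times> Q \<Longrightarrow> 0 \<le> w i g"
    and w_psd: "\<And>i. i < k \<Longrightarrow> psd_on (V \<times> Q) (\<lambda>g h. complex_of_real (w i (g - h)))"
    and w_fiber: "\<And>i x. i < k \<Longrightarrow> x \<in> V \<Longrightarrow> (\<Sum>\<alpha>\<in>Q. w i (x, \<alpha>)) \<le> 1"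
    and a_bound: "\<And>i j. i < k \<Longrightarrow> j \<in> J \<Longrightarrow> \<bar>a i j\<bar> < 2 ^ B"
    and J: "J \<subseteq> {..<d}" "card J \<le> k"
    and section_ex: "\<And>i. i < k \<Longrightarrow> \<exists>\<sigma>. \<forall>v\<in>V. \<sigma> v \<in> vpow d V \<and> lform (a i) d (\<sigma> v) = v"
    and R: "R \<subseteq> vpow k Q" "fin_subgroup R"
    and R_no_singleton: "\<And>\<alpha> i. \<alpha> \<in> R \<Longrightarrow> i < k \<Longrightarrow> (\<forall>i'<k. i' \<noteq> i \<longrightarrow> \<alpha> i' = 0) \<Longrightarrow> \<alpha> = 0"
begin

definition W where "W = vpow d V"
definition N where "N = real (card V)"
definition M where "M = real (card W)"
definition pt where "pt i \<gamma> = (lform (a i) d (fst \<gamma>), snd \<gamma> i)"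
  for \<gamma> :: "(nat \<Rightarrow> 'a) \<times> (nat \<Rightarrow> 'b)"
definition \<Gamma> where "\<Gamma> = W \<times> R"
definition \<Omega> where "\<Omega> \<gamma> = (\<Prod>i<k. w i (pt i \<gamma>))"
definition \<eta> where "\<eta> = (\<Sum>Y\<in>W. \<Sum>\<alpha>\<in>R. \<Prod>i<k. w i (lform (a i) d Y, \<alpha> i)) / M"
text \<open>Discarding all points at which some weight is below \<open>\<rho>\<close> costs at most
  an eighth of the mass. The same 8 gives \<open>\<rho> \<le> 1 / 8\<close>, by which numerical
  constants are absorbed into powers of \<open>\<rho>\<close>.\<close>

definition \<rho> where "\<rho> = \<eta> / (8 * real k)"
definition R' where "R' = {\<beta> \<in> vpow k Q. \<forall>j\<in>J. (\<lambda>i. zmul (a i j) (\<beta> i)) \<in> R}"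

lemma W: "fin_subgroup W" unfolding W_def by (rule fin_subgroup_vpow[OF V])

lemma N0: "N > 0" and M0: "M > 0"
  unfolding N_def M_def using fin_subgroupD(6)[OF V] fin_subgroupD(6)[OF W] by auto

lemma fin: "finite V" "finite Q" "finite W" "finite R" "finite \<Gamma>" "finite J"
  using V Q W R J by (auto simp: fin_subgroup_def \<Gamma>_def finite_subset)

lemma \<Gamma>: "fin_subgroup \<Gamma>" unfolding \<Gamma>_def by (intro fin_subgroup_Times W R)

lemma R_in: "\<alpha> \<in> R \<Longrightarrow> \<alpha> i \<in> Q"
  using R(1) vpow_nth[OF Q] by blast

lemma pt_in: "\<gamma> \<in> \<Gamma> \<Longrightarrow> pt i \<gamma> \<in> V \<times> Q"
  unfolding \<Gamma>_def pt_def W_def using lform_in[OF V] R_in by auto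

lemma pt_diff: "pt i (\<gamma> - \<gamma>') = pt i \<gamma> - pt i \<gamma>'"
  by (cases \<gamma>; cases \<gamma>') (simp add: pt_def lform_diff minus_prod_def)

lemma w_le1: "i < k \<Longrightarrow> g \<in> V \<times> Q \<Longrightarrow> w i g \<le> 1"
proof -
  assume i: "i < k" and g: "g \<in> V \<times> Q"
  then have "w i (fst g, snd g) \<le> (\<Sum>\<alpha>\<in>Q. w i (fst g, \<alpha>))"
    by (intro member_le_sum fin w_nonneg) auto
  also have "\<dots> \<le> 1" using i g by (intro w_fiber) auto
  finally show ?thesis by simp
qed

lemma \<Omega>_nonneg: "\<gamma> \<in> \<Gamma> \<Longrightarrow> 0 \<le> \<Omega> \<gamma>"
  unfolding \<Omega>_def by (intro prod_nonneg) (use w_nonneg pt_in in auto)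

lemma \<Omega>_le1: "\<gamma> \<in> \<Gamma> \<Longrightarrow> \<Omega> \<gamma> \<le> 1"
  unfolding \<Omega>_def by (intro prod_le_1) (use w_nonneg w_le1 pt_in in auto)

lemma \<Omega>_le: "\<gamma> \<in> \<Gamma> \<Longrightarrow> i < k \<Longrightarrow> \<Omega> \<gamma> \<le> w i (pt i \<gamma>)"
proof -
  assume g: "\<gamma> \<in> \<Gamma>" and i: "i < k"
  have "\<Omega> \<gamma> = w i (pt i \<gamma>) * (\<Prod>i\<in>{..<k} - {i}. w i (pt i \<gamma>))"
    unfolding \<Omega>_def using i by (subst prod.remove[of _ i]) auto
  also have "\<dots> \<le> w i (pt i \<gamma>) * 1"
    using g i by (intro mult_left_mono prod_le_1) (use w_nonneg w_le1 pt_in in auto)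
  finally show ?thesis by simp
qed

text \<open>Since a relation is determined by the coordinates other than \<open>i\<close>, the sum
  over \<open>R\<close> is at most the sum over all tuples in these positions, and the latter
  factorizes.\<close>

lemma sum_R_omit_le1:
  assumes i: "i < k" and X: "\<And>i. i < k \<Longrightarrow> X i \<in> V"
  shows "(\<Sum>\<alpha>\<in>R. \<Prod>i'\<in>{..<k} - {i}. w i' (X i', \<alpha> i')) \<le> 1"
proof -
  let ?I = "{..<k} - {i}"
  let ?f = "\<lambda>\<alpha>. \<Prod>i'\<in>?I. w i' (X i', \<alpha> i')"
  have inj: "inj_on (\<lambda>\<alpha>. restrict \<alpha> ?I) R"
  proof (rule inj_onI)
    fix \<alpha> \<beta> assume ab: "\<alpha> \<in> R" "\<beta> \<in> R" and eq: "restrict \<alpha> ?I = restrict \<beta> ?I"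
    have "(\<alpha> - \<beta>) i' = 0" if "i' < k" "i' \<noteq> i" for i'
      using fun_cong[OF eq, of i'] that by simp
    then have "\<alpha> - \<beta> = 0" using R_no_singleton[OF _ i, of "\<alpha> - \<beta>"] ab fin_subgroupD(3)[OF R(2)] by blast
    then show "\<alpha> = \<beta>" by simp
  qed
  have "(\<Sum>\<alpha>\<in>R. ?f \<alpha>) = (\<Sum>\<alpha>\<in>R. ?f (restrict \<alpha> ?I))" by (intro sum.cong prod.cong) auto
  also have "\<dots> = (\<Sum>g\<in>(\<lambda>\<alpha>. restrict \<alpha> ?I) ` R. ?f g)" using inj by (simp add: sum.reindex)
  also have "\<dots> \<le> (\<Sum>g\<in>?I \<rightarrow>\<^sub>E Q. ?f g)"
  proof (rule sum_mono2)
    show "finite (?I \<rightarrow>\<^sub>E Q)" using fin by (intro finite_PiE) auto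
    show "(\<lambda>\<alpha>. restrict \<alpha> ?I) ` R \<subseteq> ?I \<rightarrow>\<^sub>E Q" using R_in by (simp add: image_subset_iff restrict_PiE_iff)
    show "0 \<le> ?f g" if "g \<in> (?I \<rightarrow>\<^sub>E Q) - (\<lambda>\<alpha>. restrict \<alpha> ?I) ` R" for g
      using that X by (intro prod_nonneg) (auto intro!: w_nonneg dest: PiE_mem)
  qed
  also have "\<dots> = (\<Prod>i'\<in>?I. \<Sum>\<alpha>\<in>Q. w i' (X i', \<alpha>))"
    using fin by (intro prod_sum_PiE[symmetric]) auto
  also have "\<dots> \<le> 1"
    using X w_fiber by (intro prod_le_1 conjI sum_nonneg) (auto intro!: w_nonneg)
  finally show ?thesis .
qed

lemma sum_\<Gamma>: "(\<Sum>\<gamma>\<in>\<Gamma>. \<Omega> \<gamma>) = \<eta> * M"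
proof -
  have "(\<Sum>\<gamma>\<in>\<Gamma>. \<Omega> \<gamma>) = (\<Sum>Y\<in>W. \<Sum>\<alpha>\<in>R. \<Prod>i<k. w i (lform (a i) d Y, \<alpha> i))"
    unfolding \<Gamma>_def \<Omega>_def pt_def by (simp add: sum.cartesian_product case_prod_unfold)
  then show ?thesis using M0 by (simp add: \<eta>_def)
qed

lemma \<eta>_nonneg: "\<eta> \<ge> 0"
proof -
  have "0 \<le> (\<Sum>\<gamma>\<in>\<Gamma>. \<Omega> \<gamma>)" by (intro sum_nonneg \<Omega>_nonneg)
  then show ?thesis using M0 by (simp add: sum_\<Gamma> zero_le_mult_iff)
qed

lemma sum_small_le:
  assumes i: "i < k" and r: "r \<ge> 0"
  shows "(\<Sum>\<gamma>\<in>{\<gamma>\<in>\<Gamma>. w i (pt i \<gamma>) < r}. \<Omega> \<gamma>) \<le> r * M"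
proof -
  have "(\<Sum>\<gamma>\<in>{\<gamma>\<in>\<Gamma>. w i (pt i \<gamma>) < r}. \<Omega> \<gamma>)
      \<le> (\<Sum>\<gamma>\<in>{\<gamma>\<in>\<Gamma>. w i (pt i \<gamma>) < r}. r * (\<Prod>i'\<in>{..<k} - {i}. w i' (pt i' \<gamma>)))"
  proof (rule sum_mono)
    fix \<gamma> assume g: "\<gamma> \<in> {\<gamma>\<in>\<Gamma>. w i (pt i \<gamma>) < r}"
    have "\<Omega> \<gamma> = w i (pt i \<gamma>) * (\<Prod>i\<in>{..<k} - {i}. w i (pt i \<gamma>))"
      unfolding \<Omega>_def using i by (subst prod.remove[of _ i]) auto
    also have "\<dots> \<le> r * (\<Prod>i'\<in>{..<k} - {i}. w i' (pt i' \<gamma>))"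
      using g by (intro mult_right_mono prod_nonneg) (use w_nonneg pt_in in auto)
    finally show "\<Omega> \<gamma> \<le> r * (\<Prod>i'\<in>{..<k} - {i}. w i' (pt i' \<gamma>))" .
  qed
  also have "\<dots> \<le> (\<Sum>\<gamma>\<in>\<Gamma>. r * (\<Prod>i'\<in>{..<k} - {i}. w i' (pt i' \<gamma>)))"
    by (intro sum_mono2 fin mult_nonneg_nonneg prod_nonneg r) (use w_nonneg pt_in in auto)
  also have "\<dots> = r * (\<Sum>Y\<in>W. \<Sum>\<alpha>\<in>R. \<Prod>i'\<in>{..<k} - {i}. w i' (lform (a i') d Y, \<alpha> i'))"
    unfolding \<Gamma>_def pt_def sum_distrib_left by (simp add: sum.cartesian_product case_prod_unfold)
  also have "\<dots> \<le> r * (\<Sum>Y\<in>W. 1)"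
    by (intro mult_left_mono sum_mono sum_R_omit_le1 r i) (auto simp: W_def lform_in[OF V])
  finally show ?thesis by (simp add: M_def)
qed

lemma \<eta>_le1: "\<eta> \<le> 1"
proof -
  have "\<eta> * M = (\<Sum>\<gamma>\<in>\<Gamma>. \<Omega> \<gamma>)" by (simp add: sum_\<Gamma>)
  also have "\<dots> \<le> (\<Sum>\<gamma>\<in>\<Gamma>. (\<Prod>i'\<in>{..<k} - {0}. w i' (pt i' \<gamma>)))"
  proof (rule sum_mono)
    fix \<gamma> assume g: "\<gamma> \<in> \<Gamma>"
    have "\<Omega> \<gamma> = w 0 (pt 0 \<gamma>) * (\<Prod>i\<in>{..<k} - {0}. w i (pt i \<gamma>))"
      unfolding \<Omega>_def using k by (subst prod.remove[of _ 0]) auto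
    also have "\<dots> \<le> 1 * (\<Prod>i'\<in>{..<k} - {0}. w i' (pt i' \<gamma>))"
      using g k by (intro mult_right_mono prod_nonneg) (use w_nonneg w_le1 pt_in in auto)
    finally show "\<Omega> \<gamma> \<le> (\<Prod>i'\<in>{..<k} - {0}. w i' (pt i' \<gamma>))" by simp
  qed
  also have "\<dots> = (\<Sum>Y\<in>W. \<Sum>\<alpha>\<in>R. \<Prod>i'\<in>{..<k} - {0}. w i' (lform (a i') d Y, \<alpha> i'))"
    unfolding \<Gamma>_def pt_def by (simp add: sum.cartesian_product case_prod_unfold)
  also have "\<dots> \<le> (\<Sum>Y\<in>W. 1)"
    by (intro sum_mono sum_R_omit_le1 k) (auto simp: W_def lform_in[OF V])
  finally show ?thesis using M0 by (simp add: M_def)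
qed

end

section \<open>Additive structure of the large weights\<close>

locale bilinear_conversion_pos = bilinear_conversion +
  assumes \<eta>_pos: "\<eta> > 0"
begin

lemma \<rho>: "0 < \<rho>" "\<rho> \<le> 1 / 8" "\<rho> \<le> 1"
proof -
  show "0 < \<rho>" using \<eta>_pos k by (simp add: \<rho>_def)
  have "\<eta> / (8 * real k) \<le> 1 / (8 * 1)" using \<eta>_le1 \<eta>_pos k by (intro frac_le) auto
  then show "\<rho> \<le> 1 / 8" by (simp add: \<rho>_def)
  then show "\<rho> \<le> 1" by simp
qed

definition A0 where "A0 = {\<gamma>\<in>\<Gamma>. \<forall>i<k. \<rho> \<le> w i (pt i \<gamma>)}"
definition m where "m = (\<Sum>\<gamma>\<in>A0. \<Omega> \<gamma>)"
text \<open>A bound for the number of points of \<open>A0\<close> with the same image under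
  \<open>pt i\<close>: at most \<open>M / N\<close> tuples \<open>Y\<close> lie over a point of
  \<open>V\<close>, and each occurs with at most \<open>(1 / \<rho>) ^ k\<close> relations.\<close>

definition fib where "fib = (1 / \<rho>) ^ k * M / N"

lemma A0: "A0 \<subseteq> \<Gamma>" "finite A0"
  using fin by (auto simp: A0_def)

lemma m_lower: "\<rho> * M \<le> m"
proof -
  have "(\<Sum>\<gamma>\<in>\<Gamma> - A0. \<Omega> \<gamma>) \<le> (\<Sum>\<gamma>\<in>(\<Union>i<k. {\<gamma>\<in>\<Gamma>. w i (pt i \<gamma>) < \<rho>}). \<Omega> \<gamma>)"
    by (rule sum_mono2) (use fin \<Omega>_nonneg in \<open>auto simp: A0_def not_le\<close>)
  also have "\<dots> \<le> (\<Sum>i<k. (\<Sum>\<gamma>\<in>{\<gamma>\<in>\<Gamma>. w i (pt i \<gamma>) < \<rho>}. \<Omega> \<gamma>))"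
    by (rule sum_UN_le_sum) (use fin \<Omega>_nonneg in auto)
  also have "\<dots> \<le> (\<Sum>i<k. \<rho> * M)" using \<rho> by (intro sum_mono sum_small_le) auto
  finally have "(\<Sum>\<gamma>\<in>\<Gamma> - A0. \<Omega> \<gamma>) \<le> real k * (\<rho> * M)" by simp
  moreover have "\<eta> * M = (\<Sum>\<gamma>\<in>\<Gamma> - A0. \<Omega> \<gamma>) + m"
    using sum.subset_diff[OF A0(1) fin(5), of \<Omega>] by (simp add: sum_\<Gamma> m_def)
  moreover have "\<eta> = 8 * real k * \<rho>" using k by (simp add: \<rho>_def)
  ultimately have "7 * (real k * (\<rho> * M)) \<le> m" by (simp add: mult_ac)
  moreover have "1 * (\<rho> * M) \<le> real k * (\<rho> * M)" using k \<rho> M0 by (intro mult_right_mono) auto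
  ultimately show ?thesis using \<rho> M0 mult_pos_pos[of \<rho> M] by linarith
qed

lemma m_le: "m \<le> real (card A0)"
  unfolding m_def using sum_mono[of A0 \<Omega> "\<lambda>_. 1"] \<Omega>_le1 A0 by auto

lemma A0_lower: "\<rho> * M \<le> real (card A0)"
  using m_lower m_le by linarith

lemma A0_ne: "A0 \<noteq> {}"
proof
  assume "A0 = {}"
  then have "\<rho> * M \<le> 0" using A0_lower by simp
  moreover have "\<rho> * M > 0" using \<rho> M0 by simp
  ultimately show False by linarith
qed

lemma level_card:
  assumes "i < k" "x \<in> V" "0 < r"
  shows "real (card {\<alpha>\<in>Q. r \<le> w i (x, \<alpha>)}) \<le> 1 / r"
proof -
  have "real (card {\<alpha>\<in>Q. r \<le> w i (x, \<alpha>)}) * r \<le> (\<Sum>\<alpha>\<in>{\<alpha>\<in>Q. r \<le> w i (x, \<alpha>)}. w i (x, \<alpha>))"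
    using sum_mono[of "{\<alpha>\<in>Q. r \<le> w i (x, \<alpha>)}" "\<lambda>_. r" "\<lambda>\<alpha>. w i (x, \<alpha>)"] by auto
  also have "\<dots> \<le> (\<Sum>\<alpha>\<in>Q. w i (x, \<alpha>))" by (intro sum_mono2 fin) (use assms w_nonneg in auto)
  also have "\<dots> \<le> 1" using assms by (intro w_fiber)
  finally show ?thesis using assms by (simp add: field_simps)
qed

lemma A0_fiber_Y: "real (card {\<alpha>. (Y, \<alpha>) \<in> A0}) \<le> (1 / \<rho>) ^ k"
proof (cases "Y \<in> W")
  case False
  then have "{\<alpha>. (Y, \<alpha>) \<in> A0} = {}" by (auto simp: A0_def \<Gamma>_def)
  then show ?thesis using \<rho> by simp
next
  case True
  let ?L = "\<lambda>i. {\<alpha>\<in>Q. \<rho> \<le> w i (lform (a i) d Y, \<alpha>)}"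
  have inV: "lform (a i) d Y \<in> V" for i using True by (simp add: W_def lform_in[OF V])
  have "inj_on (\<lambda>\<alpha>. restrict \<alpha> {..<k}) {\<alpha>. (Y, \<alpha>) \<in> A0}"
  proof (rule inj_onI)
    fix \<alpha> \<beta> assume "\<alpha> \<in> {\<alpha>. (Y, \<alpha>) \<in> A0}" "\<beta> \<in> {\<alpha>. (Y, \<alpha>) \<in> A0}" and eq: "restrict \<alpha> {..<k} = restrict \<beta> {..<k}"
    then have ab: "\<alpha> \<in> vpow k Q" "\<beta> \<in> vpow k Q" using R by (auto simp: A0_def \<Gamma>_def)
    show "\<alpha> = \<beta>"
    proof
      fix i show "\<alpha> i = \<beta> i" using fun_cong[OF eq, of i] ab by (cases "i < k") (auto simp: vpow_def)
    qed
  qed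
  moreover have "(\<lambda>\<alpha>. restrict \<alpha> {..<k}) ` {\<alpha>. (Y, \<alpha>) \<in> A0} \<subseteq> PiE {..<k} ?L"
    using R_in by (simp add: image_subset_iff restrict_PiE_iff A0_def \<Gamma>_def pt_def)
  moreover have "finite (PiE {..<k} ?L)" using fin by (intro finite_PiE) auto
  ultimately have "card {\<alpha>. (Y, \<alpha>) \<in> A0} \<le> card (PiE {..<k} ?L)" by (intro card_inj_on_le)
  also have "\<dots> = (\<Prod>i<k. card (?L i))" by (simp add: card_PiE)
  finally have "real (card {\<alpha>. (Y, \<alpha>) \<in> A0}) \<le> (\<Prod>i<k. real (card (?L i)))"
    unfolding of_nat_prod[symmetric] of_nat_le_iff .
  also have "\<dots> \<le> (\<Prod>i<k. 1 / \<rho>)" using \<rho> inV by (intro prod_mono conjI level_card) auto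
  finally show ?thesis by simp
qed

lemma card_Y_sub:
  assumes "S \<subseteq> A0" "fst ` S \<subseteq> P" "finite P"
  shows "real (card S) \<le> real (card P) * (1 / \<rho>) ^ k"
proof -
  have fS: "finite S" using assms A0 finite_subset by blast
  have "real (card S) \<le> real (card (fst ` S)) * (1 / \<rho>) ^ k"
  proof (rule card_le_card_image_mult[OF fS])
    fix Y assume "Y \<in> fst ` S"
    have "inj_on snd {x\<in>S. fst x = Y}" by (auto simp: inj_on_def)
    moreover have "snd ` {x\<in>S. fst x = Y} \<subseteq> {\<alpha>. (Y, \<alpha>) \<in> A0}" using assms by auto
    moreover have "finite {\<alpha>. (Y, \<alpha>) \<in> A0}"
      by (rule finite_subset[of _ "snd ` A0"]) (use A0 in force)+
    ultimately have "card {x\<in>S. fst x = Y} \<le> card {\<alpha>. (Y, \<alpha>) \<in> A0}" by (intro card_inj_on_le)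
    then show "real (card {x\<in>S. fst x = Y}) \<le> (1 / \<rho>) ^ k" using A0_fiber_Y[of Y] by linarith
  qed
  also have "\<dots> \<le> real (card P) * (1 / \<rho>) ^ k"
    using assms \<rho> by (intro mult_right_mono) (auto intro: card_mono)
  finally show ?thesis .
qed

lemma A0_upper: "real (card A0) \<le> M * (1 / \<rho>) ^ k"
  unfolding M_def by (rule card_Y_sub) (use fin in \<open>auto simp: A0_def \<Gamma>_def\<close>)

text \<open>Adding \<open>\<sigma> v\<close> for all \<open>v \<in> V\<close> to the fibre gives
  disjoint copies of it inside \<open>W\<close>.\<close>

lemma card_form_fiber:
  assumes i: "i < k"
  shows "real (card {Y\<in>W. lform (a i) d Y = X}) \<le> M / N"
proof -
  obtain \<sigma> where s: "\<And>v. v \<in> V \<Longrightarrow> \<sigma> v \<in> W \<and> lform (a i) d (\<sigma> v) = v"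
    using section_ex[OF i] unfolding W_def by blast
  let ?F = "{Y\<in>W. lform (a i) d Y = X}"
  let ?f = "\<lambda>(Y, v). Y + \<sigma> v"
  have "inj_on ?f (?F \<times> V)"
  proof (rule inj_onI, clarify)
    fix Y v Y' v' assume v: "v \<in> V" "v' \<in> V" and eq: "Y + \<sigma> v = Y' + \<sigma> v'"
      and X: "X = lform (a i) d Y" "lform (a i) d Y' = lform (a i) d Y"
    have "lform (a i) d (Y + \<sigma> v) = lform (a i) d (Y' + \<sigma> v')" by (simp add: eq)
    then have "v = v'" using s v X by (simp add: lform_add)
    then show "Y = Y' \<and> v = v'" using eq by simp
  qed
  moreover have "?f ` (?F \<times> V) \<subseteq> W" using s fin_subgroupD(4)[OF W] by auto
  ultimately have "card (?F \<times> V) \<le> card W" using fin by (intro card_inj_on_le)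
  then have "real (card ?F) * N \<le> M" by (simp add: card_cartesian_product N_def M_def flip: of_nat_mult)
  then show ?thesis using N0 by (simp add: field_simps)
qed

lemma A0_fiber_pt:
  assumes i: "i < k"
  shows "real (card {\<gamma>\<in>A0. pt i \<gamma> = g}) \<le> fib"
proof -
  have "real (card {\<gamma>\<in>A0. pt i \<gamma> = g}) \<le> real (card {Y\<in>W. lform (a i) d Y = fst g}) * (1 / \<rho>) ^ k"
    by (rule card_Y_sub) (use fin in \<open>auto simp: A0_def \<Gamma>_def pt_def\<close>)
  also have "\<dots> \<le> M / N * (1 / \<rho>) ^ k"
    using card_form_fiber[OF i] \<rho> by (intro mult_right_mono) auto
  finally show ?thesis by (simp add: fib_def mult.commute)
qed

lemma fib_pos: "fib > 0"
  using \<rho> M0 N0 by (simp add: fib_def)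

text \<open>The threshold is such that the pairs below it, at most
  \<open>(M * (1 / \<rho>) ^ k) ^ 2\<close> in number, contribute at most
  \<open>\<rho> ^ 3 * M ^ 2\<close>. This is less than half of the mass
  \<open>\<rho> ^ 2 * M ^ 2\<close> that the differences carry.\<close>

definition Ed where "Ed \<gamma> b \<longleftrightarrow> \<rho> ^ (2 * k + 3) \<le> \<Omega> (\<gamma> - b)"

lemma \<Omega>_psd: "psd_on \<Gamma> (\<lambda>\<gamma> \<gamma>'. complex_of_real (\<Omega> (\<gamma> - \<gamma>')))"
proof -
  have "psd_on \<Gamma> (\<lambda>\<gamma> \<gamma>'. \<Prod>i<k. complex_of_real (w i (pt i \<gamma> - pt i \<gamma>')))"
    by (intro psd_on_prod psd_on_reindex[OF w_psd] image_subsetI pt_in) auto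
  then show ?thesis by (simp add: \<Omega>_def pt_diff)
qed

text \<open>Cauchy--Schwarz for the kernel \<open>\<Omega> (\<gamma> - \<gamma>')\<close> with base
  point 0 turns the mass \<open>m\<close> of \<open>A0\<close> into mass on the differences.\<close>

lemma edges: "\<rho> ^ 3 * M\<^sup>2 \<le> real (card {p \<in> A0 \<times> A0. Ed (fst p) (snd p)})"
proof -
  let ?E = "{p \<in> A0 \<times> A0. Ed (fst p) (snd p)}"
  have Z: "0 \<in> \<Gamma>" using fin_subgroupD(2)[OF \<Gamma>] .
  have dif: "\<gamma> - b \<in> \<Gamma>" if "\<gamma> \<in> A0" "b \<in> A0" for \<gamma> b using that A0 fin_subgroupD(3)[OF \<Gamma>] by blast
  have "(cmod (\<Sum>x\<in>A0. 1 * complex_of_real (\<Omega> (x - 0))))\<^sup>2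
      \<le> Re (complex_of_real (\<Omega> (0 - 0))) * Re (\<Sum>x\<in>A0. \<Sum>y\<in>A0. 1 * cnj 1 * complex_of_real (\<Omega> (x - y)))"
    by (rule psd_on_cauchy_schwarz[OF \<Omega>_psd]) (use A0 Z in auto)
  moreover have "cmod (\<Sum>x\<in>A0. 1 * complex_of_real (\<Omega> (x - 0))) = m"
    unfolding m_def using A0 \<Omega>_nonneg by (simp flip: of_real_sum) (intro abs_of_nonneg sum_nonneg; blast)
  moreover have "Re (\<Sum>x\<in>A0. \<Sum>y\<in>A0. 1 * cnj 1 * complex_of_real (\<Omega> (x - y))) = (\<Sum>x\<in>A0. \<Sum>y\<in>A0. \<Omega> (x - y))"
    by simp
  ultimately have "m\<^sup>2 \<le> \<Omega> 0 * (\<Sum>x\<in>A0. \<Sum>y\<in>A0. \<Omega> (x - y))" by simp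
  also have "\<dots> \<le> 1 * (\<Sum>x\<in>A0. \<Sum>y\<in>A0. \<Omega> (x - y))"
    using \<Omega>_le1[OF Z] dif by (intro mult_right_mono sum_nonneg \<Omega>_nonneg) auto
  also have "\<dots> = (\<Sum>p\<in>A0\<times>A0. \<Omega> (fst p - snd p))"
    by (simp add: sum.cartesian_product case_prod_unfold)
  also have "\<dots> \<le> (\<Sum>p\<in>A0\<times>A0. of_bool (Ed (fst p) (snd p)) + \<rho> ^ (2 * k + 3))"
  proof (rule sum_mono)
    fix p assume p: "p \<in> A0 \<times> A0"
    then have "\<Omega> (fst p - snd p) \<le> 1" using dif \<Omega>_le1 by auto
    then show "\<Omega> (fst p - snd p) \<le> of_bool (Ed (fst p) (snd p)) + \<rho> ^ (2 * k + 3)"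
      using \<rho> by (cases "Ed (fst p) (snd p)") (auto simp: Ed_def intro: add_increasing2)
  qed
  also have "\<dots> = real (card ?E) + \<rho> ^ (2 * k + 3) * (real (card A0))\<^sup>2"
    using A0 by (simp add: sum.distrib sum_of_bool_eq card_cartesian_product power2_eq_square Int_def)
  also have "\<rho> ^ (2 * k + 3) * (real (card A0))\<^sup>2 \<le> \<rho> ^ (2 * k + 3) * (M * (1 / \<rho>) ^ k)\<^sup>2"
    using A0_upper \<rho> by (intro mult_left_mono power_mono) auto
  also have "\<dots> = \<rho> ^ 3 * M\<^sup>2"
    using \<rho> by (simp add: power_mult_distrib power_add power_divide mult.commute[of 2 k] power_mult)
  finally have 1: "m\<^sup>2 \<le> real (card ?E) + \<rho> ^ 3 * M\<^sup>2" by simp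
  have "(\<rho> * M)\<^sup>2 \<le> m\<^sup>2" using m_lower \<rho> M0 by (intro power_mono) auto
  then have "\<rho>\<^sup>2 * M\<^sup>2 \<le> real (card ?E) + \<rho> ^ 3 * M\<^sup>2" using 1 by (simp add: power_mult_distrib)
  moreover have "2 * \<rho> ^ 3 * M\<^sup>2 \<le> \<rho>\<^sup>2 * M\<^sup>2"
    using \<rho> by (intro mult_right_mono) (auto simp: power3_eq_cube power2_eq_square)
  ultimately show ?thesis by linarith
qed

end

context bilinear_conversion_pos
begin

lemma large_structured_subset:
  obtains A where "A \<subseteq> A0" "\<rho> ^ (2 * k + 5) * M \<le> real (card A)"
    "\<And>x y. x \<in> A \<Longrightarrow> y \<in> A \<Longrightarrow> \<rho> ^ (10 * k + 22) * M ^ 3 \<le>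
      real (card {(b, z, b'). b \<in> A0 \<and> z \<in> A0 \<and> b' \<in> A0 \<and> Ed x b \<and> Ed z b \<and> Ed z b' \<and> Ed y b'})"
proof -
  let ?n = "real (card A0)"
  let ?\<alpha> = "\<rho> ^ (2 * k + 3)"
  have "?\<alpha> * ?n\<^sup>2 \<le> ?\<alpha> * (M * (1 / \<rho>) ^ k)\<^sup>2"
    using A0_upper \<rho> by (intro mult_left_mono power_mono) auto
  also have "\<dots> = \<rho> ^ 3 * M\<^sup>2"
    using \<rho> by (simp add: power_mult_distrib power_add power_divide mult.commute[of 2 k] power_mult)
  finally have "?\<alpha> * ?n\<^sup>2 \<le> real (card {p \<in> A0 \<times> A0. Ed (fst p) (snd p)})"
    using edges by linarith
  then obtain A where A: "A \<subseteq> A0" "?\<alpha> / 2 * ?n \<le> real (card A)"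
    "\<And>x y. x \<in> A \<Longrightarrow> y \<in> A \<Longrightarrow> ?\<alpha> ^ 5 / 4096 * ?n ^ 3 \<le>
      real (card {(b, z, b'). b \<in> A0 \<and> z \<in> A0 \<and> b' \<in> A0 \<and> Ed x b \<and> Ed z b \<and> Ed z b' \<and> Ed y b'})"
    using dense_graph_paths[OF A0(2) A0_ne, of ?\<alpha> Ed] \<rho> by auto
  have "\<rho> ^ (2 * k + 5) * M = ?\<alpha> * \<rho> * (\<rho> * M)"
    by (simp add: power_add power_numeral_reduce mult_ac)
  also have "\<dots> \<le> ?\<alpha> * (1 / 2) * ?n"
    using A0_lower \<rho> M0 by (intro mult_mono) auto
  finally have 1: "\<rho> ^ (2 * k + 5) * M \<le> real (card A)" using A(2) by simp
  \<comment> \<open>As \<open>8 ^ 4 = 4096\<close>, four powers of \<open>\<rho>\<close> absorb the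
    constant of the path count.\<close>
  have "\<rho> ^ 4 \<le> (1 / 8) ^ 4" using \<rho> by (intro power_mono) auto
  then have r4: "\<rho> ^ 4 \<le> 1 / 4096" by (simp add: power_divide)
  have "\<rho> ^ (10 * k + 22) * M ^ 3 = ?\<alpha> ^ 5 * \<rho> ^ 4 * (\<rho> * M) ^ 3"
  proof -
    have "\<rho> ^ (10 * k + 22) = ?\<alpha> ^ 5 * \<rho> ^ 4 * \<rho> ^ 3"
      unfolding power_mult[symmetric] power_add[symmetric] by (simp add: algebra_simps)
    then show ?thesis by (simp add: power_mult_distrib mult_ac)
  qed
  also have "\<dots> \<le> ?\<alpha> ^ 5 * (1 / 4096) * ?n ^ 3"
    using A0_lower \<rho> M0 r4 by (intro mult_mono power_mono) auto
  finally have 2: "\<rho> ^ (10 * k + 22) * M ^ 3 \<le> ?\<alpha> ^ 5 / 4096 * ?n ^ 3" by simp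
  show thesis
  proof (rule that[OF A(1) 1])
    fix x y assume "x \<in> A" "y \<in> A"
    then show "\<rho> ^ (10 * k + 22) * M ^ 3 \<le>
      real (card {(b, z, b'). b \<in> A0 \<and> z \<in> A0 \<and> b' \<in> A0 \<and> Ed x b \<and> Ed z b \<and> Ed z b' \<and> Ed y b'})"
      using A(3)[of x y] 2 by linarith
  qed
qed

definition large where "large i = {g\<in>V \<times> Q. \<rho> ^ (2 * k + 3) \<le> w i g}"

lemma large_card: "i < k \<Longrightarrow> real (card (large i)) \<le> N * (1 / \<rho>) ^ (2 * k + 3)"
proof -
  assume i: "i < k"
  have "large i = (SIGMA x:V. {\<alpha>\<in>Q. \<rho> ^ (2 * k + 3) \<le> w i (x, \<alpha>)})" by (auto simp: large_def)
  then have "real (card (large i)) = (\<Sum>x\<in>V. real (card {\<alpha>\<in>Q. \<rho> ^ (2 * k + 3) \<le> w i (x, \<alpha>)}))"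
    using fin by (simp add: card_SigmaI)
  also have "\<dots> \<le> (\<Sum>x\<in>V. 1 / \<rho> ^ (2 * k + 3))"
    using i \<rho> by (intro sum_mono level_card) auto
  finally show ?thesis by (simp add: N_def power_divide)
qed

lemma finite_large: "finite (large i)"
  using fin by (auto simp: large_def)

lemma Ed_large:
  assumes "i < k" "\<gamma> \<in> A0" "b \<in> A0" "Ed \<gamma> b"
  shows "pt i \<gamma> - pt i b \<in> large i"
proof -
  have dif: "\<gamma> - b \<in> \<Gamma>" using assms A0 fin_subgroupD(3)[OF \<Gamma>] by blast
  show ?thesis using \<Omega>_le[OF dif assms(1)] pt_in[OF dif, of i] assms(4)
    by (auto simp: large_def Ed_def pt_diff)
qed

text \<open>The graph lives on \<open>A0\<close>, of size about \<open>M\<close>, but its edges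
  project to differences in \<open>large i\<close>, of size about \<open>N\<close>. A path of length
  four from \<open>x\<close> to \<open>y\<close> writes \<open>pt i x - pt i y\<close> as an
  alternating sum of four elements of \<open>large i\<close>, and at most \<open>fib ^ 3\<close>
  paths give the same sum. Every difference thus has many representations, so there are few
  differences.\<close>

lemma projection_doubling:
  assumes A: "A \<subseteq> A0" "\<rho> ^ (2 * k + 5) * M \<le> real (card A)"
    "\<And>x y. x \<in> A \<Longrightarrow> y \<in> A \<Longrightarrow> \<rho> ^ (10 * k + 22) * M ^ 3 \<le>
      real (card {(b, z, b'). b \<in> A0 \<and> z \<in> A0 \<and> b' \<in> A0 \<and> Ed x b \<and> Ed z b \<and> Ed z b' \<and> Ed y b'})"
    and i: "i < k"
  defines "T \<equiv> pt i ` A"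
  shows "\<rho> ^ (3 * k + 5) * N \<le> real (card T)"
    and "real (card (diffset T T)) \<le> (1 / \<rho>) ^ (24 * k + 39) * real (card T)"
proof -
  have fA: "finite A" using A A0 finite_subset by blast
  have fT: "finite T" using fA by (simp add: T_def)
  have "real (card A) \<le> real (card T) * fib"
    unfolding T_def
  proof (rule card_le_card_image_mult[OF fA])
    fix g
    have "card {x\<in>A. pt i x = g} \<le> card {x\<in>A0. pt i x = g}" using A A0 by (intro card_mono) auto
    then show "real (card {x\<in>A. pt i x = g}) \<le> fib" using A0_fiber_pt[OF i, of g] by linarith
  qed
  then have "\<rho> ^ (2 * k + 5) * M \<le> real (card T) * ((1 / \<rho>) ^ k * M / N)" using A(2) by (simp add: fib_def)
  then have "\<rho> ^ (2 * k + 5) * M \<le> (real (card T) * ((1 / \<rho>) ^ k / N)) * M" by (simp add: mult_ac)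
  then have "\<rho> ^ (2 * k + 5) \<le> real (card T) * ((1 / \<rho>) ^ k / N)" using M0 by (simp only: mult_le_cancel_right_pos)
  then have "\<rho> ^ k * N * \<rho> ^ (2 * k + 5) \<le> \<rho> ^ k * N * (real (card T) * ((1 / \<rho>) ^ k / N))"
    using \<rho> N0 by (intro mult_left_mono) auto
  also have "\<dots> = real (card T)" using \<rho> N0 by (simp add: power_divide)
  finally have "\<rho> ^ k * N * \<rho> ^ (2 * k + 5) \<le> real (card T)" .
  moreover have "\<rho> ^ (3 * k + 5) = \<rho> ^ k * \<rho> ^ (2 * k + 5)" by (simp flip: power_add)
  ultimately show T: "\<rho> ^ (3 * k + 5) * N \<le> real (card T)" by (simp only: mult_ac)
  let ?L = "large i"
  let ?sgn = "\<lambda>(s1, s2, s3, s4). s1 - s2 + s3 - (s4 :: 'a \<times> 'b)"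
  define q where "q \<delta> = {s \<in> ?L \<times> ?L \<times> ?L \<times> ?L. ?sgn s = \<delta>}" for \<delta>
  have fq: "finite (q \<delta>)" for \<delta> using finite_large by (simp add: q_def)
  have q_lower: "\<rho> ^ (10 * k + 22) * M ^ 3 \<le> real (card (q \<delta>)) * (fib * (fib * fib))" if "\<delta> \<in> diffset T T" for \<delta>
  proof -
    from that obtain u v where "u \<in> T" "v \<in> T" and uv: "\<delta> = u - v" unfolding mem_diffset by blast
    then obtain x y where "x \<in> A" "y \<in> A" "u = pt i x" "v = pt i y" unfolding T_def by blast
    then have xy: "x \<in> A" "y \<in> A" "\<delta> = pt i x - pt i y" using uv by auto
    let ?Tr = "{(b, z, b'). b \<in> A0 \<and> z \<in> A0 \<and> b' \<in> A0 \<and> Ed x b \<and> Ed z b \<and> Ed z b' \<and> Ed y b'}"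
    let ?f = "\<lambda>(b, z, b'). (pt i x - pt i b, pt i z - pt i b, pt i z - pt i b', pt i y - pt i b')"
    have fTr: "finite ?Tr" by (rule finite_subset[of _ "A0 \<times> A0 \<times> A0"]) (use A0 in auto)
    have "real (card ?Tr) \<le> real (card (?f ` ?Tr)) * (fib * (fib * fib))"
    proof (rule card_le_card_image_mult[OF fTr])
      fix s assume "s \<in> ?f ` ?Tr"
      obtain s1 s2 s3 s4 where s: "s = (s1, s2, s3, s4)" by (cases s) auto
      let ?P = "\<lambda>g. {\<gamma>\<in>A0. pt i \<gamma> = g}"
      let ?gb = "pt i x - s1" and ?gb' = "pt i y - s4"
      have "{t \<in> ?Tr. ?f t = s} \<subseteq> ?P ?gb \<times> ?P (s2 + ?gb) \<times> ?P ?gb'"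
        unfolding s by (auto simp: algebra_simps)
      moreover have fP: "finite (?P g)" for g using A0 by simp
      ultimately have "card {t \<in> ?Tr. ?f t = s} \<le> card (?P ?gb \<times> ?P (s2 + ?gb) \<times> ?P ?gb')"
        by (intro card_mono) auto
      then have "real (card {t \<in> ?Tr. ?f t = s}) \<le> real (card (?P ?gb)) * (real (card (?P (s2 + ?gb))) * real (card (?P ?gb')))"
        unfolding card_cartesian_product of_nat_mult[symmetric] of_nat_le_iff .
      also have "\<dots> \<le> fib * (fib * fib)"
        using fib_pos by (intro mult_mono A0_fiber_pt i) auto
      finally show "real (card {t \<in> ?Tr. ?f t = s}) \<le> fib * (fib * fib)" .
    qed
    moreover have "?f ` ?Tr \<subseteq> q \<delta>"
    proof
      fix s assume "s \<in> ?f ` ?Tr"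
      then obtain b z b' where t: "b \<in> A0" "z \<in> A0" "b' \<in> A0" "Ed x b" "Ed z b" "Ed z b'" "Ed y b'"
        and s: "s = (pt i x - pt i b, pt i z - pt i b, pt i z - pt i b', pt i y - pt i b')" by auto
      have "x \<in> A0" "y \<in> A0" using xy A by auto
      then show "s \<in> q \<delta>" using t i unfolding s q_def xy(3) by (auto intro!: Ed_large)
    qed
    then have "card (?f ` ?Tr) \<le> card (q \<delta>)" using fq by (intro card_mono)
    then have "real (card (?f ` ?Tr)) * (fib * (fib * fib)) \<le> real (card (q \<delta>)) * (fib * (fib * fib))"
      using fib_pos by (intro mult_right_mono) auto
    ultimately show ?thesis using A(3)[OF xy(1,2)] by linarith
  qed
  have "(\<Sum>\<delta>\<in>diffset T T. card (q \<delta>)) = card (\<Union>\<delta>\<in>diffset T T. q \<delta>)"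
    using fT fq by (intro card_UN_disjoint[symmetric]) (auto simp: q_def)
  also have "\<dots> \<le> card (?L \<times> ?L \<times> ?L \<times> ?L)"
    using finite_large by (intro card_mono) (auto simp: q_def)
  finally have "(\<Sum>\<delta>\<in>diffset T T. real (card (q \<delta>))) \<le> real (card ?L) ^ 4"
    unfolding of_nat_sum[symmetric] card_cartesian_product of_nat_power[symmetric] of_nat_le_iff
    by (simp add: eval_nat_numeral)
  also have "\<dots> \<le> (N * (1 / \<rho>) ^ (2 * k + 3)) ^ 4" using large_card[OF i] by (intro power_mono) auto
  finally have 1: "(\<Sum>\<delta>\<in>diffset T T. real (card (q \<delta>))) \<le> (N * (1 / \<rho>) ^ (2 * k + 3)) ^ 4" .
  have "real (card (diffset T T)) * (\<rho> ^ (10 * k + 22) * M ^ 3)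
      \<le> (\<Sum>\<delta>\<in>diffset T T. real (card (q \<delta>)) * (fib * (fib * fib)))"
    using sum_mono[OF q_lower] by simp
  also have "\<dots> \<le> (N * (1 / \<rho>) ^ (2 * k + 3)) ^ 4 * (fib * (fib * fib))"
    unfolding sum_distrib_right[symmetric] using 1 fib_pos by (intro mult_right_mono) auto
  \<comment> \<open>The exponent is \<open>4 (2 k + 3)\<close> from \<open>large i\<close> plus
    \<open>3 k\<close> from the fibres. Division by the number of paths adds
    \<open>10 k + 22\<close>, and the comparison of \<open>N\<close> with \<open>card T\<close> adds
    \<open>3 k + 5\<close>, which makes \<open>24 k + 39\<close>.\<close>
  also have "\<dots> = N * (1 / \<rho>) ^ (11 * k + 12) * M ^ 3"
  proof -
    have "(1 / \<rho>) ^ (3 * k) = (1 / \<rho>) ^ k * ((1 / \<rho>) ^ k * (1 / \<rho>) ^ k)"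
      unfolding power_add[symmetric] by (rule arg_cong[where f = "power (1 / \<rho>)"]) simp
    then have "fib * (fib * fib) = (1 / \<rho>) ^ (3 * k) * M ^ 3 / N ^ 3"
      by (simp add: fib_def power3_eq_cube mult_ac)
    moreover have "(N * (1 / \<rho>) ^ (2 * k + 3)) ^ 4 = N ^ 4 * (1 / \<rho>) ^ (8 * k + 12)"
      unfolding power_mult_distrib power_mult[symmetric] by (simp add: algebra_simps)
    ultimately have "(N * (1 / \<rho>) ^ (2 * k + 3)) ^ 4 * (fib * (fib * fib))
        = (N ^ 4 / N ^ 3) * ((1 / \<rho>) ^ (8 * k + 12) * (1 / \<rho>) ^ (3 * k)) * M ^ 3" by simp
    also have "(1 / \<rho>) ^ (8 * k + 12) * (1 / \<rho>) ^ (3 * k) = (1 / \<rho>) ^ (11 * k + 12)"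
      by (simp flip: power_add)
    also have "N ^ 4 / N ^ 3 = N" using N0 by (simp add: eval_nat_numeral)
    finally show ?thesis .
  qed
  finally have "real (card (diffset T T)) * \<rho> ^ (10 * k + 22) \<le> N * (1 / \<rho>) ^ (11 * k + 12)"
    using M0 by (simp flip: mult.assoc)
  then have "real (card (diffset T T)) * \<rho> ^ (10 * k + 22) * (1 / \<rho>) ^ (10 * k + 22) \<le> N * (1 / \<rho>) ^ (11 * k + 12) * (1 / \<rho>) ^ (10 * k + 22)"
    using \<rho> by (intro mult_right_mono) auto
  moreover have "\<rho> ^ (10 * k + 22) * (1 / \<rho>) ^ (10 * k + 22) = 1"
    using \<rho> by (simp flip: power_mult_distrib)
  ultimately have "real (card (diffset T T)) \<le> N * (1 / \<rho>) ^ (21 * k + 34)"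
    by (simp add: mult.assoc flip: power_add)
  also have "\<dots> = (\<rho> ^ (3 * k + 5) * N) * (1 / \<rho>) ^ (24 * k + 39)"
  proof -
    have "(1 / \<rho>) ^ (24 * k + 39) = (1 / \<rho>) ^ (3 * k + 5) * (1 / \<rho>) ^ (21 * k + 34)"
      by (simp flip: power_add)
    moreover have "\<rho> ^ (3 * k + 5) * (1 / \<rho>) ^ (3 * k + 5) = 1" using \<rho> by (simp flip: power_mult_distrib)
    ultimately show ?thesis by (simp add: mult_ac)
  qed
  also have "\<dots> \<le> real (card T) * (1 / \<rho>) ^ (24 * k + 39)"
    using T \<rho> by (intro mult_right_mono) auto
  finally show "real (card (diffset T T)) \<le> (1 / \<rho>) ^ (24 * k + 39) * real (card T)" by (simp add: mult.commute)
qed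

end

context bilinear_conversion_pos
begin

text \<open>Structured points with first coordinates in a common direction have second coordinates
  which satisfy the required relations up to boundedly many errors; differences of points with the
  same error satisfy them exactly.\<close>

lemma conversion: "\<rho> ^ (1300 * k ^ 3 * (B + 1)) * N \<le> (\<Sum>h\<in>V. \<Sum>\<beta>\<in>R'. \<Prod>i<k. w i (h, \<beta> i))"
proof -
  obtain A where A: "A \<subseteq> A0" "\<rho> ^ (2 * k + 5) * M \<le> real (card A)"
    "\<And>x y. x \<in> A \<Longrightarrow> y \<in> A \<Longrightarrow> \<rho> ^ (10 * k + 22) * M ^ 3 \<le>
      real (card {(b, z, b'). b \<in> A0 \<and> z \<in> A0 \<and> b' \<in> A0 \<and> Ed x b \<and> Ed z b \<and> Ed z b' \<and> Ed y b'})"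
    using large_structured_subset by blast
  define T where "T i = pt i ` A" for i
  define U where "U i = fst ` T i" for i
  define P where "P = fst ` A"
  define K where "K = (1 / \<rho>) ^ (24 * k + 39)"
  define \<Phi> where "\<Phi> = K ^ (10 * B + 10) * (1 / \<rho>)"
  have r1: "1 / \<rho> \<ge> 1" using \<rho> by simp
  have "K \<ge> 1" unfolding K_def using r1 by (rule one_le_power)
  then have "K ^ (10 * B + 10) \<ge> 1" by (rule one_le_power)
  then have "1 * 1 \<le> K ^ (10 * B + 10) * (1 / \<rho>)" using r1 by (intro mult_mono) auto
  then have \<Phi>1: "\<Phi> \<ge> 1" by (simp add: \<Phi>_def)
  have fA: "finite A" using A A0 finite_subset by blast
  have "\<rho> ^ (2 * k + 5) * M > 0" using \<rho> M0 by simp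
  then have "A \<noteq> {}" using A(2) by auto
  then have Tne: "T i \<noteq> {}" for i by (simp add: T_def)
  have fT: "finite (T i)" for i using fA by (simp add: T_def)
  have TV: "T i \<subseteq> V \<times> Q" for i unfolding T_def using A A0 pt_in by blast
  have Tw: "\<rho> \<le> w i t" if "i < k" "t \<in> T i" for i t using that A(1) by (auto simp: T_def A0_def)
  have Tfib: "real (card {v. (x, v) \<in> T i}) \<le> 1 / \<rho>" if i: "i < k" for i x
  proof (cases "x \<in> V")
    case True
    have "card {v. (x, v) \<in> T i} \<le> card {\<alpha>\<in>Q. \<rho> \<le> w i (x, \<alpha>)}"
      using TV[of i] Tw i fin by (intro card_mono) auto
    then show ?thesis using level_card[OF i True \<rho>(1)] by linarith
  next
    case False
    then have "{v. (x, v) \<in> T i} = {}" using TV by blast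
    then show ?thesis using \<rho> by simp
  qed
  have Tcard: "\<rho> ^ (3 * k + 5) * N \<le> real (card (T i))"
    and Tdouble: "real (card (diffset (T i) (T i))) \<le> K * real (card (T i))" if "i < k" for i
    using projection_doubling[OF A that] by (simp_all add: T_def K_def)
  define Ds where "Ds i j x = {v. \<exists>t\<in>T i. \<exists>t'\<in>T i. zmul (a i j) t - t' = (x, v)}" for i j x
  have Ds: "finite (Ds i j x)" "real (card (Ds i j x)) \<le> \<Phi>" if "i < k" "j \<in> J" for i j x
    unfolding Ds_def \<Phi>_def
    by (rule dilate_difference_fiber[OF fT Tne Tdouble[OF that(1)] Tfib[OF that(1)] a_bound[OF that]])+
  have UV: "U i \<subseteq> V" for i using TV[of i] by (auto simp: U_def)
  have Ucard: "\<rho> ^ (3 * k + 6) \<le> real (card (U i)) / N" if i: "i < k" for i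
  proof -
    have "real (card (T i)) \<le> real (card (U i)) * (1 / \<rho>)"
      unfolding U_def
    proof (rule card_le_card_image_mult[OF fT])
      fix x
      have "inj_on snd {t \<in> T i. fst t = x}" by (auto simp: inj_on_def)
      moreover have "snd ` {t \<in> T i. fst t = x} \<subseteq> {v. (x, v) \<in> T i}" by auto
      moreover have "finite {v. (x, v) \<in> T i}" by (rule finite_subset[of _ "snd ` T i"]) (use fT in force)+
      ultimately have "card {t \<in> T i. fst t = x} \<le> card {v. (x, v) \<in> T i}" by (intro card_inj_on_le)
      then show "real (card {t \<in> T i. fst t = x}) \<le> 1 / \<rho>" using Tfib[OF i, of x] by linarith
    qed
    then have "\<rho> * (\<rho> ^ (3 * k + 5) * N) \<le> \<rho> * (real (card (U i)) * (1 / \<rho>))"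
      using Tcard[OF i] \<rho> by (intro mult_left_mono) auto
    also have "\<dots> = real (card (U i))" using \<rho> by simp
    finally have "\<rho> ^ (3 * k + 6) * N \<le> real (card (U i))" by (simp add: power_add mult_ac power_numeral_reduce)
    then show ?thesis using N0 by (simp add: pos_le_divide_eq)
  qed
  have PW: "P \<subseteq> W" unfolding P_def using A A0 by (auto simp: \<Gamma>_def)
  have Pcard: "\<rho> ^ (3 * k + 5) \<le> real (card P) / M"
  proof -
    have "real (card A) \<le> real (card P) * (1 / \<rho>) ^ k"
      by (rule card_Y_sub) (use A fA in \<open>auto simp: P_def\<close>)
    then have "\<rho> ^ k * (\<rho> ^ (2 * k + 5) * M) \<le> \<rho> ^ k * (real (card P) * (1 / \<rho>) ^ k)"
      using A(2) \<rho> by (intro mult_left_mono) auto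
    also have "\<dots> = real (card P)" using \<rho> by (simp add: power_divide)
    finally have "\<rho> ^ k * \<rho> ^ (2 * k + 5) * M \<le> real (card P)" by simp
    moreover have "\<rho> ^ (3 * k + 5) = \<rho> ^ k * \<rho> ^ (2 * k + 5)" by (simp flip: power_add)
    ultimately show ?thesis using M0 by (simp add: pos_le_divide_eq)
  qed
  \<comment> \<open>The sets \<open>U i\<close> and \<open>P\<close> are dense in \<open>V\<close>
    and \<open>W\<close>. Suitable translates therefore have many \<open>h\<close> in common, with
    all \<open>x i + h\<close> in \<open>U i\<close> and all \<open>y j + unitv j h\<close> in
    \<open>P\<close>.\<close>
  have "\<exists>x. (\<forall>i\<in>{..<k}. x i \<in> V) \<and> real (card V) * (\<Prod>i\<in>{..<k}. real (card (U i)) / real (card V))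
      \<le> real (card {h \<in> V. \<forall>i\<in>{..<k}. x i + h \<in> U i})"
    by (rule translate_select[where t = "\<lambda>i h. h"]) (use V UV fin in auto)
  then obtain x where x: "\<And>i. i < k \<Longrightarrow> x i \<in> V"
    "N * (\<Prod>i\<in>{..<k}. real (card (U i)) / N) \<le> real (card {h \<in> V. \<forall>i\<in>{..<k}. x i + h \<in> U i})"
    unfolding N_def by auto
  define H1 where "H1 = {h \<in> V. \<forall>i\<in>{..<k}. x i + h \<in> U i}"
  have "\<exists>y. (\<forall>j\<in>J. y j \<in> W) \<and> real (card H1) * (\<Prod>j\<in>J. real (card P) / real (card W))
      \<le> real (card {h \<in> H1. \<forall>j\<in>J. y j + unitv j h \<in> P})"
    by (rule translate_select[where t = unitv]) (use W PW fin J(1) unitv_in[OF V] in \<open>auto simp: H1_def W_def\<close>)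
  then obtain y where y: "\<And>j. j \<in> J \<Longrightarrow> y j \<in> W"
    "real (card H1) * (\<Prod>j\<in>J. real (card P) / M) \<le> real (card {h \<in> H1. \<forall>j\<in>J. y j + unitv j h \<in> P})"
    unfolding M_def by auto
  define H0 where "H0 = {h \<in> H1. \<forall>j\<in>J. y j + unitv j h \<in> P}"
  have H0V: "H0 \<subseteq> V" by (auto simp: H0_def H1_def)
  have fH0: "finite H0" using H0V fin finite_subset by blast
  let ?e0 = "(3 * k + 6) * k + (3 * k + 5) * k"
  have H0card: "\<rho> ^ ?e0 * N \<le> real (card H0)"
  proof -
    have "(\<rho> ^ (3 * k + 6)) ^ k \<le> (\<Prod>i\<in>{..<k}. real (card (U i)) / N)"
      using prod_mono[of "{..<k}" "\<lambda>_. \<rho> ^ (3 * k + 6)" "\<lambda>i. real (card (U i)) / N"] Ucard \<rho> by simp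
    then have "N * (\<rho> ^ (3 * k + 6)) ^ k \<le> real (card H1)"
      using x(2) N0 unfolding H1_def by (meson mult_left_mono less_imp_le order_trans)
    moreover have "(\<rho> ^ (3 * k + 5)) ^ k \<le> (\<Prod>j\<in>J. real (card P) / M)"
    proof -
      have "(\<rho> ^ (3 * k + 5)) ^ k \<le> (\<rho> ^ (3 * k + 5)) ^ card J"
        using J(2) \<rho> by (intro power_decreasing) (auto intro: power_le_one)
      also have "\<dots> \<le> (real (card P) / M) ^ card J" using Pcard \<rho> by (intro power_mono) auto
      finally show ?thesis by simp
    qed
    ultimately have "(N * (\<rho> ^ (3 * k + 6)) ^ k) * (\<rho> ^ (3 * k + 5)) ^ k \<le> real (card H1) * (\<Prod>j\<in>J. real (card P) / M)"
      using \<rho> N0 by (intro mult_mono) auto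
    also have "\<dots> \<le> real (card H0)" using y(2) by (simp add: H0_def)
    finally have "(N * (\<rho> ^ (3 * k + 6)) ^ k) * (\<rho> ^ (3 * k + 5)) ^ k \<le> real (card H0)" .
    moreover have "\<rho> ^ ?e0 = (\<rho> ^ (3 * k + 6)) ^ k * (\<rho> ^ (3 * k + 5)) ^ k"
      by (simp only: power_mult[symmetric] power_add[symmetric])
    ultimately show ?thesis by (simp only: mult.commute mult.left_commute)
  qed
  have "\<rho> ^ ?e0 * N > 0" using \<rho> N0 by simp
  then have H0ne: "H0 \<noteq> {}" using H0card by auto
  have "\<forall>h. \<forall>i. \<exists>v. h \<in> H0 \<longrightarrow> i < k \<longrightarrow> (x i + h, v) \<in> T i"
    by (force simp: H0_def H1_def U_def)
  then obtain be0 where be0: "\<And>h i. h \<in> H0 \<Longrightarrow> i < k \<Longrightarrow> (x i + h, be0 h i) \<in> T i" by metis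
  define be where "be h i = (if i < k then be0 h i else 0)" for h i
  have be: "(x i + h, be h i) \<in> T i" if "h \<in> H0" "i < k" for h i using be0 that by (simp add: be_def)
  have "\<forall>h. \<forall>j. \<exists>v. h \<in> H0 \<longrightarrow> j \<in> J \<longrightarrow> (y j + unitv j h, v) \<in> A"
    by (force simp: H0_def P_def)
  then obtain al where al: "\<And>h j. h \<in> H0 \<Longrightarrow> j \<in> J \<Longrightarrow> (y j + unitv j h, al h j) \<in> A" by metis
  have beQ: "be h \<in> vpow k Q" if "h \<in> H0" for h
    using be[OF that] TV unfolding vpow_def be_def by auto
  have alR: "al h j \<in> R" if "h \<in> H0" "j \<in> J" for h j
    using al[OF that] A A0 by (auto simp: \<Gamma>_def)
  \<comment> \<open>The form maps \<open>unitv j h\<close> to \<open>a i j h\<close>, so that the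
    first coordinate of \<open>a i j\<close> times \<open>(x i + h, be h i)\<close> minus
    \<open>pt i (y j + unitv j h, al h j)\<close> does not depend on \<open>h\<close>. For each pair
    \<open>(i, j)\<close> all errors hence lie in one fibre of bounded size.\<close>
  define err where "err h = (\<lambda>(i, j)\<in>{..<k} \<times> J. zmul (a i j) (be h i) - al h j i)" for h
  let ?X = "\<lambda>(i, j). zmul (a i j) (x i) - lform (a i) d (y j)"
  let ?S = "PiE ({..<k} \<times> J) (\<lambda>p. Ds (fst p) (snd p) (?X p))"
  have errS: "err ` H0 \<subseteq> ?S"
  proof (rule image_subsetI)
    fix h assume h: "h \<in> H0"
    have "zmul (a i j) (be h i) - al h j i \<in> Ds i j (zmul (a i j) (x i) - lform (a i) d (y j))"
      if ij: "i < k" "j \<in> J" for i j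
    proof -
      have "pt i (y j + unitv j h, al h j) \<in> T i" using al[OF h ij(2)] by (simp add: T_def)
      moreover have "zmul (a i j) (x i + h, be h i) - pt i (y j + unitv j h, al h j)
          = (zmul (a i j) (x i) - lform (a i) d (y j), zmul (a i j) (be h i) - al h j i)"
        using ij J(1) by (auto simp: prod_eq_iff fst_zmul snd_zmul pt_def lform_add lform_unitv zmul_add_right subset_iff)
      ultimately show ?thesis using be[OF h ij(1)] unfolding Ds_def by blast
    qed
    then show "err h \<in> ?S" by (auto simp: err_def)
  qed
  have fS: "finite ?S" using Ds fin by (intro finite_PiE) auto
  have "real (card ?S) = (\<Prod>p\<in>{..<k} \<times> J. real (card (Ds (fst p) (snd p) (?X p))))"
    using fin by (simp add: card_PiE)
  also have "\<dots> \<le> (\<Prod>p\<in>{..<k} \<times> J. \<Phi>)" using Ds by (intro prod_mono) auto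
  also have "\<dots> = \<Phi> ^ (k * card J)" by (simp add: card_cartesian_product)
  also have "\<dots> \<le> \<Phi> ^ (k * k)" using \<Phi>1 J(2) by (intro power_increasing) auto
  finally have cS: "real (card ?S) \<le> \<Phi> ^ (k * k)" .
  obtain v where v: "real (card H0) \<le> \<Phi> ^ (k * k) * real (card {h \<in> H0. err h = v})"
    using pigeonhole_fiber[OF fH0 errS fS cS H0ne] by blast
  define H2 where "H2 = {h \<in> H0. err h = v}"
  have H20: "H2 \<subseteq> H0" and fH2: "finite H2" using fH0 by (auto simp: H2_def)
  let ?e1 = "?e0 + ((24 * k + 39) * (10 * B + 10) + 1) * (k * k)"
  have H2card: "\<rho> ^ ?e1 * N \<le> real (card H2)"
  proof -
    let ?q = "((24 * k + 39) * (10 * B + 10) + 1) * (k * k)"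
    have "\<Phi> = (1 / \<rho>) ^ ((24 * k + 39) * (10 * B + 10) + 1)"
      unfolding \<Phi>_def K_def by (simp add: power_mult)
    then have "\<Phi> ^ (k * k) = (1 / \<rho>) ^ ?q" by (simp only: power_mult)
    then have "\<rho> ^ ?e0 * N \<le> (1 / \<rho>) ^ ?q * real (card H2)" using v H0card by (simp add: H2_def)
    then have "\<rho> ^ ?q * (\<rho> ^ ?e0 * N) \<le> \<rho> ^ ?q * ((1 / \<rho>) ^ ?q * real (card H2))"
      using \<rho> by (intro mult_left_mono) auto
    also have "\<dots> = real (card H2)" using \<rho> by (simp add: power_divide)
    also have "\<rho> ^ ?q * (\<rho> ^ ?e0 * N) = \<rho> ^ ?e1 * N" by (simp only: power_add mult_ac)
    finally show ?thesis .
  qed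
  define G where "G = (\<Sum>h\<in>V. \<Sum>\<beta>\<in>R'. \<Prod>i<k. w i (h, \<beta> i))"
  have fR': "finite R'" unfolding R'_def using finite_vpow[OF fin(2)] by simp
  have R'Q: "\<beta> i \<in> Q" if "\<beta> \<in> R'" for \<beta> i using that vpow_nth[OF Q] by (auto simp: R'_def)
  define wt where "wt p = (\<Prod>i<k. w i (fst p, snd p i))" for p :: "'a \<times> (nat \<Rightarrow> 'b)"
  have wt_nonneg: "0 \<le> wt p" if "p \<in> V \<times> R'" for p
    unfolding wt_def using that R'Q by (intro prod_nonneg) (auto intro: w_nonneg)
  have dif: "(h - h', be h - be h') \<in> V \<times> R'" if h: "h \<in> H2" "h' \<in> H2" for h h'
  proof -
    have hh: "h \<in> H0" "h' \<in> H0" using h H20 by auto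
    have "be h - be h' \<in> vpow k Q" using beQ[OF hh(1)] beQ[OF hh(2)] fin_subgroupD(3)[OF fin_subgroup_vpow[OF Q]] by blast
    moreover have "(\<lambda>i. zmul (a i j) ((be h - be h') i)) \<in> R" if j: "j \<in> J" for j
    proof -
      have "(\<lambda>i. zmul (a i j) ((be h - be h') i)) = al h j - al h' j"
      proof
        fix i show "zmul (a i j) ((be h - be h') i) = (al h j - al h' j) i"
        proof (cases "i < k")
          case True
          have "err h (i, j) = err h' (i, j)" using h by (simp add: H2_def)
          then have "zmul (a i j) (be h i) - al h j i = zmul (a i j) (be h' i) - al h' j i"
            using True j by (simp add: err_def)
          then show ?thesis by (simp add: zmul_diff_right algebra_simps)
        next
          case False
          then have "al h j i = 0" "al h' j i = 0" using alR[OF hh(1) j] alR[OF hh(2) j] R(1) by (auto simp: vpow_def)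
          then show ?thesis using False by (simp add: be_def)
        qed
      qed
      then show ?thesis using alR[OF hh(1) j] alR[OF hh(2) j] fin_subgroupD(3)[OF R(2)] by auto
    qed
    ultimately have "be h - be h' \<in> R'" by (simp add: R'_def)
    then show ?thesis using hh H0V fin_subgroupD(3)[OF V] by auto
  qed
  have col: "(\<Sum>h\<in>H2. wt (h - h', be h - be h')) \<le> G" if h': "h' \<in> H2" for h'
  proof -
    have inj: "inj_on (\<lambda>h. (h - h', be h - be h')) H2" by (auto simp: inj_on_def)
    have "(\<Sum>h\<in>H2. wt (h - h', be h - be h')) = (\<Sum>p\<in>(\<lambda>h. (h - h', be h - be h')) ` H2. wt p)"
      using inj by (simp add: sum.reindex)
    also have "\<dots> \<le> (\<Sum>p\<in>V \<times> R'. wt p)"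
      using dif h' wt_nonneg fin fR' by (intro sum_mono2) auto
    also have "\<dots> = G" by (simp add: G_def wt_def sum.cartesian_product case_prod_unfold)
    finally show ?thesis .
  qed
  \<comment> \<open>\<open>None\<close> is a base point with all coordinates 0. Cauchy--Schwarz
    against it replaces the points \<open>(x i + h, be h i)\<close> by their differences, in which
    the translates \<open>x i\<close> cancel.\<close>
  define g where "g p i = (case p of None \<Rightarrow> 0 | Some h \<Rightarrow> (x i + h, be h i))" for p i
  let ?SS = "insert None (Some ` H2)"
  have gV: "g p i \<in> V \<times> Q" if "p \<in> ?SS" "i < k" for p i
    using that be[of _ i] H20 TV[of i] fin_subgroupD(2)[OF V] fin_subgroupD(2)[OF Q]
    by (auto simp: g_def zero_prod_def split: option.splits)
  have "psd_on ?SS (\<lambda>p q. \<Prod>i<k. complex_of_real (w i (g p i - g q i)))"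
    using gV by (intro psd_on_prod psd_on_reindex[OF w_psd] image_subsetI) auto
  then have psd: "psd_on ?SS (\<lambda>p q. complex_of_real (\<Prod>i<k. w i (g p i - g q i)))" by simp
  have "(cmod (\<Sum>p\<in>Some ` H2. 1 * complex_of_real (\<Prod>i<k. w i (g p i - g None i))))\<^sup>2
      \<le> Re (complex_of_real (\<Prod>i<k. w i (g None i - g None i)))
        * Re (\<Sum>p\<in>Some ` H2. \<Sum>q\<in>Some ` H2. 1 * cnj 1 * complex_of_real (\<Prod>i<k. w i (g p i - g q i)))"
    by (rule psd_on_cauchy_schwarz[OF psd]) (use fH2 in auto)
  also have "(\<Sum>p\<in>Some ` H2. 1 * complex_of_real (\<Prod>i<k. w i (g p i - g None i)))
      = complex_of_real (\<Sum>h\<in>H2. \<Prod>i<k. w i (x i + h, be h i))"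
    by (simp add: sum.reindex g_def)
  also have "(\<Sum>p\<in>Some ` H2. \<Sum>q\<in>Some ` H2. 1 * cnj 1 * complex_of_real (\<Prod>i<k. w i (g p i - g q i)))
      = complex_of_real (\<Sum>h\<in>H2. \<Sum>h'\<in>H2. wt (h - h', be h - be h'))"
    by (simp add: sum.reindex g_def wt_def)
  finally have 1: "(\<Sum>h\<in>H2. \<Prod>i<k. w i (x i + h, be h i))\<^sup>2
      \<le> (\<Prod>i<k. w i 0) * (\<Sum>h\<in>H2. \<Sum>h'\<in>H2. wt (h - h', be h - be h'))"
    by (simp only: norm_of_real power2_abs Re_complex_of_real diff_self)
  have z: "0 \<in> V \<times> Q" using fin_subgroupD(2)[OF V] fin_subgroupD(2)[OF Q] by (simp add: zero_prod_def)
  have "(\<Sum>h\<in>H2. \<Sum>h'\<in>H2. wt (h - h', be h - be h')) = (\<Sum>h'\<in>H2. \<Sum>h\<in>H2. wt (h - h', be h - be h'))"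
    by (rule sum.swap)
  also have "\<dots> \<le> (\<Sum>h'\<in>H2. G)" by (intro sum_mono col)
  also have "\<dots> \<le> N * G"
  proof -
    have "card H2 \<le> card V" using H20 H0V fin by (intro card_mono) auto
    moreover have "0 \<le> G"
      unfolding G_def using R'Q by (intro sum_nonneg prod_nonneg) (auto intro: w_nonneg)
    ultimately show ?thesis by (simp add: N_def mult_right_mono)
  qed
  finally have 2: "(\<Sum>h\<in>H2. \<Sum>h'\<in>H2. wt (h - h', be h - be h')) \<le> N * G" .
  have s0: "0 \<le> (\<Sum>h\<in>H2. \<Sum>h'\<in>H2. wt (h - h', be h - be h'))" by (intro sum_nonneg wt_nonneg dif)
  have "(\<Sum>h\<in>H2. \<rho> ^ k) \<le> (\<Sum>h\<in>H2. \<Prod>i<k. w i (x i + h, be h i))"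
  proof (rule sum_mono)
    fix h assume "h \<in> H2"
    then have "\<rho> \<le> w i (x i + h, be h i)" if "i < k" for i using Tw be H20 that by blast
    then show "\<rho> ^ k \<le> (\<Prod>i<k. w i (x i + h, be h i))"
      using prod_mono[of "{..<k}" "\<lambda>_. \<rho>" "\<lambda>i. w i (x i + h, be h i)"] \<rho> by simp
  qed
  moreover have "\<rho> ^ ?e1 * N * \<rho> ^ k \<le> real (card H2) * \<rho> ^ k"
    using H2card \<rho> by (intro mult_right_mono) auto
  ultimately have "\<rho> ^ ?e1 * N * \<rho> ^ k \<le> (\<Sum>h\<in>H2. \<Prod>i<k. w i (x i + h, be h i))"
    unfolding sum_constant by linarith
  then have "(\<rho> ^ ?e1 * N * \<rho> ^ k)\<^sup>2 \<le> (\<Sum>h\<in>H2. \<Prod>i<k. w i (x i + h, be h i))\<^sup>2"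
    using \<rho> N0 by (intro power_mono) auto
  also have "\<dots> \<le> 1 * (N * G)"
  proof -
    have "(\<Prod>i<k. w i 0) \<le> 1" using z by (intro prod_le_1) (use w_nonneg w_le1 in auto)
    then have "(\<Prod>i<k. w i 0) * (\<Sum>h\<in>H2. \<Sum>h'\<in>H2. wt (h - h', be h - be h'))
        \<le> 1 * (\<Sum>h\<in>H2. \<Sum>h'\<in>H2. wt (h - h', be h - be h'))"
      using s0 by (rule mult_right_mono)
    then show ?thesis using 1 2 by linarith
  qed
  also have "(\<rho> ^ ?e1 * N * \<rho> ^ k)\<^sup>2 = \<rho> ^ (2 * ?e1 + 2 * k) * N * N"
  proof -
    have "(\<rho> ^ e * N * \<rho> ^ k)\<^sup>2 = \<rho> ^ (2 * e + 2 * k) * N * N" for e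
      unfolding power2_eq_square mult_2 power_add by (simp add: mult.commute mult.left_commute)
    then show ?thesis .
  qed
  finally have "\<rho> ^ (2 * ?e1 + 2 * k) * N \<le> G" using N0 by simp
  moreover have "\<rho> ^ (1300 * k ^ 3 * (B + 1)) \<le> \<rho> ^ (2 * ?e1 + 2 * k)"
  proof (rule power_decreasing)
    have k1: "1 \<le> k" using k by simp
    have kk: "k \<le> k ^ 3" "k\<^sup>2 \<le> k ^ 3" using power_increasing[OF _ k1, of 1 3] power_increasing[OF _ k1, of 2 3] by auto
    \<comment> \<open>The main term \<open>480 k ^ 3 (B + 1)\<close> belongs to the at most
      \<open>k ^ 2\<close> error coordinates, each at a cost of about \<open>240 k (B + 1)\<close>
      powers of \<open>\<rho>\<close>, doubled by the square. The coefficients add up to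
      1298.\<close>
    have "2 * ?e1 + 2 * k = 12 * k\<^sup>2 + 24 * k + 480 * (k ^ 3 * (B + 1)) + 780 * (k\<^sup>2 * (B + 1)) + 2 * k\<^sup>2"
      by (simp add: power2_eq_square power3_eq_cube algebra_simps)
    also have "\<dots> \<le> 12 * (k ^ 3 * (B + 1)) + 24 * (k ^ 3 * (B + 1)) + 480 * (k ^ 3 * (B + 1)) + 780 * (k ^ 3 * (B + 1)) + 2 * (k ^ 3 * (B + 1))"
      using kk by (intro add_mono mult_le_mono) auto
    also have "\<dots> \<le> 1300 * k ^ 3 * (B + 1)" by simp
    finally show "2 * ?e1 + 2 * k \<le> 1300 * k ^ 3 * (B + 1)" .
  qed (use \<rho> in auto)
  then have "\<rho> ^ (1300 * k ^ 3 * (B + 1)) * N \<le> \<rho> ^ (2 * ?e1 + 2 * k) * N"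
    using N0 by (intro mult_right_mono) auto
  ultimately show ?thesis unfolding G_def[symmetric] by linarith
qed

end

theorem (in bilinear_conversion) bilinear_conversion:
  "(\<eta> / (8 * real k)) ^ (1300 * k ^ 3 * (B + 1)) \<le> (\<Sum>h\<in>V. \<Sum>\<beta>\<in>R'. \<Prod>i<k. w i (h, \<beta> i)) / real (card V)"
proof (cases "\<eta> = 0")
  case True
  have R'Q: "\<beta> i \<in> Q" if "\<beta> \<in> R'" for \<beta> i using that vpow_nth[OF Q] by (auto simp: R'_def)
  have "0 \<le> (\<Sum>h\<in>V. \<Sum>\<beta>\<in>R'. \<Prod>i<k. w i (h, \<beta> i)) / real (card V)"
    using R'Q by (intro divide_nonneg_nonneg sum_nonneg prod_nonneg) (auto intro: w_nonneg)
  then show ?thesis using True k by (simp add: zero_power)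
next
  case False
  then interpret bilinear_conversion_pos V Q w k d B a J R
    using \<eta>_nonneg by unfold_locales auto
  show ?thesis using conversion N0 by (simp add: \<rho>_def N_def pos_le_divide_eq)
qed

section \<open>Averages\<close>

definition mean :: "'a set \<Rightarrow> ('a \<Rightarrow> real) \<Rightarrow> real" where
  "mean A f = (\<Sum>x\<in>A. f x) / real (card A)"

lemma expect_of_real: "expect A (\<lambda>x. of_real (f x)) = of_real (mean A f)"
  by (simp add: expect_def mean_def)

lemma Re_expect: "Re (expect A f) = mean A (\<lambda>x. Re (f x))"
  unfolding expect_def mean_def using Re_divide_of_nat by (simp add: Re_divide_of_nat)

lemma expect_cong: "(\<And>x. x \<in> A \<Longrightarrow> f x = g x) \<Longrightarrow> expect A f = expect A g"
  by (simp add: expect_def)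

lemma mean_cong: "(\<And>x. x \<in> A \<Longrightarrow> f x = g x) \<Longrightarrow> mean A f = mean A g"
  by (simp add: mean_def)

lemma expect_const: "finite A \<Longrightarrow> A \<noteq> {} \<Longrightarrow> expect A (\<lambda>_. c) = c"
  by (simp add: expect_def)

lemma mean_const: "finite A \<Longrightarrow> A \<noteq> {} \<Longrightarrow> mean A (\<lambda>_. c) = c"
  by (simp add: mean_def)

lemma expect_cmult: "expect A (\<lambda>x. c * f x) = c * expect A f"
  by (simp add: expect_def sum_distrib_left)

lemma expect_cmult_right: "expect A (\<lambda>x. f x * c) = expect A f * c"
  by (simp add: expect_def sum_distrib_right)

lemma expect_cnj: "expect A (\<lambda>x. cnj (f x)) = cnj (expect A f)"
  by (simp add: expect_def)

lemma expect_swap: "expect A (\<lambda>x. expect B (f x)) = expect B (\<lambda>y. expect A (\<lambda>x. f x y))"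
  unfolding expect_def by (subst sum_divide_distrib[symmetric], subst sum.swap) (simp add: sum_divide_distrib mult.commute)

lemma expect_Times: "expect (A \<times> B) f = expect A (\<lambda>a. expect B (\<lambda>b. f (a, b)))"
  unfolding expect_def
  by (simp add: sum.cartesian_product[symmetric] card_cartesian_product sum_divide_distrib[symmetric] mult.commute)
     (simp add: sum.cartesian_product)

lemma expect_reindex: "bij_betw h A B \<Longrightarrow> expect B f = expect A (\<lambda>x. f (h x))"
  unfolding expect_def using sum.reindex_bij_betw[of h A B f] bij_betw_same_card[of h A B] by simp

lemma expect_mult: "expect A f * expect B g = expect A (\<lambda>x. expect B (\<lambda>y. f x * g y))"
  by (simp add: expect_cmult expect_cmult_right)

lemma mean_nonneg: "(\<And>x. x \<in> A \<Longrightarrow> 0 \<le> f x) \<Longrightarrow> 0 \<le> mean A f"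
  unfolding mean_def by (intro divide_nonneg_nonneg sum_nonneg) auto

lemma mean_mono: "(\<And>x. x \<in> A \<Longrightarrow> f x \<le> g x) \<Longrightarrow> mean A f \<le> mean A g"
  unfolding mean_def by (intro divide_right_mono sum_mono) auto

lemma cmod_expect_le: "cmod (expect A f) \<le> mean A (\<lambda>x. cmod (f x))"
  unfolding expect_def mean_def by (simp add: norm_divide divide_right_mono norm_sum)

lemma cmod_expect_le1:
  assumes "\<And>x. x \<in> A \<Longrightarrow> cmod (f x) \<le> 1" shows "cmod (expect A f) \<le> 1"
proof -
  have "cmod (expect A f) \<le> mean A (\<lambda>x. 1)"
    by (rule order_trans[OF cmod_expect_le mean_mono]) (rule assms)
  also have "\<dots> \<le> 1" by (simp add: mean_def divide_le_eq)
  finally show ?thesis .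
qed

text \<open>Jensen's inequality, from the tangent to \<open>x ^ n\<close> at the mean.\<close>

lemma power_mean:
  assumes "finite A" "A \<noteq> {}" and f: "\<And>x. x \<in> A \<Longrightarrow> 0 \<le> f x"
  shows "mean A f ^ n \<le> mean A (\<lambda>x. f x ^ n)"
proof (cases n)
  case 0
  then show ?thesis using assms by (simp add: mean_const)
next
  case (Suc m)
  define c where "c = mean A f"
  have c0: "c \<ge> 0" unfolding c_def using f by (rule mean_nonneg)
  have tangent: "c ^ n + real n * c ^ m * (x - c) \<le> x ^ n" if "x \<ge> 0" for x
  proof -
    have "x ^ n - c ^ n - real n * c ^ m * (x - c) = (x - c) * ((\<Sum>i<n. c ^ (m - i) * x ^ i) - real n * c ^ m)"
      using power_diff_sumr2[of x n c] by (simp add: algebra_simps Suc)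
    also have "(\<Sum>i<n. c ^ (m - i) * x ^ i) - real n * c ^ m = (\<Sum>i<n. c ^ (m - i) * x ^ i - c ^ m)"
      by (simp add: sum_subtractf)
    also have "(x - c) * \<dots> = (\<Sum>i<n. (x - c) * (c ^ (m - i) * x ^ i - c ^ m))"
      by (rule sum_distrib_left)
    also have "\<dots> \<ge> 0"
    proof (rule sum_nonneg)
      fix i assume "i \<in> {..<n}"
      then have "c ^ m = c ^ (m - i) * c ^ i" using Suc by (simp flip: power_add)
      then have eq: "(x - c) * (c ^ (m - i) * x ^ i - c ^ m) = c ^ (m - i) * ((x - c) * (x ^ i - c ^ i))"
        by (simp add: algebra_simps)
      have "0 \<le> (x - c) * (x ^ i - c ^ i)"
      proof (cases "c \<le> x")
        case True
        then show ?thesis using power_mono[OF True c0, of i] by simp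
      next
        case False
        then show ?thesis using power_mono[OF _ that, of c i] by (intro mult_nonpos_nonpos) auto
      qed
      then show "0 \<le> (x - c) * (c ^ (m - i) * x ^ i - c ^ m)" unfolding eq using c0 by simp
    qed
    finally show ?thesis by simp
  qed
  have "mean A (\<lambda>x. c ^ n + real n * c ^ m * (f x - c)) \<le> mean A (\<lambda>x. f x ^ n)"
    by (intro mean_mono tangent f)
  moreover have "mean A (\<lambda>x. c ^ n + real n * c ^ m * (f x - c)) = c ^ n + real n * c ^ m * (mean A f - c)"
  proof -
    have "card A > 0" using assms by (simp add: card_gt_0_iff)
    moreover have "(\<Sum>x\<in>A. c ^ n + real n * c ^ m * (f x - c)) = real (card A) * c ^ n + real n * c ^ m * ((\<Sum>x\<in>A. f x) - real (card A) * c)"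
      by (simp add: sum.distrib sum_distrib_left[symmetric] sum_subtractf)
    ultimately show ?thesis unfolding mean_def by (simp add: field_simps)
  qed
  ultimately show ?thesis by (simp add: c_def)
qed

lemma cmod_expect_sq_le:
  "(cmod (expect A f))\<^sup>2 \<le> mean A (\<lambda>x. (cmod (f x))\<^sup>2)"
proof (cases "finite A \<and> A \<noteq> {}")
  case True
  have "(cmod (expect A f))\<^sup>2 \<le> (mean A (\<lambda>x. cmod (f x)))\<^sup>2"
    by (intro power_mono cmod_expect_le) auto
  also have "\<dots> \<le> mean A (\<lambda>x. (cmod (f x))\<^sup>2)" using True by (intro power_mean) auto
  finally show ?thesis .
qed (auto simp: expect_def mean_def)

lemma expect_translate:
  assumes V: "fin_subgroup V" and c: "c \<in> V"
  shows "expect V (\<lambda>x. f (x + c)) = expect V f"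
proof -
  have "bij_betw (\<lambda>x. x + c) V V"
    by (rule bij_betw_byWitness[where f' = "\<lambda>x. x - c"]) (use fin_subgroupD[OF V] c in auto)
  from expect_reindex[OF this, of f] show ?thesis by simp
qed

section \<open>Averages over tuples and over cubes\<close>

lemma vpow_0: "vpow 0 V = {0}"
  by (auto simp: vpow_def fun_eq_iff)

lemma vpow_Suc_bij: "fin_subgroup V \<Longrightarrow> bij_betw (\<lambda>(h, x). h(t := x)) (vpow t V \<times> V) (vpow (Suc t) V)"
  by (rule bij_betw_byWitness[where f' = "\<lambda>h. (h(t := 0), h t)"])
     (auto simp: vpow_def fun_eq_iff less_Suc_eq fin_subgroupD)

lemma expect_vpow_Suc:
  "fin_subgroup V \<Longrightarrow> expect (vpow (Suc t) V) f = expect (vpow t V) (\<lambda>h. expect V (\<lambda>x. f (h(t := x))))"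
  using expect_reindex[OF vpow_Suc_bij[of V t], of f] by (simp add: expect_Times case_prod_unfold)

lemma expect_vpow_prod:
  assumes W: "fin_subgroup W"
  shows "expect (vpow k W) (\<lambda>h. \<Prod>i<k. f i (h i)) = (\<Prod>i<k. expect W (f i))"
proof (induction k)
  case 0
  then show ?case by (simp add: vpow_0 expect_def)
next
  case (Suc k)
  have "expect (vpow (Suc k) W) (\<lambda>h. \<Prod>i<Suc k. f i (h i)) = expect (vpow k W) (\<lambda>h. expect W (\<lambda>x. (\<Prod>i<k. f i (h i)) * f k x))"
    by (subst expect_vpow_Suc[OF W]) (simp add: mult.commute cong: prod.cong_simp)
  then show ?case using Suc by (simp add: expect_mult[symmetric])
qed

lemma expect_vpow_upd:
  assumes V: "fin_subgroup V" and j: "j < t"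
  shows "expect (vpow t V) f = expect (vpow t V) (\<lambda>h. expect V (\<lambda>x. f (h(j := x))))"
proof -
  have VV: "fin_subgroup (vpow t V)" by (rule fin_subgroup_vpow[OF V])
  have "expect (vpow t V) f = expect V (\<lambda>x. expect (vpow t V) f)"
    using fin_subgroupD[OF V] by (intro expect_const[symmetric]) auto
  also have "\<dots> = expect V (\<lambda>x. expect (vpow t V) (\<lambda>h. f (h + unitv j x)))"
    by (intro expect_cong expect_translate[symmetric] VV unitv_in V j)
  also have "\<dots> = expect (vpow t V) (\<lambda>h. expect V (\<lambda>x. f (h + unitv j x)))"
    by (rule expect_swap)
  also have "\<dots> = expect (vpow t V) (\<lambda>h. expect V (\<lambda>x. f (h(j := x))))"
  proof (rule expect_cong)
    fix h assume h: "h \<in> vpow t V"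
    have eq: "h + unitv j x = h(j := x + h j)" for x by (auto simp: unitv_def fun_eq_iff add.commute)
    have "expect V (\<lambda>x. f (h + unitv j x)) = expect V (\<lambda>x. f (h(j := x + h j)))" by (simp add: eq)
    also have "\<dots> = expect V (\<lambda>x. f (h(j := x)))"
      by (rule expect_translate[OF V, of "h j" "\<lambda>x. f (h(j := x))"]) (use vpowD h j in auto)
    finally show "expect V (\<lambda>x. f (h + unitv j x)) = expect V (\<lambda>x. f (h(j := x)))" .
  qed
  finally show ?thesis .
qed

text \<open>The iterated multiplicative derivative of \<open>F\<close> at \<open>v\<close> in the
  directions \<open>h 0, ..., h (t - 1)\<close>: the product over the corners of a cube, with
  alternating conjugations.\<close>

primrec box :: "nat \<Rightarrow> ('v::ab_group_add \<Rightarrow> complex) \<Rightarrow> (nat \<Rightarrow> 'v) \<Rightarrow> 'v \<Rightarrow> complex" where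
  "box 0 F h v = F v"
| "box (Suc t) F h v = box t F h v * cnj (box t F h (v + h t))"

lemma box_mult: "box t (\<lambda>v. F v * G v) h v = box t F h v * box t G h v"
  by (induction t arbitrary: v) auto

lemma box_cnj: "box t (\<lambda>v. cnj (F v)) h v = cnj (box t F h v)"
  by (induction t arbitrary: v) auto

lemma box_one: "box t (\<lambda>v. 1) h v = 1"
  by (induction t arbitrary: v) auto

lemma box_prod: "finite I \<Longrightarrow> box t (\<lambda>v. \<Prod>i\<in>I. F i v) h v = (\<Prod>i\<in>I. box t (F i) h v)"
  by (induction I rule: finite_induct) (auto simp: box_mult box_one)

lemma box_translate: "box t (\<lambda>v. F (v + c)) h v = box t F h (v + c)"
  by (induction t arbitrary: v) (auto simp: add_ac)

lemma box_cong: "(\<And>l. l < t \<Longrightarrow> h l = h' l) \<Longrightarrow> box t F h v = box t F h' v"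
  by (induction t arbitrary: v) auto

lemma box_hom: "(\<And>v l. l < t \<Longrightarrow> \<psi> (v + h l) = \<psi> v + e l) \<Longrightarrow> box t (\<lambda>v. f (\<psi> v)) h v = box t f e (\<psi> v)"
  by (induction t arbitrary: v) auto

lemma box_le1:
  assumes G: "fin_subgroup G" and F: "\<And>v. v \<in> G \<Longrightarrow> cmod (F v) \<le> 1"
  shows "(\<And>l. l < t \<Longrightarrow> h l \<in> G) \<Longrightarrow> v \<in> G \<Longrightarrow> cmod (box t F h v) \<le> 1"
proof (induction t arbitrary: v)
  case (Suc t)
  have "cmod (box t F h v) \<le> 1" "cmod (box t F h (v + h t)) \<le> 1"
    using Suc.prems fin_subgroupD(4)[OF G] by (auto intro!: Suc.IH)
  then show ?case by (simp add: norm_mult mult_le_one)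
qed (use F in simp)

text \<open>The corners other than \<open>y\<close> are grouped by the last direction
  \<open>l\<close> that they involve.\<close>

lemma box_decomp: "box t g h y = g y * (\<Prod>l<t. cnj (box l g h (y + h l)))"
  by (induction t) auto

text \<open>The Cauchy--Schwarz inequality, once for each factor \<open>B l\<close>, in a direction which leaves that
  factor unchanged.\<close>

lemma box_cauchy_schwarz:
  fixes G :: "'v::ab_group_add set" and W :: "'w::ab_group_add set"
  assumes G: "fin_subgroup G" and W: "fin_subgroup W"
    and \<iota>: "\<And>l y. l < t \<Longrightarrow> y \<in> W \<Longrightarrow> \<iota> l y \<in> G"
    and \<iota>_diff: "\<And>l y y'. l < t \<Longrightarrow> y \<in> W \<Longrightarrow> y' \<in> W \<Longrightarrow> \<iota> l (y - y') = \<iota> l y - \<iota> l y'"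
    and B1: "\<And>l v. l < t \<Longrightarrow> v \<in> G \<Longrightarrow> cmod (B l v) \<le> 1"
    and B_inv: "\<And>l v y. l < t \<Longrightarrow> v \<in> G \<Longrightarrow> y \<in> W \<Longrightarrow> B l (v + \<iota> l y) = B l v"
    and t: "t > 0"
  shows "cmod (expect G (\<lambda>v. F v * (\<Prod>l<t. B l v))) ^ (2 ^ t)
    \<le> Re (expect G (\<lambda>v. expect (vpow t W) (\<lambda>Y. box t F (\<lambda>l. \<iota> l (Y l)) v)))"
  using \<iota> \<iota>_diff B1 B_inv t
proof (induction t arbitrary: F B)
  case 0
  then show ?case by (simp add: vpow_0 expect_def)
next
  case (Suc t)
  let ?X = "\<lambda>v. F v * (\<Prod>l<t. B l v)"
  let ?S = "\<lambda>v. expect W (\<lambda>y. ?X (v + \<iota> t y))"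
  let ?F = "\<lambda>h v. F v * cnj (F (v + \<iota> t h))"
  let ?B = "\<lambda>h l v. B l v * cnj (B l (v + \<iota> t h))"
  have fW: "finite W" "W \<noteq> {}" using fin_subgroupD[OF W] by auto
  have "expect G (\<lambda>v. F v * (\<Prod>l<Suc t. B l v)) = expect W (\<lambda>y. expect G (\<lambda>v. ?X v * B t v))"
    using fW by (simp add: expect_const mult_ac)
  also have "\<dots> = expect W (\<lambda>y. expect G (\<lambda>v. ?X (v + \<iota> t y) * B t v))"
  proof (rule expect_cong)
    fix y assume y: "y \<in> W"
    have "expect G (\<lambda>v. ?X v * B t v) = expect G (\<lambda>v. ?X (v + \<iota> t y) * B t (v + \<iota> t y))"
      by (rule expect_translate[OF G, symmetric]) (use Suc.prems(1)[OF _ y] in simp)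
    also have "\<dots> = expect G (\<lambda>v. ?X (v + \<iota> t y) * B t v)"
      by (rule expect_cong) (use Suc.prems(4) y in simp)
    finally show "expect G (\<lambda>v. ?X v * B t v) = expect G (\<lambda>v. ?X (v + \<iota> t y) * B t v)" .
  qed
  also have "\<dots> = expect G (\<lambda>v. ?S v * B t v)"
    by (subst expect_swap) (simp add: expect_cmult_right)
  finally have "(cmod (expect G (\<lambda>v. F v * (\<Prod>l<Suc t. B l v))))\<^sup>2 \<le> mean G (\<lambda>v. (cmod (?S v * B t v))\<^sup>2)"
    using cmod_expect_sq_le by simp
  also have "\<dots> \<le> mean G (\<lambda>v. (cmod (?S v))\<^sup>2)"
    using Suc.prems(3) by (intro mean_mono power_mono) (auto simp: norm_mult mult_left_le)
  also have "\<dots> = Re (expect G (\<lambda>v. ?S v * cnj (?S v)))"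
    unfolding mult_cnj_eq expect_of_real by simp
  also have "expect G (\<lambda>v. ?S v * cnj (?S v)) = expect W (\<lambda>h. expect G (\<lambda>v. ?X v * cnj (?X (v + \<iota> t h))))"
  proof -
    have "expect G (\<lambda>v. ?S v * cnj (?S v)) = expect G (\<lambda>v. expect W (\<lambda>y. expect W (\<lambda>y'. ?X (v + \<iota> t y) * cnj (?X (v + \<iota> t y')))))"
      unfolding expect_cnj[symmetric] expect_mult ..
    also have "\<dots> = expect G (\<lambda>v. expect W (\<lambda>y. expect W (\<lambda>h. ?X (v + \<iota> t y) * cnj (?X (v + \<iota> t (h + y))))))"
      by (intro expect_cong expect_translate[OF W, symmetric])
    also have "\<dots> = expect W (\<lambda>y. expect W (\<lambda>h. expect G (\<lambda>v. ?X (v + \<iota> t y) * cnj (?X (v + \<iota> t (h + y))))))"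
      by (subst expect_swap, intro expect_cong, rule expect_swap)
    also have "\<dots> = expect W (\<lambda>y. expect W (\<lambda>h. expect G (\<lambda>v. ?X v * cnj (?X (v + \<iota> t h)))))"
    proof (rule expect_cong, rule expect_cong)
      fix y h assume yh: "y \<in> W" "h \<in> W"
      have "\<iota> t h = \<iota> t (h + y) - \<iota> t y"
        using Suc.prems(2)[of t "h + y" y] yh fin_subgroupD(4)[OF W] by simp
      then have e: "\<iota> t (h + y) = \<iota> t y + \<iota> t h" by simp
      show "expect G (\<lambda>v. ?X (v + \<iota> t y) * cnj (?X (v + \<iota> t (h + y)))) = expect G (\<lambda>v. ?X v * cnj (?X (v + \<iota> t h)))"
        unfolding e add.assoc[symmetric] using Suc.prems(1)[OF _ yh(1)]
        by (intro expect_translate[OF G, of "\<iota> t y" "\<lambda>v. ?X v * cnj (?X (v + \<iota> t h))"]) simp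
    qed
    also have "\<dots> = expect W (\<lambda>h. expect G (\<lambda>v. ?X v * cnj (?X (v + \<iota> t h))))"
      by (rule expect_const[OF fW])
    finally show ?thesis .
  qed
  also have "\<dots> = expect W (\<lambda>h. expect G (\<lambda>v. ?F h v * (\<Prod>l<t. ?B h l v)))"
    by (simp add: prod.distrib mult_ac)
  finally have 0: "(cmod (expect G (\<lambda>v. F v * (\<Prod>l<Suc t. B l v))))\<^sup>2
      \<le> Re (expect W (\<lambda>h. expect G (\<lambda>v. ?F h v * (\<Prod>l<t. ?B h l v))))" .
  have goal: "expect G (\<lambda>v. expect (vpow (Suc t) W) (\<lambda>Y. box (Suc t) F (\<lambda>l. \<iota> l (Y l)) v))
      = expect W (\<lambda>h. expect G (\<lambda>v. expect (vpow t W) (\<lambda>Y. box t (?F h) (\<lambda>l. \<iota> l (Y l)) v)))"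
  proof -
    have "box (Suc t) F (\<lambda>l. \<iota> l ((Y(t := h)) l)) v = box t (?F h) (\<lambda>l. \<iota> l (Y l)) v" for Y h v
    proof -
      have "box t F (\<lambda>l. \<iota> l ((Y(t := h)) l)) u = box t F (\<lambda>l. \<iota> l (Y l)) u" for u by (rule box_cong) simp
      then show ?thesis by (simp add: box_mult box_cnj box_translate)
    qed
    then have "expect G (\<lambda>v. expect (vpow (Suc t) W) (\<lambda>Y. box (Suc t) F (\<lambda>l. \<iota> l (Y l)) v))
      = expect G (\<lambda>v. expect W (\<lambda>h. expect (vpow t W) (\<lambda>Y. box t (?F h) (\<lambda>l. \<iota> l (Y l)) v)))"
      unfolding expect_vpow_Suc[OF W] by (subst expect_swap) simp
    then show ?thesis by (simp only: expect_swap[of G W])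
  qed
  show ?case
  \<comment> \<open>When no factor is left, the square already has the desired form. Otherwise the
    modulus has to move inside the average over \<open>h\<close>, where the induction hypothesis
    applies.\<close>
  proof (cases "t = 0")
    case True
    then show ?thesis using 0 unfolding goal by (simp add: vpow_0 expect_def[of "{0}"])
  next
    case False
    note 0
    also have "Re (expect W (\<lambda>h. expect G (\<lambda>v. ?F h v * (\<Prod>l<t. ?B h l v))))
        \<le> cmod (expect W (\<lambda>h. expect G (\<lambda>v. ?F h v * (\<Prod>l<t. ?B h l v))))" by (rule complex_Re_le_cmod)
    also have "\<dots> \<le> mean W (\<lambda>h. cmod (expect G (\<lambda>v. ?F h v * (\<Prod>l<t. ?B h l v))))" by (rule cmod_expect_le)
    finally have 1: "(cmod (expect G (\<lambda>v. F v * (\<Prod>l<Suc t. B l v))))\<^sup>2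
        \<le> mean W (\<lambda>h. cmod (expect G (\<lambda>v. ?F h v * (\<Prod>l<t. ?B h l v))))" .
    have "cmod (expect G (\<lambda>v. F v * (\<Prod>l<Suc t. B l v))) ^ (2 ^ Suc t)
        = ((cmod (expect G (\<lambda>v. F v * (\<Prod>l<Suc t. B l v))))\<^sup>2) ^ (2 ^ t)" by (simp add: power_mult)
    also have "\<dots> \<le> mean W (\<lambda>h. cmod (expect G (\<lambda>v. ?F h v * (\<Prod>l<t. ?B h l v)))) ^ (2 ^ t)"
      by (rule power_mono[OF 1]) simp
    also have "\<dots> \<le> mean W (\<lambda>h. cmod (expect G (\<lambda>v. ?F h v * (\<Prod>l<t. ?B h l v))) ^ (2 ^ t))"
      using fW by (intro power_mean) auto
    also have "\<dots> \<le> mean W (\<lambda>h. Re (expect G (\<lambda>v. expect (vpow t W) (\<lambda>Y. box t (?F h) (\<lambda>l. \<iota> l (Y l)) v))))"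
    proof (intro mean_mono Suc.IH)
      fix h l v assume h: "h \<in> W" and l: "l < t" and v: "v \<in> G"
      have hv: "\<iota> t h \<in> G" using Suc.prems(1)[OF _ h] by simp
      have vh: "v + \<iota> t h \<in> G" by (rule fin_subgroupD(4)[OF G v hv])
      have "cmod (B l v) \<le> 1" "cmod (B l (v + \<iota> t h)) \<le> 1" using Suc.prems(3) l v vh by auto
      then show "cmod (?B h l v) \<le> 1" by (simp add: norm_mult mult_le_one)
      fix y assume y: "y \<in> W"
      have "B l (v + \<iota> t h + \<iota> l y) = B l (v + \<iota> t h)" "B l (v + \<iota> l y) = B l v"
        using Suc.prems(4) l v vh y by auto
      moreover have "v + \<iota> l y + \<iota> t h = v + \<iota> t h + \<iota> l y" by (simp add: add_ac)
      ultimately show "?B h l (v + \<iota> l y) = ?B h l v" by (simp only:)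
    qed (use Suc.prems False in auto)
    finally show ?thesis unfolding goal Re_expect[of W] .
  qed
qed

section \<open>Uniformity averages and dual functions\<close>

definition U_avg :: "'a::ab_group_add set \<Rightarrow> nat \<Rightarrow> ('a \<Rightarrow> complex) \<Rightarrow> complex" where
  "U_avg V t f = expect V (\<lambda>x. expect (vpow t V) (\<lambda>h. box t f h x))"

text \<open>The product runs over all corners of the cube except \<open>y\<close>, grouped as in
  \<open>box_decomp\<close>.\<close>

definition dual_fun :: "'a::ab_group_add set \<Rightarrow> nat \<Rightarrow> ('a \<Rightarrow> complex) \<Rightarrow> 'a \<Rightarrow> complex" where
  "dual_fun V t g y = expect (vpow t V) (\<lambda>h. \<Prod>l<t. cnj (box l g h (y + h l)))"

definition deriv_avg :: "'a::ab_group_add set \<Rightarrow> nat \<Rightarrow> ('a \<Rightarrow> complex) \<Rightarrow> (nat \<Rightarrow> 'a) \<Rightarrow> complex" where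
  "deriv_avg V t g h = expect V (\<lambda>z. box t g h z)"

lemma U_avg_dual_fun: "U_avg V t g = expect V (\<lambda>y. g y * dual_fun V t g y)"
  unfolding U_avg_def dual_fun_def expect_cmult[symmetric] by (simp only: box_decomp[of t g])

text \<open>The last direction makes the two opposite faces of the cube independent, so that their
  average is a squared modulus.\<close>

lemma U_avg_Suc:
  assumes V: "fin_subgroup V"
  shows "U_avg V (Suc t) g = of_real (mean (vpow t V) (\<lambda>h. (cmod (deriv_avg V t g h))\<^sup>2))"
proof -
  have fV: "finite V" "V \<noteq> {}" using fin_subgroupD[OF V] by auto
  have bc: "box t g (h(t := x)) v = box t g h v" for h x v by (rule box_cong) simp
  have "U_avg V (Suc t) g = expect V (\<lambda>x. expect (vpow t V) (\<lambda>h. expect V (\<lambda>y. box t g h x * cnj (box t g h (x + y)))))"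
    unfolding U_avg_def expect_vpow_Suc[OF V] box.simps
    by (simp add: bc)
  also have "\<dots> = expect (vpow t V) (\<lambda>h. expect V (\<lambda>x. expect V (\<lambda>y. box t g h x * cnj (box t g h (y + x)))))"
    by (subst expect_swap) (simp add: add.commute)
  also have "\<dots> = expect (vpow t V) (\<lambda>h. expect V (\<lambda>x. expect V (\<lambda>y. box t g h x * cnj (box t g h y))))"
    by (rule expect_cong, rule expect_cong) (rule expect_translate[OF V])
  also have "\<dots> = expect (vpow t V) (\<lambda>h. deriv_avg V t g h * cnj (deriv_avg V t g h))"
    unfolding deriv_avg_def expect_cnj[symmetric] expect_mult ..
  finally show ?thesis unfolding mult_cnj_eq expect_of_real .
qed

lemma U_avg_nonneg:
  assumes "fin_subgroup V" "t > 0"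
  shows "\<exists>r\<ge>0. U_avg V t g = complex_of_real r"
proof -
  obtain s where "t = Suc s" using assms(2) gr0_implies_Suc by blast
  then show ?thesis unfolding U_avg_Suc[OF assms(1)]
    by (intro exI[of _ "mean (vpow s V) (\<lambda>h. (cmod (deriv_avg V s g h))\<^sup>2)"] conjI mean_nonneg) (auto simp: U_avg_Suc[OF assms(1)])
qed

lemma U_avg_cnj: "U_avg V t (\<lambda>x. cnj (g x)) = cnj (U_avg V t g)"
  by (simp add: U_avg_def box_cnj expect_cnj)

definition bounded1 :: "'a set \<Rightarrow> ('a \<Rightarrow> complex) \<Rightarrow> bool" where
  "bounded1 V f \<longleftrightarrow> (\<forall>x\<in>V. cmod (f x) \<le> 1)"

lemma bounded1_box:
  assumes "fin_subgroup V" "bounded1 V g" "h \<in> vpow t V" "y \<in> V" "l \<le> t"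
  shows "cmod (box l g h y) \<le> 1"
  using assms by (intro box_le1[OF assms(1)]) (auto simp: bounded1_def vpow_def)

lemma bounded1_dual_fun:
  assumes V: "fin_subgroup V" and g: "bounded1 V g" shows "bounded1 V (dual_fun V t g)"
  unfolding bounded1_def dual_fun_def
proof (intro ballI cmod_expect_le1)
  fix y h assume y: "y \<in> V" and h: "h \<in> vpow t V"
  have "cmod (box l g h (y + h l)) \<le> 1" if "l < t" for l
    using that h y fin_subgroupD(4)[OF V] vpowD(1)[OF h that] by (intro bounded1_box[OF V g h]) auto
  then show "cmod (\<Prod>l<t. cnj (box l g h (y + h l))) \<le> 1"
    unfolding prod_norm[symmetric] by (intro prod_le_1) auto
qed

text \<open>The direction \<open>\<iota> l\<close> moves \<open>\<psi>\<close> by any prescribed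
  amount and fixes \<open>B l\<close>. After Cauchy--Schwarz only the cube of \<open>f\<close> at
  \<open>\<psi> v\<close> remains, and translation in the direction \<open>\<iota> 0\<close> shows
  that \<open>\<psi> v\<close> is uniformly distributed in \<open>V\<close>.\<close>

lemma gowers_von_neumann:
  fixes G :: "'v::ab_group_add set" and V :: "'a::ab_group_add set"
  assumes G: "fin_subgroup G" and V: "fin_subgroup V" and t: "t > 0"
    and \<iota>: "\<And>l y. l < t \<Longrightarrow> y \<in> V \<Longrightarrow> \<iota> l y \<in> G"
    and \<iota>_diff: "\<And>l y y'. l < t \<Longrightarrow> y \<in> V \<Longrightarrow> y' \<in> V \<Longrightarrow> \<iota> l (y - y') = \<iota> l y - \<iota> l y'"
    and \<psi>: "\<And>v. v \<in> G \<Longrightarrow> \<psi> v \<in> V" "\<And>l v y. l < t \<Longrightarrow> y \<in> V \<Longrightarrow> \<psi> (v + \<iota> l y) = \<psi> v + y"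
    and B1: "\<And>l v. l < t \<Longrightarrow> v \<in> G \<Longrightarrow> cmod (B l v) \<le> 1"
    and B_inv: "\<And>l v y. l < t \<Longrightarrow> v \<in> G \<Longrightarrow> y \<in> V \<Longrightarrow> B l (v + \<iota> l y) = B l v"
  shows "cmod (expect G (\<lambda>v. f (\<psi> v) * (\<Prod>l<t. B l v))) ^ (2 ^ t) \<le> Re (U_avg V t f)"
proof -
  have fG: "finite G" "G \<noteq> {}" and fV: "finite V" "V \<noteq> {}" using fin_subgroupD[OF G] fin_subgroupD[OF V] by auto
  let ?g = "\<lambda>x. expect (vpow t V) (\<lambda>h. box t f h x)"
  have "expect G (\<lambda>v. expect (vpow t V) (\<lambda>Y. box t (\<lambda>v. f (\<psi> v)) (\<lambda>l. \<iota> l (Y l)) v)) = expect G (\<lambda>v. ?g (\<psi> v))"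
  proof (rule expect_cong, rule expect_cong)
    fix v Y assume "Y \<in> vpow t V"
    then show "box t (\<lambda>v. f (\<psi> v)) (\<lambda>l. \<iota> l (Y l)) v = box t f Y (\<psi> v)"
      using \<psi>(2) by (intro box_hom) (auto simp: vpow_def)
  qed
  also have "\<dots> = expect V (\<lambda>y. expect G (\<lambda>v. ?g (\<psi> v)))" by (rule expect_const[OF fV, symmetric])
  also have "\<dots> = expect V (\<lambda>y. expect G (\<lambda>v. ?g (\<psi> (v + \<iota> 0 y))))"
    by (rule expect_cong, rule expect_translate[OF G, symmetric]) (use \<iota> t in auto)
  also have "\<dots> = expect V (\<lambda>y. expect G (\<lambda>v. ?g (\<psi> v + y)))"
    by (rule expect_cong) (use \<psi>(2) t in auto)
  also have "\<dots> = expect G (\<lambda>v. expect V (\<lambda>y. ?g (y + \<psi> v)))"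
    by (subst expect_swap) (simp add: add.commute)
  also have "\<dots> = expect G (\<lambda>v. expect V ?g)"
    by (rule expect_cong, rule expect_translate[OF V]) (rule \<psi>(1))
  also have "\<dots> = U_avg V t f" unfolding U_avg_def by (rule expect_const[OF fG])
  finally have "expect G (\<lambda>v. expect (vpow t V) (\<lambda>Y. box t (\<lambda>v. f (\<psi> v)) (\<lambda>l. \<iota> l (Y l)) v)) = U_avg V t f" .
  moreover have "cmod (expect G (\<lambda>v. f (\<psi> v) * (\<Prod>l<t. B l v))) ^ (2 ^ t)
      \<le> Re (expect G (\<lambda>v. expect (vpow t V) (\<lambda>Y. box t (\<lambda>v. f (\<psi> v)) (\<lambda>l. \<iota> l (Y l)) v)))"
    by (rule box_cauchy_schwarz[OF G V]) (fact \<iota> \<iota>_diff B1 B_inv t)+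
  ultimately show ?thesis by simp
qed

text \<open>The shape of dual functions of order \<open>t\<close>: the \<open>l\<close>-th factor depends on \<open>h l\<close> and \<open>y\<close> only
  through their sum, up to the other coordinates of \<open>h\<close>.\<close>

definition cube_rep ::
    "'a::ab_group_add set \<Rightarrow> nat \<Rightarrow> ((nat \<Rightarrow> 'a) \<Rightarrow> complex) \<Rightarrow> ('a \<Rightarrow> complex) \<Rightarrow> bool" where
  "cube_rep V t A F \<longleftrightarrow> (\<exists>b.
     (\<forall>y\<in>V. F y = expect (vpow t V) (\<lambda>h. A h * (\<Prod>l<t. b l h y))) \<and>
     (\<forall>l<t. \<forall>h\<in>vpow t V. \<forall>y\<in>V. cmod (b l h y) \<le> 1) \<and>
     (\<forall>l<t. \<forall>h y x. b l (h - unitv l x) (y + x) = b l h y))"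

lemma box_sub_unitv:
  assumes "l' \<le> l" shows "box l' g (h - unitv l x) v = box l' g h v"
  by (rule box_cong) (use assms in \<open>auto simp: unitv_def\<close>)

lemma cube_rep_dual_fun:
  assumes V: "fin_subgroup V" and g: "bounded1 V g"
  shows "cube_rep V t (\<lambda>_. 1) (dual_fun V t g)"
  unfolding cube_rep_def
proof (intro exI[of _ "\<lambda>l h y. cnj (box l g h (y + h l))"] conjI allI ballI impI)
  fix l h y assume l: "l < t" and h: "h \<in> vpow t V" and y: "y \<in> V"
  show "cmod (cnj (box l g h (y + h l))) \<le> 1"
    using l h y fin_subgroupD(4)[OF V] vpowD(1)[OF h l] by (auto intro!: bounded1_box[OF V g h])
next
  fix l h y x
  show "cnj (box l g (h - unitv l x) (y + x + (h - unitv l x) l)) = cnj (box l g h (y + h l))"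
    by (simp add: box_sub_unitv) (simp add: unitv_def)
qed (simp add: dual_fun_def)

text \<open>In the last factor \<open>h t\<close> occurs only in the sum with \<open>y\<close>.
  Averaging over \<open>h t\<close> therefore removes \<open>y\<close>, and the factor becomes a
  coefficient depending on the other directions alone. This is how a dual function of order
  \<open>t + 1\<close> enters a step at order \<open>t\<close>.\<close>

lemma cube_rep_dual_fun_Suc:
  assumes V: "fin_subgroup V" and g: "bounded1 V g"
  shows "cube_rep V t (\<lambda>h. cnj (deriv_avg V t g h)) (dual_fun V (Suc t) g)"
  unfolding cube_rep_def
proof (intro exI[of _ "\<lambda>l h y. cnj (box l g h (y + h l))"] conjI allI ballI impI)
  fix y assume y: "y \<in> V"
  have "dual_fun V (Suc t) g y = expect (vpow t V) (\<lambda>h. expect V (\<lambda>x. (\<Prod>l<t. cnj (box l g h (y + h l))) * cnj (box t g h (x + y))))"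
  proof -
    have "(\<Prod>l<Suc t. cnj (box l g (h(t := x)) (y + (h(t := x)) l)))
      = (\<Prod>l<t. cnj (box l g h (y + h l))) * cnj (box t g h (x + y))" for h x
    proof -
      have b: "box l g (h(t := x)) v = box l g h v" if "l \<le> t" for l v
        by (rule box_cong) (use that in auto)
      have "(\<Prod>l<t. cnj (box l g (h(t := x)) (y + (h(t := x)) l))) = (\<Prod>l<t. cnj (box l g h (y + h l)))"
        by (rule prod.cong) (auto simp: b)
      then show ?thesis by (simp add: b add.commute)
    qed
    then show ?thesis unfolding dual_fun_def expect_vpow_Suc[OF V] by simp
  qed
  also have "\<dots> = expect (vpow t V) (\<lambda>h. cnj (deriv_avg V t g h) * (\<Prod>l<t. cnj (box l g h (y + h l))))"
  proof (rule expect_cong)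
    fix h
    have "expect V (\<lambda>x. cnj (box t g h (x + y))) = expect V (\<lambda>x. cnj (box t g h x))"
      by (rule expect_translate[OF V y])
    then show "expect V (\<lambda>x. (\<Prod>l<t. cnj (box l g h (y + h l))) * cnj (box t g h (x + y)))
      = cnj (deriv_avg V t g h) * (\<Prod>l<t. cnj (box l g h (y + h l)))"
      unfolding expect_cmult deriv_avg_def expect_cnj[symmetric] by (simp only: mult.commute)
  qed
  finally show "dual_fun V (Suc t) g y = \<dots>" .
next
  fix l h y assume l: "l < t" and h: "h \<in> vpow t V" and y: "y \<in> V"
  show "cmod (cnj (box l g h (y + h l))) \<le> 1"
    using l h y fin_subgroupD(4)[OF V] vpowD(1)[OF h l] by (auto intro!: bounded1_box[OF V g h])
next
  fix l h y x
  show "cnj (box l g (h - unitv l x) (y + x + (h - unitv l x) l)) = cnj (box l g h (y + h l))"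
    by (simp add: box_sub_unitv) (simp add: unitv_def)
qed

text \<open>A dummy direction with factor 1 raises the order; \<open>h(t := 0)\<close> leads back to
  the shorter tuples.\<close>

lemma cube_rep_Suc:
  fixes V :: "'a::ab_group_add set"
  assumes V: "fin_subgroup V" and F: "cube_rep V t (\<lambda>_. 1) F"
  shows "cube_rep V (Suc t) (\<lambda>_. 1) F"
proof -
  obtain b where b: "\<And>y. y \<in> V \<Longrightarrow> F y = expect (vpow t V) (\<lambda>h. \<Prod>l<t. b l h y)"
    "\<And>l h y. l < t \<Longrightarrow> h \<in> vpow t V \<Longrightarrow> y \<in> V \<Longrightarrow> cmod (b l h y) \<le> 1"
    "\<And>l h y x. l < t \<Longrightarrow> b l (h - unitv l x) (y + x) = b l h y"
    using F unfolding cube_rep_def by auto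
  let ?b = "\<lambda>l h y. if l < t then b l (h(t := 0)) y else 1"
  have h0: "h(t := 0) = h" if "h \<in> vpow t V" for h using vpowD(2)[OF that, of t] by (auto simp: fun_eq_iff)
  have hV: "h(t := 0) \<in> vpow t V" if "h \<in> vpow (Suc t) V" for h using that by (auto simp: vpow_def)
  show ?thesis unfolding cube_rep_def
  proof (intro exI[of _ ?b] conjI allI ballI impI)
    fix y assume y: "y \<in> V"
    have "expect (vpow (Suc t) V) (\<lambda>h. 1 * (\<Prod>l<Suc t. ?b l h y)) = expect (vpow t V) (\<lambda>h. expect V (\<lambda>x. \<Prod>l<t. b l h y))"
      unfolding expect_vpow_Suc[OF V] by (intro expect_cong) (simp add: h0)
    also have "\<dots> = F y" using fin_subgroupD[OF V] by (subst expect_const) (auto simp: b(1)[OF y])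
    finally show "F y = expect (vpow (Suc t) V) (\<lambda>h. 1 * (\<Prod>l<Suc t. ?b l h y))" ..
  next
    fix l h y assume "l < Suc t" "h \<in> vpow (Suc t) V" "y \<in> V"
    then show "cmod (?b l h y) \<le> 1" using b(2) hV by auto
  next
    fix l h y and x :: 'a assume "l < Suc t"
    have "(h - unitv l x)(t := 0) = h(t := 0) - unitv l x" if "l < t"
      using that by (auto simp: fun_eq_iff unitv_def)
    then show "?b l (h - unitv l x) (y + x) = ?b l h y" using b(3) by simp
  qed
qed

section \<open>Multilinear averages of positive definite functions\<close>

lemma sum_vpow: "(\<Sum>x\<in>vpow k Q. \<Prod>i<k. f i (x i)) = (\<Prod>i<k. \<Sum>y\<in>Q. (f i y :: 'c::comm_semiring_1))" if "finite Q"
proof -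
  have "(\<Sum>x\<in>vpow k Q. \<Prod>i<k. f i (x i)) = (\<Sum>g\<in>{..<k} \<rightarrow>\<^sub>E Q. \<Prod>i<k. f i (if i < k then g i else 0))"
    by (rule sum.reindex_bij_betw[OF vpow_bij, symmetric])
  also have "\<dots> = (\<Sum>g\<in>{..<k} \<rightarrow>\<^sub>E Q. \<Prod>i<k. f i (g i))" by (intro sum.cong prod.cong) auto
  also have "\<dots> = (\<Prod>i<k. \<Sum>y\<in>Q. f i y)" using that by (intro prod_sum_PiE[symmetric]) auto
  finally show ?thesis .
qed

lemma mean_vpow_Suc:
  "fin_subgroup V \<Longrightarrow> mean (vpow (Suc t) V) f = mean (vpow t V) (\<lambda>h. mean V (\<lambda>x. f (h(t := x))))"
  using expect_vpow_Suc[of V t "\<lambda>h. of_real (f h)"] by (simp add: expect_of_real)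

lemma mean_vpow_upd:
  "fin_subgroup V \<Longrightarrow> j < t \<Longrightarrow> mean (vpow t V) f = mean (vpow t V) (\<lambda>h. mean V (\<lambda>x. f (h(j := x))))"
  using expect_vpow_upd[of V j t "\<lambda>h. of_real (f h)"] by (simp add: expect_of_real)

lemma mean_swap: "mean A (\<lambda>x. mean B (f x)) = mean B (\<lambda>y. mean A (\<lambda>x. f x y))"
proof -
  have "complex_of_real (mean A (\<lambda>x. mean B (f x))) = complex_of_real (mean B (\<lambda>y. mean A (\<lambda>x. f x y)))"
    unfolding expect_of_real[symmetric] by (rule expect_swap)
  then show ?thesis by simp
qed

lemma mean_divide: "mean A (\<lambda>x. f x / c) = mean A f / c"
  by (simp add: mean_def sum_divide_distrib mult.commute)

text \<open>\<open>Q\<close> is the character group of \<open>V\<close>, written additively so that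
  sumset estimates apply to sets of pairs of a point and a frequency.\<close>

locale dual_pair =
  fixes V :: "'a::ab_group_add set" and Q :: "'b::ab_group_add set" and pair :: "'a \<Rightarrow> 'b \<Rightarrow> complex"
  assumes V: "fin_subgroup V" and Q: "fin_subgroup Q"
    and pair_add_left: "x \<in> V \<Longrightarrow> y \<in> V \<Longrightarrow> \<alpha> \<in> Q \<Longrightarrow> pair (x + y) \<alpha> = pair x \<alpha> * pair y \<alpha>"
    and pair_add_right: "x \<in> V \<Longrightarrow> \<alpha> \<in> Q \<Longrightarrow> \<beta> \<in> Q \<Longrightarrow> pair x (\<alpha> + \<beta>) = pair x \<alpha> * pair x \<beta>"
    and pair_unit: "x \<in> V \<Longrightarrow> \<alpha> \<in> Q \<Longrightarrow> cmod (pair x \<alpha>) = 1"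
    and orth_left: "\<alpha> \<in> Q \<Longrightarrow> expect V (\<lambda>x. pair x \<alpha>) = of_bool (\<alpha> = 0)"
    and orth_right: "x \<in> V \<Longrightarrow> (\<Sum>\<alpha>\<in>Q. pair x \<alpha>) = of_nat (card V) * of_bool (x = 0)"
begin

lemma pair_nonzero: "x \<in> V \<Longrightarrow> \<alpha> \<in> Q \<Longrightarrow> pair x \<alpha> \<noteq> 0"
  using pair_unit by force

lemma pair_0_left: "\<alpha> \<in> Q \<Longrightarrow> pair 0 \<alpha> = 1"
  using pair_add_left[of 0 0 \<alpha>] pair_nonzero[of 0 \<alpha>] fin_subgroupD(2)[OF V] by simp

lemma pair_0_right: "x \<in> V \<Longrightarrow> pair x 0 = 1"
  using pair_add_right[of x 0 0] pair_nonzero[of x 0] fin_subgroupD(2)[OF Q] by simp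

lemma pair_uminus_left: "x \<in> V \<Longrightarrow> \<alpha> \<in> Q \<Longrightarrow> pair (- x) \<alpha> = cnj (pair x \<alpha>)"
proof -
  assume x: "x \<in> V" and \<alpha>: "\<alpha> \<in> Q"
  have "pair x \<alpha> * pair (- x) \<alpha> = 1"
    using pair_add_left[of x "- x" \<alpha>] x \<alpha> fin_subgroupD(5)[OF V x] pair_0_left by simp
  moreover have "pair x \<alpha> * cnj (pair x \<alpha>) = 1" using pair_unit[OF x \<alpha>] by (simp add: mult_cnj_eq)
  ultimately show ?thesis using pair_nonzero[OF x \<alpha>] by (metis mult_cancel_left)
qed

lemma pair_uminus_right: "x \<in> V \<Longrightarrow> \<alpha> \<in> Q \<Longrightarrow> pair x (- \<alpha>) = cnj (pair x \<alpha>)"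
proof -
  assume x: "x \<in> V" and \<alpha>: "\<alpha> \<in> Q"
  have "pair x \<alpha> * pair x (- \<alpha>) = 1"
    using pair_add_right[of x \<alpha> "- \<alpha>"] x \<alpha> fin_subgroupD(5)[OF Q \<alpha>] pair_0_right by simp
  moreover have "pair x \<alpha> * cnj (pair x \<alpha>) = 1" using pair_unit[OF x \<alpha>] by (simp add: mult_cnj_eq)
  ultimately show ?thesis using pair_nonzero[OF x \<alpha>] by (metis mult_cancel_left)
qed

lemma pair_diff_left: "x \<in> V \<Longrightarrow> y \<in> V \<Longrightarrow> \<alpha> \<in> Q \<Longrightarrow> pair (x - y) \<alpha> = pair x \<alpha> * cnj (pair y \<alpha>)"
  using pair_add_left[of x "- y" \<alpha>] pair_uminus_left fin_subgroupD(5)[OF V] by simp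

lemma pair_diff_right: "x \<in> V \<Longrightarrow> \<alpha> \<in> Q \<Longrightarrow> \<beta> \<in> Q \<Longrightarrow> pair x (\<alpha> - \<beta>) = pair x \<alpha> * cnj (pair x \<beta>)"
  using pair_add_right[of x \<alpha> "- \<beta>"] pair_uminus_right fin_subgroupD(5)[OF Q] by simp

lemma pair_sum_left: "finite I \<Longrightarrow> (\<And>i. i \<in> I \<Longrightarrow> f i \<in> V) \<Longrightarrow> \<alpha> \<in> Q \<Longrightarrow> pair (\<Sum>i\<in>I. f i) \<alpha> = (\<Prod>i\<in>I. pair (f i) \<alpha>)"
  by (induction I rule: finite_induct) (auto simp: pair_0_left pair_add_left fin_subgroup_sum[OF V])

lemma pair_sum_right: "finite I \<Longrightarrow> (\<And>i. i \<in> I \<Longrightarrow> f i \<in> Q) \<Longrightarrow> x \<in> V \<Longrightarrow> pair x (\<Sum>i\<in>I. f i) = (\<Prod>i\<in>I. pair x (f i))"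
  by (induction I rule: finite_induct) (auto simp: pair_0_right pair_add_right fin_subgroup_sum[OF Q])

lemma pair_zmul: "x \<in> V \<Longrightarrow> \<alpha> \<in> Q \<Longrightarrow> pair (zmul c x) \<alpha> = pair x (zmul c \<alpha>)"
  unfolding zmul_def by (simp add: pair_diff_left pair_diff_right pair_sum_left pair_sum_right fin_subgroup_sum V Q)

definition fc where "fc f \<alpha> = expect V (\<lambda>z. f z * cnj (pair z \<alpha>))"

lemma fourier_inversion:
  assumes z: "z \<in> V"
  shows "f z = (\<Sum>\<alpha>\<in>Q. fc f \<alpha> * pair z \<alpha>)"
proof -
  have "(\<Sum>\<alpha>\<in>Q. fc f \<alpha> * pair z \<alpha>) = (\<Sum>\<alpha>\<in>Q. \<Sum>x\<in>V. f x * (pair z \<alpha> * cnj (pair x \<alpha>))) / of_nat (card V)"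
    unfolding fc_def expect_def by (simp add: sum_divide_distrib sum_distrib_left sum_distrib_right mult_ac)
  also have "\<dots> = (\<Sum>x\<in>V. f x * (\<Sum>\<alpha>\<in>Q. pair (z - x) \<alpha>)) / of_nat (card V)"
    by (subst sum.swap) (simp add: sum_distrib_left pair_diff_left z)
  also have "\<dots> = (\<Sum>x\<in>V. if x = z then f x * of_nat (card V) else 0) / of_nat (card V)"
    using z fin_subgroupD(3)[OF V] by (intro arg_cong2[where f = "(/)"] sum.cong) (auto simp: orth_right)
  also have "\<dots> = f z" using z fin_subgroupD[OF V] by (auto simp: sum.delta)
  finally show ?thesis ..
qed

text \<open>Up to normalization the coefficient is the quadratic form of the kernel, evaluated at
  the conjugate of the character \<open>\<alpha>\<close>.\<close>

lemma fc_nonneg: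
  assumes psd: "psd_on V (\<lambda>x y. f (x - y))" and \<alpha>: "\<alpha> \<in> Q"
  shows "\<exists>r\<ge>0. fc f \<alpha> = complex_of_real r"
proof -
  have fV: "finite V" "V \<noteq> {}" using fin_subgroupD[OF V] by auto
  obtain r where r: "r \<ge> 0" "(\<Sum>x\<in>V. \<Sum>y\<in>V. cnj (pair x \<alpha>) * cnj (cnj (pair y \<alpha>)) * f (x - y)) = complex_of_real r"
    using psd_on_quadratic_form[OF psd fV(1) order_refl, of "\<lambda>x. cnj (pair x \<alpha>)"] by blast
  have "fc f \<alpha> = expect V (\<lambda>y. fc f \<alpha>)" by (rule expect_const[OF fV, symmetric])
  also have "\<dots> = expect V (\<lambda>y. expect V (\<lambda>x. f (x - y) * cnj (pair (x - y) \<alpha>)))"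
  proof (rule expect_cong)
    fix y assume y: "y \<in> V"
    show "fc f \<alpha> = expect V (\<lambda>x. f (x - y) * cnj (pair (x - y) \<alpha>))"
      using expect_translate[OF V fin_subgroupD(5)[OF V y], of "\<lambda>x. f x * cnj (pair x \<alpha>)"] by (simp add: fc_def)
  qed
  also have "\<dots> = expect V (\<lambda>x. expect V (\<lambda>y. f (x - y) * cnj (pair (x - y) \<alpha>)))" by (rule expect_swap)
  also have "\<dots> = expect V (\<lambda>x. expect V (\<lambda>y. cnj (pair x \<alpha>) * cnj (cnj (pair y \<alpha>)) * f (x - y)))"
    by (intro expect_cong) (simp add: pair_diff_left \<alpha>)
  also have "\<dots> = complex_of_real (r / (real (card V) * real (card V)))"
    unfolding expect_def sum_divide_distrib[symmetric] r(2) by simp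
  finally show ?thesis using r(1) by (intro exI[of _ "r / (real (card V) * real (card V))"]) auto
qed

text \<open>A tuple of frequencies survives the average over \<open>y\<close> if and only if the
  combined character is trivial in every variable \<open>y j\<close>.\<close>

lemma expect_prod_lform:
  "expect (vpow d V) (\<lambda>y. \<Prod>i<k. f i (lform (a i) d y))
    = (\<Sum>\<alpha>\<in>{\<alpha> \<in> vpow k Q. \<forall>j<d. (\<Sum>i<k. zmul (a i j) (\<alpha> i)) = 0}. \<Prod>i<k. fc (f i) (\<alpha> i))"
proof -
  have fQ: "finite Q" using fin_subgroupD[OF Q] by simp
  have "expect (vpow d V) (\<lambda>y. \<Prod>i<k. f i (lform (a i) d y))
      = expect (vpow d V) (\<lambda>y. \<Sum>\<alpha>\<in>vpow k Q. (\<Prod>i<k. fc (f i) (\<alpha> i)) * (\<Prod>i<k. pair (lform (a i) d y) (\<alpha> i)))"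
  proof (rule expect_cong)
    fix y assume y: "y \<in> vpow d V"
    have "(\<Prod>i<k. f i (lform (a i) d y)) = (\<Prod>i<k. \<Sum>\<alpha>\<in>Q. fc (f i) \<alpha> * pair (lform (a i) d y) \<alpha>)"
      by (intro prod.cong refl fourier_inversion lform_in[OF V y])
    also have "\<dots> = (\<Sum>\<alpha>\<in>vpow k Q. \<Prod>i<k. fc (f i) (\<alpha> i) * pair (lform (a i) d y) (\<alpha> i))"
      by (rule sum_vpow[OF fQ, symmetric])
    finally show "(\<Prod>i<k. f i (lform (a i) d y)) = (\<Sum>\<alpha>\<in>vpow k Q. (\<Prod>i<k. fc (f i) (\<alpha> i)) * (\<Prod>i<k. pair (lform (a i) d y) (\<alpha> i)))"
      by (simp add: prod.distrib)
  qed
  also have "\<dots> = (\<Sum>\<alpha>\<in>vpow k Q. (\<Prod>i<k. fc (f i) (\<alpha> i)) * expect (vpow d V) (\<lambda>y. \<Prod>i<k. pair (lform (a i) d y) (\<alpha> i)))"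
    unfolding expect_def by (subst sum.swap) (simp add: sum_divide_distrib sum_distrib_left)
  also have "\<dots> = (\<Sum>\<alpha>\<in>vpow k Q. (\<Prod>i<k. fc (f i) (\<alpha> i)) * of_bool (\<forall>j<d. (\<Sum>i<k. zmul (a i j) (\<alpha> i)) = 0))"
  proof (intro sum.cong refl arg_cong2[where f = times])
    fix \<alpha> assume al: "\<alpha> \<in> vpow k Q"
    have alQ: "\<alpha> i \<in> Q" for i by (rule vpow_nth[OF Q al])
    have sQ: "(\<Sum>i<k. zmul (a i j) (\<alpha> i)) \<in> Q" for j by (intro fin_subgroup_sum[OF Q] fin_subgroup_zmul[OF Q] alQ)
    have "expect (vpow d V) (\<lambda>y. \<Prod>i<k. pair (lform (a i) d y) (\<alpha> i))
        = expect (vpow d V) (\<lambda>y. \<Prod>j<d. pair (y j) (\<Sum>i<k. zmul (a i j) (\<alpha> i)))"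
    proof (rule expect_cong)
      fix y assume y: "y \<in> vpow d V"
      have yV: "y j \<in> V" for j by (rule vpow_nth[OF V y])
      have "(\<Prod>i<k. pair (lform (a i) d y) (\<alpha> i)) = (\<Prod>i<k. \<Prod>j<d. pair (y j) (zmul (a i j) (\<alpha> i)))"
        unfolding lform_def by (intro prod.cong refl) (simp add: pair_sum_left fin_subgroup_zmul[OF V] yV alQ pair_zmul)
      also have "\<dots> = (\<Prod>j<d. \<Prod>i<k. pair (y j) (zmul (a i j) (\<alpha> i)))" by (rule prod.swap)
      also have "\<dots> = (\<Prod>j<d. pair (y j) (\<Sum>i<k. zmul (a i j) (\<alpha> i)))"
        by (intro prod.cong refl) (simp add: pair_sum_right fin_subgroup_zmul[OF Q] yV alQ)
      finally show "(\<Prod>i<k. pair (lform (a i) d y) (\<alpha> i)) = (\<Prod>j<d. pair (y j) (\<Sum>i<k. zmul (a i j) (\<alpha> i)))" .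
    qed
    also have "\<dots> = (\<Prod>j<d. expect V (\<lambda>x. pair x (\<Sum>i<k. zmul (a i j) (\<alpha> i))))"
      by (rule expect_vpow_prod[OF V, where f = "\<lambda>j x. pair x (\<Sum>i<k. zmul (a i j) (\<alpha> i))"])
    also have "\<dots> = (\<Prod>j<d. of_bool ((\<Sum>i<k. zmul (a i j) (\<alpha> i)) = 0))"
      by (intro prod.cong refl orth_left sQ)
    also have "\<dots> = of_bool (\<forall>j<d. (\<Sum>i<k. zmul (a i j) (\<alpha> i)) = 0)"
      by (induction d) (auto simp: less_Suc_eq)
    finally show "expect (vpow d V) (\<lambda>y. \<Prod>i<k. pair (lform (a i) d y) (\<alpha> i)) = of_bool (\<forall>j<d. (\<Sum>i<k. zmul (a i j) (\<alpha> i)) = 0)" .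
  qed
  also have "\<dots> = (\<Sum>\<alpha>\<in>{\<alpha> \<in> vpow k Q. \<forall>j<d. (\<Sum>i<k. zmul (a i j) (\<alpha> i)) = 0}. \<Prod>i<k. fc (f i) (\<alpha> i))"
    using finite_vpow[OF fQ] by (intro sum.mono_neutral_cong_right) auto
  finally show ?thesis .
qed

end

text \<open>The columns \<open>J\<close> are few but detect all relations between the forms; with all \<open>d\<close> columns the
  bounds would depend on \<open>d\<close>. In \<open>Rel r\<close>, the relations between the tensor powers of order \<open>r + 1\<close>, only
  the last factor is tested on all columns.\<close>

locale form_system = dual_pair +
  fixes k d B :: nat and a :: "nat \<Rightarrow> nat \<Rightarrow> int" and J :: "nat set"
  assumes k: "k > 0"
    and a_bound: "i < k \<Longrightarrow> j \<in> J \<Longrightarrow> \<bar>a i j\<bar> < 2 ^ B"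
    and J: "J \<subseteq> {..<d}" "card J \<le> k"
    and J_faithful: "i < k \<Longrightarrow> \<alpha> \<in> Q \<Longrightarrow> (\<And>j. j \<in> J \<Longrightarrow> zmul (a i j) \<alpha> = 0) \<Longrightarrow> \<alpha> = 0"
    and separating_section: "i < k \<Longrightarrow> i' < k \<Longrightarrow> \<exists>\<sigma>.
      (\<forall>v\<in>V. \<sigma> v \<in> vpow d V \<and> lform (a i) d (\<sigma> v) = v \<and> (i' \<noteq> i \<longrightarrow> lform (a i') d (\<sigma> v) = 0)) \<and>
      (\<forall>v\<in>V. \<forall>v'\<in>V. \<sigma> (v - v') = \<sigma> v - \<sigma> v')"
begin

primrec Rel where
  "Rel 0 = {\<alpha> \<in> vpow k Q. \<forall>j<d. (\<Sum>i<k. zmul (a i j) (\<alpha> i)) = 0}"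
| "Rel (Suc r) = {\<beta> \<in> vpow k Q. \<forall>j\<in>J. (\<lambda>i. zmul (a i j) (\<beta> i)) \<in> Rel r}"

lemma section_ex: "i < k \<Longrightarrow> \<exists>\<sigma>. \<forall>v\<in>V. \<sigma> v \<in> vpow d V \<and> lform (a i) d (\<sigma> v) = v"
  using separating_section[of i i] by blast

lemma Rel_sub: "Rel r \<subseteq> vpow k Q"
  by (cases r) auto

lemma Rel_subgroup: "fin_subgroup (Rel r)"
proof (induction r)
  case 0
  have "finite (Rel 0)" using finite_subset[OF Rel_sub[of 0] finite_vpow[OF fin_subgroupD(1)[OF Q]]] .
  then show ?case using fin_subgroup_vpow[OF Q, of k]
    by (auto simp: fin_subgroup_def zmul_diff_right sum_subtractf)
next
  case (Suc r)
  have "finite (Rel (Suc r))" using finite_subset[OF Rel_sub[of "Suc r"] finite_vpow[OF fin_subgroupD(1)[OF Q]]] .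
  moreover have "(\<lambda>i. 0) \<in> Rel r" using fin_subgroupD(2)[OF Suc] by (simp add: zero_fun_def)
  moreover have "(\<lambda>i. zmul (a i j) (x i - y i)) \<in> Rel r"
    if "(\<lambda>i. zmul (a i j) (x i)) \<in> Rel r" "(\<lambda>i. zmul (a i j) (y i)) \<in> Rel r" for x y j
    using fin_subgroupD(3)[OF Suc that] by (simp add: zmul_diff_right fun_diff_def)
  ultimately show ?case using fin_subgroup_vpow[OF Q, of k]
    by (auto simp: fin_subgroup_def)
qed

text \<open>The conversion demands this of its set of relations. If only the \<open>i\<close>-th
  coordinate is left, all its multiples by \<open>a i j\<close> with \<open>j \<in> J\<close>
  vanish, and \<open>J_faithful\<close> applies.\<close>

lemma Rel_no_singleton:
  "\<alpha> \<in> Rel r \<Longrightarrow> i < k \<Longrightarrow> (\<forall>i'<k. i' \<noteq> i \<longrightarrow> \<alpha> i' = 0) \<Longrightarrow> \<alpha> = 0"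
proof (induction r arbitrary: \<alpha>)
  case 0
  have "zmul (a i j) (\<alpha> i) = 0" if j: "j \<in> J" for j
  proof -
    have "(\<Sum>i'<k. zmul (a i' j) (\<alpha> i')) = (\<Sum>i'<k. if i' = i then zmul (a i j) (\<alpha> i) else 0)"
      using 0 by (intro sum.cong) auto
    then show ?thesis using 0 j J(1) by auto
  qed
  moreover have "\<alpha> i \<in> Q" using 0 vpow_nth[OF Q] by auto
  ultimately have "\<alpha> i = 0" using J_faithful[OF \<open>i < k\<close>] by blast
  then show ?case using 0 by (auto simp: vpow_def fun_eq_iff) (metis not_less)
next
  case (Suc r)
  have "zmul (a i j) (\<alpha> i) = 0" if j: "j \<in> J" for j
  proof -
    have "(\<lambda>i. zmul (a i j) (\<alpha> i)) = 0" using Suc.prems j by (intro Suc.IH) auto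
    then show ?thesis by (metis zero_fun_apply)
  qed
  moreover have "\<alpha> i \<in> Q" using Suc.prems vpow_nth[OF Q] by auto
  ultimately have "\<alpha> i = 0" using J_faithful[OF \<open>i < k\<close>] by blast
  then show ?case using Suc.prems by (auto simp: vpow_def fun_eq_iff) (metis not_less)
qed

end

section \<open>Conversion of all variables but the last\<close>

locale multilinear_system = form_system +
  fixes t :: nat and A :: "nat \<Rightarrow> (nat \<Rightarrow> 'a) \<Rightarrow> complex"
  assumes t: "t > 0"
    and A_bound: "i < k \<Longrightarrow> y \<in> vpow t V \<Longrightarrow> cmod (A i y) \<le> 1"
    and A_psd: "i < k \<Longrightarrow> l < t \<Longrightarrow> y \<in> vpow t V \<Longrightarrow> psd_on V (\<lambda>x x'. A i (y(l := x - x')))"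
begin

definition wt where "wt i X \<alpha> = Re (fc (\<lambda>z. A i (X(t - 1 := z))) \<alpha>)"
text \<open>The variables below \<open>r\<close> are already converted and have the same value
  \<open>h l\<close> for all forms; the others still depend on the form. \<open>S 0\<close> is the
  given average, and in \<open>S (t - 1)\<close> the forms have disappeared from the arguments of
  the weights.\<close>

definition mixed where "mixed r h Y i l = (if l < r then h l else lform (a i) d (Y l))"
definition S where
  "S r = mean (vpow r V) (\<lambda>h. mean (vpow (t - 1) (vpow d V)) (\<lambda>Y. \<Sum>\<alpha>\<in>Rel r. \<Prod>i<k. wt i (mixed r h Y i) (\<alpha> i)))"

lemma upd_in: "X \<in> vpow (t - 1) V \<Longrightarrow> z \<in> V \<Longrightarrow> X(t - 1 := z) \<in> vpow t V"
  using t by (auto simp: vpow_def)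

lemma mixed_in: "r \<le> t - 1 \<Longrightarrow> h \<in> vpow r V \<Longrightarrow> Y \<in> vpow (t - 1) (vpow d V) \<Longrightarrow> mixed r h Y i \<in> vpow (t - 1) V"
  unfolding vpow_def[of "t - 1" V] mixed_def
  using lform_in[OF V] vpowD(1)[of h r V] vpowD[of Y "t - 1" "vpow d V"]
  by (auto simp: lform_0[unfolded zero_fun_def] zero_fun_def)

lemma fc_wt:
  assumes i: "i < k" and X: "X \<in> vpow (t - 1) V" and \<alpha>: "\<alpha> \<in> Q"
  shows "fc (\<lambda>z. A i (X(t - 1 := z))) \<alpha> = complex_of_real (wt i X \<alpha>)" "0 \<le> wt i X \<alpha>"
proof -
  have "X(t - 1 := 0) \<in> vpow t V" using upd_in[OF X] fin_subgroupD(2)[OF V] by simp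
  then have "psd_on V (\<lambda>x x'. A i ((X(t - 1 := 0))(t - 1 := x - x')))" using t by (intro A_psd i) auto
  then have "psd_on V (\<lambda>x x'. A i (X(t - 1 := x - x')))" by simp
  then obtain r where "r \<ge> 0" "fc (\<lambda>z. A i (X(t - 1 := z))) \<alpha> = complex_of_real r"
    using fc_nonneg[of "\<lambda>z. A i (X(t - 1 := z))", OF _ \<alpha>] by blast
  then show "fc (\<lambda>z. A i (X(t - 1 := z))) \<alpha> = complex_of_real (wt i X \<alpha>)" "0 \<le> wt i X \<alpha>"
    by (simp_all add: wt_def)
qed

lemma wt_sum_le1:
  assumes i: "i < k" and X: "X \<in> vpow (t - 1) V"
  shows "(\<Sum>\<alpha>\<in>Q. wt i X \<alpha>) \<le> 1"
proof -
  have "complex_of_real (\<Sum>\<alpha>\<in>Q. wt i X \<alpha>) = (\<Sum>\<alpha>\<in>Q. fc (\<lambda>z. A i (X(t - 1 := z))) \<alpha> * pair 0 \<alpha>)"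
    using fc_wt[OF i X] by (simp add: pair_0_left)
  also have "\<dots> = A i (X(t - 1 := 0))" by (rule fourier_inversion[symmetric]) (rule fin_subgroupD(2)[OF V])
  finally have "(\<Sum>\<alpha>\<in>Q. wt i X \<alpha>) = Re (A i (X(t - 1 := 0)))" by (metis Re_complex_of_real)
  also have "\<dots> \<le> cmod (A i (X(t - 1 := 0)))" by (rule complex_Re_le_cmod)
  also have "\<dots> \<le> 1" using fin_subgroupD(2)[OF V] by (intro A_bound i upd_in X)
  finally show ?thesis .
qed

text \<open>The conversion is applied to the variable \<open>r\<close> with all others fixed.
  Jensen's inequality carries the power through the averages over these.\<close>

lemma S_step:
  assumes r: "Suc r \<le> t - 1"
  shows "(S r / (8 * real k)) ^ (1300 * k ^ 3 * (B + 1)) \<le> S (Suc r)"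
proof -
  let ?C = "1300 * k ^ 3 * (B + 1)"
  let ?W = "vpow d V" and ?YY = "vpow (t - 1) (vpow d V)"
  have W: "fin_subgroup ?W" by (rule fin_subgroup_vpow[OF V])
  have fYY: "finite ?YY" "?YY \<noteq> {}" using fin_subgroupD[OF fin_subgroup_vpow[OF W, of "t - 1"]] by auto
  have fr: "finite (vpow r V)" "vpow r V \<noteq> {}" using fin_subgroupD[OF fin_subgroup_vpow[OF V, of r]] by auto
  define e where "e h Y = mean ?W (\<lambda>y. \<Sum>\<alpha>\<in>Rel r. \<Prod>i<k. wt i ((mixed r h Y i)(r := lform (a i) d y)) (\<alpha> i))" for h Y
  have main: "0 \<le> e h Y" "(e h Y / (8 * real k)) ^ ?C
      \<le> mean V (\<lambda>x. \<Sum>\<beta>\<in>Rel (Suc r). \<Prod>i<k. wt i ((mixed r h Y i)(r := x)) (\<beta> i))"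
    if h: "h \<in> vpow r V" and Y: "Y \<in> ?YY" for h Y
  proof -
    define X where "X i = mixed r h Y i" for i
    have X: "X i \<in> vpow (t - 1) V" for i unfolding X_def using r by (intro mixed_in h Y) auto
    have Xr: "(X i)(r := x) \<in> vpow (t - 1) V" if "x \<in> V" for i x using X[of i] that r by (auto simp: vpow_def)
    define w where "w i g = wt i ((X i)(r := fst g)) (snd g)" for i and g :: "'a \<times> 'b"
    interpret bc: bilinear_conversion V Q w k d B a J "Rel r"
    proof unfold_locales
      show "0 \<le> w i g" if "i < k" "g \<in> V \<times> Q" for i g
        unfolding w_def using that by (intro fc_wt(2) Xr) auto
      show "(\<Sum>\<alpha>\<in>Q. w i (x, \<alpha>)) \<le> 1" if "i < k" "x \<in> V" for i x
        unfolding w_def using that wt_sum_le1[OF _ Xr] by simp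
      \<comment> \<open>Before the average over \<open>z\<close> is taken, the coefficient is a
        kernel in the \<open>r\<close>-th variable, positive semidefinite by \<open>A_psd\<close>,
        times a character at a difference of frequencies, which has rank one.\<close>
      show "psd_on (V \<times> Q) (\<lambda>g h. complex_of_real (w i (g - h)))" if i: "i < k" for i
      proof -
        let ?K = "\<lambda>z g h. A i (((X i)(t - 1 := z))(r := fst g - fst h)) * (cnj (pair z (snd g)) * cnj (cnj (pair z (snd h))))"
        have "psd_on (V \<times> Q) (?K z)" if z: "z \<in> V" for z
        proof -
          have "psd_on V (\<lambda>x x'. A i (((X i)(t - 1 := z))(r := x - x')))"
            using r by (intro A_psd i upd_in X z) auto
          from psd_on_reindex[OF this, of fst "V \<times> Q"]
          have 1: "psd_on (V \<times> Q) (\<lambda>g h. A i (((X i)(t - 1 := z))(r := fst g - fst h)))" by auto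
          have 2: "psd_on (V \<times> Q) (\<lambda>g h. cnj (pair z (snd g)) * cnj (cnj (pair z (snd h))))"
            by (rule psd_on_rank1) (rule refl)
          show ?thesis by (rule psd_on_mult[OF 1 2])
        qed
        then have "psd_on (V \<times> Q) (\<lambda>g h. (\<Sum>z\<in>V. ?K z g h) / complex_of_real (real (card V)))"
          using fin_subgroupD(1)[OF V] by (intro psd_on_divide psd_on_sum) auto
        then show ?thesis
        proof (rule psd_on_cong)
          fix g h assume gh: "g \<in> V \<times> Q" "h \<in> V \<times> Q"
          then have in1: "fst g - fst h \<in> V" "snd g - snd h \<in> Q" using fin_subgroupD(3)[OF V] fin_subgroupD(3)[OF Q] by auto
          have "complex_of_real (w i (g - h)) = fc (\<lambda>z. A i ((X i)(r := fst g - fst h, t - 1 := z))) (snd g - snd h)"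
            unfolding w_def using fc_wt(1)[OF i Xr[OF in1(1)] in1(2)] by simp
          also have "\<dots> = (\<Sum>z\<in>V. ?K z g h) / complex_of_real (real (card V))"
          proof -
            have tw: "(X i)(t - 1 := z, r := u) = (X i)(r := u, t - 1 := z)" for z u
              using r by (intro fun_upd_twist) auto
            show ?thesis unfolding fc_def expect_def tw using gh
              by (intro arg_cong2[where f = "(/)"] sum.cong) (auto simp: pair_diff_right)
          qed
          finally show "complex_of_real (w i (g - h)) = (\<Sum>z\<in>V. ?K z g h) / complex_of_real (real (card V))" .
        qed
      qed
    qed (use V Q k a_bound J section_ex Rel_sub Rel_subgroup Rel_no_singleton in auto)
    have "bc.\<eta> = e h Y"
      unfolding bc.\<eta>_def e_def mean_def bc.W_def bc.M_def w_def X_def by simp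
    moreover have "bc.R' = Rel (Suc r)" by (simp add: bc.R'_def)
    ultimately show "0 \<le> e h Y" "(e h Y / (8 * real k)) ^ ?C
      \<le> mean V (\<lambda>x. \<Sum>\<beta>\<in>Rel (Suc r). \<Prod>i<k. wt i ((mixed r h Y i)(r := x)) (\<beta> i))"
      using bc.\<eta>_nonneg bc.bilinear_conversion by (simp_all add: w_def X_def mean_def)
  qed
  have "S r = mean (vpow r V) (\<lambda>h. mean ?YY (\<lambda>Y. e h Y))"
    unfolding S_def
  proof (rule mean_cong)
    fix h assume "h \<in> vpow r V"
    have "mixed r h (Y(r := y)) i = (mixed r h Y i)(r := lform (a i) d y)" for Y y i
      by (auto simp: mixed_def fun_eq_iff)
    then show "mean ?YY (\<lambda>Y. \<Sum>\<alpha>\<in>Rel r. \<Prod>i<k. wt i (mixed r h Y i) (\<alpha> i)) = mean ?YY (\<lambda>Y. e h Y)"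
      unfolding e_def using r by (subst mean_vpow_upd[OF W, of r]) auto
  qed
  then have "(S r / (8 * real k)) ^ ?C = mean (vpow r V) (\<lambda>h. mean ?YY (\<lambda>Y. e h Y / (8 * real k))) ^ ?C"
    by (simp add: mean_divide)
  also have "\<dots> \<le> mean (vpow r V) (\<lambda>h. mean ?YY (\<lambda>Y. e h Y / (8 * real k)) ^ ?C)"
    using fr main(1) by (intro power_mean mean_nonneg) auto
  also have "\<dots> \<le> mean (vpow r V) (\<lambda>h. mean ?YY (\<lambda>Y. (e h Y / (8 * real k)) ^ ?C))"
    using fYY main(1) by (intro mean_mono power_mean) auto
  also have "\<dots> \<le> mean (vpow r V) (\<lambda>h. mean ?YY (\<lambda>Y. mean V (\<lambda>x. \<Sum>\<beta>\<in>Rel (Suc r). \<Prod>i<k. wt i ((mixed r h Y i)(r := x)) (\<beta> i))))"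
    by (intro mean_mono main(2))
  also have "\<dots> = mean (vpow r V) (\<lambda>h. mean V (\<lambda>x. mean ?YY (\<lambda>Y. \<Sum>\<beta>\<in>Rel (Suc r). \<Prod>i<k. wt i ((mixed r h Y i)(r := x)) (\<beta> i))))"
    by (simp only: mean_swap[of ?YY V])
  also have "\<dots> = S (Suc r)"
  proof -
    have eq: "(mixed r h Y i)(r := x) = mixed (Suc r) (h(r := x)) Y i" for h Y i x
      by (auto simp: mixed_def fun_eq_iff)
    show ?thesis unfolding S_def mean_vpow_Suc[OF V] eq ..
  qed
  finally show ?thesis .
qed

lemma S_0: "expect (vpow t (vpow d V)) (\<lambda>Y. \<Prod>i<k. A i (\<lambda>l. lform (a i) d (Y l))) = complex_of_real (S 0)"
proof -
  have W: "fin_subgroup (vpow d V)" by (rule fin_subgroup_vpow[OF V])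
  have ts: "t = Suc (t - 1)" using t by simp
  have "expect (vpow t (vpow d V)) (\<lambda>Y. \<Prod>i<k. A i (\<lambda>l. lform (a i) d (Y l)))
      = expect (vpow (t - 1) (vpow d V)) (\<lambda>Y. expect (vpow d V) (\<lambda>y. \<Prod>i<k. A i ((mixed 0 0 Y i)(t - 1 := lform (a i) d y))))"
  proof -
    have eq: "(mixed 0 0 Y i)(t - 1 := lform (a i) d y) = (\<lambda>l. lform (a i) d ((Y(t - 1 := y)) l))" for i Y y
      by (auto simp: mixed_def fun_eq_iff)
    show ?thesis unfolding eq
      using expect_vpow_Suc[OF W, of "t - 1" "\<lambda>Y. \<Prod>i<k. A i (\<lambda>l. lform (a i) d (Y l))"]
      unfolding ts[symmetric] .
  qed
  also have "\<dots> = expect (vpow (t - 1) (vpow d V)) (\<lambda>Y. complex_of_real (\<Sum>\<alpha>\<in>Rel 0. \<Prod>i<k. wt i (mixed 0 0 Y i) (\<alpha> i)))"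
  proof (rule expect_cong)
    fix Y assume Y: "Y \<in> vpow (t - 1) (vpow d V)"
    have X: "mixed 0 0 Y i \<in> vpow (t - 1) V" for i by (rule mixed_in[OF _ _ Y]) (auto simp: vpow_0)
    have "expect (vpow d V) (\<lambda>y. \<Prod>i<k. A i ((mixed 0 0 Y i)(t - 1 := lform (a i) d y)))
      = (\<Sum>\<alpha>\<in>Rel 0. \<Prod>i<k. fc (\<lambda>z. A i ((mixed 0 0 Y i)(t - 1 := z))) (\<alpha> i))"
      unfolding Rel.simps by (rule expect_prod_lform)
    also have "\<dots> = (\<Sum>\<alpha>\<in>Rel 0. \<Prod>i<k. complex_of_real (wt i (mixed 0 0 Y i) (\<alpha> i)))"
    proof (intro sum.cong prod.cong refl)
      fix \<alpha> i assume "\<alpha> \<in> Rel 0" "i \<in> {..<k}"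
      then show "fc (\<lambda>z. A i ((mixed 0 0 Y i)(t - 1 := z))) (\<alpha> i) = complex_of_real (wt i (mixed 0 0 Y i) (\<alpha> i))"
        using Rel_sub[of 0] vpow_nth[OF Q] by (intro fc_wt(1) X) blast+
    qed
    finally show "expect (vpow d V) (\<lambda>y. \<Prod>i<k. A i ((mixed 0 0 Y i)(t - 1 := lform (a i) d y)))
      = complex_of_real (\<Sum>\<alpha>\<in>Rel 0. \<Prod>i<k. wt i (mixed 0 0 Y i) (\<alpha> i))" by simp
  qed
  also have "\<dots> = complex_of_real (S 0)"
    unfolding expect_of_real S_def by (simp add: vpow_0 mean_def[of "{0}"])
  finally show ?thesis .
qed

lemma S_nonneg: "r \<le> t - 1 \<Longrightarrow> 0 \<le> S r"
  unfolding S_def using Rel_sub[of r] vpow_nth[OF Q]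
  by (intro mean_nonneg sum_nonneg prod_nonneg fc_wt(2) mixed_in) blast+

text \<open>When the relations are trivial, only the frequency 0 is left. Its weights are at most 1,
  so all but the \<open>j\<close>-th may be dropped, and the mean of that one is the average of
  \<open>A j\<close>.\<close>

theorem multilinear_system:
  assumes trivial: "Rel (t - 1) \<subseteq> {0}" and j: "j < k"
  shows "(cmod (expect (vpow t (vpow d V)) (\<lambda>Y. \<Prod>i<k. A i (\<lambda>l. lform (a i) d (Y l)))) / (8 * real k))
      ^ ((2 * (1300 * k ^ 3 * (B + 1))) ^ (t - 1)) \<le> Re (expect (vpow t V) (A j))"
proof -
  let ?C = "1300 * k ^ 3 * (B + 1)"
  let ?\<eta> = "S 0"
  have W: "fin_subgroup (vpow d V)" by (rule fin_subgroup_vpow[OF V])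
  have \<eta>0: "0 \<le> ?\<eta>" by (rule S_nonneg) simp
  have "cmod (complex_of_real ?\<eta>) \<le> 1"
    unfolding S_0[symmetric]
  proof (rule cmod_expect_le1)
    fix Y assume Y: "Y \<in> vpow t (vpow d V)"
    have "(\<lambda>l. lform (a i) d (Y l)) \<in> vpow t V" for i
      using lform_in[OF V] Y unfolding vpow_def[of t] by (auto simp: lform_0)
    then show "cmod (\<Prod>i<k. A i (\<lambda>l. lform (a i) d (Y l))) \<le> 1"
      unfolding prod_norm[symmetric] by (intro prod_le_1) (auto intro: A_bound)
  qed
  then have \<eta>1: "?\<eta> \<le> 1" using \<eta>0 by simp
  let ?x = "?\<eta> / (8 * real k)"
  have x0: "0 \<le> ?x" using \<eta>0 by simp
  have "?\<eta> \<le> 1 * (8 * real k)" using \<eta>1 k by linarith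
  then have x1: "?x \<le> 1" using k by (subst pos_divide_le_eq) auto
  have "0 < ?C" using k by simp
  then have C1: "1 \<le> ?C" by linarith
  have "r \<le> t - 1 \<Longrightarrow> ?x ^ ((2 * ?C) ^ r) \<le> S r" for r
  proof (induction r)
    case 0
    then show ?case using \<eta>0 k by (simp add: pos_divide_le_eq mult_le_cancel_left1)
  next
    case (Suc r)
    \<comment> \<open>One further power of \<open>?x\<close>, which is at most
      \<open>1 / (8 k)\<close>, pays for the divisor in the next conversion. The factor 2 in the
      base of the exponent makes room for it.\<close>
    have "?x ^ ((2 * ?C) ^ Suc r) \<le> ?x ^ (((2 * ?C) ^ r + 1) * ?C)"
    proof (rule power_decreasing[OF _ x0 x1])
      have "1 \<le> (2 * ?C) ^ r" using C1 by simp
      then have "((2 * ?C) ^ r + 1) * ?C \<le> (2 * (2 * ?C) ^ r) * ?C" by (intro mult_right_mono) auto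
      then show "((2 * ?C) ^ r + 1) * ?C \<le> (2 * ?C) ^ Suc r" by (simp only: power_Suc mult_ac)
    qed
    also have "\<dots> = (?x ^ ((2 * ?C) ^ r) * ?x) ^ ?C" by (simp only: power_mult power_add power_one_right)
    also have "\<dots> \<le> (S r * (1 / (8 * real k))) ^ ?C"
      using Suc x0 \<eta>1 k S_nonneg[of r] by (intro power_mono mult_mono divide_right_mono mult_nonneg_nonneg) auto
    also have "\<dots> \<le> S (Suc r)" using S_step[of r] Suc.prems by simp
    finally show ?case .
  qed
  then have "?x ^ ((2 * ?C) ^ (t - 1)) \<le> S (t - 1)" by simp
  also have "\<dots> \<le> mean (vpow (t - 1) V) (\<lambda>h. wt j h 0)"
    unfolding S_def
  proof (rule mean_mono)
    fix h assume h: "h \<in> vpow (t - 1) V"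
    have Q0: "0 \<in> Q" by (rule fin_subgroupD(2)[OF Q])
    have wt1: "wt i h 0 \<le> 1" if "i < k" for i
    proof -
      have "wt i h 0 \<le> (\<Sum>\<alpha>\<in>Q. wt i h \<alpha>)"
        using that h Q0 fin_subgroupD(1)[OF Q] by (intro member_le_sum fc_wt(2)) auto
      then show ?thesis using wt_sum_le1[OF that h] by linarith
    qed
    have R0: "Rel (t - 1) = {0}" using trivial fin_subgroupD(2)[OF Rel_subgroup] by blast
    have "mean (vpow (t - 1) (vpow d V)) (\<lambda>Y. \<Sum>\<alpha>\<in>Rel (t - 1). \<Prod>i<k. wt i (mixed (t - 1) h Y i) (\<alpha> i))
        = mean (vpow (t - 1) (vpow d V)) (\<lambda>Y. \<Prod>i<k. wt i h 0)"
    proof (rule mean_cong)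
      fix Y assume Y: "Y \<in> vpow (t - 1) (vpow d V)"
      have "mixed (t - 1) h Y i l = h l" for i l
      proof (cases "l < t - 1")
        case False
        then have "Y l = 0" "h l = 0" using vpowD(2)[OF Y] vpowD(2)[OF h] by auto
        then show ?thesis using False by (simp add: mixed_def lform_0)
      qed (simp add: mixed_def)
      then have "mixed (t - 1) h Y i = h" for i by (simp add: fun_eq_iff)
      then show "(\<Sum>\<alpha>\<in>Rel (t - 1). \<Prod>i<k. wt i (mixed (t - 1) h Y i) (\<alpha> i)) = (\<Prod>i<k. wt i h 0)"
        unfolding R0 by simp
    qed
    also have "\<dots> = (\<Prod>i<k. wt i h 0)"
      using fin_subgroupD[OF fin_subgroup_vpow[OF W, of "t - 1"]] by (intro mean_const) auto
    also have "\<dots> = wt j h 0 * (\<Prod>i\<in>{..<k} - {j}. wt i h 0)" using j by (subst prod.remove[of _ j]) auto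
    also have "\<dots> \<le> wt j h 0 * 1"
      using j h Q0 wt1 by (intro mult_left_mono prod_le_1) (auto intro: fc_wt(2))
    finally show "mean (vpow (t - 1) (vpow d V)) (\<lambda>Y. \<Sum>\<alpha>\<in>Rel (t - 1). \<Prod>i<k. wt i (mixed (t - 1) h Y i) (\<alpha> i)) \<le> wt j h 0"
      by simp
  qed
  also have "\<dots> = Re (expect (vpow (t - 1) V) (\<lambda>h. expect V (\<lambda>z. A j (h(t - 1 := z)))))"
    unfolding Re_expect[of "vpow (t - 1) V"] wt_def fc_def
    by (intro mean_cong arg_cong[where f = Re] expect_cong) (simp add: pair_0_right)
  also have "\<dots> = Re (expect (vpow t V) (A j))"
  proof -
    have "t = Suc (t - 1)" using t by simp
    then show ?thesis using expect_vpow_Suc[OF V, of "t - 1" "A j"] by metis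
  qed
  finally show ?thesis unfolding S_0 using \<eta>0 by simp
qed

end

section \<open>Averages over a system of linear forms\<close>

text \<open>As a function of one direction \<open>c\<close>, the product over the cube splits into
  two opposite faces, which are translates of each other by \<open>c\<close>.\<close>

lemma box_psd_factor:
  "l < t \<Longrightarrow> \<exists>Q. \<forall>v c. box t F (e(l := c)) v = Q v * cnj (Q (v + c))"
proof (induction t)
  case (Suc t)
  show ?case
  proof (cases "l = t")
    case True
    have eq: "box t F (e(t := c)) v = box t F e v" for c v by (rule box_cong) auto
    have *: "box (Suc t) F (e(l := c)) v = box t F e v * cnj (box t F e (v + c))" for c v
      unfolding box.simps True eq by simp
    show ?thesis by (rule exI[of _ "box t F e"], intro allI, rule *)
  next
    case False
    then obtain Q where Q: "\<And>v c. box t F (e(l := c)) v = Q v * cnj (Q (v + c))"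
      using Suc.IH Suc.prems by (metis less_antisym)
    have *: "box (Suc t) F (e(l := c)) v = (Q v * cnj (Q (v + e t))) * cnj (Q (v + c) * cnj (Q (v + c + e t)))" for v c
      using False by (simp add: Q add_ac)
    show ?thesis by (rule exI[of _ "\<lambda>v. Q v * cnj (Q (v + e t))"], intro allI, rule *)
  qed
qed simp

text \<open>The autocorrelation of \<open>A\<close> over boxes with edges along the coordinate axes.
  The sign agrees with \<open>shift\<close>, which moves coordinate \<open>l\<close> by the negative
  value of the form.\<close>

definition box_corr :: "'a::ab_group_add set \<Rightarrow> nat \<Rightarrow> ((nat \<Rightarrow> 'a) \<Rightarrow> complex) \<Rightarrow> (nat \<Rightarrow> 'a) \<Rightarrow> complex" where
  "box_corr V t A y = expect (vpow t V) (\<lambda>h. box t A (\<lambda>l. unitv l (- y l)) h)"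

lemma box_corr_le1:
  assumes V: "fin_subgroup V" and A: "\<And>h. h \<in> vpow t V \<Longrightarrow> cmod (A h) \<le> 1" and y: "y \<in> vpow t V"
  shows "cmod (box_corr V t A y) \<le> 1"
  unfolding box_corr_def
proof (rule cmod_expect_le1)
  fix h assume "h \<in> vpow t V"
  then show "cmod (box t A (\<lambda>l. unitv l (- y l)) h) \<le> 1"
    using A y fin_subgroupD(5)[OF V] vpowD(1)[OF y] by (intro box_le1[OF fin_subgroup_vpow[OF V]] unitv_in[OF V]) auto
qed

text \<open>Translation of \<open>h\<close> by \<open>unitv l x\<close> gives the two faces the base
  points \<open>h + unitv l x\<close> and \<open>h + unitv l x'\<close>, so that the average is a
  sum of rank one kernels.\<close>

lemma box_corr_psd:
  assumes V: "fin_subgroup V" and l: "l < t"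
  shows "psd_on V (\<lambda>x x'. box_corr V t A (y(l := x - x')))"
proof -
  have VV: "fin_subgroup (vpow t V)" by (rule fin_subgroup_vpow[OF V])
  obtain Q where Q: "\<And>v c. box t A ((\<lambda>l. unitv l (- y l))(l := c)) v = Q v * cnj (Q (v + c))"
    using box_psd_factor[OF l, of A "\<lambda>l. unitv l (- y l)"] by blast
  let ?K = "\<lambda>h x x'. Q (h + unitv l x) * cnj (Q (h + unitv l x'))"
  have "psd_on V (\<lambda>x x'. (\<Sum>h\<in>vpow t V. ?K h x x') / complex_of_real (real (card (vpow t V))))"
    using fin_subgroupD(1)[OF VV] by (intro psd_on_divide psd_on_sum psd_on_rank1) auto
  then show ?thesis
  proof (rule psd_on_cong)
    fix x x' assume x: "x \<in> V" "x' \<in> V"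
    have dir: "(\<lambda>l'. unitv l' (- (y(l := x - x')) l')) = (\<lambda>l. unitv l (- y l))(l := unitv l (x' - x))"
      by (auto simp: fun_eq_iff)
    have "box_corr V t A (y(l := x - x')) = expect (vpow t V) (\<lambda>h. Q h * cnj (Q (h + unitv l (x' - x))))"
      unfolding box_corr_def dir Q ..
    also have "\<dots> = expect (vpow t V) (\<lambda>h. Q (h + unitv l x) * cnj (Q (h + unitv l x + unitv l (x' - x))))"
      by (rule expect_translate[OF VV unitv_in[OF V x(1) l], symmetric])
    also have "\<dots> = expect (vpow t V) (\<lambda>h. ?K h x x')"
      by (intro expect_cong) (simp add: add.assoc unitv_add[symmetric])
    finally show "box_corr V t A (y(l := x - x')) = (\<Sum>h\<in>vpow t V. ?K h x x') / complex_of_real (real (card (vpow t V)))"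
      by (simp add: expect_def)
  qed
qed

lemma U_avg_cnj_funpow: "U_avg V t (\<lambda>x. (cnj ^^ n) (g x)) = (cnj ^^ n) (U_avg V t g)"
  by (induction n) (simp_all add: U_avg_cnj)

lemma Re_cnj_funpow: "Re ((cnj ^^ n) z) = Re z"
  by (induction n) auto

text \<open>The counterpart of \<open>box_decomp\<close> for the opposite corner: every other corner
  omits some direction \<open>l\<close> and joins a factor that is constant in
  \<open>h l\<close>.\<close>

lemma box_far_corner:
  assumes V: "fin_subgroup V" and g: "bounded1 V g"
  shows "\<exists>c. (\<forall>h z. box t g h z = (cnj ^^ t) (g (z + (\<Sum>l<t. h l))) * (\<Prod>l<t. c l h z)) \<and>
    (\<forall>l<t. \<forall>h z u. c l (h + unitv l u) z = c l h z) \<and>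
    (\<forall>l<t. \<forall>h z. (\<forall>l'<t. h l' \<in> V) \<longrightarrow> z \<in> V \<longrightarrow> cmod (c l h z) \<le> 1)"
proof (induction t)
  case (Suc t)
  then obtain c where c: "\<And>h z. box t g h z = (cnj ^^ t) (g (z + (\<Sum>l<t. h l))) * (\<Prod>l<t. c l h z)"
    "\<And>l h z u. l < t \<Longrightarrow> c l (h + unitv l u) z = c l h z"
    "\<And>l h z. l < t \<Longrightarrow> (\<forall>l'<t. h l' \<in> V) \<Longrightarrow> z \<in> V \<Longrightarrow> cmod (c l h z) \<le> 1" by blast
  let ?c = "\<lambda>l h z. if l = t then box t g h z else cnj (c l h (z + h t))"
  show ?case
  proof (intro exI[of _ ?c] conjI allI impI)
    fix h z
    have "box (Suc t) g h z = box t g h z * cnj ((cnj ^^ t) (g (z + h t + (\<Sum>l<t. h l))) * (\<Prod>l<t. c l h (z + h t)))"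
      by (simp add: c(1)[symmetric])
    also have "z + h t + (\<Sum>l<t. h l) = z + (\<Sum>l<Suc t. h l)" by (simp add: add_ac)
    finally show "box (Suc t) g h z = (cnj ^^ Suc t) (g (z + (\<Sum>l<Suc t. h l))) * (\<Prod>l<Suc t. ?c l h z)"
      by (simp add: mult_ac)
  next
    fix l h z u assume "l < Suc t"
    have "box t g (h + unitv t u) z = box t g h z" by (rule box_cong) (simp add: unitv_def)
    moreover have "(h + unitv l u) t = h t" if "l < t" using that by (simp add: unitv_def)
    ultimately show "?c l (h + unitv l u) z = ?c l h z" using c(2) \<open>l < Suc t\<close> by auto
  next
    fix l h z assume "l < Suc t" and h: "\<forall>l'<Suc t. h l' \<in> V" and z: "z \<in> V"
    have "cmod (box t g h z) \<le> 1"
      using g h z by (intro box_le1[OF V]) (auto simp: bounded1_def)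
    then show "cmod (?c l h z) \<le> 1" using c(3)[of l h "z + h t"] h z fin_subgroupD(4)[OF V] \<open>l < Suc t\<close> by auto
  qed
qed simp

lemma deriv_avg_bounded:
  "fin_subgroup V \<Longrightarrow> bounded1 V g \<Longrightarrow> h \<in> vpow t V \<Longrightarrow> cmod (deriv_avg V t g h) \<le> 1"
  unfolding deriv_avg_def by (intro cmod_expect_le1 bounded1_box[of V g h t]) auto

text \<open>Apart from the corner of \<open>box t g h z\<close> at \<open>z + (\<Sum>l<t. h l)\<close>, every factor is invariant under a
  joint shift of \<open>h l\<close> and \<open>y l\<close> for some \<open>l\<close>.\<close>

lemma expect_box_corr_deriv_avg:
  assumes V: "fin_subgroup V" and t: "t > 0" and g: "bounded1 V g"
  shows "cmod (expect (vpow t V) (box_corr V t (\<lambda>h. cnj (deriv_avg V t g h)))) ^ (2 ^ t) \<le> Re (U_avg V t g)"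
proof -
  let ?P = "vpow t V" and ?D = "deriv_avg V t g"
  have P: "fin_subgroup ?P" by (rule fin_subgroup_vpow[OF V])
  obtain c where c: "\<And>h z. box t g h z = (cnj ^^ t) (g (z + (\<Sum>l<t. h l))) * (\<Prod>l<t. c l h z)"
    "\<And>l h z u. l < t \<Longrightarrow> c l (h + unitv l u) z = c l h z"
    "\<And>l h z. l < t \<Longrightarrow> (\<forall>l'<t. h l' \<in> V) \<Longrightarrow> z \<in> V \<Longrightarrow> cmod (c l h z) \<le> 1"
    using box_far_corner[OF V g, of t] by blast
  define e where "e y = (\<lambda>l. unitv l (- y l))" for y :: "nat \<Rightarrow> 'a"
  define b where "b l v = cnj (box l ?D (e (fst (snd v))) (fst v + e (fst (snd v)) l)) * c l (fst v) (snd (snd v))" for l v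
  let ?G = "?P \<times> ?P \<times> V"
  let ?\<iota> = "\<lambda>l (u::'a). (unitv l u, unitv l u, 0 :: 'a)"
  let ?\<psi> = "\<lambda>v. snd (snd v) + (\<Sum>l<t. fst v l)"
  have "expect ?P (box_corr V t (\<lambda>h. cnj (?D h))) = cnj (expect ?P (\<lambda>y. expect ?P (\<lambda>h. box t ?D (e y) h)))"
    unfolding box_corr_def box_cnj e_def expect_cnj ..
  also have "expect ?P (\<lambda>y. expect ?P (\<lambda>h. box t ?D (e y) h)) = expect ?P (\<lambda>h. expect ?P (\<lambda>y. box t ?D (e y) h))"
    by (rule expect_swap)
  also have "\<dots> = expect ?P (\<lambda>h. expect ?P (\<lambda>y. expect V (\<lambda>z. (cnj ^^ t) (g (z + (\<Sum>l<t. h l))) * (\<Prod>l<t. b l (h, y, z)))))"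
    unfolding b_def prod.distrib box_decomp[of t ?D] deriv_avg_def expect_cmult_right[symmetric] c(1) fst_conv snd_conv
    by (intro expect_cong) (simp only: mult_ac)
  also have "\<dots> = expect ?G (\<lambda>v. (cnj ^^ t) (g (?\<psi> v)) * (\<Prod>l<t. b l v))"
    unfolding expect_Times fst_conv snd_conv ..
  finally have "cmod (expect ?P (box_corr V t (\<lambda>h. cnj (?D h)))) = cmod (expect ?G (\<lambda>v. (cnj ^^ t) (g (?\<psi> v)) * (\<Prod>l<t. b l v)))"
    by simp
  moreover have "cmod (expect ?G (\<lambda>v. (cnj ^^ t) (g (?\<psi> v)) * (\<Prod>l<t. b l v))) ^ (2 ^ t) \<le> Re (U_avg V t (\<lambda>x. (cnj ^^ t) (g x)))"
  proof (rule gowers_von_neumann[where \<iota> = ?\<iota> and \<psi> = ?\<psi> and f = "\<lambda>x. (cnj ^^ t) (g x)"])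
    show "fin_subgroup ?G" by (intro fin_subgroup_Times P V)
    show "(unitv l u, unitv l u, 0) \<in> ?G" if "l < t" "u \<in> V" for l u
      using that unitv_in[OF V] fin_subgroupD(2)[OF V] by auto
    show "?\<iota> l (u - u') = ?\<iota> l u - ?\<iota> l u'" for l u u'
      by (simp add: unitv_diff)
    show "?\<psi> v \<in> V" if "v \<in> ?G" for v
    proof -
      have "(\<Sum>l<t. fst v l) \<in> V" using that by (intro fin_subgroup_sum[OF V]) (auto simp: vpow_def)
      then show ?thesis using that fin_subgroupD(4)[OF V] by auto
    qed
    show "?\<psi> (v + ?\<iota> l u) = ?\<psi> v + u" if "l < t" for v l u
      using that by (simp add: sum.distrib unitv_def add_ac)
    show "cmod (b l v) \<le> 1" if l: "l < t" and v: "v \<in> ?G" for l v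
    proof -
      obtain h y z where [simp]: "v = (h, y, z)" and hyz: "h \<in> ?P" "y \<in> ?P" "z \<in> V" using v by auto
      have e: "e y l' \<in> ?P" if "l' < t" for l'
        unfolding e_def by (intro unitv_in[OF V] fin_subgroupD(5)[OF V] vpowD(1)[OF hyz(2)] that)
      have "cmod (box l ?D (e y) (h + e y l)) \<le> 1"
        using l e hyz by (intro box_le1[OF P] deriv_avg_bounded[OF V g] fin_subgroupD(4)[OF P]) auto
      moreover have "cmod (c l h z) \<le> 1" using hyz vpowD(1)[OF hyz(1)] by (intro c(3) l) auto
      ultimately show ?thesis by (simp add: b_def norm_mult mult_le_one)
    qed
    show "b l (v + ?\<iota> l u) = b l v" if l: "l < t" for l v u
    proof -
      obtain h y z where [simp]: "v = (h, y, z)" by (cases v) auto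
      have "e (y + unitv l u) l = e y l - unitv l u" by (auto simp: e_def unitv_def fun_eq_iff)
      moreover have "box l ?D (e (y + unitv l u)) x = box l ?D (e y) x" for x
        by (rule box_cong) (auto simp: e_def unitv_def fun_eq_iff)
      ultimately show ?thesis using c(2)[OF l] by (simp add: b_def)
    qed
  qed (fact V t)+
  ultimately show ?thesis by (simp add: U_avg_cnj_funpow Re_cnj_funpow)
qed

section \<open>Averages of products along the forms\<close>

context form_system
begin

definition form_avg where "form_avg F = expect (vpow d V) (\<lambda>x. \<Prod>i<k. F i (lform (a i) d x))"

lemma form_avg_le1:
  assumes "\<And>i. i < k \<Longrightarrow> bounded1 V (F i)" shows "cmod (form_avg F) \<le> 1"
  unfolding form_avg_def
proof (rule cmod_expect_le1)
  fix x assume "x \<in> vpow d V"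
  then show "cmod (\<Prod>i<k. F i (lform (a i) d x)) \<le> 1"
    unfolding prod_norm[symmetric] using assms lform_in[OF V] by (intro prod_le_1) (auto simp: bounded1_def)
qed

text \<open>\<open>H y\<close> averages the product of the other factors over the fibre of the
  \<open>j\<close>-th form above \<open>y\<close>; the additive section \<open>\<sigma>\<close>
  moves a uniformly random \<open>x\<close> into this fibre.\<close>

lemma form_avg_dual:
  assumes j: "j < k" and F: "\<And>i. i < k \<Longrightarrow> i \<noteq> j \<Longrightarrow> bounded1 V (F i)"
  shows "\<exists>H. bounded1 V H \<and> (\<forall>f. form_avg (F(j := f)) = expect V (\<lambda>y. f y * H y))"
proof -
  obtain \<sigma> where \<sigma>: "\<And>v. v \<in> V \<Longrightarrow> \<sigma> v \<in> vpow d V" "\<And>v. v \<in> V \<Longrightarrow> lform (a j) d (\<sigma> v) = v"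
    "\<And>v v'. v \<in> V \<Longrightarrow> v' \<in> V \<Longrightarrow> \<sigma> (v - v') = \<sigma> v - \<sigma> v'"
    using separating_section[OF j j] by blast
  let ?W = "vpow d V" and ?\<phi> = "lform (a j) d"
  have W: "fin_subgroup ?W" by (rule fin_subgroup_vpow[OF V])
  have fV: "finite V" "V \<noteq> {}" using fin_subgroupD[OF V] by auto
  define B where "B x = (\<Prod>i\<in>{..<k} - {j}. F i (lform (a i) d x))" for x
  have B1: "cmod (B x) \<le> 1" if "x \<in> ?W" for x
    unfolding B_def prod_norm[symmetric] using F lform_in[OF V that] by (intro prod_le_1) (auto simp: bounded1_def)
  define H where "H y = expect ?W (\<lambda>x. B (x + \<sigma> y - \<sigma> (?\<phi> x)))" for y
  have "bounded1 V H"
    unfolding bounded1_def H_def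
    by (intro ballI cmod_expect_le1 B1 fin_subgroupD(3,4)[OF W] \<sigma>(1) lform_in[OF V])
  moreover have "form_avg (F(j := f)) = expect V (\<lambda>y. f y * H y)" for f
  proof -
    have "form_avg (F(j := f)) = expect ?W (\<lambda>x. f (?\<phi> x) * B x)"
      unfolding form_avg_def B_def using j
      by (intro expect_cong) (subst prod.remove[of _ j], auto intro!: prod.cong)
    also have "\<dots> = expect V (\<lambda>y. expect ?W (\<lambda>x. f (?\<phi> x) * B x))" by (rule expect_const[OF fV, symmetric])
    also have "\<dots> = expect V (\<lambda>y. expect ?W (\<lambda>x. f (?\<phi> (x + \<sigma> y)) * B (x + \<sigma> y)))"
      by (rule expect_cong, rule expect_translate[OF W, symmetric]) (rule \<sigma>(1))
    also have "\<dots> = expect ?W (\<lambda>x. expect V (\<lambda>y. f (y + ?\<phi> x) * B (x + \<sigma> (y + ?\<phi> x - ?\<phi> x))))"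
      by (subst expect_swap, intro expect_cong) (simp add: lform_add \<sigma>(2) add.commute)
    also have "\<dots> = expect ?W (\<lambda>x. expect V (\<lambda>y. f y * B (x + \<sigma> (y - ?\<phi> x))))"
      by (rule expect_cong, rule expect_translate[OF V, where f = "\<lambda>z. f z * B (_ + \<sigma> (z - _))"]) (rule lform_in[OF V])
    also have "\<dots> = expect ?W (\<lambda>x. expect V (\<lambda>y. f y * B (x + \<sigma> y - \<sigma> (?\<phi> x))))"
      by (intro expect_cong) (simp add: \<sigma>(3) lform_in[OF V] add_diff_eq)
    also have "\<dots> = expect V (\<lambda>y. f y * H y)"
      unfolding H_def by (subst expect_swap) (simp add: expect_cmult)
    finally show ?thesis .
  qed
  ultimately show ?thesis by blast
qed

lemma form_avg_expand:
  assumes "\<And>i y. i < k \<Longrightarrow> y \<in> V \<Longrightarrow> F i y = expect (vpow t V) (\<lambda>h. g i h y)"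
  shows "form_avg F = expect (vpow d V \<times> vpow k (vpow t V)) (\<lambda>v. \<Prod>i<k. g i (snd v i) (lform (a i) d (fst v)))"
  unfolding form_avg_def expect_Times fst_conv snd_conv
proof (rule expect_cong)
  fix x assume x: "x \<in> vpow d V"
  have "(\<Prod>i<k. F i (lform (a i) d x)) = (\<Prod>i<k. expect (vpow t V) (\<lambda>h. g i h (lform (a i) d x)))"
    by (intro prod.cong refl) (simp add: assms lform_in[OF V x])
  also have "\<dots> = expect (vpow k (vpow t V)) (\<lambda>h. \<Prod>i<k. g i (h i) (lform (a i) d x))"
    by (rule expect_vpow_prod[OF fin_subgroup_vpow[OF V], symmetric])
  finally show "(\<Prod>i<k. F i (lform (a i) d x)) = expect (vpow k (vpow t V)) (\<lambda>h. \<Prod>i<k. g i (h i) (lform (a i) d x))" .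
qed

text \<open>Under this translation the argument of every form and the \<open>l\<close>-th coordinate
  of the corresponding tuple move by opposite amounts. The \<open>l\<close>-th factors of all cube
  representations are therefore invariant.\<close>

definition shift :: "nat \<Rightarrow> (nat \<Rightarrow> 'a) \<Rightarrow> (nat \<Rightarrow> 'a) \<times> (nat \<Rightarrow> nat \<Rightarrow> 'a)" where
  "shift l x = (x, \<lambda>i. if i < k then unitv l (- lform (a i) d x) else 0)"

lemma shift_in: "l < t \<Longrightarrow> x \<in> vpow d V \<Longrightarrow> shift l x \<in> vpow d V \<times> vpow k (vpow t V)"
  unfolding shift_def vpow_def[of k]
  using unitv_in[OF V] fin_subgroupD(5)[OF V] lform_in[OF V] by auto

lemma shift_diff: "shift l (x - y) = shift l x - shift l y"
  by (auto simp: shift_def lform_diff fun_eq_iff unitv_def)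

text \<open>A function which is left raw is treated as a single factor of a cube representation, in the
  direction \<open>c i\<close>. This direction is then taken in the kernel of the \<open>i\<close>-th form.\<close>

lemma form_avg_control:
  assumes j: "j < k" and t: "t > 0"
    and R: "R \<subseteq> {..<k} - {j}" "inj_on c R" "c ` R \<subseteq> {..<t}"
    and raw: "\<And>i. i \<in> R \<Longrightarrow> bounded1 V (F i)"
    and rep: "\<And>i. i < k \<Longrightarrow> i \<noteq> j \<Longrightarrow> i \<notin> R \<Longrightarrow> cube_rep V t (\<lambda>_. 1) (F i)"
  shows "cmod (form_avg F) ^ (2 ^ t) \<le> Re (U_avg V t (F j))"
proof -
  define P where "P i b \<longleftrightarrow> (\<forall>y\<in>V. F i y = expect (vpow t V) (\<lambda>h. \<Prod>l<t. b l h y)) \<and>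
     (\<forall>l<t. \<forall>h\<in>vpow t V. \<forall>y\<in>V. cmod (b l h y) \<le> 1) \<and>
     (\<forall>l<t. (i \<in> R \<and> c i = l \<and> (\<forall>h h'. b l h = b l h')) \<or> (\<forall>h y x. b l (h - unitv l x) (y + x) = b l h y))" for i b
  have "\<exists>b. P i b" if i: "i < k" "i \<noteq> j" for i
  proof (cases "i \<in> R")
    case True
    have ci: "c i < t" using R(3) True by auto
    have fP: "finite (vpow t V)" "vpow t V \<noteq> {}" using fin_subgroupD[OF fin_subgroup_vpow[OF V, of t]] by auto
    have "(\<Prod>l<t. if l = c i then F i y else 1) = F i y" for y using ci by simp
    then show ?thesis using True raw[OF True] unfolding P_def
      by (intro exI[of _ "\<lambda>l h y. if l = c i then F i y else 1"]) (auto simp: expect_const[OF fP] bounded1_def)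
  next
    case False
    then show ?thesis using rep[OF i False] unfolding cube_rep_def P_def by simp
  qed
  then have "\<forall>i\<in>{..<k} - {j}. \<exists>b. P i b" by blast
  from bchoice[OF this] obtain b where "\<forall>i\<in>{..<k} - {j}. P i (b i)" ..
  then have b: "\<And>i y. i < k \<Longrightarrow> i \<noteq> j \<Longrightarrow> y \<in> V \<Longrightarrow> F i y = expect (vpow t V) (\<lambda>h. \<Prod>l<t. b i l h y)"
     "\<And>i l h y. i < k \<Longrightarrow> i \<noteq> j \<Longrightarrow> l < t \<Longrightarrow> h \<in> vpow t V \<Longrightarrow> y \<in> V \<Longrightarrow> cmod (b i l h y) \<le> 1"
     "\<And>i l. i < k \<Longrightarrow> i \<noteq> j \<Longrightarrow> l < t \<Longrightarrow> (i \<in> R \<and> c i = l \<and> (\<forall>h h'. b i l h = b i l h')) \<or> (\<forall>h y x. b i l (h - unitv l x) (y + x) = b i l h y)"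
    unfolding P_def by blast+
  define P' :: "nat \<Rightarrow> ('a \<Rightarrow> nat \<Rightarrow> 'a) \<Rightarrow> bool" where "P' l \<sigma> \<longleftrightarrow> (\<forall>v\<in>V. \<sigma> v \<in> vpow d V \<and> lform (a j) d (\<sigma> v) = v \<and> (\<forall>i\<in>R. c i = l \<longrightarrow> lform (a i) d (\<sigma> v) = 0)) \<and>
      (\<forall>v\<in>V. \<forall>v'\<in>V. \<sigma> (v - v') = \<sigma> v - \<sigma> v')" for l \<sigma>
  have "\<exists>\<sigma>. P' l \<sigma>" for l
  proof (cases "\<exists>i\<in>R. c i = l")
    case True
    then obtain i where i: "i \<in> R" "c i = l" by blast
    have uniq: "i' = i" if "i' \<in> R" "c i' = l" for i' using inj_onD[OF R(2)] that i by auto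
    have ij: "i < k" "i \<noteq> j" using i R(1) by auto
    obtain \<sigma> where "\<forall>v\<in>V. \<sigma> v \<in> vpow d V \<and> lform (a j) d (\<sigma> v) = v \<and> lform (a i) d (\<sigma> v) = 0"
      "\<forall>v\<in>V. \<forall>v'\<in>V. \<sigma> (v - v') = \<sigma> v - \<sigma> v'"
      using separating_section[OF j ij(1)] ij(2) by blast
    then have "P' l \<sigma>" unfolding P'_def using uniq by auto
    then show ?thesis by blast
  next
    case False
    obtain \<sigma> where "\<forall>v\<in>V. \<sigma> v \<in> vpow d V \<and> lform (a j) d (\<sigma> v) = v"
      "\<forall>v\<in>V. \<forall>v'\<in>V. \<sigma> (v - v') = \<sigma> v - \<sigma> v'"
      using separating_section[OF j j] by blast
    then have "P' l \<sigma>" unfolding P'_def using False by auto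
    then show ?thesis by blast
  qed
  then have "\<forall>l. \<exists>\<sigma>. P' l \<sigma>" by blast
  from choice[OF this] obtain \<sigma> where "\<forall>l. P' l (\<sigma> l)" ..
  then have \<sigma>: "\<And>l v. v \<in> V \<Longrightarrow> \<sigma> l v \<in> vpow d V" "\<And>l v. v \<in> V \<Longrightarrow> lform (a j) d (\<sigma> l v) = v"
    "\<And>l v i. v \<in> V \<Longrightarrow> i \<in> R \<Longrightarrow> c i = l \<Longrightarrow> lform (a i) d (\<sigma> l v) = 0"
    "\<And>l v v'. v \<in> V \<Longrightarrow> v' \<in> V \<Longrightarrow> \<sigma> l (v - v') = \<sigma> l v - \<sigma> l v'"
    unfolding P'_def by blast+
  let ?G = "vpow d V \<times> vpow k (vpow t V)"
  define \<beta> where "\<beta> l v = (\<Prod>i\<in>{..<k} - {j}. b i l (snd v i) (lform (a i) d (fst v)))" for l v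
  have fP: "finite (vpow t V)" "vpow t V \<noteq> {}" using fin_subgroupD[OF fin_subgroup_vpow[OF V, of t]] by auto
  have "form_avg F = expect ?G (\<lambda>v. \<Prod>i<k. (if i = j then F j (lform (a i) d (fst v)) else \<Prod>l<t. b i l (snd v i) (lform (a i) d (fst v))))"
  proof (rule form_avg_expand[where g = "\<lambda>i h y. if i = j then F j y else \<Prod>l<t. b i l h y"])
    fix i y assume "i < k" "y \<in> V"
    then show "F i y = expect (vpow t V) (\<lambda>h. if i = j then F j y else \<Prod>l<t. b i l h y)"
      using b(1) by (cases "i = j") (simp_all add: expect_const[OF fP])
  qed
  also have "\<dots> = expect ?G (\<lambda>v. F j (lform (a j) d (fst v)) * (\<Prod>l<t. \<beta> l v))"
  proof (rule expect_cong)
    fix v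
    have "(\<Prod>i<k. (if i = j then F j (lform (a i) d (fst v)) else \<Prod>l<t. b i l (snd v i) (lform (a i) d (fst v))))
      = F j (lform (a j) d (fst v)) * (\<Prod>i\<in>{..<k} - {j}. \<Prod>l<t. b i l (snd v i) (lform (a i) d (fst v)))"
      using j by (subst prod.remove[of _ j]) (auto intro!: prod.cong)
    then show "(\<Prod>i<k. (if i = j then F j (lform (a i) d (fst v)) else \<Prod>l<t. b i l (snd v i) (lform (a i) d (fst v))))
      = F j (lform (a j) d (fst v)) * (\<Prod>l<t. \<beta> l v)" unfolding \<beta>_def by (subst prod.swap)
  qed
  finally have eq: "form_avg F = expect ?G (\<lambda>v. F j (lform (a j) d (fst v)) * (\<Prod>l<t. \<beta> l v))" .
  show ?thesis unfolding eq
  proof (rule gowers_von_neumann[where \<iota> = "\<lambda>l y. shift l (\<sigma> l y)" and \<psi> = "\<lambda>v. lform (a j) d (fst v)"])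
    show "fin_subgroup ?G" by (intro fin_subgroup_Times fin_subgroup_vpow V)
    show "cmod (\<beta> l v) \<le> 1" if "l < t" "v \<in> ?G" for l v
      unfolding \<beta>_def prod_norm[symmetric] using that b(2) lform_in[OF V]
      by (intro prod_le_1) (auto simp: vpow_def[of k])
    show "\<beta> l (v + shift l (\<sigma> l y)) = \<beta> l v" if l: "l < t" and v: "v \<in> ?G" and y: "y \<in> V" for l v y
      unfolding \<beta>_def
    proof (rule prod.cong[OF refl])
      fix i assume "i \<in> {..<k} - {j}"
      then have i: "i < k" "i \<noteq> j" by auto
      let ?x = "lform (a i) d (\<sigma> l y)"
      have eqs: "snd (v + shift l (\<sigma> l y)) i = snd v i - unitv l ?x"
        "lform (a i) d (fst (v + shift l (\<sigma> l y))) = lform (a i) d (fst v) + ?x"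
        using i by (simp_all add: shift_def lform_add unitv_uminus)
      from b(3)[OF i l] show "b i l (snd (v + shift l (\<sigma> l y)) i) (lform (a i) d (fst (v + shift l (\<sigma> l y))))
          = b i l (snd v i) (lform (a i) d (fst v))"
      proof
        assume c: "i \<in> R \<and> c i = l \<and> (\<forall>h h'. b i l h = b i l h')"
        then have "?x = 0" using \<sigma>(3)[OF y] by blast
        then show ?thesis unfolding eqs by (simp add: unitv_0)
      next
        assume "\<forall>h y x. b i l (h - unitv l x) (y + x) = b i l h y"
        then show ?thesis unfolding eqs by blast
      qed
    qed
    show "shift l (\<sigma> l (y - y')) = shift l (\<sigma> l y) - shift l (\<sigma> l y')" if "y \<in> V" "y' \<in> V" for l y y'
      using that by (simp only: \<sigma>(4) shift_diff)
    show "shift l (\<sigma> l y) \<in> ?G" if "l < t" "y \<in> V" for l y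
      using that by (intro shift_in \<sigma>(1))
    show "lform (a j) d (fst (v + shift l (\<sigma> l y))) = lform (a j) d (fst v) + y" if "y \<in> V" for v l y
      using that by (simp add: shift_def lform_add \<sigma>(2))
  qed (use V t lform_in in auto)
qed

text \<open>The factors with index \<open>l\<close> are removed in the directions
  \<open>shift l\<close>. What remains of each \<open>A i\<close> is its correlation along edges
  given by the \<open>i\<close>-th form of the new variables \<open>Y\<close>.\<close>

lemma form_avg_box_corr:
  assumes t: "t > 0" and F: "\<And>i. i < k \<Longrightarrow> cube_rep V t (A i) (F i)"
  shows "cmod (form_avg F) ^ (2 ^ t)
    \<le> cmod (expect (vpow t (vpow d V)) (\<lambda>Y. \<Prod>i<k. box_corr V t (A i) (\<lambda>l. lform (a i) d (Y l))))"
proof -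
  have "\<forall>i\<in>{..<k}. \<exists>b. (\<forall>y\<in>V. F i y = expect (vpow t V) (\<lambda>h. A i h * (\<Prod>l<t. b l h y))) \<and>
     (\<forall>l<t. \<forall>h\<in>vpow t V. \<forall>y\<in>V. cmod (b l h y) \<le> 1) \<and> (\<forall>l<t. \<forall>h y x. b l (h - unitv l x) (y + x) = b l h y)"
    using F unfolding cube_rep_def by blast
  from bchoice[OF this] obtain b where "\<forall>i\<in>{..<k}. (\<forall>y\<in>V. F i y = expect (vpow t V) (\<lambda>h. A i h * (\<Prod>l<t. b i l h y))) \<and>
     (\<forall>l<t. \<forall>h\<in>vpow t V. \<forall>y\<in>V. cmod (b i l h y) \<le> 1) \<and> (\<forall>l<t. \<forall>h y x. b i l (h - unitv l x) (y + x) = b i l h y)" ..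
  then have b: "\<And>i y. i < k \<Longrightarrow> y \<in> V \<Longrightarrow> F i y = expect (vpow t V) (\<lambda>h. A i h * (\<Prod>l<t. b i l h y))"
     "\<And>i l h y. i < k \<Longrightarrow> l < t \<Longrightarrow> h \<in> vpow t V \<Longrightarrow> y \<in> V \<Longrightarrow> cmod (b i l h y) \<le> 1"
     "\<And>i l h y x. i < k \<Longrightarrow> l < t \<Longrightarrow> b i l (h - unitv l x) (y + x) = b i l h y"
    by blast+
  let ?W = "vpow d V" and ?P = "vpow t V" let ?G = "?W \<times> vpow k ?P"
  have P: "fin_subgroup ?P" by (rule fin_subgroup_vpow[OF V])
  define \<beta> where "\<beta> l v = (\<Prod>i<k. b i l (snd v i) (lform (a i) d (fst v)))" for l v
  define A' where "A' v = (\<Prod>i<k. A i (snd v i))" for v :: "(nat \<Rightarrow> 'a) \<times> (nat \<Rightarrow> nat \<Rightarrow> 'a)"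
  have "form_avg F = expect ?G (\<lambda>v. \<Prod>i<k. A i (snd v i) * (\<Prod>l<t. b i l (snd v i) (lform (a i) d (fst v))))"
    using b(1) by (rule form_avg_expand)
  also have "\<dots> = expect ?G (\<lambda>v. A' v * (\<Prod>l<t. \<beta> l v))"
    unfolding A'_def \<beta>_def prod.distrib by (subst prod.swap) (rule refl)
  finally have eq: "form_avg F = expect ?G (\<lambda>v. A' v * (\<Prod>l<t. \<beta> l v))" .
  have "cmod (form_avg F) ^ (2 ^ t) \<le> Re (expect ?G (\<lambda>v. expect (vpow t ?W) (\<lambda>Y. box t A' (\<lambda>l. shift l (Y l)) v)))"
    unfolding eq
  proof (rule box_cauchy_schwarz[where W = ?W])
    show "fin_subgroup ?G" by (intro fin_subgroup_Times fin_subgroup_vpow V)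
    show "cmod (\<beta> l v) \<le> 1" if "l < t" "v \<in> ?G" for l v
      unfolding \<beta>_def prod_norm[symmetric] using that b(2) lform_in[OF V]
      by (intro prod_le_1) (auto simp: vpow_def[of k])
    show "\<beta> l (v + shift l y) = \<beta> l v" if l: "l < t" and v: "v \<in> ?G" and y: "y \<in> ?W" for l v y
      unfolding \<beta>_def
    proof (rule prod.cong[OF refl])
      fix i assume i: "i \<in> {..<k}"
      have "snd (v + shift l y) i = snd v i - unitv l (lform (a i) d y)"
        "lform (a i) d (fst (v + shift l y)) = lform (a i) d (fst v) + lform (a i) d y"
        using i by (simp_all add: shift_def lform_add unitv_uminus)
      then show "b i l (snd (v + shift l y) i) (lform (a i) d (fst (v + shift l y))) = b i l (snd v i) (lform (a i) d (fst v))"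
        using b(3) i l by simp
    qed
  qed (use t shift_in in \<open>auto simp only: shift_diff fin_subgroup_vpow[OF V]\<close>)
  also have "expect ?G (\<lambda>v. expect (vpow t ?W) (\<lambda>Y. box t A' (\<lambda>l. shift l (Y l)) v))
      = expect (vpow t ?W) (\<lambda>Y. expect ?G (\<lambda>v. box t A' (\<lambda>l. shift l (Y l)) v))" by (rule expect_swap)
  also have "\<dots> = expect (vpow t ?W) (\<lambda>Y. \<Prod>i<k. box_corr V t (A i) (\<lambda>l. lform (a i) d (Y l)))"
  proof (rule expect_cong)
    fix Y assume "Y \<in> vpow t ?W"
    let ?e = "\<lambda>i l. unitv l (- lform (a i) d (Y l))"
    have fW: "finite ?W" "?W \<noteq> {}" using fin_subgroupD[OF fin_subgroup_vpow[OF V, of d]] by auto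
    have "box t A' (\<lambda>l. shift l (Y l)) v = (\<Prod>i<k. box t (A i) (?e i) (snd v i))" for v
    proof -
      have "box t (\<lambda>v. A i (snd v i)) (\<lambda>l. shift l (Y l)) v = box t (A i) (?e i) (snd v i)" if "i < k" for i
        using that by (intro box_hom[where \<psi> = "\<lambda>v. snd v i"]) (simp add: shift_def)
      then show ?thesis unfolding A'_def by (subst box_prod) auto
    qed
    then have "expect ?G (\<lambda>v. box t A' (\<lambda>l. shift l (Y l)) v) = expect (vpow k ?P) (\<lambda>h. \<Prod>i<k. box t (A i) (?e i) (h i))"
      by (simp add: expect_Times expect_const[OF fW])
    also have "\<dots> = (\<Prod>i<k. expect ?P (box t (A i) (?e i)))" by (rule expect_vpow_prod[OF P])
    finally show "expect ?G (\<lambda>v. box t A' (\<lambda>l. shift l (Y l)) v) = (\<Prod>i<k. box_corr V t (A i) (\<lambda>l. lform (a i) d (Y l)))"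
      unfolding box_corr_def .
  qed
  also have "Re \<dots> \<le> cmod \<dots>" by (rule complex_Re_le_cmod)
  finally show ?thesis .
qed

end

section \<open>Lowering the order of the dual functions\<close>

context form_system
begin

text \<open>The square of the average is at most the mean square of \<open>H\<close>, which is the
  average with \<open>cnj H\<close> in position \<open>j\<close>; control of this position then
  makes \<open>U_avg V t H\<close> large. The order \<open>t'\<close> of the dual function is left
  free because \<open>level_step\<close> obtains \<open>H\<close> at order \<open>t + 1\<close> and
  inserts the dual function of order \<open>t\<close>.\<close>

lemma dual_gain:
  assumes j: "j < k" and t: "t > 0" and F: "\<And>i. i < k \<Longrightarrow> bounded1 V (F i)"
    and R: "R \<subseteq> {..<k} - {j}" "inj_on c R" "c ` R \<subseteq> {..<t}"
    and rep: "\<And>i. i < k \<Longrightarrow> i \<noteq> j \<Longrightarrow> i \<notin> R \<Longrightarrow> cube_rep V t (\<lambda>_. 1) (F i)"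
  shows "\<exists>H. bounded1 V H \<and> (\<forall>t'. form_avg (F(j := dual_fun V t' H)) = U_avg V t' H) \<and>
    cmod (form_avg F) ^ (2 ^ (t + 1)) \<le> Re (U_avg V t H)"
proof -
  obtain H where H: "bounded1 V H" "\<And>f. form_avg (F(j := f)) = expect V (\<lambda>y. f y * H y)"
    using form_avg_dual[OF j, of F] F by blast
  let ?F = "F(j := (\<lambda>y. cnj (H y)))"
  have "(cmod (form_avg F))\<^sup>2 = (cmod (expect V (\<lambda>y. F j y * H y)))\<^sup>2" using H(2)[of "F j"] by simp
  also have "\<dots> \<le> mean V (\<lambda>y. (cmod (F j y * H y))\<^sup>2)" by (rule cmod_expect_sq_le)
  also have "\<dots> \<le> mean V (\<lambda>y. (cmod (H y))\<^sup>2)"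
    using F[OF j] by (intro mean_mono power_mono) (auto simp: norm_mult bounded1_def mult_left_le_one_le)
  also have "\<dots> = Re (expect V (\<lambda>y. H y * cnj (H y)))" unfolding mult_cnj_eq expect_of_real by simp
  also have "expect V (\<lambda>y. H y * cnj (H y)) = form_avg ?F" by (simp add: H(2) mult.commute)
  also have "Re (form_avg ?F) \<le> cmod (form_avg ?F)" by (rule complex_Re_le_cmod)
  finally have "cmod (form_avg F) ^ (2 ^ (t + 1)) \<le> cmod (form_avg ?F) ^ (2 ^ t)"
    by (simp add: power_mult power_mono)
  also have "\<dots> \<le> Re (U_avg V t (?F j))"
    using F R rep by (intro form_avg_control[OF j t R]) auto
  also have "\<dots> = Re (U_avg V t H)" by (simp add: U_avg_cnj)
  finally have "cmod (form_avg F) ^ (2 ^ (t + 1)) \<le> Re (U_avg V t H)" .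
  moreover have "form_avg (F(j := dual_fun V t' H)) = U_avg V t' H" for t'
    by (simp add: H(2) U_avg_dual_fun mult.commute)
  ultimately show ?thesis using H(1) by blast
qed

text \<open>To give all functions a cube representation, the one at \<open>i0\<close> is also
  replaced by a dual function, but only for bounding \<open>U_avg V t H\<close> from below. By the
  choice of \<open>H\<close> this number equals the average in which position \<open>j\<close> alone
  is changed and \<open>F i0\<close> is intact.\<close>

lemma level_step:
  assumes i0: "i0 < k" and j: "j < k" "j \<noteq> i0" and t: "t > 0" and Rel: "Rel (t - 1) \<subseteq> {0}"
    and f: "bounded1 V (F i0)"
    and dual: "\<And>i. i < k \<Longrightarrow> i \<noteq> i0 \<Longrightarrow> \<exists>g. bounded1 V g \<and> (F i = dual_fun V t g \<or> F i = dual_fun V (Suc t) g)"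
  shows "\<exists>g. bounded1 V g \<and> (cmod (form_avg F) / (8 * real k)) ^ (2 ^ (4 * t + 4) * (2 * (1300 * k ^ 3 * (B + 1))) ^ (t - 1))
    \<le> cmod (form_avg (F(j := dual_fun V t g)))"
proof -
  let ?N = "(2 * (1300 * k ^ 3 * (B + 1))) ^ (t - 1)" and ?K = "8 * real k"
  have K1: "1 \<le> ?K" using k by simp
  have rep: "cube_rep V (Suc t) (\<lambda>_. 1) (F i)" if i: "i < k" "i \<noteq> i0" for i
    using dual[OF i] cube_rep_dual_fun[OF V] cube_rep_Suc[OF V] by metis
  have rep': "\<exists>A. (\<forall>h\<in>vpow t V. cmod (A h) \<le> 1) \<and> cube_rep V t A (F i)" if i: "i < k" "i \<noteq> i0" for i
  proof -
    obtain g where g: "bounded1 V g" "F i = dual_fun V t g \<or> F i = dual_fun V (Suc t) g" using dual[OF i] by blast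
    from g(2) show ?thesis
    proof
      assume "F i = dual_fun V t g"
      then show ?thesis using cube_rep_dual_fun[OF V g(1), of t] by (intro exI[of _ "\<lambda>_. 1"]) simp
    next
      assume "F i = dual_fun V (Suc t) g"
      then show ?thesis using cube_rep_dual_fun_Suc[OF V g(1), of t] deriv_avg_bounded[OF V g(1), of _ t]
        by (intro exI[of _ "\<lambda>h. cnj (deriv_avg V t g h)"]) simp
    qed
  qed
  have bd: "bounded1 V (F i)" if i: "i < k" for i
    using f dual[OF i] bounded1_dual_fun[OF V] by (cases "i = i0") metis+
  obtain H where H: "bounded1 V H" "\<And>t'. form_avg (F(j := dual_fun V t' H)) = U_avg V t' H"
    "cmod (form_avg F) ^ (2 ^ (t + 2)) \<le> Re (U_avg V (Suc t) H)"
    using dual_gain[OF j(1), of "Suc t" F "{i0}" "\<lambda>_. 0"] bd rep i0 j by auto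
  define F1 where "F1 = F(j := dual_fun V (Suc t) H)"
  have F1: "cmod (form_avg F) ^ (2 ^ (t + 2)) \<le> cmod (form_avg F1)"
    unfolding F1_def H(2) using H(3) complex_Re_le_cmod order_trans by blast
  have bd1: "bounded1 V (F1 i)" if "i < k" for i
    using bd[OF that] bounded1_dual_fun[OF V H(1)] by (simp add: F1_def)
  have rep1: "cube_rep V (Suc t) (\<lambda>_. 1) (F1 i)" if "i < k" "i \<noteq> i0" for i
    using rep[OF that] cube_rep_dual_fun[OF V H(1)] by (simp add: F1_def)
  obtain H' where H': "bounded1 V H'" "\<And>t'. form_avg (F1(i0 := dual_fun V t' H')) = U_avg V t' H'"
    "cmod (form_avg F1) ^ (2 ^ (t + 2)) \<le> Re (U_avg V (Suc t) H')"
    using dual_gain[OF i0, of "Suc t" F1 "{}" "\<lambda>_. 0"] bd1 rep1 by auto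
  define F2 where "F2 = F1(i0 := dual_fun V (Suc t) H')"
  have F2: "cmod (form_avg F1) ^ (2 ^ (t + 2)) \<le> cmod (form_avg F2)"
    unfolding F2_def H'(2) using H'(3) complex_Re_le_cmod order_trans by blast
  let ?D = "\<lambda>h. cnj (deriv_avg V t H h)"
  have "\<exists>A. (\<forall>h\<in>vpow t V. cmod (A h) \<le> 1) \<and> cube_rep V t A (F2 i) \<and> (i = j \<longrightarrow> A = ?D)" if i: "i < k" for i
  proof -
    consider "i = j" | "i = i0" | "i \<noteq> j" "i \<noteq> i0" by blast
    then show ?thesis
    proof cases
      case 1
      then show ?thesis using cube_rep_dual_fun_Suc[OF V H(1), of t] deriv_avg_bounded[OF V H(1), of _ t] j(2)
        by (intro exI[of _ ?D]) (simp add: F1_def F2_def)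
    next
      case 2
      then show ?thesis using cube_rep_dual_fun_Suc[OF V H'(1), of t] deriv_avg_bounded[OF V H'(1), of _ t] j(2)
        by (intro exI[of _ "\<lambda>h. cnj (deriv_avg V t H' h)"]) (simp add: F1_def F2_def)
    next
      case 3
      then show ?thesis using rep'[OF i] by (simp add: F1_def F2_def)
    qed
  qed
  then have "\<forall>i\<in>{..<k}. \<exists>A. (\<forall>h\<in>vpow t V. cmod (A h) \<le> 1) \<and> cube_rep V t A (F2 i) \<and> (i = j \<longrightarrow> A = ?D)" by blast
  from bchoice[OF this] obtain A where
    "\<forall>i\<in>{..<k}. (\<forall>h\<in>vpow t V. cmod (A i h) \<le> 1) \<and> cube_rep V t (A i) (F2 i) \<and> (i = j \<longrightarrow> A i = ?D)" ..
  then have A: "\<And>i h. i < k \<Longrightarrow> h \<in> vpow t V \<Longrightarrow> cmod (A i h) \<le> 1" "\<And>i. i < k \<Longrightarrow> cube_rep V t (A i) (F2 i)" "A j = ?D"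
    using j(1) by auto
  interpret ms: multilinear_system V Q pair k d B a J t "\<lambda>i. box_corr V t (A i)"
  proof unfold_locales
    show "cmod (box_corr V t (A i) y) \<le> 1" if "i < k" "y \<in> vpow t V" for i y
      by (rule box_corr_le1[OF V A(1)[OF that(1)] that(2)])
    show "psd_on V (\<lambda>x x'. box_corr V t (A i) (y(l := x - x')))" if "l < t" for i l y
      by (rule box_corr_psd[OF V that])
  qed (rule t)
  let ?X = "cmod (expect (vpow t (vpow d V)) (\<lambda>Y. \<Prod>i<k. box_corr V t (A i) (\<lambda>l. lform (a i) d (Y l))))"
  let ?Y = "cmod (expect (vpow t V) (box_corr V t ?D))" and ?\<delta> = "cmod (form_avg F)"
  \<comment> \<open>Each of the two passages to dual functions of order \<open>t + 1\<close> costs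
    \<open>t + 2\<close> squarings, and the elimination of the cubes costs \<open>t\<close>. The
    comparison of the correlation with \<open>U_avg V t H\<close> adds the last
    \<open>t\<close>.\<close>
  have "t + 2 + (t + 2) + t = 3 * t + 4" by simp
  then have "(2::nat) ^ (t + 2) * 2 ^ (t + 2) * 2 ^ t = 2 ^ (3 * t + 4)" by (simp only: power_add[symmetric])
  then have "?\<delta> ^ (2 ^ (3 * t + 4)) = ((?\<delta> ^ (2 ^ (t + 2))) ^ (2 ^ (t + 2))) ^ (2 ^ t)"
    unfolding power_mult[symmetric] by simp
  also have "\<dots> \<le> (cmod (form_avg F1) ^ (2 ^ (t + 2))) ^ (2 ^ t)" by (intro power_mono F1) auto
  also have "\<dots> \<le> cmod (form_avg F2) ^ (2 ^ t)" by (intro power_mono F2) auto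
  also have "\<dots> \<le> ?X" by (rule form_avg_box_corr[OF t A(2)])
  finally have X: "?\<delta> ^ (2 ^ (3 * t + 4)) \<le> ?X" .
  have "(?\<delta> / ?K) ^ (2 ^ (3 * t + 4)) = ?\<delta> ^ (2 ^ (3 * t + 4)) / ?K ^ (2 ^ (3 * t + 4))" by (rule power_divide)
  also have "\<dots> \<le> ?X / ?K"
  proof (rule frac_le[OF _ X])
    show "?K \<le> ?K ^ (2 ^ (3 * t + 4))" using K1 by (intro self_le_power) auto
  qed (use K1 in auto)
  finally have "((?\<delta> / ?K) ^ (2 ^ (3 * t + 4))) ^ ?N \<le> (?X / ?K) ^ ?N" using K1 by (intro power_mono) auto
  also have "\<dots> \<le> Re (expect (vpow t V) (box_corr V t (A j)))"
    using ms.multilinear_system[OF Rel j(1)] .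
  also have "\<dots> \<le> ?Y" unfolding A(3) by (rule complex_Re_le_cmod)
  finally have "(((?\<delta> / ?K) ^ (2 ^ (3 * t + 4))) ^ ?N) ^ (2 ^ t) \<le> ?Y ^ (2 ^ t)"
    using K1 by (intro power_mono) auto
  also have "\<dots> \<le> Re (U_avg V t H)" by (rule expect_box_corr_deriv_avg[OF V t H(1)])
  also have "\<dots> \<le> cmod (form_avg (F(j := dual_fun V t H)))" unfolding H(2) by (rule complex_Re_le_cmod)
  finally have "(?\<delta> / ?K) ^ (2 ^ (3 * t + 4) * ?N * 2 ^ t) \<le> cmod (form_avg (F(j := dual_fun V t H)))"
    by (simp only: power_mult)
  moreover have "2 ^ (3 * t + 4) * ?N * 2 ^ t = 2 ^ (4 * t + 4) * ?N"
  proof -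
    have "(2::nat) ^ (4 * t + 4) = 2 ^ (3 * t + 4) * 2 ^ t" by (simp add: power_add[symmetric])
    then show ?thesis by (simp only: mult_ac)
  qed
  ultimately show ?thesis using H(1) by metis
qed

text \<open>A common exponent for single replacements at all orders up to \<open>k\<close>. It is at
  least twice the exponent of such a step, which keeps the divisor in \<open>gain\<close>
  intact.\<close>

definition loss :: nat where "loss = 2 ^ (4 * k + 5) * (2 * (1300 * k ^ 3 * (B + 1))) ^ k"

definition gain where "gain F = cmod (form_avg F) / (8 * real k)"

lemma gain_nonneg: "0 \<le> gain F"
  by (simp add: gain_def)

lemma gain_le: "gain F \<le> cmod (form_avg F)"
proof -
  have "cmod (form_avg F) / (8 * real k) \<le> cmod (form_avg F) / 1" using k by (intro divide_left_mono) auto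
  then show ?thesis by (simp add: gain_def)
qed

lemma gain_le1: "(\<And>i. i < k \<Longrightarrow> bounded1 V (F i)) \<Longrightarrow> gain F \<le> 1"
  by (rule order_trans[OF gain_le form_avg_le1])

text \<open>One spare factor \<open>gain F\<close> is at most \<open>1 / (8 k)\<close> and becomes
  the divisor in \<open>gain F'\<close>.\<close>

lemma gain_step:
  assumes F: "\<And>i. i < k \<Longrightarrow> bounded1 V (F i)" and e: "e > 0" "2 * e \<le> loss"
    and le: "gain F ^ e \<le> cmod (form_avg F')"
  shows "gain F ^ loss \<le> gain F'"
proof -
  have "gain F \<le> 1 / (8 * real k)" unfolding gain_def using form_avg_le1[OF F] by (intro divide_right_mono) auto
  have "gain F ^ loss \<le> gain F ^ (e + 1)"
    using e gain_nonneg gain_le1[OF F] by (intro power_decreasing) auto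
  also have "\<dots> = gain F ^ e * gain F" by simp
  also have "\<dots> \<le> cmod (form_avg F') * (1 / (8 * real k))"
    by (intro mult_mono le gain_nonneg) (use \<open>gain F \<le> 1 / (8 * real k)\<close> in auto)
  finally show ?thesis by (simp add: gain_def)
qed

lemma loss_ge:
  assumes "t \<le> k" shows "2 * (2 ^ (4 * t + 4) * (2 * (1300 * k ^ 3 * (B + 1))) ^ (t - 1)) \<le> loss"
proof -
  have "0 < 2 * (1300 * k ^ 3 * (B + 1))" using k by simp
  then have "1 \<le> 2 * (1300 * k ^ 3 * (B + 1))" by linarith
  then have "(2 * (1300 * k ^ 3 * (B + 1))) ^ (t - 1) \<le> (2 * (1300 * k ^ 3 * (B + 1))) ^ k"
    using assms by (intro power_increasing) auto
  moreover have "(2::nat) * 2 ^ (4 * t + 4) \<le> 2 ^ (4 * k + 5)"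
    using assms power_increasing[of "4 * t + 5" "4 * k + 5" "2::nat"] by (simp add: power_add)
  ultimately show ?thesis unfolding loss_def mult.assoc[symmetric] by (intro mult_mono) auto
qed

lemma loss_ge': "2 * 2 ^ k \<le> loss" "1 \<le> loss"
proof -
  have "0 < (2 * (1300 * k ^ 3 * (B + 1))) ^ k" using k by simp
  then have "1 \<le> (2 * (1300 * k ^ 3 * (B + 1))) ^ k" by linarith
  then have "(2::nat) ^ (4 * k + 5) * 1 \<le> loss" unfolding loss_def by (intro mult_left_mono) auto
  moreover have "(2::nat) ^ Suc k \<le> 2 ^ (4 * k + 5)" by (intro power_increasing) auto
  ultimately show "2 * 2 ^ k \<le> loss" by simp
  moreover have "(0::nat) < 2 ^ k" by simp
  ultimately show "1 \<le> loss" by linarith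
qed

text \<open>\<open>Inv\<close> describes families in which some positions have been replaced and
  others have not, so that the single step can be repeated in any order.\<close>

lemma sweep:
  assumes "Inv F"
    and step: "\<And>F j. Inv F \<Longrightarrow> j < k \<Longrightarrow> j \<noteq> i0 \<Longrightarrow>
      \<exists>g. bounded1 V g \<and> Inv (F(j := dual_fun V t g)) \<and> gain F ^ loss \<le> gain (F(j := dual_fun V t g))"
    and "finite D" "D \<subseteq> {..<k} - {i0}"
  shows "\<exists>G. Inv G \<and> G i0 = F i0 \<and> (\<forall>i\<in>D. \<exists>g. bounded1 V g \<and> G i = dual_fun V t g) \<and> gain F ^ (loss ^ card D) \<le> gain G"
  using assms(3,4)
proof (induction D rule: finite_induct)
  case empty
  then show ?case using assms(1) by (intro exI[of _ F]) simp
next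
  case (insert j D)
  then obtain G where G: "Inv G" "G i0 = F i0" "\<forall>i\<in>D. \<exists>g. bounded1 V g \<and> G i = dual_fun V t g"
    "gain F ^ (loss ^ card D) \<le> gain G" by auto
  from insert obtain g where g: "bounded1 V g" "Inv (G(j := dual_fun V t g))" "gain G ^ loss \<le> gain (G(j := dual_fun V t g))"
    using step[OF G(1), of j] by auto
  have "gain F ^ (loss ^ card (insert j D)) = (gain F ^ (loss ^ card D)) ^ loss"
    using insert by (simp add: power_mult[symmetric] mult.commute)
  also have "\<dots> \<le> gain G ^ loss" by (intro power_mono G(4)) (simp add: gain_nonneg)
  finally have "gain F ^ (loss ^ card (insert j D)) \<le> gain (G(j := dual_fun V t g))" using g(3) by linarith
  moreover have "(G(j := dual_fun V t g)) i0 = F i0" using insert G(2) by auto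
  moreover have "\<forall>i\<in>insert j D. \<exists>g'. bounded1 V g' \<and> (G(j := dual_fun V t g)) i = dual_fun V t g'"
    using g(1) G(3) by auto
  ultimately show ?case using g(2) by blast
qed

text \<open>From order \<open>k - 1\<close> on, each of the other functions can be given a direction
  of its own.\<close>

lemma class_map: "j < k \<Longrightarrow> k - 1 \<le> t \<Longrightarrow> \<exists>c. inj_on c ({..<k} - {j}) \<and> c ` ({..<k} - {j}) \<subseteq> {..<t}"
  by (intro exI[of _ "\<lambda>i. if i < j then i else i - 1"] conjI) (auto simp: inj_on_def split: if_splits)

lemma form_avg_control_raw:
  assumes i0: "i0 < k" and t: "t > 0" "k - 1 \<le> t" and F: "\<And>i. i < k \<Longrightarrow> bounded1 V (F i)"
  shows "cmod (form_avg F) ^ (2 ^ t) \<le> Re (U_avg V t (F i0))"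
proof -
  obtain c where "inj_on c ({..<k} - {i0})" "c ` ({..<k} - {i0}) \<subseteq> {..<t}" using class_map[OF i0 t(2)] by blast
  then show ?thesis using F by (intro form_avg_control[OF i0 t(1), of "{..<k} - {i0}" c]) auto
qed

text \<open>All other functions may be raw here, one for each of the \<open>k - 1\<close>
  directions.\<close>

lemma top_step:
  assumes k1: "k > 1" and j: "j < k" and F: "\<And>i. i < k \<Longrightarrow> bounded1 V (F i)"
  shows "\<exists>g. bounded1 V g \<and> gain F ^ loss \<le> gain (F(j := dual_fun V (k - 1) g))"
proof -
  obtain c where c: "inj_on c ({..<k} - {j})" "c ` ({..<k} - {j}) \<subseteq> {..<k - 1}" using class_map[OF j order_refl] by blast
  obtain H where H: "bounded1 V H" "\<And>t'. form_avg (F(j := dual_fun V t' H)) = U_avg V t' H"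
    "cmod (form_avg F) ^ (2 ^ (k - 1 + 1)) \<le> Re (U_avg V (k - 1) H)"
    using dual_gain[OF j, of "k - 1" F "{..<k} - {j}" c] F c k1 by auto
  have "gain F ^ (2 ^ k) \<le> cmod (form_avg F) ^ (2 ^ k)" by (intro power_mono gain_le gain_nonneg)
  also have "\<dots> \<le> cmod (form_avg (F(j := dual_fun V (k - 1) H)))"
    unfolding H(2) using H(3) k1 complex_Re_le_cmod[of "U_avg V (k - 1) H"] by simp
  finally have "gain F ^ loss \<le> gain (F(j := dual_fun V (k - 1) H))"
    by (intro gain_step[where e = "2 ^ k"] F loss_ge') auto
  then show ?thesis using H(1) by blast
qed

text \<open>\<open>m\<close> is the number of levels below \<open>k - 1\<close>, and
  \<open>\<tau> + n\<close> is the current order. The case \<open>m = 0\<close> turns raw functions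
  into dual functions of order \<open>k - 1\<close>, hence \<open>m + 1\<close> sweeps of
  \<open>k - 1\<close> replacements each.\<close>

lemma descent:
  assumes i0: "i0 < k" and \<tau>: "\<tau> > 0" and F: "\<And>i. i < k \<Longrightarrow> bounded1 V (F i)"
    and Rel: "\<And>t. \<tau> \<le> t \<Longrightarrow> Rel (t - 1) \<subseteq> {0}"
  shows "\<tau> + n = k - 1 - m \<Longrightarrow> k > 1 \<Longrightarrow> \<exists>G. G i0 = F i0 \<and> (\<forall>i<k. i \<noteq> i0 \<longrightarrow> (\<exists>g. bounded1 V g \<and> G i = dual_fun V (\<tau> + n) g)) \<and>
    gain F ^ (loss ^ ((m + 1) * (k - 1))) \<le> gain G"
proof (induction m arbitrary: n)
  case 0
  have card: "card ({..<k} - {i0}) = k - 1" using i0 by simp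
  define Inv where "Inv G \<longleftrightarrow> (\<forall>i<k. bounded1 V (G i))" for G :: "nat \<Rightarrow> 'a \<Rightarrow> complex"
  have "\<exists>g. bounded1 V g \<and> Inv (G(j := dual_fun V (k - 1) g)) \<and> gain G ^ loss \<le> gain (G(j := dual_fun V (k - 1) g))"
    if G: "Inv G" and j: "j < k" for G j
  proof -
    obtain g where "bounded1 V g" "gain G ^ loss \<le> gain (G(j := dual_fun V (k - 1) g))"
      using top_step[OF 0(2) j, of G] G unfolding Inv_def by blast
    then show ?thesis using bounded1_dual_fun[OF V] G unfolding Inv_def by (intro exI[of _ g]) auto
  qed
  then obtain G where "G i0 = F i0" "\<forall>i\<in>{..<k} - {i0}. \<exists>g. bounded1 V g \<and> G i = dual_fun V (k - 1) g"
    "gain F ^ (loss ^ card ({..<k} - {i0})) \<le> gain G"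
    using sweep[of Inv F i0 "k - 1" "{..<k} - {i0}"] F unfolding Inv_def by blast
  then show ?case using 0 unfolding card by (intro exI[of _ G]) simp
next
  case (Suc m)
  have card: "card ({..<k} - {i0}) = k - 1" using i0 by simp
  let ?t = "\<tau> + n"
  obtain G where G: "G i0 = F i0" "\<And>i. i < k \<Longrightarrow> i \<noteq> i0 \<Longrightarrow> \<exists>g. bounded1 V g \<and> G i = dual_fun V (Suc ?t) g"
    "gain F ^ (loss ^ ((m + 1) * (k - 1))) \<le> gain G"
  proof -
    have "\<tau> + Suc n = k - 1 - m" using Suc.prems \<tau> by arith
    from Suc.IH[OF this Suc.prems(2)] show ?thesis using that unfolding add_Suc_right by blast
  qed
  define Inv where "Inv G \<longleftrightarrow> G i0 = F i0 \<and> (\<forall>i<k. i \<noteq> i0 \<longrightarrow> (\<exists>g. bounded1 V g \<and> (G i = dual_fun V ?t g \<or> G i = dual_fun V (Suc ?t) g)))"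
    for G :: "nat \<Rightarrow> 'a \<Rightarrow> complex"
  have bd: "bounded1 V (G i)" if "Inv G" "i < k" for G i
    using that F bounded1_dual_fun[OF V] unfolding Inv_def by (cases "i = i0") metis+
  have tk: "?t \<le> k" "?t > 0" using Suc.prems \<tau> by auto
  have step: "\<exists>g. bounded1 V g \<and> Inv (G(j := dual_fun V ?t g)) \<and> gain G ^ loss \<le> gain (G(j := dual_fun V ?t g))"
    if G: "Inv G" and j: "j < k" "j \<noteq> i0" for G j
  proof -
    have "k ^ 3 > 0" using k by simp
    then have pos: "0 < 2 ^ (4 * ?t + 4) * (2 * (1300 * k ^ 3 * (B + 1))) ^ (?t - 1)" by simp
    have "\<exists>g. bounded1 V g \<and> (cmod (form_avg G) / (8 * real k)) ^ (2 ^ (4 * ?t + 4) * (2 * (1300 * k ^ 3 * (B + 1))) ^ (?t - 1))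
      \<le> cmod (form_avg (G(j := dual_fun V ?t g)))"
      using G F[OF i0] tk(2) unfolding Inv_def by (intro level_step[OF i0 j _ Rel]) auto
    then obtain g where g: "bounded1 V g" "gain G ^ (2 ^ (4 * ?t + 4) * (2 * (1300 * k ^ 3 * (B + 1))) ^ (?t - 1))
      \<le> cmod (form_avg (G(j := dual_fun V ?t g)))" unfolding gain_def by blast
    have "gain G ^ loss \<le> gain (G(j := dual_fun V ?t g))"
      by (rule gain_step[OF bd[OF G] pos loss_ge[OF tk(1)] g(2)])
    moreover have "Inv (G(j := dual_fun V ?t g))" using G g(1) j unfolding Inv_def by auto
    ultimately show ?thesis using g(1) by blast
  qed
  have "Inv G" unfolding Inv_def using G(1,2) by blast
  from sweep[of Inv G i0 ?t "{..<k} - {i0}", OF this step]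
  obtain G' where G': "G' i0 = G i0" "\<forall>i\<in>{..<k} - {i0}. \<exists>g. bounded1 V g \<and> G' i = dual_fun V ?t g"
    "gain G ^ (loss ^ card ({..<k} - {i0})) \<le> gain G'" by auto
  have "gain F ^ (loss ^ ((Suc m + 1) * (k - 1))) = (gain F ^ (loss ^ ((m + 1) * (k - 1)))) ^ (loss ^ (k - 1))"
  proof -
    have "(Suc m + 1) * (k - 1) = (m + 1) * (k - 1) + (k - 1)" by simp
    then show ?thesis by (simp only: power_add power_mult)
  qed
  also have "\<dots> \<le> gain G ^ (loss ^ (k - 1))" by (intro power_mono G(3)) (simp add: gain_nonneg)
  also have "\<dots> \<le> gain G'" using G'(3) unfolding card .
  finally show ?case using G'(1,2) G(1) by auto
qed

theorem gowers_control_weak: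
  assumes i0: "i0 < k" and \<tau>: "\<tau> > 0" and F: "\<And>i. i < k \<Longrightarrow> bounded1 V (F i)"
    and Rel: "\<And>t. \<tau> \<le> t \<Longrightarrow> Rel (t - 1) \<subseteq> {0}"
  shows "gain F ^ (loss ^ (k * k) * 2 ^ \<tau>) \<le> Re (U_avg V \<tau> (F i0))"
proof -
  have g01: "0 \<le> gain F" "gain F \<le> 1" using gain_nonneg gain_le1[OF F] by auto
  have l1: "1 \<le> loss ^ e" for e using loss_ge'(2) by simp
  show ?thesis
  \<comment> \<open>For \<open>\<tau>\<close> at least \<open>k - 1\<close> the raw functions are
    controlled at once. The descent starts at order \<open>k - 1\<close> and is possible only for
    smaller \<open>\<tau>\<close>.\<close>
  proof (cases "k - 1 \<le> \<tau>")
    case True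
    have "gain F ^ (loss ^ (k * k) * 2 ^ \<tau>) \<le> gain F ^ (2 ^ \<tau>)" using g01 l1 by (intro power_decreasing) auto
    also have "\<dots> \<le> cmod (form_avg F) ^ (2 ^ \<tau>)" by (intro power_mono gain_le g01)
    also have "\<dots> \<le> Re (U_avg V \<tau> (F i0))" by (rule form_avg_control_raw[OF i0 \<tau> True F])
    finally show ?thesis .
  next
    case False
    then obtain G where G: "G i0 = F i0" "\<And>i. i < k \<Longrightarrow> i \<noteq> i0 \<Longrightarrow> \<exists>g. bounded1 V g \<and> G i = dual_fun V \<tau> g"
      "gain F ^ (loss ^ ((k - 1 - \<tau> + 1) * (k - 1))) \<le> gain G"
    proof -
      have "\<tau> + 0 = k - 1 - (k - 1 - \<tau>)" "k > 1" using False by auto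
      from descent[of i0 \<tau> F 0, OF i0 \<tau> F Rel this] show ?thesis using that by auto
    qed
    have "gain F ^ (loss ^ (k * k) * 2 ^ \<tau>) = (gain F ^ (loss ^ (k * k))) ^ (2 ^ \<tau>)" by (rule power_mult)
    also have "\<dots> \<le> (gain F ^ (loss ^ ((k - 1 - \<tau> + 1) * (k - 1)))) ^ (2 ^ \<tau>)"
      using g01 False loss_ge'(2) by (intro power_mono power_decreasing power_increasing mult_le_mono) auto
    also have "\<dots> \<le> gain G ^ (2 ^ \<tau>)" by (intro power_mono G(3)) (use g01 in auto)
    also have "\<dots> \<le> cmod (form_avg G) ^ (2 ^ \<tau>)" by (intro power_mono gain_le gain_nonneg)
    also have "\<dots> \<le> Re (U_avg V \<tau> (G i0))"
    proof (rule form_avg_control[OF i0 \<tau>, of "{}" "\<lambda>_. 0"])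
      fix i assume "i < k" "i \<noteq> i0"
      then show "cube_rep V \<tau> (\<lambda>_. 1) (G i)" using G(2) cube_rep_dual_fun[OF V] by metis
    qed auto
    finally show ?thesis unfolding G(1) .
  qed
qed

end

section \<open>Powers of a system of linear forms\<close>

lemma lform_apply: "lform a d Y m = lform a d (\<lambda>j. Y j m)"
  by (simp add: lform_def zmul_fun sum_fun_apply)

lemma card_vpow: "finite V \<Longrightarrow> card (vpow n V) = card V ^ n"
  using bij_betw_same_card[OF vpow_bij[of n V]] by (simp add: card_PiE)

lemma expect_vpow_transpose: "expect (vpow t (vpow m V)) f = expect (vpow m (vpow t V)) (\<lambda>Y. f (\<lambda>l r. Y r l))"
proof (rule expect_reindex, rule bij_betw_byWitness[where f' = "\<lambda>Y l r. Y r l"])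
  have "(\<lambda>Y l r. Y r l) ` vpow m (vpow t V) \<subseteq> vpow t (vpow m V)" for m t
  proof (clarsimp simp: vpow_def[of t] vpow_def[of m] fun_eq_iff)
    fix Y :: "nat \<Rightarrow> nat \<Rightarrow> 'a" and l r assume "\<forall>j<m. (\<forall>j'<t. Y j j' \<in> V) \<and> (\<forall>j'\<ge>t. Y j j' = 0)" "\<forall>j\<ge>m. \<forall>x. Y j x = 0" "t \<le> l"
    then show "Y r l = 0" by (cases "r < m") auto
  qed
  from this this show "(\<lambda>Y l r. Y r l) ` vpow m (vpow t V) \<subseteq> vpow t (vpow m V)" "(\<lambda>Y l r. Y r l) ` vpow t (vpow m V) \<subseteq> vpow m (vpow t V)" .
qed simp_all

lemma U_avg_vpow:
  assumes V: "fin_subgroup V"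
  shows "U_avg (vpow m V) t (\<lambda>y. \<Prod>r<m. f (y r)) = U_avg V t f ^ m"
proof -
  have "box t (\<lambda>y. \<Prod>r<m. f (y r)) h x = (\<Prod>r<m. box t f (\<lambda>l. h l r) (x r))" for h and x :: "nat \<Rightarrow> 'a"
  proof -
    have "box t (\<lambda>y. f (y r)) h x = box t f (\<lambda>l. h l r) (x r)" for r
      by (rule box_hom[where \<psi> = "\<lambda>y. y r"]) simp
    then show ?thesis by (simp add: box_prod)
  qed
  then have "U_avg (vpow m V) t (\<lambda>y. \<Prod>r<m. f (y r))
    = expect (vpow m V) (\<lambda>x. expect (vpow m (vpow t V)) (\<lambda>Y. \<Prod>r<m. box t f (Y r) (x r)))"
    unfolding U_avg_def expect_vpow_transpose[of t m V] by simp
  also have "\<dots> = expect (vpow m V) (\<lambda>x. \<Prod>r<m. expect (vpow t V) (\<lambda>h. box t f h (x r)))"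
    by (rule expect_cong, rule expect_vpow_prod[OF fin_subgroup_vpow[OF V], where f = "\<lambda>r h. box t f h (_ r)"])
  also have "\<dots> = (\<Prod>r<m. expect V (\<lambda>x. expect (vpow t V) (\<lambda>h. box t f h x)))"
    by (rule expect_vpow_prod[OF V, where f = "\<lambda>r x. expect (vpow t V) (\<lambda>h. box t f h x)"])
  finally show ?thesis by (simp add: U_avg_def)
qed

lemma (in dual_pair) dual_pair_vpow:
  "dual_pair (vpow n V) (vpow n Q) (\<lambda>x \<alpha>. \<Prod>m<n. pair (x m) (\<alpha> m))"
proof
  show "fin_subgroup (vpow n V)" "fin_subgroup (vpow n Q)" using V Q by (simp_all add: fin_subgroup_vpow)
  note VQ = vpow_nth[OF V] vpow_nth[OF Q]
  show "(\<Prod>m<n. pair ((x + y) m) (\<alpha> m)) = (\<Prod>m<n. pair (x m) (\<alpha> m)) * (\<Prod>m<n. pair (y m) (\<alpha> m))"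
    if "x \<in> vpow n V" "y \<in> vpow n V" "\<alpha> \<in> vpow n Q" for x y \<alpha>
    using that by (simp add: prod.distrib[symmetric] pair_add_left VQ)
  show "(\<Prod>m<n. pair (x m) ((\<alpha> + \<beta>) m)) = (\<Prod>m<n. pair (x m) (\<alpha> m)) * (\<Prod>m<n. pair (x m) (\<beta> m))"
    if "x \<in> vpow n V" "\<alpha> \<in> vpow n Q" "\<beta> \<in> vpow n Q" for x \<alpha> \<beta>
    using that by (simp add: prod.distrib[symmetric] pair_add_right VQ)
  show "cmod (\<Prod>m<n. pair (x m) (\<alpha> m)) = 1" if "x \<in> vpow n V" "\<alpha> \<in> vpow n Q" for x \<alpha>
    using that by (simp add: prod_norm[symmetric] pair_unit VQ)
  have of_bool_prod: "(\<Prod>m<n. of_bool (P m)) = (of_bool (\<forall>m<n. P m) :: complex)" for P :: "nat \<Rightarrow> bool"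
    by (induction n) (auto simp: less_Suc_eq)
  have zero: "(\<forall>m<n. x m = 0) \<longleftrightarrow> x = 0" if "x \<in> vpow n X" for x :: "nat \<Rightarrow> 'c::ab_group_add" and X
    using vpowD(2)[OF that] by (auto simp: fun_eq_iff) (metis not_less)
  show "expect (vpow n V) (\<lambda>x. \<Prod>m<n. pair (x m) (\<alpha> m)) = of_bool (\<alpha> = 0)" if "\<alpha> \<in> vpow n Q" for \<alpha>
  proof -
    have "expect (vpow n V) (\<lambda>x. \<Prod>m<n. pair (x m) (\<alpha> m)) = (\<Prod>m<n. expect V (\<lambda>x. pair x (\<alpha> m)))"
      by (rule expect_vpow_prod[OF V, where f = "\<lambda>m x. pair x (\<alpha> m)"])
    also have "\<dots> = (\<Prod>m<n. of_bool (\<alpha> m = 0))" using that by (intro prod.cong refl orth_left VQ)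
    finally show ?thesis unfolding of_bool_prod zero[OF that] .
  qed
  show "(\<Sum>\<alpha>\<in>vpow n Q. \<Prod>m<n. pair (x m) (\<alpha> m)) = of_nat (card (vpow n V)) * of_bool (x = 0)" if "x \<in> vpow n V" for x
  proof -
    have "(\<Sum>\<alpha>\<in>vpow n Q. \<Prod>m<n. pair (x m) (\<alpha> m)) = (\<Prod>m<n. \<Sum>\<alpha>\<in>Q. pair (x m) \<alpha>)"
      using sum_vpow[OF fin_subgroupD(1)[OF Q], of "\<lambda>m. pair (x m)"] by simp
    also have "\<dots> = (\<Prod>m<n. of_nat (card V) * of_bool (x m = 0))" using that by (intro prod.cong refl orth_right VQ)
    also have "\<dots> = of_nat (card V) ^ n * of_bool (x = 0)" unfolding prod.distrib of_bool_prod zero[OF that] by simp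
    finally show ?thesis using card_vpow[OF fin_subgroupD(1)[OF V]] by simp
  qed
qed

text \<open>Geometric growth of \<open>(A / u) ^ m\<close> would exceed any constant
  \<open>K\<close>.\<close>

lemma power_le_imp_base_le:
  fixes A u :: real
  assumes "0 \<le> u" and le: "\<And>m. A ^ m \<le> K * u ^ m" shows "A \<le> u"
proof (rule ccontr)
  assume "\<not> A \<le> u"
  then have "u < A" by simp
  show False
  proof (cases "u = 0")
    case True
    then show False using le[of 1] \<open>u < A\<close> by simp
  next
    case False
    then have u: "u > 0" using assms(1) by simp
    then have "1 < A / u" using \<open>u < A\<close> by simp
    from real_arch_pow[OF this, of K] obtain m where "K < (A / u) ^ m" by blast
    then show False using le[of m] u by (simp add: power_divide field_simps)
  qed
qed

context form_system
begin

text \<open>Serves twice: for the passage from the prime field to its \<open>n\<close>-th power, and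
  for tensor powers of functions. As \<open>k\<close> and \<open>B\<close> are unchanged, so is
  \<open>loss\<close>.\<close>

lemma form_system_vpow: "form_system (vpow m V) (vpow m Q) (\<lambda>x \<alpha>. \<Prod>r<m. pair (x r) (\<alpha> r)) k d B a J"
proof (intro form_system.intro dual_pair_vpow form_system_axioms.intro)
  show "\<alpha> = 0" if i: "i < k" and \<alpha>: "\<alpha> \<in> vpow m Q" and z: "\<And>j. j \<in> J \<Longrightarrow> zmul (a i j) \<alpha> = 0" for i \<alpha>
  proof -
    have "\<alpha> r = 0" for r
    proof (rule J_faithful[OF i vpow_nth[OF Q \<alpha>]])
      fix j assume "j \<in> J"
      from fun_cong[OF z[OF this], of r] show "zmul (a i j) (\<alpha> r) = 0" by (simp add: zmul_fun)
    qed
    then show ?thesis by (simp add: fun_eq_iff)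
  qed
  show "\<exists>\<sigma>. (\<forall>v\<in>vpow m V. \<sigma> v \<in> vpow d (vpow m V) \<and> lform (a i) d (\<sigma> v) = v \<and> (i' \<noteq> i \<longrightarrow> lform (a i') d (\<sigma> v) = 0)) \<and>
      (\<forall>v\<in>vpow m V. \<forall>v'\<in>vpow m V. \<sigma> (v - v') = \<sigma> v - \<sigma> v')" if i: "i < k" "i' < k" for i i'
  proof -
    obtain \<sigma> where \<sigma>: "\<And>v. v \<in> V \<Longrightarrow> \<sigma> v \<in> vpow d V" "\<And>v. v \<in> V \<Longrightarrow> lform (a i) d (\<sigma> v) = v"
      "\<And>v. v \<in> V \<Longrightarrow> i' \<noteq> i \<Longrightarrow> lform (a i') d (\<sigma> v) = 0" "\<And>v v'. v \<in> V \<Longrightarrow> v' \<in> V \<Longrightarrow> \<sigma> (v - v') = \<sigma> v - \<sigma> v'"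
      using separating_section[OF i] by blast
    have \<sigma>0: "\<sigma> 0 = 0" using \<sigma>(4)[of 0 0] fin_subgroupD(2)[OF V] by simp
    let ?\<sigma> = "\<lambda>v j r. \<sigma> (v r) j"
    show ?thesis
    proof (intro exI[of _ ?\<sigma>] conjI ballI impI)
      fix v assume v: "v \<in> vpow m V"
      have vV: "v r \<in> V" for r by (rule vpow_nth[OF V v])
      show "?\<sigma> v \<in> vpow d (vpow m V)"
        unfolding vpow_def[of d] vpow_def[of m]
        using \<sigma>(1)[OF vV] vpowD(2)[OF v] \<sigma>0 by (auto simp: vpow_def fun_eq_iff)
      show "lform (a i) d (?\<sigma> v) = v" by (rule ext) (simp add: lform_apply \<sigma>(2)[OF vV])
      show "lform (a i') d (?\<sigma> v) = 0" if "i' \<noteq> i" by (rule ext) (simp add: lform_apply \<sigma>(3)[OF vV that])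
    next
      fix v v' assume "v \<in> vpow m V" "v' \<in> vpow m V"
      then show "?\<sigma> (v - v') = ?\<sigma> v - ?\<sigma> v'" by (auto simp: fun_eq_iff \<sigma>(4) vpow_nth[OF V])
    qed
  qed
qed (use k a_bound J in auto)

lemma Rel_vpow: "\<beta> \<in> form_system.Rel (vpow m Q) k d a J r \<Longrightarrow> (\<lambda>i. \<beta> i n) \<in> Rel r"
proof (induction r arbitrary: \<beta>)
  interpret T: form_system "vpow m V" "vpow m Q" "\<lambda>x \<alpha>. \<Prod>r<m. pair (x r) (\<alpha> r)" k d B a J by (rule form_system_vpow)
  have in_Q: "(\<lambda>i. \<beta> i n) \<in> vpow k Q" if "\<beta> \<in> vpow k (vpow m Q)" for \<beta>
    unfolding vpow_def[of k Q] using vpowD(2)[OF that] vpow_nth[OF Q vpowD(1)[OF that]] by simp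
  {
    case 0
    then have "(\<Sum>i<k. zmul (a i j) (\<beta> i)) n = 0" if "j < d" for j using that by simp
    then show ?case using 0 in_Q by (simp add: sum_fun_apply zmul_fun)
  next
    case (Suc r)
    have "(\<lambda>i. zmul (a i j) (\<beta> i n)) \<in> Rel r" if "j \<in> J" for j
      using Suc.IH[of "\<lambda>i. zmul (a i j) (\<beta> i)"] Suc.prems that by (simp add: zmul_fun)
    then show ?case using Suc.prems in_Q by simp
  }
qed

lemma Rel_vpow_trivial:
  assumes "Rel r \<subseteq> {0}" shows "form_system.Rel (vpow m Q) k d a J r \<subseteq> {0}"
proof
  fix \<beta> assume "\<beta> \<in> form_system.Rel (vpow m Q) k d a J r"
  from Rel_vpow[OF this] assms have "(\<lambda>i. \<beta> i n) = 0" for n by blast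
  then have "\<beta> i n = 0" for i n by (metis zero_fun_apply)
  then show "\<beta> \<in> {0}" by (simp add: fun_eq_iff)
qed

lemma form_avg_vpow: "form_system.form_avg (vpow m V) k d a (\<lambda>i y. \<Prod>r<m. F i (y r)) = form_avg F ^ m"
proof -
  interpret T: form_system "vpow m V" "vpow m Q" "\<lambda>x \<alpha>. \<Prod>r<m. pair (x r) (\<alpha> r)" k d B a J by (rule form_system_vpow)
  have "T.form_avg (\<lambda>i y. \<Prod>r<m. F i (y r)) = expect (vpow m (vpow d V)) (\<lambda>Y. \<Prod>r<m. \<Prod>i<k. F i (lform (a i) d (Y r)))"
    unfolding T.form_avg_def expect_vpow_transpose[of d m V] by (intro expect_cong) (simp only: lform_apply[of _ d "\<lambda>l r. _ r l"] prod.swap[of _ "{..<k}"])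
  also have "\<dots> = (\<Prod>r<m. form_avg F)"
    unfolding form_avg_def by (rule expect_vpow_prod[OF fin_subgroup_vpow[OF V], where f = "\<lambda>r x. \<Prod>i<k. F i (lform (a i) d x)"])
  finally show ?thesis by simp
qed

text \<open>The constant factor in the weak bound disappears when it is applied to tensor powers.\<close>

theorem gowers_control_strong:
  assumes i0: "i0 < k" and \<tau>: "\<tau> > 0" and F: "\<And>i. i < k \<Longrightarrow> bounded1 V (F i)"
    and Rel: "\<And>t. \<tau> \<le> t \<Longrightarrow> Rel (t - 1) \<subseteq> {0}"
  shows "cmod (form_avg F) ^ (loss ^ (k * k) * 2 ^ \<tau>) \<le> Re (U_avg V \<tau> (F i0))"
proof -
  let ?N = "loss ^ (k * k) * 2 ^ \<tau>"
  obtain u where u: "u \<ge> 0" "U_avg V \<tau> (F i0) = complex_of_real u" using U_avg_nonneg[OF V \<tau>] by blast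
  have "(cmod (form_avg F) ^ ?N) ^ m \<le> (8 * real k) ^ ?N * u ^ m" for m
  proof -
    interpret T: form_system "vpow m V" "vpow m Q" "\<lambda>x \<alpha>. \<Prod>r<m. pair (x r) (\<alpha> r)" k d B a J by (rule form_system_vpow)
    let ?F = "\<lambda>i y. \<Prod>r<m. F i (y r)"
    have "bounded1 (vpow m V) (?F i)" if "i < k" for i
      using F[OF that] vpow_nth[OF V] by (auto simp: bounded1_def prod_norm[symmetric] intro!: prod_le_1)
    then have "T.gain ?F ^ ?N \<le> Re (U_avg (vpow m V) \<tau> (?F i0))"
      by (intro T.gowers_control_weak[OF i0 \<tau>] Rel_vpow_trivial Rel)
    \<comment> \<open>Both the average and \<open>U_avg\<close> of the tensor power are
      \<open>m\<close>-th powers, whereas the divisor \<open>8 k\<close> occurs only once.\<close>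
    then have "(cmod (form_avg F) ^ m / (8 * real k)) ^ ?N \<le> u ^ m"
      unfolding T.gain_def form_avg_vpow U_avg_vpow[OF V] u(2) norm_power of_real_power[symmetric] Re_complex_of_real .
    then have "(cmod (form_avg F) ^ m) ^ ?N \<le> (8 * real k) ^ ?N * u ^ m"
      using k by (simp add: power_divide pos_divide_le_eq mult.commute)
    then show ?thesis by (simp only: power_mult[symmetric] mult.commute[of m])
  qed
  then have "cmod (form_avg F) ^ ?N \<le> u" by (rule power_le_imp_base_le[OF u(1)])
  then show ?thesis by (simp add: u(2))
qed

end

section \<open>Roots of unity\<close>

text \<open>The preceding results concern finite subgroups of a type in class \<open>ab_group_add\<close>. The circle contains
  the groups of all orders \<open>p\<close>, so that \<open>p\<close> need not be encoded in a type.\<close>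

typedef circle = "{z::complex. cmod z = 1}"
  by (rule exI[of _ 1]) simp

instantiation circle :: ab_group_add
begin

definition "0 = Abs_circle 1"
definition "x + y = Abs_circle (Rep_circle x * Rep_circle y)"
definition "- x = Abs_circle (cnj (Rep_circle x))"
definition "x - y = Abs_circle (Rep_circle x * cnj (Rep_circle y))"

instance
proof
  have Rep: "cmod (Rep_circle x) = 1" for x using Rep_circle[of x] by simp
  have cancel: "cnj (Rep_circle x) * Rep_circle x = 1" for x
    using Rep[of x] by (metis complex_norm_square mult.commute of_real_1 power_one)
  fix x y z :: circle
  show "x + y + z = x + (y + z)"
    by (simp add: plus_circle_def Abs_circle_inverse norm_mult Rep mult.assoc)
  show "x + y = y + x" by (simp add: plus_circle_def mult.commute)
  show "0 + x = x" by (simp add: zero_circle_def plus_circle_def Abs_circle_inverse Rep_circle_inverse)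
  show "- x + x = 0" by (simp add: zero_circle_def plus_circle_def uminus_circle_def Abs_circle_inverse Rep cancel)
  show "x - y = x + - y"
    by (simp add: minus_circle_def plus_circle_def uminus_circle_def Abs_circle_inverse Rep)
qed

end

lemma cmod_Rep_circle: "cmod (Rep_circle x) = 1"
  using Rep_circle[of x] by simp

lemma Rep_circle_0: "Rep_circle 0 = 1"
  by (simp add: zero_circle_def Abs_circle_inverse)

lemma Rep_circle_add: "Rep_circle (x + y) = Rep_circle x * Rep_circle y"
  by (simp add: plus_circle_def Abs_circle_inverse norm_mult cmod_Rep_circle)

lemma Rep_circle_eq_1_iff: "Rep_circle x = 1 \<longleftrightarrow> x = 0"
  by (metis Rep_circle_0 Rep_circle_inject)

definition unity_root :: "nat \<Rightarrow> int \<Rightarrow> circle" where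
  "unity_root p c = Abs_circle (cis (2 * pi * real_of_int c / real p))"

lemma Rep_unity_root: "Rep_circle (unity_root p c) = cis (2 * pi * real_of_int c / real p)"
  by (simp add: unity_root_def Abs_circle_inverse)

lemma unity_root_0: "unity_root p 0 = 0"
  by (simp add: unity_root_def zero_circle_def)

lemma unity_root_add: "unity_root p (a + b) = unity_root p a + unity_root p b"
  by (simp add: Rep_circle_inject[symmetric] Rep_circle_add Rep_unity_root cis_mult add_divide_distrib distrib_left)

lemma unity_root_diff: "unity_root p (a - b) = unity_root p a - unity_root p b"
  using unity_root_add[of p "a - b" b] by simp

lemma unity_root_sum: "unity_root p (\<Sum>i\<in>I. f i) = (\<Sum>i\<in>I. unity_root p (f i))"
  by (induction I rule: infinite_finite_induct) (auto simp: unity_root_0 unity_root_add)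

lemma zmul_unity_root: "zmul c (unity_root p a) = unity_root p (c * a)"
proof -
  have "zmul c (unity_root p a) = unity_root p (int (nat c) * a - int (nat (- c)) * a)"
    unfolding zmul_def unity_root_sum[symmetric] unity_root_diff[symmetric] by simp
  also have "int (nat c) * a - int (nat (- c)) * a = c * a" by (cases "c \<ge> 0") auto
  finally show ?thesis .
qed

lemma unity_root_eq_0_iff:
  assumes "p > 0" shows "unity_root p a = 0 \<longleftrightarrow> int p dvd a"
proof -
  have mult: "unity_root p (int p * b) = 0" for b
  proof -
    have "cis (2 * pi * real_of_int b) = 1" by (rule cis_multiple_2pi) simp
    then show ?thesis using assms by (simp add: Rep_circle_eq_1_iff[symmetric] Rep_unity_root mult_ac)
  qed
  have a: "unity_root p a = unity_root p (a mod int p)"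
    using unity_root_add[of p "int p * (a div int p)" "a mod int p"] mult by simp
  define r where "r = nat (a mod int p)"
  have r: "a mod int p = int r" "r < p" using assms by (auto simp: r_def nat_less_iff)
  have "unity_root p (int r) = 0 \<longleftrightarrow> r = 0"
  proof
    assume "unity_root p (int r) = 0"
    then have "cis (2 * pi * real r / real p) = cis (2 * pi * real 0 / real p)"
      by (simp add: Rep_circle_eq_1_iff[symmetric] Rep_unity_root)
    then show "r = 0"
      using inj_onD[OF bij_betw_imp_inj_on[OF bij_betw_roots_unity[OF assms]]] r(2) assms by fastforce
  qed (simp add: unity_root_0)
  then show ?thesis unfolding a r(1) using r(1) by (auto simp: dvd_eq_mod_eq_0)
qed

lemma unity_root_eq_iff: "p > 0 \<Longrightarrow> unity_root p a = unity_root p b \<longleftrightarrow> a mod int p = b mod int p"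
  using unity_root_eq_0_iff[of p "a - b"] by (simp add: unity_root_diff mod_eq_dvd_iff)

definition unity_roots :: "nat \<Rightarrow> circle set" where
  "unity_roots p = unity_root p ` Fp p"

definition unity_index :: "nat \<Rightarrow> circle \<Rightarrow> int" where
  "unity_index p = the_inv_into (Fp p) (unity_root p)"

lemma bij_betw_unity_root: "p > 0 \<Longrightarrow> bij_betw (unity_root p) (Fp p) (unity_roots p)"
  unfolding unity_roots_def by (rule inj_on_imp_bij_betw) (auto simp: inj_on_def Fp_def unity_root_eq_iff)

lemma unity_root_in: "p > 0 \<Longrightarrow> unity_root p a \<in> unity_roots p"
  unfolding unity_roots_def by (rule image_eqI[of _ _ "a mod int p"]) (auto simp: unity_root_eq_iff Fp_def)

lemma unity_index_root: "p > 0 \<Longrightarrow> unity_index p (unity_root p a) = a mod int p"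
  unfolding unity_index_def
  by (rule the_inv_into_f_eq[OF bij_betw_imp_inj_on[OF bij_betw_unity_root]]) (auto simp: unity_root_eq_iff Fp_def)

lemma unity_rootsE:
  assumes "x \<in> unity_roots p" obtains a where "x = unity_root p a"
  using assms unfolding unity_roots_def by blast

lemma fin_subgroup_unity_roots: "p > 0 \<Longrightarrow> fin_subgroup (unity_roots p)"
  unfolding fin_subgroup_def
proof (intro conjI ballI)
  show "finite (unity_roots p)" by (simp add: unity_roots_def Fp_def)
  show "0 \<in> unity_roots p" if "p > 0" using unity_root_in[OF that, of 0] by (simp add: unity_root_0)
  show "x - y \<in> unity_roots p" if "p > 0" "x \<in> unity_roots p" "y \<in> unity_roots p" for x y
    using that by (auto elim!: unity_rootsE simp: unity_root_diff[symmetric] unity_root_in)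
qed

lemma card_unity_roots: "p > 0 \<Longrightarrow> card (unity_roots p) = p"
  using bij_betw_same_card[OF bij_betw_unity_root[of p]] by (simp add: Fp_def)

text \<open>In terms of exponents modulo \<open>p\<close> the pairing is multiplication, so that the
  group of roots is its own dual.\<close>

definition unity_pair :: "nat \<Rightarrow> circle \<Rightarrow> circle \<Rightarrow> complex" where
  "unity_pair p x \<alpha> = Rep_circle (zmul (unity_index p x) \<alpha>)"

lemma unity_pair: "p > 0 \<Longrightarrow> unity_pair p (unity_root p a) (unity_root p b) = Rep_circle (unity_root p (a * b))"
  unfolding unity_pair_def unity_index_root zmul_unity_root
  by (intro arg_cong[where f = Rep_circle]) (simp add: unity_root_eq_iff mod_mult_left_eq)

text \<open>Translation by \<open>unity_root p 1\<close> multiplies the average of the character by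
  the value of \<open>\<alpha>\<close>, so that it vanishes unless \<open>\<alpha> = 0\<close>.
  Symmetry of the pairing gives the second orthogonality relation.\<close>

lemma dual_pair_unity_roots:
  assumes p: "prime p" shows "dual_pair (unity_roots p) (unity_roots p) (unity_pair p)"
proof -
  have p0: "p > 0" using p prime_gt_0_nat by blast
  note C = fin_subgroup_unity_roots[OF p0]
  have sum: "expect (unity_roots p) (\<lambda>x. unity_pair p x \<alpha>) = of_bool (\<alpha> = 0)" if \<alpha>: "\<alpha> \<in> unity_roots p" for \<alpha>
  proof -
    obtain b where b: "\<alpha> = unity_root p b" using \<alpha> by (rule unity_rootsE)
    let ?S = "expect (unity_roots p) (\<lambda>x. unity_pair p x \<alpha>)"
    have "?S = expect (unity_roots p) (\<lambda>x. unity_pair p (x + unity_root p 1) \<alpha>)"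
      by (rule expect_translate[OF C unity_root_in[OF p0], symmetric])
    also have "\<dots> = expect (unity_roots p) (\<lambda>x. unity_pair p x \<alpha> * Rep_circle \<alpha>)"
      by (rule expect_cong) (auto elim!: unity_rootsE simp: b unity_root_add[symmetric] unity_pair[OF p0] distrib_right Rep_circle_add[symmetric])
    also have "\<dots> = ?S * Rep_circle \<alpha>" by (rule expect_cmult_right)
    finally have "?S * (Rep_circle \<alpha> - 1) = 0" by (simp add: right_diff_distrib)
    moreover have "?S = 1" if "\<alpha> = 0"
      unfolding that unity_pair_def using p0 by (simp add: Rep_circle_0 expect_def card_unity_roots)
    ultimately show ?thesis by (auto simp: Rep_circle_eq_1_iff)
  qed
  have sym: "unity_pair p x y = unity_pair p y x" if "x \<in> unity_roots p" "y \<in> unity_roots p" for x y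
    using that by (auto elim!: unity_rootsE simp: unity_pair[OF p0] mult.commute)
  have right: "unity_pair p x (\<alpha> + \<beta>) = unity_pair p x \<alpha> * unity_pair p x \<beta>" for x \<alpha> \<beta>
    by (simp add: unity_pair_def zmul_add_right Rep_circle_add)
  show ?thesis
  proof
    show "unity_pair p (x + y) \<alpha> = unity_pair p x \<alpha> * unity_pair p y \<alpha>"
      if "x \<in> unity_roots p" "y \<in> unity_roots p" "\<alpha> \<in> unity_roots p" for x y \<alpha>
      using that right sym fin_subgroupD(4)[OF C] by simp
    show "(\<Sum>\<alpha>\<in>unity_roots p. unity_pair p x \<alpha>) = of_nat (card (unity_roots p)) * of_bool (x = 0)" if x: "x \<in> unity_roots p" for x
    proof -
      have "(\<Sum>\<alpha>\<in>unity_roots p. unity_pair p x \<alpha>) = of_nat (card (unity_roots p)) * expect (unity_roots p) (\<lambda>\<alpha>. unity_pair p x \<alpha>)"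
        using p0 by (simp add: expect_def card_unity_roots)
      also have "expect (unity_roots p) (\<lambda>\<alpha>. unity_pair p x \<alpha>) = expect (unity_roots p) (\<lambda>\<alpha>. unity_pair p \<alpha> x)"
        by (rule expect_cong) (rule sym[OF x])
      finally show ?thesis unfolding sum[OF x] .
    qed
  qed (use C sum right in \<open>auto simp: unity_pair_def cmod_Rep_circle\<close>)
qed

section \<open>The system over the prime field and its relations\<close>

definition annihilator :: "nat \<Rightarrow> nat \<Rightarrow> (nat \<Rightarrow> nat \<Rightarrow> int) \<Rightarrow> nat set \<Rightarrow> (nat \<Rightarrow> circle) set" where
  "annihilator p k a J = {\<gamma> \<in> vpow k (unity_roots p). \<forall>j\<in>J. (\<Sum>i<k. zmul (a i j) (\<gamma> i)) = 0}"

text \<open>A rank argument by counting. A further column that cuts down the annihilator shrinks it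
  by a factor of at least \<open>p\<close>, which preserves the inequality in \<open>P\<close>;
  since the annihilator contains 0, this happens at most \<open>k\<close> times.\<close>

lemma few_columns_suffice:
  assumes p: "prime p"
  shows "\<exists>J\<subseteq>{..<d}. card J \<le> k \<and> annihilator p k a J = annihilator p k a {..<d}"
proof -
  have p0: "p > 0" and p1: "p > 1" using p prime_gt_0_nat prime_gt_1_nat by blast+
  note C = fin_subgroup_unity_roots[OF p0]
  define L where "L j \<gamma> = (\<Sum>i<k. zmul (a i j) (\<gamma> i))" for j and \<gamma> :: "nat \<Rightarrow> circle"
  have L_diff: "L j (\<gamma> - \<gamma>') = L j \<gamma> - L j \<gamma>'" for j \<gamma> \<gamma>'
    by (simp add: L_def zmul_diff_right sum_subtractf)
  have L_add: "L j (\<gamma> + \<gamma>') = L j \<gamma> + L j \<gamma>'" for j \<gamma> \<gamma>'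
    by (simp add: L_def zmul_add_right sum.distrib)
  have L_zmul: "L j (zmul c \<gamma>) = zmul c (L j \<gamma>)" for j c \<gamma>
    by (simp add: L_def zmul_fun zmul_zmul zmul_sum_right mult.commute)
  have K_def: "annihilator p k a J = {\<gamma> \<in> vpow k (unity_roots p). \<forall>j\<in>J. L j \<gamma> = 0}" for J
    by (simp add: annihilator_def L_def)
  have sub: "fin_subgroup (annihilator p k a J)" for J
    using fin_subgroup_vpow[OF C, of k] by (auto simp: K_def fin_subgroup_def L_diff) (simp add: L_def)
  define P where "P J \<longleftrightarrow> J \<subseteq> {..<d} \<and> p ^ card J * card (annihilator p k a J) \<le> p ^ k" for J
  have card_le: "card J \<le> k" if "P J" for J
  proof -
    have "p ^ card J * 1 \<le> p ^ card J * card (annihilator p k a J)"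
      using fin_subgroupD(6)[OF sub[of J]] by (intro mult_left_mono) auto
    then have "p ^ card J \<le> p ^ k" using that unfolding P_def mult_1_right by (elim conjE) (rule order_trans)
    then show ?thesis using p1 by simp
  qed
  have "P {}" by (simp add: P_def annihilator_def card_vpow fin_subgroupD[OF C] card_unity_roots[OF p0])
  then obtain J where J: "P J" "\<And>J'. P J' \<Longrightarrow> card J' \<le> card J"
  proof -
    have "\<forall>J. P J \<longrightarrow> card J < Suc k" using card_le by (simp add: less_Suc_eq_le)
    from ex_has_greatest_nat[OF \<open>P {}\<close> this] show ?thesis using that by blast
  qed
  have Jd: "J \<subseteq> {..<d}" using J(1) by (simp add: P_def)
  have "annihilator p k a J \<subseteq> annihilator p k a {..<d}"
  proof (rule ccontr)
    assume "\<not> ?thesis"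
    then obtain \<gamma> j where \<gamma>: "\<gamma> \<in> annihilator p k a J" and j: "j < d" "L j \<gamma> \<noteq> 0" unfolding K_def by blast
    have jJ: "j \<notin> J" using \<gamma> j(2) unfolding K_def by blast
    let ?K = "annihilator p k a J" and ?K' = "annihilator p k a (insert j J)"
    have "L j \<gamma> \<in> unity_roots p"
      unfolding L_def using \<gamma> vpow_nth[OF C] by (intro fin_subgroup_sum[OF C] fin_subgroup_zmul[OF C]) (auto simp: annihilator_def)
    then obtain b where b: "L j \<gamma> = unity_root p b" by (rule unity_rootsE)
    have nb: "\<not> int p dvd b" using j(2) b unity_root_eq_0_iff[OF p0] by simp
    \<comment> \<open>\<open>\<gamma>\<close> satisfies the columns in \<open>J\<close> but not
      column \<open>j\<close>, so that its multiples represent \<open>p\<close> different cosets of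
      the smaller annihilator.\<close>
    have "inj_on (\<lambda>(h, m). h + zmul (int m) \<gamma>) (?K' \<times> {..<p})"
    proof (rule inj_onI)
      fix u v assume uv: "u \<in> ?K' \<times> {..<p}" "v \<in> ?K' \<times> {..<p}"
        "(case u of (h, m) \<Rightarrow> h + zmul (int m) \<gamma>) = (case v of (h, m) \<Rightarrow> h + zmul (int m) \<gamma>)"
      obtain h m h' m' where u: "u = (h, m)" "v = (h', m')" by (cases u, cases v)
      have h: "h \<in> ?K'" "h' \<in> ?K'" and m: "m \<in> {..<p}" "m' \<in> {..<p}"
        and eq: "h + zmul (int m) \<gamma> = h' + zmul (int m') \<gamma>" using uv by (auto simp: u)
      have "L j (h + zmul (int m) \<gamma>) = L j (h' + zmul (int m') \<gamma>)" by (simp only: eq)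
      moreover have "L j h = 0" "L j h' = 0" using h by (auto simp: K_def)
      ultimately have "zmul (int m) (L j \<gamma>) = zmul (int m') (L j \<gamma>)" by (simp add: L_add L_zmul)
      then have "int p dvd (int m - int m') * b"
        unfolding b zmul_unity_root using unity_root_eq_0_iff[OF p0, of "(int m - int m') * b"]
        by (simp add: left_diff_distrib unity_root_diff)
      then have "int p dvd int m - int m'" using nb p by (simp add: prime_dvd_mult_iff)
      then have "int m mod int p = int m' mod int p" by (simp add: mod_eq_dvd_iff)
      then have "m = m'" using m by simp
      then show "u = v" using eq by (simp add: u)
    qed
    moreover have "(\<lambda>(h, m). h + zmul (int m) \<gamma>) ` (?K' \<times> {..<p}) \<subseteq> ?K"
    proof -
      have "?K' \<subseteq> ?K" by (auto simp: K_def)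
      then show ?thesis using \<gamma> by (auto intro!: fin_subgroupD(4)[OF sub] fin_subgroup_zmul[OF sub])
    qed
    ultimately have "card (?K' \<times> {..<p}) \<le> card ?K"
      by (rule card_inj_on_le) (rule fin_subgroupD(1)[OF sub])
    then have "p ^ card J * (card ?K' * p) \<le> p ^ card J * card ?K" by (intro mult_left_mono) (auto simp: card_cartesian_product)
    also have "\<dots> \<le> p ^ k" using J(1) by (simp add: P_def)
    finally have "p ^ card (insert j J) * card ?K' \<le> p ^ k"
      using jJ finite_subset[OF Jd] by (simp add: mult_ac)
    then have "P (insert j J)" using Jd j(1) by (simp add: P_def)
    from J(2)[OF this] show False using jJ finite_subset[OF Jd] by simp
  qed
  moreover have "annihilator p k a {..<d} \<subseteq> annihilator p k a J" using Jd by (auto simp: annihilator_def)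
  ultimately show ?thesis using Jd card_le[OF J(1)] by blast
qed

lemma form_system_unity_roots:
  assumes p: "prime p" and k: "k > 0"
    and bound: "\<And>i j. i < k \<Longrightarrow> j < d \<Longrightarrow> \<bar>a i j\<bar> < 2 ^ B"
    and J: "J \<subseteq> {..<d}" "card J \<le> k" "annihilator p k a J = annihilator p k a {..<d}"
    and nonzero: "\<And>i. i < k \<Longrightarrow> \<exists>j<d. \<not> int p dvd a i j"
    and nonprop: "\<And>i i'. i < k \<Longrightarrow> i' < k \<Longrightarrow> i' \<noteq> i \<Longrightarrow> \<exists>j<d. \<exists>j'<d. \<not> int p dvd a i j * a i' j' - a i j' * a i' j"
  shows "form_system (unity_roots p) (unity_roots p) (unity_pair p) k d B a J"
proof (intro form_system.intro dual_pair_unity_roots[OF p] form_system_axioms.intro)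
  have p0: "p > 0" using p prime_gt_0_nat by blast
  note C = fin_subgroup_unity_roots[OF p0]
  have inverse: "\<exists>w. int p dvd c * w - 1" if "\<not> int p dvd c" for c
  proof -
    have "coprime (int p) c" using that p by (intro prime_imp_coprime) auto
    then obtain u v where "u * int p + v * c = 1" using bezout_int[of "int p" c] by auto
    then have "c * v - 1 = int p * (- u)" by (simp add: algebra_simps)
    then show ?thesis by (intro exI[of _ v]) simp
  qed
  show "\<alpha> = 0" if i: "i < k" and \<alpha>: "\<alpha> \<in> unity_roots p" and z: "\<And>j. j \<in> J \<Longrightarrow> zmul (a i j) \<alpha> = 0" for i \<alpha>
  proof -
    have L: "(\<Sum>i'<k. zmul (a i' j) (unitv i \<alpha> i')) = zmul (a i j) \<alpha>" for j
    proof -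
      have "(\<Sum>i'<k. zmul (a i' j) (unitv i \<alpha> i')) = (\<Sum>i'<k. if i' = i then zmul (a i j) \<alpha> else 0)"
        by (intro sum.cong) (auto simp: unitv_def)
      then show ?thesis using i by simp
    qed
    \<comment> \<open>A tuple with the single entry \<open>\<alpha>\<close> is annihilated by
      \<open>J\<close>, hence by all columns, and one of these has an invertible entry in row
      \<open>i\<close>.\<close>
    have "unitv i \<alpha> \<in> annihilator p k a J"
      unfolding annihilator_def using unitv_in[OF C \<alpha> i] z by (simp add: L)
    then have "unitv i \<alpha> \<in> annihilator p k a {..<d}" unfolding J(3) .
    then have all: "zmul (a i j) \<alpha> = 0" if "j < d" for j using that by (simp add: annihilator_def L)
    obtain j where j: "j < d" "\<not> int p dvd a i j" using nonzero[OF i] by blast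
    obtain b where b: "\<alpha> = unity_root p b" using \<alpha> by (rule unity_rootsE)
    have "int p dvd a i j * b" using all[OF j(1)] unfolding b zmul_unity_root unity_root_eq_0_iff[OF p0] .
    then have "int p dvd b" using j(2) p by (simp add: prime_dvd_mult_iff)
    then show ?thesis by (simp add: b unity_root_eq_0_iff[OF p0])
  qed
  show "\<exists>\<sigma>. (\<forall>v\<in>unity_roots p. \<sigma> v \<in> vpow d (unity_roots p) \<and> lform (a i) d (\<sigma> v) = v \<and> (i' \<noteq> i \<longrightarrow> lform (a i') d (\<sigma> v) = 0)) \<and>
      (\<forall>v\<in>unity_roots p. \<forall>v'\<in>unity_roots p. \<sigma> (v - v') = \<sigma> v - \<sigma> v')" if i: "i < k" "i' < k" for i i'
  proof -
    have "\<exists>z. int p dvd (\<Sum>j<d. a i j * z j) - 1 \<and> (i' \<noteq> i \<longrightarrow> (\<Sum>j<d. a i' j * z j) = 0)"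
    proof (cases "i' = i")
      case True
      obtain j where j: "j < d" "\<not> int p dvd a i j" using nonzero[OF i(1)] by blast
      obtain w where w: "int p dvd a i j * w - 1" using inverse[OF j(2)] by blast
      have "(\<Sum>j'<d. a i j' * (if j' = j then w else 0)) = a i j * w" using j(1) by (simp add: if_distrib[where f = "times _"] cong: if_cong)
      then show ?thesis using w True by (intro exI[of _ "\<lambda>j'. if j' = j then w else 0"]) simp
    next
      case False
      obtain j j' where j: "j < d" "j' < d" "\<not> int p dvd a i j * a i' j' - a i j' * a i' j" using nonprop[OF i False] by blast
      obtain w where w: "int p dvd (a i j * a i' j' - a i j' * a i' j) * w - 1" using inverse[OF j(3)] by blast
      \<comment> \<open>Cramer's rule for the two forms in the columns \<open>j\<close> and
        \<open>j'\<close>, with \<open>w\<close> an inverse of the minor modulo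
        \<open>p\<close>.\<close>
      let ?z = "\<lambda>m. (if m = j then a i' j' * w else 0) + (if m = j' then - a i' j * w else 0)"
      have sum: "(\<Sum>m<d. c m * ?z m) = c j * (a i' j' * w) + c j' * (- a i' j * w)" for c :: "nat \<Rightarrow> int"
        using j by (simp add: distrib_left sum.distrib if_distrib[where f = "times _"] cong: if_cong)
      show ?thesis
      proof (intro exI[of _ ?z] conjI impI)
        show "int p dvd (\<Sum>m<d. a i m * ?z m) - 1" unfolding sum using w by (simp add: algebra_simps)
        show "(\<Sum>m<d. a i' m * ?z m) = 0" unfolding sum by (simp add: algebra_simps)
      qed
    qed
    then obtain z where z: "int p dvd (\<Sum>j<d. a i j * z j) - 1" "i' \<noteq> i \<Longrightarrow> (\<Sum>j<d. a i' j * z j) = 0" by blast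
    let ?\<sigma> = "\<lambda>v j. if j < d then zmul (z j) v else 0"
    have form: "lform (a m) d (?\<sigma> v) = zmul (\<Sum>j<d. a m j * z j) v" for m and v :: circle
      unfolding lform_def zmul_sum_left by (intro sum.cong) (auto simp: zmul_zmul)
    show ?thesis
    proof (intro exI[of _ ?\<sigma>] conjI ballI impI)
      fix v assume v: "v \<in> unity_roots p"
      show "?\<sigma> v \<in> vpow d (unity_roots p)" using v fin_subgroup_zmul[OF C] by (auto simp: vpow_def)
      obtain b where b: "v = unity_root p b" using v by (rule unity_rootsE)
      have "int p dvd (\<Sum>j<d. a i j * z j) * b - b"
        using dvd_mult2[OF z(1), of b] by (simp add: left_diff_distrib)
      then show "lform (a i) d (?\<sigma> v) = v"
        unfolding form unfolding b zmul_unity_root unity_root_eq_iff[OF p0] mod_eq_dvd_iff .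
      show "lform (a i') d (?\<sigma> v) = 0" if "i' \<noteq> i" unfolding form using z(2)[OF that] by simp
    next
      fix v v' :: circle
      show "?\<sigma> (v - v') = ?\<sigma> v - ?\<sigma> v'" by (auto simp: fun_eq_iff zmul_diff_right)
    qed
  qed
qed (use k bound J in auto)

text \<open>In coordinates, a relation between tensor powers is tested on one monomial
  \<open>f\<close> at a time. At every step \<open>J_all\<close> extends the test for one factor
  from the columns in \<open>J\<close> to all columns.\<close>

lemma Rel_unity_roots:
  assumes fs: "form_system (unity_roots p) (unity_roots p) (unity_pair p) k d B a J"
    and J_all: "annihilator p k a J = annihilator p k a {..<d}"
  shows "\<beta> \<in> form_system.Rel (unity_roots p) k d a J r \<Longrightarrow> f ` {..<Suc r} \<subseteq> {..<d} \<Longrightarrow>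
    (\<Sum>i<k. zmul (\<Prod>l<Suc r. a i (f l)) (\<beta> i)) = 0"
proof (induction r arbitrary: \<beta> f)
  interpret form_system "unity_roots p" "unity_roots p" "unity_pair p" k d B a J by (rule fs)
  {
    case 0
    then show ?case by auto
  next
    case (Suc r)
    have \<beta>: "\<beta> \<in> vpow k (unity_roots p)" using Suc.prems(1) by simp
    let ?\<gamma> = "\<lambda>i. zmul (\<Prod>l<Suc r. a i (f l)) (\<beta> i)"
    have "(\<Sum>i<k. zmul (a i j) (?\<gamma> i)) = 0" if "j \<in> J" for j
    proof -
      have "f ` {..<Suc r} \<subseteq> f ` {..<Suc (Suc r)}" by (rule image_mono) auto
      then have "f ` {..<Suc r} \<subseteq> {..<d}" using Suc.prems(2) by (rule order_trans)
      moreover have "(\<lambda>i. zmul (a i j) (\<beta> i)) \<in> Rel r" using Suc.prems(1) that by auto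
      ultimately show ?thesis using Suc.IH[of "\<lambda>i. zmul (a i j) (\<beta> i)" f] by (simp add: zmul_zmul mult_ac)
    qed
    moreover have "?\<gamma> \<in> vpow k (unity_roots p)"
      using \<beta> fin_subgroup_zmul[OF V] by (auto simp: vpow_def)
    ultimately have "?\<gamma> \<in> annihilator p k a J" by (simp add: annihilator_def)
    then have "?\<gamma> \<in> annihilator p k a {..<d}" unfolding J_all .
    moreover have "f (Suc r) < d" using Suc.prems(2) by auto
    ultimately have "(\<Sum>i<k. zmul (a i (f (Suc r))) (?\<gamma> i)) = 0" by (simp add: annihilator_def)
    then show ?case by (simp add: zmul_zmul mult_ac)
  }
qed

section \<open>Transfer to residues\<close>

text \<open>Expanding the product of the forms over all maps \<open>f\<close> expresses the tensor
  powers through the monomials in the coefficients. A combination that annihilates all monomials is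
  a dependence, unless it is zero modulo \<open>p\<close>.\<close>

lemma tensor_independent_coeffs:
  assumes indep: "\<not> tensor_dependent p d k \<Phi> t" and p: "p > 0"
    and \<Phi>: "\<And>i x. i < k \<Longrightarrow> x \<in> Fp_vec p d \<Longrightarrow> \<Phi> i x = (\<Sum>j<d. a i j * x j) mod int p"
    and c: "\<And>f. f \<in> {..<t} \<rightarrow>\<^sub>E {..<d} \<Longrightarrow> int p dvd (\<Sum>i<k. c i * (\<Prod>l<t. a i (f l)))"
    and i: "i < k"
  shows "int p dvd c i"
proof (rule ccontr)
  assume "\<not> int p dvd c i"
  then have ci: "c i mod int p \<noteq> 0" by (simp add: dvd_eq_mod_eq_0)
  have "tensor_dependent p d k \<Phi> t"
    unfolding tensor_dependent_def
  proof (intro bexI[of _ "\<lambda>i. c i mod int p"] conjI ballI)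
    show "\<exists>i<k. c i mod int p \<noteq> 0" using ci i by blast
    show "(\<lambda>i. c i mod int p) \<in> {..<k} \<rightarrow> Fp p" using p by (simp add: Fp_def)
    fix v assume v: "v \<in> {..<t} \<rightarrow>\<^sub>E Fp_vec p d"
    have "(\<Sum>i<k. c i mod int p * tensor_power p t (\<Phi> i) v) mod int p
        = (\<Sum>i<k. (c i mod int p * tensor_power p t (\<Phi> i) v) mod int p) mod int p" by (rule mod_sum_eq[symmetric])
    also have "\<dots> = (\<Sum>i<k. (c i * (\<Prod>l<t. \<Sum>j<d. a i j * v l j)) mod int p) mod int p"
    proof (rule arg_cong[where f = "\<lambda>x. x mod int p"], rule sum.cong[OF refl])
      fix i assume "i \<in> {..<k}"
      then have "(\<Prod>l<t. \<Phi> i (v l)) = (\<Prod>l<t. (\<Sum>j<d. a i j * v l j) mod int p)"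
        using v by (intro prod.cong refl \<Phi>) auto
      then have "tensor_power p t (\<Phi> i) v = (\<Prod>l<t. \<Sum>j<d. a i j * v l j) mod int p"
        by (simp add: tensor_power_def mod_prod_eq)
      then show "(c i mod int p * tensor_power p t (\<Phi> i) v) mod int p = (c i * (\<Prod>l<t. \<Sum>j<d. a i j * v l j)) mod int p"
        by (simp add: mod_mult_eq)
    qed
    also have "\<dots> = (\<Sum>i<k. c i * (\<Prod>l<t. \<Sum>j<d. a i j * v l j)) mod int p" by (rule mod_sum_eq)
    also have "(\<Sum>i<k. c i * (\<Prod>l<t. \<Sum>j<d. a i j * v l j))
        = (\<Sum>i<k. \<Sum>f\<in>{..<t} \<rightarrow>\<^sub>E {..<d}. (\<Prod>l<t. v l (f l)) * (c i * (\<Prod>l<t. a i (f l))))"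
      by (subst prod_sum_PiE) (auto simp: sum_distrib_left prod.distrib mult_ac)
    also have "\<dots> = (\<Sum>f\<in>{..<t} \<rightarrow>\<^sub>E {..<d}. (\<Prod>l<t. v l (f l)) * (\<Sum>i<k. c i * (\<Prod>l<t. a i (f l))))"
      by (subst sum.swap) (simp add: sum_distrib_left)
    finally have "(\<Sum>i<k. c i mod int p * tensor_power p t (\<Phi> i) v) mod int p
        = (\<Sum>f\<in>{..<t} \<rightarrow>\<^sub>E {..<d}. (\<Prod>l<t. v l (f l)) * (\<Sum>i<k. c i * (\<Prod>l<t. a i (f l)))) mod int p" .
    moreover have "int p dvd (\<Sum>f\<in>{..<t} \<rightarrow>\<^sub>E {..<d}. (\<Prod>l<t. v l (f l)) * (\<Sum>i<k. c i * (\<Prod>l<t. a i (f l))))"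
      by (intro dvd_sum dvd_mult c)
    ultimately show "(\<Sum>i<k. c i mod int p * tensor_power p t (\<Phi> i) v) mod int p = 0" by simp
  qed
  then show False using indep by blast
qed

text \<open>A zero form has zero tensor powers of positive order, which would be a dependence by
  itself.\<close>

lemma tensor_independent_nonzero:
  assumes indep: "\<not> tensor_dependent p d k \<Phi> t" and t: "t > 0" and p: "prime p"
    and \<Phi>: "\<And>i x. i < k \<Longrightarrow> x \<in> Fp_vec p d \<Longrightarrow> \<Phi> i x = (\<Sum>j<d. a i j * x j) mod int p"
    and i: "i < k"
  shows "\<exists>j<d. \<not> int p dvd a i j"
proof (rule ccontr)
  assume "\<not> ?thesis"
  then have all: "int p dvd a i j" if "j < d" for j using that by blast
  have p0: "p > 0" using p prime_gt_0_nat by blast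
  have "int p dvd of_bool (i = i)"
  proof (rule tensor_independent_coeffs[OF indep p0 \<Phi> _ i, where c = "\<lambda>i'. of_bool (i' = i)"])
    fix f assume f: "f \<in> {..<t} \<rightarrow>\<^sub>E {..<d}"
    have "(\<Sum>i'<k. of_bool (i' = i) * (\<Prod>l<t. a i' (f l))) = (\<Prod>l<t. a i (f l))"
      using i by (simp add: of_bool_def if_distrib[where f = "\<lambda>x. x * _"] cong: if_cong)
    moreover have "int p dvd (\<Prod>l<t. a i (f l))"
      using f t all[of "f 0"] by (intro dvd_trans[OF _ dvd_prodI[of _ 0]]) auto
    ultimately show "int p dvd (\<Sum>i'<k. of_bool (i' = i) * (\<Prod>l<t. a i' (f l)))" by simp
  qed
  then show False using prime_gt_1_nat[OF p] by simp
qed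

lemma tensor_independent_nonproportional:
  assumes indep: "\<not> tensor_dependent p d k \<Phi> t" and t: "t > 0" and p: "prime p"
    and \<Phi>: "\<And>i x. i < k \<Longrightarrow> x \<in> Fp_vec p d \<Longrightarrow> \<Phi> i x = (\<Sum>j<d. a i j * x j) mod int p"
    and i: "i < k" "i' < k" "i' \<noteq> i"
  shows "\<exists>j<d. \<exists>j'<d. \<not> int p dvd a i j * a i' j' - a i j' * a i' j"
proof (rule ccontr)
  assume "\<not> ?thesis"
  then have all: "int p dvd a i j * a i' j' - a i j' * a i' j" if "j < d" "j' < d" for j j' using that by blast
  have p0: "p > 0" using p prime_gt_0_nat by blast
  obtain j where j: "j < d" "\<not> int p dvd a i j" using tensor_independent_nonzero[OF indep t p \<Phi> i(1)] by blast
  \<comment> \<open>If the forms are proportional with ratio \<open>a i' j / a i j\<close>, their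
    tensor powers are proportional with the \<open>t\<close>-th power of this ratio; these
    coefficients clear the denominator.\<close>
  let ?c = "\<lambda>m. if m = i' then a i j ^ t else if m = i then - (a i' j ^ t) else 0"
  have "int p dvd ?c i'"
  proof (rule tensor_independent_coeffs[OF indep p0 \<Phi> _ i(2), where c = ?c])
    fix f assume f: "f \<in> {..<t} \<rightarrow>\<^sub>E {..<d}"
    have "(\<Sum>m<k. ?c m * (\<Prod>l<t. a m (f l)))
      = (\<Sum>m<k. (if m = i' then a i j ^ t * (\<Prod>l<t. a i' (f l)) else 0) + (if m = i then - (a i' j ^ t) * (\<Prod>l<t. a i (f l)) else 0))"
      using i(3) by (intro sum.cong) auto
    also have "\<dots> = a i j ^ t * (\<Prod>l<t. a i' (f l)) - a i' j ^ t * (\<Prod>l<t. a i (f l))"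
      using i by (simp add: sum.distrib)
    also have "\<dots> = (\<Prod>l<t. a i j * a i' (f l)) - (\<Prod>l<t. a i (f l) * a i' j)"
      by (simp add: prod.distrib mult.commute)
    finally have eq: "(\<Sum>m<k. ?c m * (\<Prod>l<t. a m (f l))) = (\<Prod>l<t. a i j * a i' (f l)) - (\<Prod>l<t. a i (f l) * a i' j)" .
    have "(\<Prod>l<t. a i j * a i' (f l)) mod int p = (\<Prod>l<t. (a i j * a i' (f l)) mod int p) mod int p" by (rule mod_prod_eq[symmetric])
    also have "\<dots> = (\<Prod>l<t. (a i (f l) * a i' j) mod int p) mod int p"
    proof (rule arg_cong[where f = "\<lambda>x. x mod int p"], rule prod.cong[OF refl])
      fix l assume "l \<in> {..<t}"
      then have "f l < d" using f by auto
      then show "(a i j * a i' (f l)) mod int p = (a i (f l) * a i' j) mod int p"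
        using all[OF j(1)] by (simp add: mod_eq_dvd_iff)
    qed
    also have "\<dots> = (\<Prod>l<t. a i (f l) * a i' j) mod int p" by (rule mod_prod_eq)
    finally show "int p dvd (\<Sum>m<k. ?c m * (\<Prod>l<t. a m (f l)))" unfolding eq mod_eq_dvd_iff .
  qed
  then have "int p dvd a i j ^ t" by simp
  then show False using j(2) p prime_dvd_power[of "int p" "a i j" t] by simp
qed

section \<open>From residue vectors to tuples of roots of unity\<close>

lemma bij_betw_vpow:
  assumes e: "bij_betw e A V"
  shows "bij_betw (\<lambda>g j. if j < d then e (g j) else 0) ({..<d} \<rightarrow>\<^sub>E A) (vpow d V)"
proof (rule bij_betw_byWitness[where f' = "\<lambda>x. \<lambda>j\<in>{..<d}. inv_into A e (x j)"])
  show "\<forall>g\<in>{..<d} \<rightarrow>\<^sub>E A. (\<lambda>j\<in>{..<d}. inv_into A e (if j < d then e (g j) else 0)) = g"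
  proof
    fix g assume g: "g \<in> {..<d} \<rightarrow>\<^sub>E A"
    show "(\<lambda>j\<in>{..<d}. inv_into A e (if j < d then e (g j) else 0)) = g"
    proof
      fix j show "(\<lambda>j\<in>{..<d}. inv_into A e (if j < d then e (g j) else 0)) j = g j"
      proof (cases "j < d")
        case True
        then have "g j \<in> A" using g by auto
        then show ?thesis using True bij_betw_inv_into_left[OF e] by simp
      qed (use g in \<open>auto simp: PiE_def extensional_def\<close>)
    qed
  qed
  show "\<forall>x\<in>vpow d V. (\<lambda>j. if j < d then e ((\<lambda>j\<in>{..<d}. inv_into A e (x j)) j) else 0) = x"
    using bij_betw_inv_into_right[OF e] by (auto simp: vpow_def fun_eq_iff)
  show "(\<lambda>g j. if j < d then e (g j) else 0) ` ({..<d} \<rightarrow>\<^sub>E A) \<subseteq> vpow d V"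
    using bij_betwE[OF e] by (auto simp: vpow_def)
  show "(\<lambda>x. \<lambda>j\<in>{..<d}. inv_into A e (x j)) ` vpow d V \<subseteq> {..<d} \<rightarrow>\<^sub>E A"
    using bij_betwE[OF bij_betw_inv_into[OF e]] by (auto simp: vpow_def split: if_splits)
qed

text \<open>The recursion of \<open>box\<close> corresponds to splitting off the last coordinate of
  \<open>\<omega>\<close>.\<close>

lemma box_cube:
  "box t F h x = (\<Prod>\<omega>\<in>{..<t} \<rightarrow>\<^sub>E {0, 1::nat}. (cnj ^^ (\<Sum>l<t. \<omega> l)) (F (x + (\<Sum>l<t. zmul (int (\<omega> l)) (h l)))))"
proof (induction t arbitrary: x)
  case (Suc t)
  let ?G = "\<lambda>t x \<omega>. (cnj ^^ (\<Sum>l<t. \<omega> l)) (F (x + (\<Sum>l<t. zmul (int (\<omega> l)) (h l))))"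
  let ?P = "{..<t} \<rightarrow>\<^sub>E {0, 1::nat}"
  have inj: "inj_on (\<lambda>(y, g). g(t := y)) ({0, 1} \<times> ?P)"
    by (rule inj_combinator) simp
  have "(\<Prod>\<omega>\<in>{..<Suc t} \<rightarrow>\<^sub>E {0, 1::nat}. ?G (Suc t) x \<omega>) = (\<Prod>(y, g)\<in>{0, 1} \<times> ?P. ?G (Suc t) x (g(t := y)))"
    unfolding lessThan_Suc PiE_insert_eq by (subst prod.reindex[OF inj]) (simp add: case_prod_unfold)
  also have "\<dots> = (\<Prod>g\<in>?P. ?G (Suc t) x (g(t := 0))) * (\<Prod>g\<in>?P. ?G (Suc t) x (g(t := 1)))"
    by (subst prod.cartesian_product[symmetric]) simp
  also have "(\<Prod>g\<in>?P. ?G (Suc t) x (g(t := 0))) = (\<Prod>g\<in>?P. ?G t x g)"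
    by (intro prod.cong) simp_all
  also have "(\<Prod>g\<in>?P. ?G (Suc t) x (g(t := 1))) = (\<Prod>g\<in>?P. cnj (?G t (x + h t) g))"
    by (intro prod.cong) (simp_all add: add_ac)
  finally show ?case using Suc by simp
qed simp

definition unity_vec :: "nat \<Rightarrow> nat \<Rightarrow> (nat \<Rightarrow> int) \<Rightarrow> nat \<Rightarrow> circle" where
  "unity_vec p n x = (\<lambda>j. if j < n then unity_root p (x j) else 0)"

definition index_vec :: "nat \<Rightarrow> nat \<Rightarrow> (nat \<Rightarrow> circle) \<Rightarrow> nat \<Rightarrow> int" where
  "index_vec p n y = (\<lambda>j\<in>{..<n}. unity_index p (y j))"

lemma bij_betw_unity_vec: "p > 0 \<Longrightarrow> bij_betw (unity_vec p n) (Fp_vec p n) (vpow n (unity_roots p))"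
  using bij_betw_vpow[OF bij_betw_unity_root] unfolding unity_vec_def Fp_vec_def by blast

lemma index_vec_unity_vec: "p > 0 \<Longrightarrow> index_vec p n (unity_vec p n x) = (\<lambda>j\<in>{..<n}. x j mod int p)"
  by (auto simp: index_vec_def unity_vec_def unity_index_root)

lemma index_vec_unity_vec_id: "p > 0 \<Longrightarrow> x \<in> Fp_vec p n \<Longrightarrow> index_vec p n (unity_vec p n x) = x"
  unfolding index_vec_unity_vec by (auto simp: Fp_vec_def Fp_def PiE_def Pi_def extensional_def fun_eq_iff)

lemma index_vec_in: "p > 0 \<Longrightarrow> y \<in> vpow n (unity_roots p) \<Longrightarrow> index_vec p n y \<in> Fp_vec p n"
proof -
  assume p: "p > 0" and y: "y \<in> vpow n (unity_roots p)"
  obtain x where x: "x \<in> Fp_vec p n" "y = unity_vec p n x"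
    using bij_betw_imp_surj_on[OF bij_betw_unity_vec[OF p, of n]] y by blast
  then show ?thesis using index_vec_unity_vec_id[OF p x(1)] by simp
qed

lemma unity_vec_cube_point:
  "unity_vec p n x + (\<Sum>l<t. zmul (c l) (unity_vec p n (h l))) = unity_vec p n (\<lambda>j. x j + (\<Sum>l<t. c l * h l j))"
  by (auto simp: fun_eq_iff unity_vec_def sum_fun_apply zmul_fun zmul_unity_root unity_root_add unity_root_sum)

lemma gowers_norm_U_avg:
  assumes p: "p > 0"
  shows "gowers_norm p n t f = root (2 ^ t) (Re (U_avg (vpow n (unity_roots p)) t (\<lambda>y. f (index_vec p n y))))"
proof -
  let ?V = "vpow n (unity_roots p)" and ?A = "Fp_vec p n"
  let ?E = "\<lambda>h l. if l < t then unity_vec p n (h l) else 0"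
  note e = bij_betw_unity_vec[OF p, of n]
  have "U_avg ?V t (\<lambda>y. f (index_vec p n y))
    = expect ?A (\<lambda>x. expect ({..<t} \<rightarrow>\<^sub>E ?A) (\<lambda>h. box t (\<lambda>y. f (index_vec p n y)) (?E h) (unity_vec p n x)))"
    unfolding U_avg_def expect_reindex[OF e] expect_reindex[OF bij_betw_vpow[OF e]] ..
  also have "\<dots> = expect (?A \<times> ({..<t} \<rightarrow>\<^sub>E ?A)) (\<lambda>(x, h). \<Prod>\<omega>\<in>{..<t} \<rightarrow>\<^sub>E {0, 1}. (cnj ^^ (\<Sum>l<t. \<omega> l)) (f (cube_point p n t x h \<omega>)))"
    unfolding expect_Times prod.case
  proof (rule expect_cong, rule expect_cong)
    fix x h
    have "index_vec p n (unity_vec p n x + (\<Sum>l<t. zmul (int (\<omega> l)) (?E h l))) = cube_point p n t x h \<omega>" for \<omega>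
    proof -
      have "(\<Sum>l<t. zmul (int (\<omega> l)) (?E h l)) = (\<Sum>l<t. zmul (int (\<omega> l)) (unity_vec p n (h l)))" by (intro sum.cong) auto
      then show ?thesis by (simp only: unity_vec_cube_point index_vec_unity_vec[OF p] cube_point_def)
    qed
    then show "box t (\<lambda>y. f (index_vec p n y)) (?E h) (unity_vec p n x)
      = (\<Prod>\<omega>\<in>{..<t} \<rightarrow>\<^sub>E {0, 1}. (cnj ^^ (\<Sum>l<t. \<omega> l)) (f (cube_point p n t x h \<omega>)))"
      unfolding box_cube by (simp only:)
  qed
  finally show ?thesis by (simp add: gowers_norm_def)
qed

lemma Lambda_expect:
  assumes p: "p > 0" and \<Phi>: "\<And>i x. i < k \<Longrightarrow> x \<in> Fp_vec p d \<Longrightarrow> \<Phi> i x = (\<Sum>j<d. a i j * x j) mod int p"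
  shows "Lambda p d k \<Phi> n f
    = expect (vpow d (vpow n (unity_roots p))) (\<lambda>x. \<Prod>i<k. f i (index_vec p n (lform (a i) d x)))"
  unfolding Lambda_def expect_reindex[OF bij_betw_vpow[OF bij_betw_unity_vec[OF p]]]
proof (intro expect_cong prod.cong refl)
  fix x i assume x: "x \<in> {..<d} \<rightarrow>\<^sub>E Fp_vec p n" and i: "i \<in> {..<k}"
  have "lform (a i) d (\<lambda>j. if j < d then unity_vec p n (x j) else 0) = unity_vec p n (\<lambda>m. \<Sum>j<d. a i j * x j m)"
    by (auto simp: fun_eq_iff lform_def unity_vec_def sum_fun_apply zmul_fun zmul_unity_root unity_root_sum)
  moreover have "apply_form d n (\<Phi> i) x = (\<lambda>m\<in>{..<n}. (\<Sum>j<d. a i j * x j m) mod int p)"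
    unfolding apply_form_def
  proof (rule restrict_ext)
    fix m assume "m \<in> {..<n}"
    then have "(\<lambda>j\<in>{..<d}. x j m) \<in> Fp_vec p d" using x by (auto simp: Fp_vec_def)
    then show "\<Phi> i (\<lambda>j\<in>{..<d}. x j m) = (\<Sum>j<d. a i j * x j m) mod int p" using \<Phi> i by simp
  qed
  ultimately show "f i (apply_form d n (\<Phi> i) x) = f i (index_vec p n (lform (a i) d (\<lambda>j. if j < d then unity_vec p n (x j) else 0)))"
    by (simp add: index_vec_unity_vec[OF p])
qed

text \<open>The average is raised to the power \<open>N * 2 ^ \<tau>\<close> and the norm to the
  power \<open>2 ^ \<tau>\<close>. The common factor cancels, so that \<open>N\<close>, and with it
  \<open>M\<close>, is independent of the complexity.\<close>

lemma gowers_control_exponent: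
  assumes p: "prime p" and k: "k > 0" and fin: "finite_complexity p d k \<Phi>"
    and \<Phi>: "\<And>i x. i < k \<Longrightarrow> x \<in> Fp_vec p d \<Longrightarrow> \<Phi> i x = (\<Sum>j<d. a i j * x j) mod int p"
    and bound: "\<And>i j. i < k \<Longrightarrow> j < d \<Longrightarrow> \<bar>a i j\<bar> < 2 ^ B"
    and N: "N = (2 ^ (4 * k + 5) * (2 * (1300 * k ^ 3 * (B + 1))) ^ k) ^ (k * k)"
  shows "gowers_control p d k \<Phi> (log 2 (real N))"
proof -
  have p0: "p > 0" using p prime_gt_0_nat by blast
  define \<tau> where "\<tau> = complexity p d k \<Phi> + 1"
  have \<tau>: "\<tau> > 0" by (simp add: \<tau>_def)
  \<comment> \<open>A supremum of natural numbers bounds its set only if that set is bounded; this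
    is where finite complexity enters.\<close>
  have indep: "\<not> tensor_dependent p d k \<Phi> t" if "\<tau> \<le> t" for t
  proof
    assume "tensor_dependent p d k \<Phi> t"
    then have "t \<le> Sup {t. tensor_dependent p d k \<Phi> t}"
      using fin by (intro le_cSup_finite) (auto simp: finite_complexity_def)
    then show False using that by (simp add: \<tau>_def complexity_def)
  qed
  obtain J where J: "J \<subseteq> {..<d}" "card J \<le> k" "annihilator p k a J = annihilator p k a {..<d}"
    using few_columns_suffice[OF p] by blast
  have fs: "form_system (unity_roots p) (unity_roots p) (unity_pair p) k d B a J"
  proof (rule form_system_unity_roots[OF p k bound J])
    show "\<exists>j<d. \<not> int p dvd a i j" if "i < k" for i
      by (rule tensor_independent_nonzero[OF indep[OF order_refl] \<tau> p \<Phi> that])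
    show "\<exists>j<d. \<exists>j'<d. \<not> int p dvd a i j * a i' j' - a i j' * a i' j" if "i < k" "i' < k" "i' \<noteq> i" for i i'
      by (rule tensor_independent_nonproportional[OF indep[OF order_refl] \<tau> p \<Phi> that])
  qed
  interpret base: form_system "unity_roots p" "unity_roots p" "unity_pair p" k d B a J by (rule fs)
  have Rel: "base.Rel (t - 1) \<subseteq> {0}" if t: "\<tau> \<le> t" for t
  proof
    fix \<beta> assume \<beta>: "\<beta> \<in> base.Rel (t - 1)"
    have \<beta>V: "\<beta> \<in> vpow k (unity_roots p)" using base.Rel_sub \<beta> by blast
    define b where "b i = unity_index p (\<beta> i)" for i
    have b: "\<beta> i = unity_root p (b i)" if "i < k" for i
      using vpowD(1)[OF \<beta>V that] by (auto elim!: unity_rootsE simp: b_def unity_index_root[OF p0] unity_root_eq_iff[OF p0])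
    \<comment> \<open>\<open>Rel (t - 1)\<close> consists of relations between tensor powers of
      order \<open>t\<close>.\<close>
    have tt: "Suc (t - 1) = t" using t \<tau> by simp
    have "int p dvd b i" if i: "i < k" for i
    proof (rule tensor_independent_coeffs[OF indep[OF t] p0 \<Phi> _ i])
      fix f assume "f \<in> {..<t} \<rightarrow>\<^sub>E {..<d}"
      then have "(\<Sum>i<k. zmul (\<Prod>l<t. a i (f l)) (\<beta> i)) = 0"
        using Rel_unity_roots[OF fs J(3) \<beta>, of f] unfolding tt by auto
      moreover have "(\<Sum>i<k. zmul (\<Prod>l<t. a i (f l)) (\<beta> i)) = unity_root p (\<Sum>i<k. b i * (\<Prod>l<t. a i (f l)))"
        unfolding unity_root_sum by (intro sum.cong) (auto simp: b zmul_unity_root mult.commute)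
      ultimately show "int p dvd (\<Sum>i<k. b i * (\<Prod>l<t. a i (f l)))" using unity_root_eq_0_iff[OF p0] by simp
    qed
    then have "\<beta> i = 0" for i
      using b vpowD(2)[OF \<beta>V, of i] unity_root_eq_0_iff[OF p0] by (cases "i < k") auto
    then show "\<beta> \<in> {0}" by (simp add: fun_eq_iff)
  qed
  show ?thesis
    unfolding gowers_control_def \<tau>_def[symmetric]
  proof (intro allI impI)
    fix n f i0 assume f: "\<forall>i<k. one_bounded p n (f i)" and i0: "i0 < k"
    let ?V = "vpow n (unity_roots p)"
    interpret T: form_system ?V ?V "\<lambda>x \<alpha>. \<Prod>r<n. unity_pair p (x r) (\<alpha> r)" k d B a J by (rule base.form_system_vpow)
    let ?F = "\<lambda>i y. f i (index_vec p n y)" and ?\<Lambda> = "cmod (Lambda p d k \<Phi> n f)"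
    have bd: "bounded1 ?V (?F i)" if "i < k" for i
      using f that index_vec_in[OF p0] by (auto simp: bounded1_def one_bounded_def)
    have form_avg: "T.form_avg ?F = Lambda p d k \<Phi> n f"
      unfolding T.form_avg_def using Lambda_expect[OF p0 \<Phi>] by simp
    have loss: "T.loss ^ (k * k) = N" by (simp add: T.loss_def N)
    have N0: "N > 0" unfolding loss[symmetric] using T.loss_ge'(2) by simp
    have "?\<Lambda> ^ (N * 2 ^ \<tau>) \<le> Re (U_avg ?V \<tau> (?F i0))"
      unfolding form_avg[symmetric] loss[symmetric]
      by (rule T.gowers_control_strong[OF i0 \<tau> bd base.Rel_vpow_trivial[OF Rel]])
    then have "root (2 ^ \<tau>) ((?\<Lambda> ^ N) ^ (2 ^ \<tau>)) \<le> gowers_norm p n \<tau> (f i0)"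
      unfolding gowers_norm_U_avg[OF p0] power_mult by (intro real_root_le_mono) auto
    then have le: "?\<Lambda> ^ N \<le> gowers_norm p n \<tau> (f i0)" by (simp add: real_root_power_cancel)
    have exponent: "2 powr - log 2 (real N) = 1 / real N"
      using N0 by (simp add: powr_minus_divide)
    show "?\<Lambda> \<le> gowers_norm p n \<tau> (f i0) powr (2 powr - log 2 (real N))"
    proof (cases "?\<Lambda> = 0")
      case False
      then have pos: "?\<Lambda> > 0" by simp
      have "?\<Lambda> = (?\<Lambda> ^ N) powr (1 / real N)"
        using pos N0 by (simp add: powr_realpow[symmetric] powr_powr)
      also have "\<dots> \<le> gowers_norm p n \<tau> (f i0) powr (1 / real N)"
        using le by (intro powr_mono2) auto
      finally show ?thesis unfolding exponent .
    qed simp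
  qed
qed

text \<open>\<open>N\<close> is a power with exponent \<open>k ^ 2\<close> whose base has a
  logarithm of order \<open>k (log k + log B)\<close>, and \<open>B\<close> is about
  \<open>log L\<close>.\<close>

lemma exponent_bound:
  fixes L :: real
  assumes k: "k > 0" and L: "L \<ge> 1" and B: "B = nat \<lfloor>log 2 L\<rfloor> + 1"
    and N: "N = (2 ^ (4 * k + 5) * (2 * (1300 * k ^ 3 * (B + 1))) ^ k) ^ (k * k)"
  shows "0 \<le> log 2 (real N)" "log 2 (real N) \<le> 50 * real k ^ 3 * (ln (real k) + ln (ln (10 * L)))"
proof -
  let ?k = "real k" and ?\<Lambda> = "ln (10 * L)"
  have k1: "1 \<le> ?k" using k by simp
  have "exp (2 * 1 :: real) = exp 1 * exp 1" by (simp only: mult_2 exp_add)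
  also have "\<dots> \<le> 3 * 3" by (intro mult_mono exp_le) auto
  finally have e2: "exp (2::real) \<le> 9" by simp
  have "1 = 2 * (1 / 2 :: real)" by simp
  then have "exp (1/2 :: real) * exp (1/2) = exp 1" by (simp only: exp_add[symmetric]) simp
  then have "(exp (1/2 :: real))\<^sup>2 \<le> 2\<^sup>2" using exp_le by (simp add: power2_eq_square)
  then have "exp (1/2 :: real) \<le> 2" by (rule power2_le_imp_le) simp
  then have "1 / 2 \<le> ln (2::real)" by (subst ln_ge_iff) auto
  then have ln2: "1 / 2 \<le> ln (2::real)" "0 < ln (2::real)" by auto
  have \<Lambda>: "2 \<le> ?\<Lambda>" using L e2 by (subst ln_ge_iff) auto
  have B1: "real B \<le> log 2 L + 1" using L unfolding B by (simp add: of_nat_nat zero_le_log_cancel_iff)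
  have "real B + 1 \<le> (ln L + 2 * ln 2) / ln 2" using B1 ln2 by (simp add: log_def add_divide_distrib)
  also have "\<dots> \<le> ?\<Lambda> / ln 2"
  proof (intro divide_right_mono)
    have "ln L + 2 * ln 2 = ln (4 * L)" using L ln_realpow[of "2::real" 2] by (simp add: ln_mult)
    also have "\<dots> \<le> ?\<Lambda>" using L by (subst ln_le_cancel_iff) auto
    finally show "ln L + 2 * ln 2 \<le> ?\<Lambda>" .
  qed (use ln2 in simp)
  also have "\<dots> \<le> ?\<Lambda> / (1 / 2)" using ln2 \<Lambda> by (intro divide_left_mono) auto
  finally have B2: "real B + 1 \<le> 2 * ?\<Lambda>" by simp
  have log_le: "log 2 x \<le> 2 * ln x" if "1 \<le> x" for x :: real
  proof -
    have "ln x / ln 2 \<le> ln x / (1 / 2)" using ln2 that by (intro divide_left_mono) auto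
    then show ?thesis by (simp add: log_def)
  qed
  have logB: "log 2 (real B + 1) \<le> 1 + 2 * ln ?\<Lambda>"
  proof -
    have "log 2 (real B + 1) \<le> log 2 (2 * ?\<Lambda>)" using B2 \<Lambda> by (subst log_le_cancel_iff) auto
    also have "\<dots> = 1 + log 2 ?\<Lambda>" using \<Lambda> by (simp add: log_mult)
    also have "\<dots> \<le> 1 + 2 * ln ?\<Lambda>" using log_le[of ?\<Lambda>] \<Lambda> by simp
    finally show ?thesis .
  qed
  \<comment> \<open>The 10 in the bound keeps this iterated logarithm away from 0 even for
    \<open>k = L = 1\<close>, so that it can absorb additive constants.\<close>
  have ln\<Lambda>: "1 / 2 \<le> ln ?\<Lambda>"
  proof -
    have "ln 2 \<le> ln ?\<Lambda>" using \<Lambda> by (subst ln_le_cancel_iff) auto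
    then show ?thesis using ln2 by linarith
  qed
  have lnk: "0 \<le> ln ?k" using k1 by simp
  have log2600: "log 2 2600 \<le> (12::real)"
  proof -
    have "log 2 2600 \<le> log 2 (2 ^ 12 :: real)" by (subst log_le_cancel_iff) auto
    then show ?thesis by (simp add: log_nat_power del: power_numeral)
  qed
  have inner: "log 2 (2600 * ?k ^ 3 * (real B + 1)) = log 2 2600 + 3 * log 2 ?k + log 2 (real B + 1)"
    using k by (simp add: log_mult log_nat_power)
  also have "\<dots> \<le> 12 + 3 * (2 * ln ?k) + (1 + 2 * ln ?\<Lambda>)"
    by (intro add_mono log2600 logB mult_left_mono log_le k1) simp
  finally have inner_le: "log 2 (2600 * ?k ^ 3 * (real B + 1)) \<le> 13 + 6 * ln ?k + 2 * ln ?\<Lambda>" by simp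
  have N': "real N = (2 ^ (4 * k + 5) * (2600 * ?k ^ 3 * (real B + 1)) ^ k) ^ (k * k)"
    unfolding N by (simp add: algebra_simps)
  have logN: "log 2 (real N) = ?k * ?k * ((4 * ?k + 5) + ?k * log 2 (2600 * ?k ^ 3 * (real B + 1)))"
  proof -
    have pos: "0 < 2600 * ?k ^ 3 * (real B + 1)" using k by simp
    have "log 2 (2 ^ (4 * k + 5) * (2600 * ?k ^ 3 * (real B + 1)) ^ k)
      = real (4 * k + 5) + ?k * log 2 (2600 * ?k ^ 3 * (real B + 1))"
      using pos by (subst log_mult) (auto simp: log_nat_power)
    then show ?thesis unfolding N' using pos by (subst log_nat_power) auto
  qed
  have "0 \<le> log 2 (2600 * ?k ^ 3 * (real B + 1))"
  proof -
    have "1 * 1 \<le> 2600 * ?k ^ 3" using k1 by (intro mult_mono one_le_power) auto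
    then have "1 * 1 \<le> 2600 * ?k ^ 3 * (real B + 1)" by (intro mult_mono) auto
    then show ?thesis by (subst zero_le_log_cancel_iff) linarith+
  qed
  then show "0 \<le> log 2 (real N)" unfolding logN by (intro mult_nonneg_nonneg add_nonneg_nonneg) auto
  have "(4 * ?k + 5) + ?k * log 2 (2600 * ?k ^ 3 * (real B + 1)) \<le> 9 * ?k + ?k * (13 + 6 * ln ?k + 2 * ln ?\<Lambda>)"
    using k1 by (intro add_mono mult_left_mono inner_le) auto
  also have "\<dots> = ?k * (22 + 6 * ln ?k + 2 * ln ?\<Lambda>)" by (simp add: algebra_simps)
  also have "\<dots> \<le> ?k * (50 * (ln ?k + ln ?\<Lambda>))"
  proof (rule mult_left_mono)
    \<comment> \<open>As \<open>1 / 2 \<le> y\<close>, the constant 22 is at most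
      \<open>44 y\<close>, for which 50 leaves room.\<close>
    have "22 + 6 * x + 2 * y \<le> 50 * (x + y)" if "0 \<le> x" "1 / 2 \<le> y" for x y :: real using that by simp
    from this[OF lnk ln\<Lambda>] show "22 + 6 * ln ?k + 2 * ln ?\<Lambda> \<le> 50 * (ln ?k + ln ?\<Lambda>)" .
  qed simp
  finally have "log 2 (real N) \<le> ?k * ?k * (?k * (50 * (ln ?k + ln ?\<Lambda>)))"
    unfolding logN by (intro mult_left_mono) auto
  also have "\<dots> = 50 * ?k ^ 3 * (ln ?k + ln ?\<Lambda>)" by (simp add: power3_eq_cube)
  finally show "log 2 (real N) \<le> 50 * ?k ^ 3 * (ln ?k + ln ?\<Lambda>)" .
qed

lemma gowers_control_bound:
  fixes L :: real
  assumes p: "prime p" and fin: "finite_complexity p d k \<Phi>"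
    and \<Phi>: "\<And>i x. i < k \<Longrightarrow> x \<in> Fp_vec p d \<Longrightarrow> \<Phi> i x = (\<Sum>j<d. a i j * x j) mod int p"
    and L: "\<And>i j. i < k \<Longrightarrow> j < d \<Longrightarrow> \<bar>real_of_int (a i j)\<bar> \<le> L"
  shows "\<exists>M\<ge>0. M \<le> 50 * real k ^ 3 * (ln (real k) + ln (ln (10 * L))) \<and> gowers_control p d k \<Phi> M"
proof (cases "k = 0")
  case True
  \<comment> \<open>For \<open>k = 0\<close> the factor \<open>k ^ 3\<close> makes the bound 0, and
    there is no position \<open>i0\<close> to control.\<close>
  then show ?thesis by (intro exI[of _ 0]) (simp add: gowers_control_def)
next
  case False
  then have k: "k > 0" by simp
  \<comment> \<open>At some positive order the tensor powers are independent, so that the first form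
    is nonzero modulo \<open>p\<close>. Its nonzero integer coefficient forces
    \<open>1 \<le> L\<close>.\<close>
  obtain t where t: "t > 0" "\<not> tensor_dependent p d k \<Phi> t"
  proof -
    have "finite (insert 0 {t. tensor_dependent p d k \<Phi> t})" using fin by (simp add: finite_complexity_def)
    from ex_new_if_finite[OF infinite_UNIV_nat this] show ?thesis using that by auto
  qed
  obtain j where j: "j < d" "\<not> int p dvd a 0 j" using tensor_independent_nonzero[OF t(2,1) p \<Phi> k] by blast
  then have "a 0 j \<noteq> 0" by auto
  then have "1 \<le> \<bar>a 0 j\<bar>" by linarith
  then have "1 \<le> \<bar>real_of_int (a 0 j)\<bar>" by linarith
  then have L1: "1 \<le> L" using L[OF k j(1)] by linarith
  define B where "B = nat \<lfloor>log 2 L\<rfloor> + 1"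
  define N where "N = (2 ^ (4 * k + 5) * (2 * (1300 * k ^ 3 * (B + 1))) ^ k) ^ (k * k)"
  have "log 2 L < real B"
  proof -
    have "0 \<le> log 2 L" using L1 by simp
    then show ?thesis unfolding B_def by (simp add: of_nat_nat) linarith
  qed
  then have LB: "L < 2 ^ B" using L1 by (simp add: log_less_iff powr_realpow)
  have "\<bar>a i j\<bar> < 2 ^ B" if "i < k" "j < d" for i j
  proof -
    have "real_of_int \<bar>a i j\<bar> < real_of_int (2 ^ B)" using L[OF that] LB by simp
    then show ?thesis by (simp only: of_int_less_iff)
  qed
  then have "gowers_control p d k \<Phi> (log 2 (real N))" by (intro gowers_control_exponent[OF p k fin \<Phi> _ N_def])
  then show ?thesis using exponent_bound[OF k L1 B_def N_def] by blast
qed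

text \<open>Additivity and homogeneity are available for residue vectors only, so \<open>x\<close>
  is assembled one coordinate at a time by steps inside \<open>Fp_vec p d\<close>.\<close>

lemma linear_form_coefficients:
  assumes p: "p > 1" and \<phi>: "linear_form p d \<phi>" and x: "x \<in> Fp_vec p d"
  shows "\<phi> x = (\<Sum>j<d. \<phi> (\<lambda>m\<in>{..<d}. of_bool (m = j)) * x j) mod int p"
proof -
  define e :: "nat \<Rightarrow> nat \<Rightarrow> int" where "e j = (\<lambda>m\<in>{..<d}. of_bool (m = j))" for j
  define X where "X r = (\<lambda>m\<in>{..<d}. if m < r then x m else 0)" for r
  have xm: "x m \<in> Fp p" if "m < d" for m using PiE_mem[OF x[unfolded Fp_vec_def], of m] that by simp
  have e: "e j \<in> Fp_vec p d" for j using p by (auto simp: e_def Fp_vec_def Fp_def)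
  have Xr: "X r \<in> Fp_vec p d" for r unfolding X_def Fp_vec_def using xm p by (auto simp: Fp_def)
  have "r \<le> d \<Longrightarrow> \<phi> (X r) = (\<Sum>j<r. \<phi> (e j) * x j) mod int p" for r
  proof (induction r)
    case 0
    have "0 \<in> Fp p" using p by (simp add: Fp_def)
    then have "\<phi> (vec_scale p d 0 x) = (0 * \<phi> x) mod int p" using \<phi> x unfolding linear_form_def by blast
    moreover have "vec_scale p d 0 x = X 0" by (auto simp: vec_scale_def X_def)
    ultimately show ?case by simp
  next
    case (Suc r)
    let ?s = "vec_scale p d (x r) (e r)"
    have s: "?s \<in> Fp_vec p d" using p by (auto simp: vec_scale_def Fp_vec_def Fp_def)
    have "vec_add p d (X r) ?s = X (Suc r)"
    proof
      fix m
      show "vec_add p d (X r) ?s m = X (Suc r) m"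
        using xm[of m] by (cases "m < d") (auto simp: vec_add_def vec_scale_def X_def e_def Fp_def less_Suc_eq)
    qed
    then have "\<phi> (X (Suc r)) = (\<phi> (X r) + \<phi> ?s) mod int p"
      using \<phi> Xr[of r] s unfolding linear_form_def by metis
    moreover have "\<phi> ?s = (x r * \<phi> (e r)) mod int p"
      using \<phi> e[of r] xm[of r] Suc.prems unfolding linear_form_def by simp
    ultimately show ?case using Suc by (simp add: mod_add_eq mult.commute)
  qed
  from this[of d] have "\<phi> (X d) = (\<Sum>j<d. \<phi> (e j) * x j) mod int p" by simp
  moreover have "X d = x" using x by (auto simp: X_def Fp_vec_def PiE_def extensional_def fun_eq_iff)
  ultimately show ?thesis by (simp add: e_def)
qed

theorem theorem1p5:
  "\<exists>C::real. C > 0 \<and>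
     (\<forall>(p::nat) (d::nat) (k::nat) (\<Phi> :: nat \<Rightarrow> (nat \<Rightarrow> int) \<Rightarrow> int).
        prime p \<longrightarrow> (\<forall>i<k. linear_form p d (\<Phi> i)) \<longrightarrow> finite_complexity p d k \<Phi> \<longrightarrow>
          (\<exists>M::real. M \<ge> 0 \<and> gowers_control p d k \<Phi> M) \<and>
          (\<forall>(a :: nat \<Rightarrow> nat \<Rightarrow> int) (L::real).
             (\<forall>i<k. \<forall>x\<in>Fp_vec p d. \<Phi> i x = (\<Sum>j<d. a i j * x j) mod int p) \<longrightarrow>
             (\<forall>i<k. \<forall>j<d. \<bar>real_of_int (a i j)\<bar> \<le> L) \<longrightarrow>
             (\<exists>M::real. M \<ge> 0 \<and>
                M \<le> C * real k ^ 3 * (ln (real k) + ln (ln (10 * L))) \<and>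
                gowers_control p d k \<Phi> M)))"
proof (rule exI[of _ 50], intro conjI allI impI)
  fix p d k :: nat and \<Phi> :: "nat \<Rightarrow> (nat \<Rightarrow> int) \<Rightarrow> int"
  assume p: "prime p" and lin: "\<forall>i<k. linear_form p d (\<Phi> i)" and fin: "finite_complexity p d k \<Phi>"
  let ?a = "\<lambda>i j. \<Phi> i (\<lambda>m\<in>{..<d}. of_bool (m = j))"
  have p1: "p > 1" using p prime_gt_1_nat by blast
  \<comment> \<open>The values at the unit vectors are residues, so that \<open>L = p\<close> is
    admissible for any system of forms; the resulting \<open>M\<close> depends on the system but not
    on \<open>n\<close>.\<close>
  have "\<exists>M\<ge>0. M \<le> 50 * real k ^ 3 * (ln (real k) + ln (ln (10 * real p))) \<and> gowers_control p d k \<Phi> M"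
  proof (rule gowers_control_bound[OF p fin, where a = ?a])
    show "\<Phi> i x = (\<Sum>j<d. ?a i j * x j) mod int p" if "i < k" "x \<in> Fp_vec p d" for i x
      using linear_form_coefficients[OF p1 _ that(2)] lin that(1) by blast
    show "\<bar>real_of_int (?a i j)\<bar> \<le> real p" if "i < k" "j < d" for i j
    proof -
      have "(\<lambda>m\<in>{..<d}. of_bool (m = j)) \<in> Fp_vec p d" using p1 by (auto simp: Fp_vec_def Fp_def)
      moreover have "\<Phi> i \<in> Fp_vec p d \<rightarrow> Fp p" using lin that(1) by (simp add: linear_form_def)
      ultimately have "?a i j \<in> Fp p" by blast
      then show ?thesis by (simp add: Fp_def)
    qed
  qed
  then show "\<exists>M\<ge>0. gowers_control p d k \<Phi> M" by blast
next
  fix p d k :: nat and \<Phi> :: "nat \<Rightarrow> (nat \<Rightarrow> int) \<Rightarrow> int" and a :: "nat \<Rightarrow> nat \<Rightarrow> int" and L :: real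
  assume p: "prime p" and fin: "finite_complexity p d k \<Phi>"
    and \<Phi>: "\<forall>i<k. \<forall>x\<in>Fp_vec p d. \<Phi> i x = (\<Sum>j<d. a i j * x j) mod int p"
    and L: "\<forall>i<k. \<forall>j<d. \<bar>real_of_int (a i j)\<bar> \<le> L"
  show "\<exists>M\<ge>0. M \<le> 50 * real k ^ 3 * (ln (real k) + ln (ln (10 * L))) \<and> gowers_control p d k \<Phi> M"
  proof (rule gowers_control_bound[OF p fin, where a = a])
    show "\<Phi> i x = (\<Sum>j<d. a i j * x j) mod int p" if "i < k" "x \<in> Fp_vec p d" for i x using \<Phi> that by simp
    show "\<bar>real_of_int (a i j)\<bar> \<le> L" if "i < k" "j < d" for i j using L that by simp
  qed
qed simp

end
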